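(* For all integers $m\geq 1$ and $k\geq 1$: if ${\rm DIFF}_m(\Sigma_k^{p})={\rm co}{\rm DIFF}_m(\Sigma_k^{p})$, then ${\rm PH}={\rm DIFF}_m(\Sigma_k^{p})\,\boldsymbol{\Delta}\,{\rm DIFF}_{m-1}(\Sigma_{k+1}^{p})$.
   Context: Polynomial hierarchy: $\Sigma_0^p={\rm P}$; for $k\geq 0$, $\Sigma_{k+1}^p={\rm NP}^{\Sigma_k^p}$; ${\rm PH}=\bigcup_{k\geq 0}\Sigma_k^p$. For a class $\mathcal{C}$ of languages, ${\rm co}\mathcal{C}=\{\overline{L} : L\in\mathcal{C}\}$. For classes $\mathcal{C}_1,\mathcal{C}_2$, $\mathcal{C}_1\ominus\mathcal{C}_2=\{L_1-L_2 : L_1\in\mathcal{C}_1, L_2\in\mathcal{C}_2\}$. Boolean (difference) hierarchy: ${\rm DIFF}_1(\Sigma_k^p)=\Sigma_k^p$ and ${\rm DIFF}_{m+1}(\Sigma_k^p)=\Sigma_k^p\ominus{\rm DIFF}_m(\Sigma_k^p)$ for $m\geq 1$; ${\rm DIFF}_0$ of a class is taken to be $\{\emptyset\}$. For classes $\mathcal{C},\mathcal{D}$, $\mathcal{C}\,\boldsymbol{\Delta}\,\mathcal{D}=\{C\,\Delta\, D : C\in\mathcal{C}, D\in\mathcal{D}\}$, where $C\,\Delta\,D$ is the symmetric difference. *)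

theory Defs
  imports Main "HOL-Computational_Algebra.Polynomial"
begin

type_synonym lang = "bool list set"

section \<open>Nondeterministic multi-tape oracle Turing machines\<close>

datatype tsym = Blank | LeftEnd | Bit bool | Aux nat

datatype dir = Left | Stay | Right

text \<open>
  A transition \<open>((q, rs), (q', as))\<close> applies in state \<open>q\<close> when the heads read the symbols \<open>rs\<close>
  (one per tape); it leads to state \<open>q'\<close>, and \<open>as\<close> gives for each tape the symbol to be written
  and the head movement. Several transitions may share \<open>(q, rs)\<close>. Although the types of states
  and symbols are infinite, a machine uses only finitely many of them because its transition
  relation is finite.
\<close>

type_synonym trans = "(nat \<times> tsym list) \<times> (nat \<times> (tsym \<times> dir) list)"

record machine =
  num_tapes :: nat
  start_st :: nat
  accept_st :: nat
  query_st :: nat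
  yes_st :: nat
  no_st :: nat
  delta :: "trans set"

text \<open>Tape 0 carries the input, tape 1 is the query tape; hence at least two tapes.\<close>

definition wf_machine :: "machine \<Rightarrow> bool" where
  "wf_machine M \<longleftrightarrow>
     2 \<le> num_tapes M \<and> finite (delta M) \<and>
     (\<forall>q rs q' as. ((q, rs), (q', as)) \<in> delta M \<longrightarrow>
        length rs = num_tapes M \<and> length as = num_tapes M)"

definition deterministic :: "machine \<Rightarrow> bool" where
  "deterministic M \<longleftrightarrow> single_valued (delta M)"

definition oracle_free :: "machine \<Rightarrow> bool" where
  "oracle_free M \<longleftrightarrow>
     start_st M \<noteq> query_st M \<and>
     (\<forall>q rs q' as. ((q, rs), (q', as)) \<in> delta M \<longrightarrow> q' \<noteq> query_st M)"

text \<open>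
  Tapes are infinite to the right only; a tape is its content together with the head position.
  A left move on cell 0 leaves the head where it is (truncated subtraction).
\<close>

type_synonym tape = "(nat \<Rightarrow> tsym) \<times> nat"

type_synonym config = "nat \<times> tape list"

definition word_tape :: "bool list \<Rightarrow> tape" where
  "word_tape x =
     ((\<lambda>i. if i = 0 then LeftEnd else if i \<le> length x then Bit (x ! (i - 1)) else Blank), 0)"

definition init_config :: "machine \<Rightarrow> bool list \<Rightarrow> config" where
  "init_config M x = (start_st M, word_tape x # replicate (num_tapes M - 1) (word_tape []))"

definition read_tape :: "tape \<Rightarrow> tsym" where
  "read_tape tp = fst tp (snd tp)"

fun move :: "dir \<Rightarrow> nat \<Rightarrow> nat" where
  "move Left h = h - 1"
| "move Stay h = h"
| "move Right h = Suc h"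

definition act_tape :: "tsym \<times> dir \<Rightarrow> tape \<Rightarrow> tape" where
  "act_tape a tp = ((fst tp)(snd tp := fst a), move (snd a) (snd tp))"

text \<open>
  The word being queried: the bits from cell 1 on, up to (excluding) the first cell that does not
  hold a bit. The position of the head is irrelevant. Such a cell exists in every reachable
  configuration, as only finitely many cells are then nonblank.
\<close>

definition query_word :: "tape \<Rightarrow> bool list" where
  "query_word tp =
     map (\<lambda>i. fst tp (Suc i) = Bit True) [0..<(LEAST n. fst tp (Suc n) \<notin> range Bit)]"

text \<open>
  In the query state the oracle answers in one step; transitions of \<open>delta\<close> starting in that state
  are ignored. A query leaves the tapes unchanged.
\<close>

inductive step :: "machine \<Rightarrow> lang \<Rightarrow> config \<Rightarrow> config \<Rightarrow> bool" for M :: machine and A :: lang where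
  step_delta:
    "q \<noteq> query_st M \<Longrightarrow> ((q, map read_tape tps), (q', as)) \<in> delta M \<Longrightarrow>
     step M A (q, tps) (q', map2 act_tape as tps)"
| step_query:
    "step M A (query_st M, tps)
       (if query_word (tps ! 1) \<in> A then yes_st M else no_st M, tps)"

definition accepts :: "machine \<Rightarrow> lang \<Rightarrow> bool list \<Rightarrow> bool" where
  "accepts M A x \<longleftrightarrow> (\<exists>tps. (step M A)\<^sup>*\<^sup>* (init_config M x) (accept_st M, tps))"

text \<open>Every computation path halts within polynomially many steps, whether accepting or not.\<close>

definition poly_time :: "machine \<Rightarrow> lang \<Rightarrow> bool" where
  "poly_time M A \<longleftrightarrow>
     (\<exists>p :: nat poly. \<forall>x n c.
        (step M A ^^ n) (init_config M x) c \<longrightarrow> n \<le> poly p (length x))"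

section \<open>Complexity classes\<close>

text \<open>For an oracle-free machine the oracle is irrelevant; \<open>{}\<close> is a dummy argument.\<close>

definition class_P :: "lang set" where
  "class_P = {L. \<exists>M. wf_machine M \<and> deterministic M \<and> oracle_free M \<and> poly_time M {} \<and>
                    L = {x. accepts M {} x}}"

definition NP_oracle :: "lang \<Rightarrow> lang set" where
  "NP_oracle A = {L. \<exists>M. wf_machine M \<and> poly_time M A \<and> L = {x. accepts M A x}}"

definition NP_relative :: "lang set \<Rightarrow> lang set" where
  "NP_relative C = (\<Union>A\<in>C. NP_oracle A)"

fun SigmaP :: "nat \<Rightarrow> lang set" where
  "SigmaP 0 = class_P"
| "SigmaP (Suc k) = NP_relative (SigmaP k)"

definition PH :: "lang set" where
  "PH = (\<Union>k. SigmaP k)"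

definition co_class :: "lang set \<Rightarrow> lang set" where
  "co_class C = {- L | L. L \<in> C}"

definition diff_class :: "lang set \<Rightarrow> lang set \<Rightarrow> lang set" (infixr "\<ominus>" 65) where
  "C1 \<ominus> C2 = {L1 - L2 | L1 L2. L1 \<in> C1 \<and> L2 \<in> C2}"

fun DIFF :: "nat \<Rightarrow> lang set \<Rightarrow> lang set" where
  "DIFF 0 C = {{}}"
| "DIFF (Suc 0) C = C"
| "DIFF (Suc (Suc m)) C = C \<ominus> DIFF (Suc m) C"

definition symdiff_class :: "lang set \<Rightarrow> lang set \<Rightarrow> lang set" (infixl "\<^bold>\<Delta>" 65) where
  "C \<^bold>\<Delta> D = {sym_diff L1 L2 | L1 L2. L1 \<in> C \<and> L2 \<in> D}"

end

theory Submission
  imports Defs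
begin

text \<open>
  The proof is an easy--hard argument. It uses no complete sets: for a given oracle \<open>A\<close> in \<open>\<Sigma>\<close> level \<open>k\<close>,
  the set of \<open>m\<close>-tuples for which the last position holding a word of \<open>A\<close> is odd (counting from one) is in \<open>DIFF\<close> level \<open>m\<close>,
  so by hypothesis its complement is a nested difference as well. Comparing the two mind-change counts, a word
  outside \<open>A\<close> is either easy (an existential certificate for nonmembership exists) or extends a sequence
  of hard words. Such a sequence has fewer than \<open>m\<close> members, and relative to a maximal one the complement of \<open>A\<close>
  is itself in level \<open>k\<close>, which lowers by one level every class built on the oracle \<open>A\<close>.

  Guessing a maximal hard sequence gives \<open>PH\<close> = level \<open>k + 2\<close>. Then \<open>PH\<close> is closed under complement,
  and a language in it is predicted, relative to each hard sequence, by a level \<open>k + 1\<close> predicate and its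
  complement. The alternations of these predictions along lengthening hard sequences give \<open>DIFF\<close> level \<open>m\<close> over
  level \<open>k + 1\<close>. Applied again to the \<open>m\<close> components of such a difference, the prediction of the
  empty hard sequence is in \<open>DIFF\<close> level \<open>m\<close> over level \<open>k\<close>, and only \<open>m - 1\<close> further alternations remain.

  The closure properties of oracle classes come from nondeterministic stack programs, which are polynomially
  equivalent to the oracle Turing machines of the definitions.
\<close>

section \<open>Nondeterministic stack programs with oracle queries\<close>

text \<open>Three points are left open above. Length bounds: hardness refers to a bound on word
  lengths, and certificates are tuples of words below the same bound. One polynomial in the length
  of the input is therefore fixed in advance, large enough for every query that the nested oracle
  computations can ask; the quantifier order in \<open>Acc_subst\<close> and in \<open>Adv\<close>
  serves this purpose. Why a hard sequence cannot fill the tuple: with \<open>m\<close> hard words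
  both mind-change counts would be 0, although their parities differ. Why \<open>m - 1\<close>: hard
  sequences have lengths 0 to \<open>m - 1\<close>. The prediction of the empty one is the first
  operand of the symmetric difference. The second operand corrects it by counting alternations over
  the lengths from 1 on, of which there are at most \<open>m - 1\<close>. Such a count starts from
  the value predicted by the empty sequence, which varies with the word, so it is inserted by a case
  distinction; this stays inside level \<open>k + 1\<close> because the first operand and its
  complement both belong to that level.\<close>

type_synonym st = "nat \<Rightarrow> nat list"

datatype prog = Fail | Skip | Push nat nat | Pop nat nat | IsNil nat | Query nat bool
  | Seq prog prog (infixr ";;" 60) | Alt prog prog | Star prog

text \<open>A failing test has no execution. \<open>Query r b\<close> passes if the answer to the content of register \<open>r\<close> is \<open>b\<close>.\<close>

inductive exec :: "(bool \<Rightarrow> nat list \<Rightarrow> bool) \<Rightarrow> prog \<Rightarrow> st \<Rightarrow> nat \<Rightarrow> st \<Rightarrow> bool" for Q where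
  eSkip: "exec Q Skip s (Suc 0) s"
| ePush: "exec Q (Push r a) s (Suc 0) (s(r := a # s r))"
| ePop: "s r = a # w \<Longrightarrow> exec Q (Pop r a) s (Suc 0) (s(r := w))"
| eNil: "s r = [] \<Longrightarrow> exec Q (IsNil r) s (Suc 0) s"
| eQuery: "Q b (s r) \<Longrightarrow> exec Q (Query r b) s (Suc 0) s"
| eSeq: "exec Q p s n t \<Longrightarrow> exec Q q t m u \<Longrightarrow> exec Q (p ;; q) s (Suc (n + m)) u"
| eAlt1: "exec Q p s n t \<Longrightarrow> exec Q (Alt p q) s (Suc n) t"
| eAlt2: "exec Q q s n t \<Longrightarrow> exec Q (Alt p q) s (Suc n) t"
| eStar0: "exec Q (Star p) s (Suc 0) s"
| eStar1: "exec Q p s n t \<Longrightarrow> exec Q (Star p) t m u \<Longrightarrow> exec Q (Star p) s (Suc (n + m)) u"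

definition runs :: "(bool \<Rightarrow> nat list \<Rightarrow> bool) \<Rightarrow> prog \<Rightarrow> st \<Rightarrow> st \<Rightarrow> bool" where
  "runs Q p s t \<longleftrightarrow> (\<exists>n. exec Q p s n t)"

text \<open>Soundness speaks of \<open>runs\<close>, as every successful run has to be right;
  completeness asks for one run within a step bound. The two notions are kept apart
  throughout.\<close>

definition runs_in :: "(bool \<Rightarrow> nat list \<Rightarrow> bool) \<Rightarrow> prog \<Rightarrow> st \<Rightarrow> nat \<Rightarrow> st \<Rightarrow> bool" where
  "runs_in Q p s N t \<longleftrightarrow> (\<exists>n\<le>N. exec Q p s n t)"

inductive_cases exec_FailE: "exec Q Fail s n t"
inductive_cases exec_SkipE: "exec Q Skip s n t"
inductive_cases exec_PushE: "exec Q (Push r a) s n t"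
inductive_cases exec_PopE: "exec Q (Pop r a) s n t"
inductive_cases exec_IsNilE: "exec Q (IsNil r) s n t"
inductive_cases exec_QueryE: "exec Q (Query r b) s n t"
inductive_cases exec_SeqE: "exec Q (p ;; q) s n t"
inductive_cases exec_AltE: "exec Q (Alt p q) s n t"
inductive_cases exec_StarE: "exec Q (Star p) s n t"

lemma runs_simps [simp]:
  "\<not> runs Q Fail s t"
  "runs Q Skip s t \<longleftrightarrow> t = s"
  "runs Q (Push r a) s t \<longleftrightarrow> t = s(r := a # s r)"
  "runs Q (Pop r a) s t \<longleftrightarrow> (\<exists>w. s r = a # w \<and> t = s(r := w))"
  "runs Q (IsNil r) s t \<longleftrightarrow> s r = [] \<and> t = s"
  "runs Q (Query r b) s t \<longleftrightarrow> Q b (s r) \<and> t = s"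
  "runs Q (p ;; q) s t \<longleftrightarrow> (\<exists>u. runs Q p s u \<and> runs Q q u t)"
  "runs Q (Alt p q) s t \<longleftrightarrow> runs Q p s t \<or> runs Q q s t"
  unfolding runs_def
  by (auto elim: exec_FailE exec_SkipE exec_PushE exec_PopE exec_IsNilE exec_QueryE exec_SeqE exec_AltE
      intro: exec.intros)
   (blast intro: exec.intros elim: exec_SeqE exec_AltE)+

lemma runs_Star: "runs Q (Star p) s t \<longleftrightarrow> (runs Q p)\<^sup>*\<^sup>* s t"
proof
  assume "runs Q (Star p) s t"
  then obtain n where "exec Q (Star p) s n t" by (auto simp: runs_def)
  then show "(runs Q p)\<^sup>*\<^sup>* s t"
  proof (induction "Star p" s n t)
    case (eStar1 s n t m u)
    then have "runs Q p s t" by (auto simp: runs_def)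
    then show ?case using eStar1 by (meson converse_rtranclp_into_rtranclp)
  qed simp
next
  assume "(runs Q p)\<^sup>*\<^sup>* s t"
  then show "runs Q (Star p) s t"
    by (induction rule: converse_rtranclp_induct) (auto simp: runs_def intro: eStar0 eStar1)
qed

lemma runs_in_runs: "runs_in Q p s N t \<Longrightarrow> runs Q p s t"
  by (auto simp: runs_in_def runs_def)

lemma runs_in_mono: "runs_in Q p s n t \<Longrightarrow> n \<le> N \<Longrightarrow> runs_in Q p s N t"
  by (auto simp: runs_in_def intro: le_trans)

lemma runs_in_prim:
  "1 \<le> N \<Longrightarrow> t = s \<Longrightarrow> runs_in Q Skip s N t"
  "1 \<le> N \<Longrightarrow> t = s(r := a # s r) \<Longrightarrow> runs_in Q (Push r a) s N t"
  "1 \<le> N \<Longrightarrow> s r = a # w \<Longrightarrow> t = s(r := w) \<Longrightarrow> runs_in Q (Pop r a) s N t"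
  "1 \<le> N \<Longrightarrow> s r = [] \<Longrightarrow> t = s \<Longrightarrow> runs_in Q (IsNil r) s N t"
  "1 \<le> N \<Longrightarrow> Q b (s r) \<Longrightarrow> t = s \<Longrightarrow> runs_in Q (Query r b) s N t"
  "1 \<le> N \<Longrightarrow> t = s \<Longrightarrow> runs_in Q (Star p) s N t"
  unfolding runs_in_def by (auto intro!: exI[of _ "Suc 0"] eSkip ePush ePop eNil eQuery eStar0)

lemma runs_in_Seq:
  "runs_in Q p s n t \<Longrightarrow> runs_in Q q t m u \<Longrightarrow> n + m + 1 \<le> N \<Longrightarrow> runs_in Q (p ;; q) s N u"
  unfolding runs_in_def by clarify (rule exI, rule conjI, rule_tac [2] eSeq, auto)

lemma runs_in_Alt1: "runs_in Q p s n t \<Longrightarrow> n + 1 \<le> N \<Longrightarrow> runs_in Q (Alt p q) s N t"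
  unfolding runs_in_def by clarify (rule exI, rule conjI, rule_tac [2] eAlt1, auto)

lemma runs_in_Alt2: "runs_in Q q s n t \<Longrightarrow> n + 1 \<le> N \<Longrightarrow> runs_in Q (Alt p q) s N t"
  unfolding runs_in_def by clarify (rule exI, rule conjI, rule_tac [2] eAlt2, auto)

lemma runs_in_Star:
  "runs_in Q p s n t \<Longrightarrow> runs_in Q (Star p) t m u \<Longrightarrow> n + m + 1 \<le> N \<Longrightarrow> runs_in Q (Star p) s N u"
  unfolding runs_in_def by clarify (rule exI, rule conjI, rule_tac [2] eStar1, auto)

definition alts :: "prog list \<Rightarrow> prog" where
  "alts ps = foldr Alt ps Fail"

lemma runs_alts [simp]: "runs Q (alts ps) s t \<longleftrightarrow> (\<exists>p\<in>set ps. runs Q p s t)"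
  by (induction ps) (auto simp: alts_def)

lemma runs_in_alts:
  "p \<in> set ps \<Longrightarrow> runs_in Q p s n t \<Longrightarrow> n + length ps \<le> N \<Longrightarrow> runs_in Q (alts ps) s N t"
proof (induction ps arbitrary: N)
  case (Cons q ps)
  show ?case
  proof (cases "p = q")
    case True
    then show ?thesis using Cons.prems by (auto simp: alts_def intro: runs_in_Alt1)
  next
    case False
    then have "runs_in Q (alts ps) s (n + length ps) t" using Cons by simp
    then show ?thesis using Cons.prems by (auto simp: alts_def intro: runs_in_Alt2)
  qed
qed simp

text \<open>\<open>Star\<close> may stop at any time. The closing \<open>IsNil\<close> discards the
  runs that stop early, so the loop consumes the whole register.\<close>

definition each :: "nat list \<Rightarrow> nat \<Rightarrow> (nat \<Rightarrow> prog) \<Rightarrow> prog" where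
  "each al r body = Star (alts (map (\<lambda>a. Pop r a ;; body a) al)) ;; IsNil r"

lemma runs_each_Nil: "s r = [] \<Longrightarrow> runs Q (each al r body) s t \<longleftrightarrow> t = s"
proof -
  assume "s r = []"
  then have "\<not> runs Q (alts (map (\<lambda>a. Pop r a ;; body a) al)) s u" for u by auto
  then have "(runs Q (alts (map (\<lambda>a. Pop r a ;; body a) al)))\<^sup>*\<^sup>* s t \<longleftrightarrow> t = s"
    by (metis converse_rtranclpE rtranclp.rtrancl_refl)
  then show ?thesis using \<open>s r = []\<close> by (auto simp: each_def runs_Star simp del: runs_alts)
qed

lemma runs_each_Cons:
  assumes "s r = a # w"
  shows "runs Q (each al r body) s t \<longleftrightarrow>
    a \<in> set al \<and> (\<exists>u. runs Q (body a) (s(r := w)) u \<and> runs Q (each al r body) u t)"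
    (is "?l \<longleftrightarrow> ?r")
proof
  assume ?l
  then have "(runs Q (alts (map (\<lambda>a. Pop r a ;; body a) al)))\<^sup>*\<^sup>* s t" "t r = []"
    by (auto simp: each_def runs_Star)
  then show ?r using assms
    by (auto simp: each_def runs_Star elim!: converse_rtranclpE[of _ s])
next
  assume ?r
  then obtain u where u: "a \<in> set al" "runs Q (body a) (s(r := w)) u" "runs Q (each al r body) u t"
    by auto
  let ?p = "alts (map (\<lambda>a. Pop r a ;; body a) al)"
  have "runs Q (Pop r a ;; body a) s u" using u assms by auto
  then have "runs Q ?p s u" using u(1) by (auto simp del: runs_simps)
  moreover have "(runs Q ?p)\<^sup>*\<^sup>* u t" "t r = []" using u(3) by (auto simp: each_def runs_Star)
  ultimately have "(runs Q ?p)\<^sup>*\<^sup>* s t" by (meson converse_rtranclp_into_rtranclp)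
  then show ?l using \<open>t r = []\<close> unfolding each_def runs_simps(7) runs_Star by auto
qed

lemma runs_in_each_Nil: "s r = [] \<Longrightarrow> 3 \<le> N \<Longrightarrow> t = s \<Longrightarrow> runs_in Q (each al r body) s N t"
  unfolding each_def by (rule runs_in_Seq[where n = 1 and m = 1]) (auto intro: runs_in_prim)

text \<open>Beyond its body a round costs 3 units for the pop, its sequencing and the unrolling of
  the star, and at most \<open>length al\<close> for the choice of the alternative.\<close>

lemma runs_in_each_Cons:
  assumes "s r = a # w" "a \<in> set al" "runs_in Q (body a) (s(r := w)) n u"
    "runs_in Q (each al r body) u m t" "n + m + length al + 3 \<le> N"
  shows "runs_in Q (each al r body) s N t"
proof -
  let ?p = "alts (map (\<lambda>a. Pop r a ;; body a) al)"
  have p: "runs_in Q ?p s (n + 2 + length al) u"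
    by (rule runs_in_alts[where p = "Pop r a ;; body a" and n = "n + 2"])
      (use assms in \<open>auto intro!: runs_in_Seq[where n = 1 and m = n] runs_in_prim\<close>)
  \<comment> \<open>The remaining run is cut before its final test, so that the new round can be put
    in front of its loop.\<close>
  obtain k where "k \<le> m" "exec Q (each al r body) u k t" using assms(4) by (auto simp: runs_in_def)
  then obtain i j v where e: "exec Q (Star ?p) u i v" "exec Q (IsNil r) v j t" "k = Suc (i + j)"
    unfolding each_def by (auto elim: exec_SeqE)
  have "runs_in Q (Star ?p) u i v" using e by (auto simp: runs_in_def)
  with p have "runs_in Q (Star ?p) s (n + 2 + length al + i + 1) v" by (rule runs_in_Star) simp
  moreover have "runs_in Q (IsNil r) v j t" using e by (auto simp: runs_in_def)
  ultimately show ?thesis unfolding each_def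
    using \<open>k \<le> m\<close> e(3) assms(5) by (auto intro: runs_in_Seq)
qed

section \<open>Clearing, moving and copying stacks\<close>

definition clear :: "nat \<Rightarrow> nat \<Rightarrow> prog" where
  "clear B r = each [0..<B] r (\<lambda>a. Skip)"

definition mv :: "nat list \<Rightarrow> nat \<Rightarrow> nat \<Rightarrow> prog" where
  "mv al r u = each al r (\<lambda>a. Push u a)"

definition mv2 :: "nat list \<Rightarrow> nat \<Rightarrow> nat \<Rightarrow> nat \<Rightarrow> prog" where
  "mv2 al r u v = each al r (\<lambda>a. Push u a ;; Push v a)"

lemma runs_clear [simp]: "runs Q (clear B r) s t \<longleftrightarrow> set (s r) \<subseteq> {..<B} \<and> t = s(r := [])"
  unfolding clear_def
proof (induction "s r" arbitrary: s)
  case Nil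
  then show ?case by (auto simp: runs_each_Nil fun_upd_idem)
next
  case (Cons a w)
  have "s r = a # w" using Cons by simp
  with Cons(1)[of "s(r := w)"] show ?case by (auto simp: runs_each_Cons)
qed

lemma runs_in_clear:
  "set (s r) \<subseteq> {..<B} \<Longrightarrow> (B + 4) * length (s r) + 3 \<le> N \<Longrightarrow> t = s(r := []) \<Longrightarrow>
    runs_in Q (clear B r) s N t"
  unfolding clear_def
proof (induction "s r" arbitrary: s N)
  case Nil
  then show ?case by (auto intro!: runs_in_each_Nil)
next
  case (Cons a w)
  have [simp]: "s r = a # w" using Cons by simp
  show ?case
  proof (rule runs_in_each_Cons)
    show "runs_in Q Skip (s(r := w)) 1 (s(r := w))" by (rule runs_in_prim) auto
    show "runs_in Q (each [0..<B] r (\<lambda>a. Skip)) (s(r := w)) ((B + 4) * length w + 3) t"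
      using Cons.prems by (intro Cons.hyps(1)) auto
  qed (use Cons.prems in \<open>auto simp: algebra_simps\<close>)
qed

lemma runs_mv [simp]: "r \<noteq> u \<Longrightarrow>
    runs Q (mv al r u) s t \<longleftrightarrow> set (s r) \<subseteq> set al \<and> t = s(r := [], u := rev (s r) @ s u)"
  unfolding mv_def
proof (induction "s r" arbitrary: s)
  case Nil
  then show ?case by (auto simp: runs_each_Nil fun_upd_idem)
next
  case (Cons a w)
  have "s r = a # w" using Cons by simp
  with Cons(1)[of "s(r := w, u := a # s u)"] show ?case using Cons(3)
    by (auto simp: runs_each_Cons fun_upd_twist)
qed

lemma runs_in_mv: "r \<noteq> u \<Longrightarrow> set (s r) \<subseteq> set al \<Longrightarrow> (length al + 4) * length (s r) + 3 \<le> N \<Longrightarrow>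
    t = s(r := [], u := rev (s r) @ s u) \<Longrightarrow> runs_in Q (mv al r u) s N t"
  unfolding mv_def
proof (induction "s r" arbitrary: s N)
  case Nil
  then show ?case by (auto intro!: runs_in_each_Nil)
next
  case (Cons a w)
  have [simp]: "s r = a # w" using Cons by simp
  show ?case
  proof (rule runs_in_each_Cons)
    show "runs_in Q (Push u a) (s(r := w)) 1 (s(r := w, u := a # s u))"
      using Cons.prems by (intro runs_in_prim) auto
    show "runs_in Q (each al r (Push u)) (s(r := w, u := a # s u)) ((length al + 4) * length w + 3) t"
      using Cons.prems by (intro Cons.hyps(1)) (auto simp: fun_eq_iff)
  qed (use Cons.prems in \<open>auto simp: algebra_simps\<close>)
qed

lemma runs_mv2 [simp]: "r \<noteq> u \<Longrightarrow> r \<noteq> v \<Longrightarrow> u \<noteq> v \<Longrightarrow>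
    runs Q (mv2 al r u v) s t \<longleftrightarrow>
      set (s r) \<subseteq> set al \<and> t = s(r := [], u := rev (s r) @ s u, v := rev (s r) @ s v)"
  unfolding mv2_def
proof (induction "s r" arbitrary: s)
  case Nil
  then show ?case by (auto simp: runs_each_Nil fun_upd_idem)
next
  case (Cons a w)
  have "s r = a # w" using Cons by simp
  with Cons(1)[of "s(r := w, u := a # s u, v := a # s v)"] show ?case using Cons(3-)
    by (auto simp: runs_each_Cons fun_upd_twist)
qed

lemma runs_in_mv2: "r \<noteq> u \<Longrightarrow> r \<noteq> v \<Longrightarrow> u \<noteq> v \<Longrightarrow> set (s r) \<subseteq> set al \<Longrightarrow>
    (length al + 6) * length (s r) + 3 \<le> N \<Longrightarrow>
    t = s(r := [], u := rev (s r) @ s u, v := rev (s r) @ s v) \<Longrightarrow> runs_in Q (mv2 al r u v) s N t"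
  unfolding mv2_def
proof (induction "s r" arbitrary: s N)
  case Nil
  then show ?case by (auto intro!: runs_in_each_Nil)
next
  case (Cons a w)
  have [simp]: "s r = a # w" using Cons by simp
  show ?case
  proof (rule runs_in_each_Cons)
    show "runs_in Q (Push u a ;; Push v a) (s(r := w)) 3 (s(r := w, u := a # s u, v := a # s v))"
      using Cons.prems by (intro runs_in_Seq[where n = 1 and m = 1] runs_in_prim) auto
    show "runs_in Q (each al r (\<lambda>a. Push u a ;; Push v a)) (s(r := w, u := a # s u, v := a # s v))
        ((length al + 6) * length w + 3) t"
      using Cons.prems by (intro Cons.hyps(1)) (auto simp: fun_eq_iff)
  qed (use Cons.prems in \<open>auto simp: algebra_simps\<close>)
qed

text \<open>Reading a stack empties it. The first pass reverses \<open>r\<close> into the scratch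
  register \<open>t\<close>, the second reverses it back into \<open>r\<close> and \<open>u\<close>
  at once.\<close>

definition copy :: "nat list \<Rightarrow> nat \<Rightarrow> nat \<Rightarrow> nat \<Rightarrow> prog" where
  "copy al r t u = mv al r t ;; mv2 al t r u"

lemma runs_copy [simp]:
  assumes "r \<noteq> t" "r \<noteq> u" "t \<noteq> u" "s t = []"
  shows "runs Q (copy al r t u) s s' \<longleftrightarrow> set (s r) \<subseteq> set al \<and> s' = s(u := s r @ s u)"
proof -
  have "s(r := [], t := [], r := s r, u := s r @ s u) = s(u := s r @ s u)"
    using assms by (auto simp: fun_eq_iff)
  with assms show ?thesis unfolding copy_def by auto
qed

lemma runs_in_copy:
  assumes "r \<noteq> t" "r \<noteq> u" "t \<noteq> u" "s t = []" "set (s r) \<subseteq> set al"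
    "(2 * length al + 10) * length (s r) + 7 \<le> N" "s' = s(u := s r @ s u)"
  shows "runs_in Q (copy al r t u) s N s'"
  unfolding copy_def
proof (rule runs_in_Seq)
  show "runs_in Q (mv al r t) s ((length al + 4) * length (s r) + 3) (s(r := [], t := rev (s r)))"
    using assms by (auto intro!: runs_in_mv)
  show "runs_in Q (mv2 al t r u) (s(r := [], t := rev (s r))) ((length al + 6) * length (s r) + 3) s'"
    using assms by (intro runs_in_mv2) (auto simp: fun_eq_iff)
qed (use assms in \<open>auto simp: algebra_simps\<close>)

definition seqs :: "prog list \<Rightarrow> prog" where
  "seqs ps = foldr Seq ps Skip"

lemma seqs_simps: "seqs [] = Skip" "seqs (p # ps) = p ;; seqs ps"
  by (auto simp: seqs_def)

definition clears :: "nat \<Rightarrow> nat list \<Rightarrow> prog" where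
  "clears B rs = seqs (map (clear B) rs)"

lemma runs_clears [simp]: "runs Q (clears B rs) s t \<longleftrightarrow>
    (\<forall>r\<in>set rs. set (s r) \<subseteq> {..<B}) \<and> t = (\<lambda>r. if r \<in> set rs then [] else s r)"
  unfolding clears_def
proof (induction rs arbitrary: s)
  case (Cons r rs)
  have *: "(\<lambda>x. if x \<in> set rs then [] else (s(r := [])) x) = (\<lambda>x. if x \<in> set (r # rs) then [] else s x)"
    by auto
  show ?case unfolding list.map seqs_simps runs_simps(7) runs_clear Cons.IH
    by (simp only: *[symmetric]) auto
qed (auto simp: seqs_simps)

lemma runs_in_clears:
  "(\<And>r. r \<in> set rs \<Longrightarrow> set (s r) \<subseteq> {..<B} \<and> length (s r) \<le> n) \<Longrightarrow>
    t = (\<lambda>r. if r \<in> set rs then [] else s r) \<Longrightarrow> ((B + 4) * n + 4) * length rs + 1 \<le> N \<Longrightarrow>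
    runs_in Q (clears B rs) s N t"
  unfolding clears_def
proof (induction rs arbitrary: s N)
  case Nil
  then show ?case by (auto simp: seqs_simps intro!: runs_in_prim)
next
  case (Cons r rs)
  have "runs_in Q (clear B r) s ((B + 4) * n + 3) (s(r := []))"
    using Cons.prems(1)[of r] by (intro runs_in_clear) auto
  moreover have "runs_in Q (seqs (map (clear B) rs)) (s(r := [])) (((B + 4) * n + 4) * length rs + 1) t"
    using Cons.prems by (intro Cons.IH) auto
  ultimately show ?case using Cons.prems(3) by (auto simp: seqs_simps intro!: runs_in_Seq)
qed

subsection \<open>Register and alphabet bounds\<close>

primrec uses :: "nat set \<Rightarrow> nat \<Rightarrow> prog \<Rightarrow> bool" where
  "uses X B Fail = True"
| "uses X B Skip = True"
| "uses X B (Push r a) = (r \<in> X \<and> a < B)"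
| "uses X B (Pop r a) = (r \<in> X)"
| "uses X B (IsNil r) = (r \<in> X)"
| "uses X B (Query r b) = (r \<in> X)"
| "uses X B (p ;; q) = (uses X B p \<and> uses X B q)"
| "uses X B (Alt p q) = (uses X B p \<and> uses X B q)"
| "uses X B (Star p) = uses X B p"

lemma uses_mono: "uses X B p \<Longrightarrow> X \<subseteq> Y \<Longrightarrow> B \<le> C \<Longrightarrow> uses Y C p"
  by (induction p) auto

lemma ex_uses: "\<exists>n. \<forall>R B. n \<le> R \<longrightarrow> n \<le> B \<longrightarrow> uses {..<R} B p"
proof (induction p)
  case (Push r a)
  show ?case by (rule exI[of _ "Suc (max r a)"]) auto
next
  case (Pop r a)
  show ?case by (rule exI[of _ "Suc r"]) auto
next
  case (IsNil r)
  show ?case by (rule exI[of _ "Suc r"]) auto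
next
  case (Query r b)
  show ?case by (rule exI[of _ "Suc r"]) auto
next
  case (Seq p q)
  then obtain n m where "\<forall>R B. n \<le> R \<longrightarrow> n \<le> B \<longrightarrow> uses {..<R} B p"
    "\<forall>R B. m \<le> R \<longrightarrow> m \<le> B \<longrightarrow> uses {..<R} B q" by auto
  then show ?case by (intro exI[of _ "max n m"]) auto
next
  case (Alt p q)
  then obtain n m where "\<forall>R B. n \<le> R \<longrightarrow> n \<le> B \<longrightarrow> uses {..<R} B p"
    "\<forall>R B. m \<le> R \<longrightarrow> m \<le> B \<longrightarrow> uses {..<R} B q" by auto
  then show ?case by (intro exI[of _ "max n m"]) auto
qed auto

lemma exec_frame: "exec Q p s n t \<Longrightarrow> uses X B p \<Longrightarrow> r \<notin> X \<Longrightarrow> t r = s r"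
  by (induction rule: exec.induct) auto

lemma exec_symbols:
  "exec Q p s n t \<Longrightarrow> uses X B p \<Longrightarrow> \<forall>r. set (s r) \<subseteq> {..<B} \<Longrightarrow> set (t r) \<subseteq> {..<B}"
proof (induction arbitrary: r rule: exec.induct)
  case (ePop s r a w)
  then show ?case by (metis fun_upd_apply set_subset_Cons subset_trans)
qed auto

lemma exec_length: "exec Q p s n t \<Longrightarrow> length (t r) \<le> length (s r) + n"
proof (induction arbitrary: r rule: exec.induct)
  case eSeq
  show ?case using eSeq.IH(1)[of r] eSeq.IH(2)[of r] by simp
next
  case eStar1
  show ?case using eStar1.IH(1)[of r] eStar1.IH(2)[of r] by simp
qed (auto intro: le_SucI)

subsection \<open>Shifting registers\<close>

primrec sh :: "nat \<Rightarrow> prog \<Rightarrow> prog" where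
  "sh b Fail = Fail"
| "sh b Skip = Skip"
| "sh b (Push r a) = Push (b + r) a"
| "sh b (Pop r a) = Pop (b + r) a"
| "sh b (IsNil r) = IsNil (b + r)"
| "sh b (Query r v) = Query (b + r) v"
| "sh b (p ;; q) = sh b p ;; sh b q"
| "sh b (Alt p q) = Alt (sh b p) (sh b q)"
| "sh b (Star p) = Star (sh b p)"

lemma uses_sh: "uses X B p \<Longrightarrow> uses ((+) b ` X) B (sh b p)"
  by (induction p) auto

text \<open>Keeps the registers of a calling program, below \<open>b\<close>, apart from those of a
  program shifted by \<open>b\<close>.\<close>

definition glue :: "nat \<Rightarrow> st \<Rightarrow> st \<Rightarrow> st" where
  "glue b s t = (\<lambda>r. if r < b then s r else t (r - b))"

lemma glue_simps [simp]: "glue b s t (b + r) = t r" "r < b \<Longrightarrow> glue b s t r = s r"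
  "(glue b s t)(b + r := w) = glue b s (t(r := w))"
  by (auto simp: glue_def fun_eq_iff)

lemma exec_sh1: "exec Q p s n t \<Longrightarrow> exec Q (sh b p) (glue b e s) n (glue b e t)"
proof (induction rule: exec.induct)
  case (ePush r a s)
  show ?case using exec.ePush[of Q "b + r" a "glue b e s"] by (simp only: sh.simps glue_simps)
next
  case (ePop s r a w)
  then show ?case using exec.ePop[of "glue b e s" "b + r" a w Q] by (simp only: sh.simps glue_simps)
qed (auto intro: exec.intros)

text \<open>A shifted program cannot reach below \<open>b\<close>; the lower part of the final state
  is thus still \<open>e\<close>, and the upper part reads back as a run of
  \<open>p\<close>.\<close>

lemma exec_sh2: "exec Q (sh b p) (glue b e s) n t' \<Longrightarrow> \<exists>t. t' = glue b e t \<and> exec Q p s n t"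
proof (induction "sh b p" "glue b e s" n t' arbitrary: p s rule: exec.induct)
  case eSkip
  then show ?case by (cases p) (auto intro: exec.intros)
next
  case (ePush r a)
  then show ?case by (cases p) (auto intro: exec.intros)
next
  case (ePop r a w)
  then show ?case by (cases p) (auto intro: exec.intros)
next
  case (eNil r)
  then show ?case by (cases p) (auto intro: exec.intros)
next
  case (eQuery v r)
  then show ?case by (cases p) (auto intro: exec.intros)
next
  case (eSeq p1 n t p2 m u)
  then show ?case by (cases p) (simp_all, metis exec.eSeq)
next
  case (eAlt1 p1 n t q)
  then show ?case by (cases p) (simp_all, metis exec.eAlt1)
next
  case (eAlt2 p1 n t q)
  then show ?case by (cases p) (simp_all, metis exec.eAlt2)
next
  case (eStar0 q)
  then show ?case by (cases p) (auto intro: exec.intros)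
next
  case (eStar1 p1 n t m u)
  then obtain p' where [simp]: "p = Star p'" by (cases p) auto
  then have [simp]: "p1 = sh b p'" using eStar1.hyps by simp
  from eStar1(2)[of p' s] obtain v where v: "t = glue b e v" "exec Q p' s n v" by auto
  have "\<exists>w. u = glue b e w \<and> exec Q (Star p') v m w" using eStar1(4)[of "Star p'" v] v by simp
  then show ?case using v by (auto intro: exec.eStar1)
qed

subsection \<open>Substituting programs for queries\<close>

primrec sub :: "(nat \<Rightarrow> bool \<Rightarrow> prog) \<Rightarrow> prog \<Rightarrow> prog" where
  "sub g Fail = Fail"
| "sub g Skip = Skip"
| "sub g (Push r a) = Push r a"
| "sub g (Pop r a) = Pop r a"
| "sub g (IsNil r) = IsNil r"
| "sub g (Query r b) = g r b"
| "sub g (p ;; q) = sub g p ;; sub g q"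
| "sub g (Alt p q) = Alt (sub g p) (sub g q)"
| "sub g (Star p) = Star (sub g p)"

lemma runs_frame: "runs Q p s t \<Longrightarrow> uses X B p \<Longrightarrow> r \<notin> X \<Longrightarrow> t r = s r"
  by (auto simp: runs_def exec_frame)

text \<open>The program touches only \<open>X\<close>, so at every query the registers outside
  \<open>X\<close> still hold their initial contents \<open>e\<close>. A substituted test may use
  them as parameters or as empty scratch space.\<close>

lemma runs_sub:
  assumes g: "\<And>r b s t. r \<in> X \<Longrightarrow> \<forall>x. x \<notin> X \<longrightarrow> s x = e x \<Longrightarrow> runs Q' (g r b) s t \<Longrightarrow> t = s \<and> Q b (s r)"
  shows "uses X B p \<Longrightarrow> runs Q' (sub g p) s t \<Longrightarrow> \<forall>x. x \<notin> X \<longrightarrow> s x = e x \<Longrightarrow> runs Q p s t"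
proof (induction p arbitrary: s t)
  case (Query r b)
  then show ?case using g[of r s b t] by auto
next
  case (Seq p q)
  then obtain u where u: "runs Q' (sub g p) s u" "runs Q' (sub g q) u t" by auto
  have "runs Q p s u" using Seq u by auto
  moreover have "\<forall>x. x \<notin> X \<longrightarrow> u x = e x" using Seq.prems runs_frame[OF \<open>runs Q p s u\<close>] by auto
  moreover have "uses X B q" using Seq.prems by simp
  ultimately have "runs Q q u t" using Seq.IH(2)[of u t] u by blast
  with \<open>runs Q p s u\<close> show ?case by auto
next
  case (Star p)
  have "(runs Q' (sub g p))\<^sup>*\<^sup>* s t" using Star.prems by (simp add: runs_Star)
  then have "(runs Q p)\<^sup>*\<^sup>* s t \<and> (\<forall>x. x \<notin> X \<longrightarrow> t x = e x)"
  proof (induction rule: rtranclp_induct)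
    case base
    then show ?case using Star.prems by simp
  next
    case (step u v)
    then have "runs Q p u v" using Star by auto
    then show ?case using step runs_frame[OF \<open>runs Q p u v\<close>, of X B] Star.prems by (auto intro: rtranclp.rtrancl_into_rtrancl)
  qed
  then show ?case by (simp add: runs_Star)
qed auto

text \<open>With \<open>n\<close> steps left no register can grow by more than \<open>n\<close>
  symbols. This invariant keeps every query word within \<open>W\<close>, so that one bound
  \<open>K\<close> serves for all substituted tests.\<close>

lemma runs_in_sub:
  assumes g: "\<And>r b s. r \<in> X \<Longrightarrow> \<forall>x. x \<notin> X \<longrightarrow> s x = e x \<Longrightarrow> Q b (s r) \<Longrightarrow> length (s r) \<le> W \<Longrightarrow>
      runs_in Q' (g r b) s K s"
  shows "exec Q p s n t \<Longrightarrow> uses X B p \<Longrightarrow> \<forall>x. x \<notin> X \<longrightarrow> s x = e x \<Longrightarrow>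
    \<forall>r\<in>X. length (s r) + n \<le> W \<Longrightarrow> runs_in Q' (sub g p) s (n * (K + 1)) t"
proof (induction rule: exec.induct)
  case (eQuery b s r)
  then have "runs_in Q' (g r b) s K s" by (intro g) fastforce+
  then show ?case by (auto elim: runs_in_mono)
next
  case (eSeq p s n t q m u)
  have "\<forall>x. x \<notin> X \<longrightarrow> t x = e x" using eSeq exec_frame[OF eSeq(1), of X B] by auto
  moreover have "\<forall>r\<in>X. length (t r) + m \<le> W"
  proof
    fix r assume "r \<in> X"
    then show "length (t r) + m \<le> W" using eSeq.prems(3) exec_length[OF eSeq(1), of r] by fastforce
  qed
  moreover have "\<forall>r\<in>X. length (s r) + n \<le> W" using eSeq.prems by fastforce
  ultimately have "runs_in Q' (sub g p) s (n * (K + 1)) t" "runs_in Q' (sub g q) t (m * (K + 1)) u"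
    using eSeq by auto
  then show ?case by (simp, elim runs_in_Seq) (auto simp: algebra_simps)
next
  case (eAlt1 p s n t q)
  then show ?case by (simp, intro runs_in_Alt1[where n = "n * (K+1)"]) fastforce+
next
  case (eAlt2 p s n t q)
  then show ?case by (simp, intro runs_in_Alt2[where n = "n * (K+1)"]) fastforce+
next
  case (eStar1 p s n t m u)
  have "\<forall>x. x \<notin> X \<longrightarrow> t x = e x" using eStar1 exec_frame[OF eStar1(1), of X B] by auto
  moreover have "\<forall>r\<in>X. length (t r) + m \<le> W"
  proof
    fix r assume "r \<in> X"
    then show "length (t r) + m \<le> W" using eStar1.prems(3) exec_length[OF eStar1(1), of r] by fastforce
  qed
  moreover have "\<forall>r\<in>X. length (s r) + n \<le> W" using eStar1.prems by fastforce
  ultimately have "runs_in Q' (sub g p) s (n * (K + 1)) t" "runs_in Q' (Star (sub g p)) t (m * (K + 1)) u"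
    using eStar1 by auto
  then show ?case by (simp, elim runs_in_Star) (auto simp: algebra_simps)
qed (auto intro: runs_in_prim)

section \<open>Compiling stack programs to oracle Turing machines\<close>

text \<open>Small steps on a stack of continuations; finitely many continuations are reachable, and they become
  the machine states.\<close>

inductive sstep :: "(bool \<Rightarrow> nat list \<Rightarrow> bool) \<Rightarrow> prog list \<times> st \<Rightarrow> prog list \<times> st \<Rightarrow> bool" for Q where
  "sstep Q (Skip # K, s) (K, s)"
| "sstep Q (Push r a # K, s) (K, s(r := a # s r))"
| "s r = a # w \<Longrightarrow> sstep Q (Pop r a # K, s) (K, s(r := w))"
| "s r = [] \<Longrightarrow> sstep Q (IsNil r # K, s) (K, s)"
| "Q b (s r) \<Longrightarrow> sstep Q (Query r b # K, s) (K, s)"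
| "sstep Q ((p ;; q) # K, s) (p # q # K, s)"
| "sstep Q (Alt p q # K, s) (p # K, s)"
| "sstep Q (Alt p q # K, s) (q # K, s)"
| "sstep Q (Star p # K, s) (K, s)"
| "sstep Q (Star p # K, s) (p # Star p # K, s)"

lemma relpowp_Suc_left: "P x y \<Longrightarrow> (P ^^ n) y z \<Longrightarrow> (P ^^ Suc n) x z"
  by (metis relpowp_Suc_I2)

lemma relpowp_trans: "(P ^^ n) x y \<Longrightarrow> (P ^^ m) y z \<Longrightarrow> (P ^^ (n + m)) x z"
  by (auto simp: relpowp_add)

text \<open>\<open>exec\<close> charges one unit for every construct, sequencing and choice
  included, which makes its counter the exact number of small steps.\<close>

lemma exec_sstep: "exec Q p s n t \<Longrightarrow> (sstep Q ^^ n) (p # K, s) (K, t)"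
proof (induction arbitrary: K rule: exec.induct)
  case (eSeq p s n t q m u)
  have "(sstep Q ^^ (n + m)) (p # q # K, s) (K, u)"
    using eSeq.IH relpowp_trans by fast
  then show ?case by (intro relpowp_Suc_left) (auto intro: sstep.intros)
next
  case (eAlt1 p s n t q)
  show ?case by (rule relpowp_Suc_left[OF _ eAlt1.IH]) (rule sstep.intros)
next
  case (eAlt2 p s n t q)
  show ?case by (rule relpowp_Suc_left[OF _ eAlt2.IH]) (rule sstep.intros)
next
  case (eStar1 p s n t m u)
  have "(sstep Q ^^ (n + m)) (p # Star p # K, s) (K, u)"
    using eStar1.IH relpowp_trans by fast
  then show ?case by (intro relpowp_Suc_left) (auto intro: sstep.intros)
qed (auto intro: sstep.intros)

primrec execl :: "(bool \<Rightarrow> nat list \<Rightarrow> bool) \<Rightarrow> prog list \<Rightarrow> st \<Rightarrow> st \<Rightarrow> bool" where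
  "execl Q [] s t = (t = s)"
| "execl Q (p # K) s t = (\<exists>u. runs Q p s u \<and> execl Q K u t)"

text \<open>Stated backwards, so that a sequence of small steps, followed from its end, turns into a
  big-step execution of the initial continuation.\<close>

lemma sstep_execl: "sstep Q c c' \<Longrightarrow> execl Q (fst c') (snd c') t \<Longrightarrow> execl Q (fst c) (snd c) t"
  by (induction rule: sstep.induct)
     (auto simp: runs_Star intro: converse_rtranclp_into_rtranclp)

lemma ssteps_runs: "(sstep Q)\<^sup>*\<^sup>* (p # [], s) ([], t) \<Longrightarrow> runs Q p s t"
proof -
  have "(sstep Q)\<^sup>*\<^sup>* c ([], t) \<Longrightarrow> execl Q (fst c) (snd c) t" for c
    by (induction rule: converse_rtranclp_induct) (auto intro: sstep_execl)
  from this[of "([p], s)"] show "(sstep Q)\<^sup>*\<^sup>* (p # [], s) ([], t) \<Longrightarrow> runs Q p s t" by auto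
qed

text \<open>Collects the continuations that occur while \<open>p\<close> is executed on top of
  \<open>K\<close>. \<open>K\<close> itself, reached when \<open>p\<close> is done, is added in
  \<open>cl_closed\<close>.\<close>

primrec cl :: "prog \<Rightarrow> prog list \<Rightarrow> prog list set" where
  "cl Fail K = {Fail # K}"
| "cl Skip K = {Skip # K}"
| "cl (Push r a) K = {Push r a # K}"
| "cl (Pop r a) K = {Pop r a # K}"
| "cl (IsNil r) K = {IsNil r # K}"
| "cl (Query r b) K = {Query r b # K}"
| "cl (p ;; q) K = {(p ;; q) # K} \<union> cl p (q # K) \<union> cl q K"
| "cl (Alt p q) K = {Alt p q # K} \<union> cl p K \<union> cl q K"
| "cl (Star p) K = {Star p # K} \<union> cl p (Star p # K)"

lemma cl_head: "p # K \<in> cl p K"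
  by (cases p) auto

lemma finite_cl: "finite (cl p K)"
  by (induction p arbitrary: K) auto

lemma cl_closed: "K \<in> cl p K0 \<Longrightarrow> sstep Q (K, s) (K', s') \<Longrightarrow> K' \<in> insert K0 (cl p K0)"
proof (induction p arbitrary: K0)
  case (Seq p q)
  then consider "K = (p ;; q) # K0" | "K \<in> cl p (q # K0)" | "K \<in> cl q K0" by auto
  then show ?case
  proof cases
    case 1
    then show ?thesis using Seq cl_head by (auto elim: sstep.cases)
  qed (use Seq cl_head[of q K0] in fastforce)+
next
  case (Alt p q)
  then consider "K = Alt p q # K0" | "K \<in> cl p K0" | "K \<in> cl q K0" by auto
  then show ?case
    by cases (use Alt cl_head[of q K0] cl_head[of p K0] in \<open>fastforce elim: sstep.cases\<close>)+
next
  case (Star p)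
  then consider "K = Star p # K0" | "K \<in> cl p (Star p # K0)" by auto
  then show ?case
    by cases (use Star cl_head[of p "Star p # K0"] in \<open>fastforce elim: sstep.cases\<close>)+
qed (auto elim: sstep.cases)

primrec queries :: "prog \<Rightarrow> nat set" where
  "queries Fail = {}"
| "queries Skip = {}"
| "queries (Push r a) = {}"
| "queries (Pop r a) = {}"
| "queries (IsNil r) = {}"
| "queries (Query r b) = {r}"
| "queries (p ;; q) = queries p \<union> queries q"
| "queries (Alt p q) = queries p \<union> queries q"
| "queries (Star p) = queries p"

lemma cl_prop:
  "K \<in> cl p K0 \<Longrightarrow> uses X B p \<Longrightarrow> queries p \<subseteq> Y \<Longrightarrow> \<forall>q\<in>set K0. uses X B q \<and> queries q \<subseteq> Y \<Longrightarrow>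
    \<forall>q\<in>set K. uses X B q \<and> queries q \<subseteq> Y"
proof (induction p arbitrary: K0)
  case (Seq p q)
  from Seq.prems(1) consider "K = (p ;; q) # K0" | "K \<in> cl p (q # K0)" | "K \<in> cl q K0" by auto
  then show ?case
  proof cases
    case 1
    then show ?thesis using Seq.prems by auto
  next
    case 2
    then show ?thesis using Seq.prems by (intro Seq.IH(1)[OF 2]) auto
  next
    case 3
    then show ?thesis using Seq.prems by (intro Seq.IH(2)[OF 3]) auto
  qed
next
  case (Alt p q)
  from Alt.prems(1) consider "K = Alt p q # K0" | "K \<in> cl p K0" | "K \<in> cl q K0" by auto
  then show ?case
  proof cases
    case 1
    then show ?thesis using Alt.prems by auto
  next
    case 2
    then show ?thesis using Alt.prems by (intro Alt.IH(1)[OF 2]) auto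
  next
    case 3
    then show ?thesis using Alt.prems by (intro Alt.IH(2)[OF 3]) auto
  qed
next
  case (Star p)
  from Star.prems(1) consider "K = Star p # K0" | "K \<in> cl p (Star p # K0)" by auto
  then show ?case
  proof cases
    case 1
    then show ?thesis using Star.prems by auto
  next
    case 2
    then show ?thesis using Star.prems by (intro Star.IH[OF 2]) auto
  qed
qed auto

text \<open>0 and 1 become proper bits, so that a stack of them on tape 1 reads as a query word;
  every other symbol ends that word.\<close>

definition en :: "nat \<Rightarrow> tsym" where
  "en a = (if a = 0 then Bit False else if a = 1 then Bit True else Aux a)"

lemma en_inj: "en a = en b \<Longrightarrow> a = b"
  by (auto simp: en_def split: if_splits)

lemma en_neq [simp]: "en a \<noteq> LeftEnd" "en a \<noteq> Blank" "LeftEnd \<noteq> en a" "Blank \<noteq> en a"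
  by (auto simp: en_def)

text \<open>The top of the stack is under the head, with the bottom next to the end marker.\<close>

definition stape :: "nat list \<Rightarrow> tape" where
  "stape w = ((\<lambda>i. if i = 0 then LeftEnd else if i \<le> length w then en (rev w ! (i - 1)) else Blank),
     length w)"

lemma read_stape: "read_tape (stape w) = (case w of [] \<Rightarrow> LeftEnd | a # _ \<Rightarrow> en a)"
  by (auto simp: read_tape_def stape_def split: list.splits) (simp add: nth_append)

lemma act_pop: "act_tape (Blank, Left) (stape (a # w)) = stape w"
  by (auto simp: act_tape_def stape_def fun_eq_iff nth_append)

lemma act_stay: "act_tape (read_tape t, Stay) t = t"
  by (cases t) (auto simp: act_tape_def read_tape_def)

lemma act_push:
  "act_tape (en a, Stay) (fst (stape w), Suc (length w)) = stape (a # w)"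
  "act_tape (read_tape (stape w), Right) (stape w) = (fst (stape w), Suc (length w))"
  "read_tape (fst (stape w), Suc (length w)) = Blank"
proof -
  have "(rev w @ [a]) ! (x - Suc 0) = a" if "x = Suc (length w)" for x using that by (simp add: nth_append)
  moreover have "(rev w @ [a]) ! (x - Suc 0) = rev w ! (x - Suc 0)" if "x > 0" "x \<le> length w" for x
    using that by (auto simp: nth_append)
  ultimately show "act_tape (en a, Stay) (fst (stape w), Suc (length w)) = stape (a # w)"
    by (auto simp: act_tape_def stape_def fun_eq_iff)
qed (auto simp: act_tape_def stape_def fun_eq_iff read_tape_def)

text \<open>The list head is the top of the stack and holds the last bit of \<open>x\<close>; from
  the bottom up, that is along the tape, \<open>x\<close> then appears in its own order.\<close>

definition stk :: "bool list \<Rightarrow> nat list" where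
  "stk x = map (\<lambda>b. if b then 1 else 0) (rev x)"

definition ini :: "bool list list \<Rightarrow> st" where
  "ini xs = (\<lambda>r. if r < length xs then stk (xs ! r) else [])"

lemma word_tape_stape: "stape (stk x) = (fst (word_tape x), length x)" "word_tape [] = stape []"
  by (auto simp: stape_def word_tape_def stk_def en_def fun_eq_iff rev_map)

lemma query_word_stape:
  "query_word (stape w) = map (\<lambda>a. a = 1) (takeWhile (\<lambda>a. a < 2) (rev w))"
proof -
  let ?v = "takeWhile (\<lambda>a. a < 2) (rev w)"
  have bit: "en a \<in> range Bit \<longleftrightarrow> a < 2" for a by (auto simp: en_def)
  have le: "length ?v \<le> length w" by (metis length_rev length_takeWhile_le)
  have a: "fst (stape w) (Suc i) \<in> range Bit" "(fst (stape w) (Suc i) = Bit True) = (?v ! i = 1)"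
    if "i < length ?v" for i
  proof -
    have "rev w ! i = ?v ! i" using that by (simp add: takeWhile_nth)
    moreover have "?v ! i < 2" using that by (metis nth_mem set_takeWhileD)
    ultimately show "fst (stape w) (Suc i) \<in> range Bit" "(fst (stape w) (Suc i) = Bit True) = (?v ! i = 1)"
      using that le bit by (auto simp: stape_def en_def)
  qed
  have "(LEAST n. fst (stape w) (Suc n) \<notin> range Bit) = length ?v"
  proof (rule Least_equality)
    show "fst (stape w) (Suc (length ?v)) \<notin> range Bit"
    proof (cases "length ?v < length w")
      case True
      then have "\<not> rev w ! length ?v < 2" by (metis length_rev nth_length_takeWhile)
      then show ?thesis using True bit by (auto simp: stape_def)
    next
      case False
      then show ?thesis by (auto simp: stape_def)
    qed
    show "length ?v \<le> y" if "fst (stape w) (Suc y) \<notin> range Bit" for y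
      using that a(1)[of y] by (meson not_le)
  qed
  then show ?thesis by (auto simp: query_word_def a(2)[simplified] intro!: nth_equalityI)
qed

text \<open>Only the bits at the bottom of the stack reach the oracle, as in \<open>query_word\<close>.\<close>

definition Qt :: "lang \<Rightarrow> bool \<Rightarrow> nat list \<Rightarrow> bool" where
  "Qt A b w \<longleftrightarrow> (map (\<lambda>a. a = 1) (takeWhile (\<lambda>a. a < 2) (rev w)) \<in> A) = b"

section \<open>The machine of a program\<close>

locale compiler =
  fixes p :: prog and R B :: nat and f :: "prog list \<Rightarrow> nat"
  assumes R: "2 \<le> R" "uses {..<R} B p" "queries p \<subseteq> {1}"
    and f: "inj_on f (insert [] (cl p []))"
begin

definition "S = insert [] (cl p [])"

text \<open>Each continuation has two states; the second is reached in the middle of a push, which needs two moves.\<close>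

definition "cd i K = 5 + 2 * f K + i" for i :: nat

lemma cd_inj: "K \<in> S \<Longrightarrow> K' \<in> S \<Longrightarrow> i < 2 \<Longrightarrow> i' < 2 \<Longrightarrow> cd i K = cd i' K' \<longleftrightarrow> i = i' \<and> K = K'"
proof -
  assume "K \<in> S" "K' \<in> S" "i < 2" "i' < 2"
  moreover have "cd i K = cd i' K' \<Longrightarrow> i = i' \<and> f K = f K'" if "i < 2" "i' < 2"
    using that unfolding cd_def by presburger
  ultimately show ?thesis using f unfolding S_def by (metis inj_onD)
qed

lemma cd_ge [simp]: "cd i K \<noteq> 0" "cd i K \<noteq> 1" "cd i K \<noteq> 2" "cd i K \<noteq> 3" "cd i K \<noteq> 4" "cd i K \<noteq> Suc 0"
  "0 \<noteq> cd i K" "1 \<noteq> cd i K" "2 \<noteq> cd i K" "3 \<noteq> cd i K" "4 \<noteq> cd i K" "Suc 0 \<noteq> cd i K"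
  by (auto simp: cd_def)

text \<open>A finite set of symbols that covers every reading in the simulated runs, including the
  codes stored on tape \<open>R\<close>. Instructions that rewrite what they read are generated once
  for each of its elements.\<close>

definition "G = {Blank, LeftEnd} \<union> range Bit \<union> en ` {..<B} \<union> (\<lambda>K. Aux (cd 0 K)) ` S"

lemma finite_S: "finite S" by (simp add: S_def finite_cl)

lemma finite_G: "finite G" by (simp add: G_def finite_S)

lemma S_closed: "K \<in> S \<Longrightarrow> sstep Q (K, s) (K', s') \<Longrightarrow> K' \<in> S"
  using cl_closed[of K p "[]" Q s K' s'] by (auto simp: S_def elim: sstep.cases)

lemma S_start: "[p] \<in> S"
  using cl_head[of p "[]"] by (simp add: S_def)

lemma S_prop: "K \<in> S \<Longrightarrow> q \<in> set K \<Longrightarrow> uses {..<R} B q \<and> queries q \<subseteq> {1}"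
  using cl_prop[of K p "[]" "{..<R}" B "{1}"] R by (auto simp: S_def)

text \<open>Instructions \<open>(q, i, s, w, d, q')\<close> act on tape \<open>i\<close> only. Tape \<open>R\<close> remembers, across a query, the continuation
  to return to, because all queries share the two answer states.\<close>

fun ins :: "prog list \<Rightarrow> (nat \<times> nat \<times> tsym \<times> tsym \<times> dir \<times> nat) set" where
  "ins [] = {}"
| "ins (Fail # K) = {}"
| "ins (Skip # K) = {(cd 0 (Skip # K), 0, s, s, Stay, cd 0 K) |s. s \<in> G}"
| "ins (Push r a # K) = {(cd 0 (Push r a # K), r, s, s, Right, cd (Suc 0) (Push r a # K)) |s. s \<in> G} \<union>
     {(cd (Suc 0) (Push r a # K), r, Blank, en a, Stay, cd 0 K)}"
| "ins (Pop r a # K) = {(cd 0 (Pop r a # K), r, en a, Blank, Left, cd 0 K)}"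
| "ins (IsNil r # K) = {(cd 0 (IsNil r # K), r, LeftEnd, LeftEnd, Stay, cd 0 K)}"
| "ins (Query r b # K) =
     {(cd 0 (Query r b # K), R, s, Aux (cd 0 (Query r b # K)), Stay, 0) |s. s \<in> G} \<union>
     {(if b then 1 else 2, R, Aux (cd 0 (Query r b # K)), Aux (cd 0 (Query r b # K)), Stay, cd 0 K)}"
| "ins ((p1 ;; p2) # K) = {(cd 0 ((p1 ;; p2) # K), 0, s, s, Stay, cd 0 (p1 # p2 # K)) |s. s \<in> G}"
| "ins (Alt p1 p2 # K) = {(cd 0 (Alt p1 p2 # K), 0, s, s, Stay, cd 0 (p1 # K)) |s. s \<in> G} \<union>
     {(cd 0 (Alt p1 p2 # K), 0, s, s, Stay, cd 0 (p2 # K)) |s. s \<in> G}"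
| "ins (Star p1 # K) = {(cd 0 (Star p1 # K), 0, s, s, Stay, cd 0 K) |s. s \<in> G} \<union>
     {(cd 0 (Star p1 # K), 0, s, s, Stay, cd 0 (p1 # Star p1 # K)) |s. s \<in> G}"

text \<open>States 0, 1, 2 are the query state and the two answers. States 3 and 4 bring the head of
  tape 0 onto the last input bit, because a stack tape keeps its head on the top. Hence the codes
  \<open>cd\<close> start at 5.\<close>

definition "I = {(3, 0, LeftEnd, LeftEnd, Right, 4), (4, 0, Blank, Blank, Left, cd 0 [p])} \<union>
  {(4, 0, Bit b, Bit b, Right, 4) |b. True} \<union> \<Union> (ins ` S)"

lemma finite_I: "finite I"
proof -
  have "finite (ins K)" for K
    by (induction K rule: ins.induct) (auto simp: finite_G)
  moreover have "{(4, 0, Bit b, Bit b, Right, 4) |b. True} =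
      (\<lambda>b. (4 :: nat, 0 :: nat, Bit b, Bit b, Right, 4 :: nat)) ` UNIV" by auto
  ultimately show ?thesis unfolding I_def using finite_S by (auto simp del: ins.simps)
qed

definition "M = \<lparr>num_tapes = Suc R, start_st = 3, accept_st = cd 0 [], query_st = 0, yes_st = 1, no_st = 2,
  delta = {((q, rs), (q', (map (\<lambda>s. (s, Stay)) rs)[i := (w, d)])) |q rs q' i w d.
    length rs = Suc R \<and> set rs \<subseteq> G \<and> (q, i, rs ! i, w, d, q') \<in> I}\<rparr>"

lemma M_simps [simp]: "num_tapes M = Suc R" "start_st M = 3" "accept_st M = cd 0 []" "query_st M = 0"
  "yes_st M = 1" "no_st M = 2"
  by (auto simp: M_def)

lemma M_states: "yes_st M \<noteq> query_st M" "no_st M \<noteq> query_st M"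
  by auto

lemma wf_M: "wf_machine M"
proof -
  have "delta M \<subseteq> (\<lambda>((q, i, s, w, d, q'), rs). ((q, rs), (q', (map (\<lambda>s. (s, Stay)) rs)[i := (w, d)]))) `
      (I \<times> {rs. set rs \<subseteq> G \<and> length rs = Suc R})" by (force simp: M_def)
  then have "finite (delta M)"
    by (rule finite_subset) (auto intro: finite_lists_length_eq finite_I finite_G)
  then show ?thesis using R by (auto simp: wf_machine_def M_def)
qed

lemma map2_act: "map2 act_tape ((map (\<lambda>s. (s, Stay)) (map read_tape tps))[i := (w, d)]) tps =
    tps[i := act_tape (w, d) (tps ! i)]"
  by (cases "i < length tps"; rule nth_equalityI) (auto simp: nth_list_update act_stay list_update_beyond)

lemma step_I:
  "q \<noteq> 0 \<Longrightarrow> length tps = Suc R \<Longrightarrow> set (map read_tape tps) \<subseteq> G \<Longrightarrow> i < length tps \<Longrightarrow>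
    (q, i, read_tape (tps ! i), w, d, q') \<in> I \<Longrightarrow>
    step M A (q, tps) (q', tps[i := act_tape (w, d) (tps ! i)])"
  unfolding map2_act[symmetric] by (rule step_delta) (auto simp: M_def, force)

lemma step_E:
  assumes "step M A (q, tps) c"
  obtains "q = 0" "c = (if query_word (tps ! 1) \<in> A then 1 else 2, tps)" |
    i w d q' where "q \<noteq> 0" "length tps = Suc R" "(q, i, map read_tape tps ! i, w, d, q') \<in> I"
      "c = (q', tps[i := act_tape (w, d) (tps ! i)])"
  using assms
proof cases
  case (step_delta q' as)
  then obtain i w d where *: "as = (map (\<lambda>s. (s, Stay)) (map read_tape tps))[i := (w, d)]"
    "length tps = Suc R" "(q, i, map read_tape tps ! i, w, d, q') \<in> I" by (auto simp: M_def)
  then show ?thesis using step_delta that(2)[of i w d q'] map2_act by (auto simp del: map_map)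
next
  case step_query
  then show ?thesis using that(1) by auto
qed

lemma step_I_E: "step M A (q, tps) c \<Longrightarrow> q \<noteq> 0 \<Longrightarrow>
    \<exists>i w d q'. (q, i, map read_tape tps ! i, w, d, q') \<in> I \<and> c = (q', tps[i := act_tape (w, d) (tps ! i)])"
  by (erule step_E) blast+

text \<open>The tapes below \<open>R\<close> are the registers. The last one stores the single
  symbol \<open>z\<close> in cell 0, which is \<open>LeftEnd\<close> at the start and later the code
  of the latest query.\<close>

definition "tpo s z = map (\<lambda>r. stape (s r)) [0..<R] @ [((fst (stape []))(0 := z), 0)]"

lemma tpo_simps [simp]: "length (tpo s z) = Suc R" "r < R \<Longrightarrow> tpo s z ! r = stape (s r)"
  "tpo s z ! R = ((fst (stape []))(0 := z), 0)"
  by (auto simp: tpo_def nth_append)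

lemma tpo_upd: "r < R \<Longrightarrow> (tpo s z)[r := stape w] = tpo (s(r := w)) z"
  "(tpo s z)[R := ((fst (stape []))(0 := y), 0)] = tpo s y"
  by (rule nth_equalityI; auto simp: nth_list_update less_Suc_eq)+

lemma tpo_init: "init_config M x = (3, (tpo (ini [x]) LeftEnd)[0 := word_tape x])"
proof -
  have e: "(fst (stape []))(0 := LeftEnd) = fst (stape [])" by (auto simp: stape_def fun_eq_iff)
  have "snd (stape []) = 0" by (simp add: stape_def)
  with e have "stape [] = ((fst (stape []))(0 := LeftEnd), 0)" by (metis prod.collapse)
  then have e: "((fst (stape []))(0 := LeftEnd), 0) = stape []" by simp
  have "word_tape x # replicate R (stape []) = (tpo (ini [x]) LeftEnd)[0 := word_tape x]"
  proof (rule nth_equalityI)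
    fix i assume "i < length (word_tape x # replicate R (stape []))"
    then consider "i = 0" | j where "i = Suc j" "i < R" | j where "i = Suc j" "i = R"
      by (cases i; cases "i < R") auto
    then show "(word_tape x # replicate R (stape [])) ! i = (tpo (ini [x]) LeftEnd)[0 := word_tape x] ! i"
      by cases (use e tpo_simps(3)[of "ini [x]" LeftEnd] in \<open>auto simp: ini_def nth_Cons' simp del: tpo_simps(3)\<close>)
  qed simp
  then show ?thesis by (simp add: init_config_def word_tape_stape(2))
qed

lemma ins_cases: "(q, i, s, w, d, q') \<in> ins K' \<Longrightarrow> q = 1 \<or> q = 2 \<or> q = cd 0 K' \<or>
    q = cd (Suc 0) K' \<and>
    (\<exists>r a K''. K' = Push r a # K'' \<and> i = r \<and> s = Blank \<and> w = en a \<and> d = Stay \<and> q' = cd 0 K'')"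
  by (induction K' rule: ins.induct) (auto split: if_splits)

text \<open>Codes of different continuations differ, so an instruction that applies in
  \<open>cd 0 K\<close> can only have been generated by \<open>K\<close>.\<close>

lemma I_main: "(cd 0 K, i, s, w, d, q') \<in> I \<Longrightarrow> K \<in> S \<Longrightarrow> (cd 0 K, i, s, w, d, q') \<in> ins K"
proof -
  assume a: "(cd 0 K, i, s, w, d, q') \<in> I" "K \<in> S"
  then obtain K' where K': "K' \<in> S" "(cd 0 K, i, s, w, d, q') \<in> ins K'"
    unfolding I_def by (auto simp del: ins.simps)
  have "K = K'" using ins_cases[OF K'(2)] cd_inj[OF a(2) K'(1)] by auto
  then show ?thesis using K' by simp
qed

lemma I_push: "(cd (Suc 0) K, i, s, w, d, q') \<in> I \<Longrightarrow> K \<in> S \<Longrightarrow>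
    \<exists>r a K'. K = Push r a # K' \<and> i = r \<and> s = Blank \<and> w = en a \<and> d = Stay \<and> q' = cd 0 K'"
proof -
  assume a: "(cd (Suc 0) K, i, s, w, d, q') \<in> I" "K \<in> S"
  then obtain K' where K': "K' \<in> S" "(cd (Suc 0) K, i, s, w, d, q') \<in> ins K'"
    unfolding I_def by (auto simp del: ins.simps)
  have "K = K'" using ins_cases[OF K'(2)] cd_inj[OF a(2) K'(1)] by auto
  then show ?thesis using ins_cases[OF K'(2)] cd_inj[OF a(2) K'(1)] by auto
qed

lemma I_ans: "((if b then 1 else 2), i, s, w, d, q') \<in> I \<Longrightarrow>
    \<exists>r K. Query r b # K \<in> S \<and> i = R \<and> s = Aux (cd 0 (Query r b # K)) \<and> w = s \<and> d = Stay \<and> q' = cd 0 K"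
proof -
  have "(q, i, s, w, d, q') \<in> ins K' \<Longrightarrow> K' \<in> S \<Longrightarrow> (\<exists>j. q = cd j K') \<or> (\<exists>r b K.
     q = (if b then 1 else 2) \<and> K' = Query r b # K \<and> i = R \<and> s = Aux (cd 0 (Query r b # K)) \<and> w = s \<and> d = Stay \<and> q' = cd 0 K)" for q K'
    by (induction K' rule: ins.induct) auto
  then have *: "(q, i, s, w, d, q') \<in> ins K' \<Longrightarrow> K' \<in> S \<Longrightarrow> q = (if b then 1 else 2) \<Longrightarrow> (\<exists>r K.
     K' = Query r b # K \<and> i = R \<and> s = Aux (cd 0 (Query r b # K)) \<and> w = s \<and> d = Stay \<and> q' = cd 0 K)" for q K'
    by (fastforce split: if_splits)
  assume "((if b then 1 else 2), i, s, w, d, q') \<in> I"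
  then obtain K' where "K' \<in> S" "((if b then 1 else 2), i, s, w, d, q') \<in> ins K'"
    by (auto simp: I_def simp del: ins.simps split: if_splits)
  with *[OF this(2,1) refl] show ?thesis by blast
qed

definition "good A x K s \<longleftrightarrow> K \<in> S \<and> (sstep (Qt A))\<^sup>*\<^sup>* ([p], ini [x]) (K, s)"

text \<open>The six forms of a reachable configuration: before and during the scan of the input, at
  a continuation, in the middle of a push, and before and after the answer to a query.\<close>

inductive inv :: "lang \<Rightarrow> bool list \<Rightarrow> config \<Rightarrow> bool" for A x where
  inv0: "inv A x (3, (tpo (ini [x]) LeftEnd)[0 := word_tape x])"
| inv1: "1 \<le> j \<Longrightarrow> j \<le> Suc (length x) \<Longrightarrow>
    inv A x (4, (tpo (ini [x]) LeftEnd)[0 := (fst (word_tape x), j)])"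
| inv2: "good A x K s \<Longrightarrow> inv A x (cd 0 K, tpo s z)"
| inv3: "good A x (Push r a # K) s \<Longrightarrow>
    inv A x (cd (Suc 0) (Push r a # K), (tpo s z)[r := (fst (stape (s r)), Suc (length (s r)))])"
| inv4: "good A x (Query r b # K) s \<Longrightarrow> inv A x (0, tpo s (Aux (cd 0 (Query r b # K))))"
| inv5: "good A x (Query r b # K) s \<Longrightarrow>
    inv A x (if query_word (stape (s 1)) \<in> A then 1 else 2, tpo s (Aux (cd 0 (Query r b # K))))"

lemma good_step: "good A x K s \<Longrightarrow> sstep (Qt A) (K, s) (K', s') \<Longrightarrow> good A x K' s'"
  using S_closed by (auto simp: good_def intro: rtranclp.rtrancl_into_rtrancl)

lemma good_start: "good A x [p] (ini [x])"
  using S_start by (auto simp: good_def)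

lemma good_uses: "good A x (q # K) s \<Longrightarrow> uses {..<R} B q \<and> queries q \<subseteq> {1}"
  unfolding good_def by (metis S_prop list.set_intros(1))

lemma inv_step_main:
  assumes g: "good A x K s" and st: "step M A (cd 0 K, tpo s z) c"
  shows "inv A x c"
proof -
  from st obtain i w d q' where i: "(cd 0 K, i, map read_tape (tpo s z) ! i, w, d, q') \<in> I"
    and c: "c = (q', (tpo s z)[i := act_tape (w, d) (tpo s z ! i)])"
    by (rule step_E) auto
  have "K \<in> S" using g by (auto simp: good_def)
  with i have i': "(cd 0 K, i, map read_tape (tpo s z) ! i, w, d, q') \<in> ins K" by (rule I_main)
  have "K \<noteq> []" using i' by auto
  then obtain q K' where K: "K = q # K'" by (cases K) auto
  have R0: "0 < R" using R by simp
  have rd: "read_tape (stape v) = en a \<Longrightarrow> \<exists>w. v = a # w" for v a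
    by (auto simp: read_stape split: list.splits dest: en_inj)
  have rdn: "read_tape (stape v) = LeftEnd \<Longrightarrow> v = []" for v
    by (auto simp: read_stape split: list.splits)
  have silent: "inv A x c" if "i = 0" "w = read_tape (tpo s z ! 0)" "d = Stay" "q' = cd 0 K''"
    "sstep (Qt A) (K, s) (K'', s)" for K''
  proof -
    have "c = (cd 0 K'', tpo s z)" using that R0 c by (simp add: act_stay tpo_upd)
    then show ?thesis using good_step[OF g that(5)] by (auto intro: inv.intros)
  qed
  note u = good_uses[OF g[unfolded K]]
  show ?thesis
  proof (cases q)
    case Fail
    then show ?thesis using i' K by auto
  next
    case Skip
    then show ?thesis using i' K R0 by (intro silent) (auto intro: sstep.intros)
  next
    case (Push r a)
    then have "r < R" using u by auto
    with i' K Push have e: "i = r" "w = read_tape (stape (s r))" "d = Right" "q' = cd (Suc 0) K"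
      using \<open>K \<in> S\<close> by (auto simp: cd_inj)
    then have "c = (cd (Suc 0) K, (tpo s z)[r := (fst (stape (s r)), Suc (length (s r)))])"
      using c \<open>r < R\<close> by (auto simp: act_push)
    then show ?thesis using g K Push by (auto intro: inv.intros)
  next
    case (Pop r a)
    then have "r < R" using u by auto
    with i' K Pop have e: "i = r" "read_tape (stape (s r)) = en a" "w = Blank" "d = Left" "q' = cd 0 K'"
      by auto
    then obtain v where v: "s r = a # v" using rd by blast
    then have "c = (cd 0 K', tpo (s(r := v)) z)" using c e \<open>r < R\<close> by (simp add: act_pop tpo_upd)
    moreover have "sstep (Qt A) (K, s) (K', s(r := v))" using K Pop v by (auto intro: sstep.intros)
    ultimately show ?thesis using good_step[OF g] by (auto intro: inv.intros)
  next
    case (IsNil r)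
    then have "r < R" using u by auto
    with i' K IsNil have e: "i = r" "read_tape (stape (s r)) = LeftEnd" "w = LeftEnd" "d = Stay" "q' = cd 0 K'"
      by auto
    then have v: "s r = []" using rdn by blast
    then have "c = (cd 0 K', tpo s z)" using c e \<open>r < R\<close> act_stay[of "stape (s r)"]
      by (simp add: tpo_upd fun_upd_idem)
    moreover have "sstep (Qt A) (K, s) (K', s)" using K IsNil v by (auto intro: sstep.intros)
    ultimately show ?thesis using good_step[OF g] by (auto intro: inv.intros)
  next
    case (Query r b)
    with i' K have e: "i = R" "w = Aux (cd 0 K)" "d = Stay" "q' = 0" by (auto split: if_splits)
    then have "c = (0, tpo s (Aux (cd 0 K)))" using c by (simp add: tpo_upd act_tape_def)
    then show ?thesis using g K Query by (auto intro: inv.intros)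
  next
    case (Seq p1 p2)
    then show ?thesis using i' K R0 by (intro silent[of "p1 # p2 # K'"]) (auto intro: sstep.intros)
  next
    case (Alt p1 p2)
    from i' K Alt consider "q' = cd 0 (p1 # K')" | "q' = cd 0 (p2 # K')" by auto
    then show ?thesis
    proof cases
      case 1
      then show ?thesis using i' K Alt R0 by (intro silent[of "p1 # K'"]) (auto intro: sstep.intros)
    next
      case 2
      then show ?thesis using i' K Alt R0 by (intro silent[of "p2 # K'"]) (auto intro: sstep.intros)
    qed
  next
    case (Star p1)
    from i' K Star consider "q' = cd 0 K'" | "q' = cd 0 (p1 # Star p1 # K')" by auto
    then show ?thesis
    proof cases
      case 1
      then show ?thesis using i' K Star R0 by (intro silent[of "K'"]) (auto intro: sstep.intros)
    next
      case 2
      then show ?thesis using i' K Star R0 by (intro silent[of "p1 # Star p1 # K'"]) (auto intro: sstep.intros)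
    qed
  qed
qed

lemma I_start: "(3, i, s, w, d, q') \<in> I \<longleftrightarrow> (i, s, w, d, q') = (0, LeftEnd, LeftEnd, Right, 4)"
  "(4, i, s, w, d, q') \<in> I \<longleftrightarrow> (i, s, w, d, q') = (0, Blank, Blank, Left, cd 0 [p]) \<or>
     (\<exists>b. (i, s, w, d, q') = (0, Bit b, Bit b, Right, 4))"
proof -
  have "(q, i, s, w, d, q') \<in> ins K' \<Longrightarrow> q \<noteq> 3 \<and> q \<noteq> 4" for q K'
    using ins_cases[of q i s w d q' K'] by auto
  then have "(3, i, s, w, d, q') \<notin> ins K'" "(4, i, s, w, d, q') \<notin> ins K'" for K' by blast+
  then show "(3, i, s, w, d, q') \<in> I \<longleftrightarrow> (i, s, w, d, q') = (0, LeftEnd, LeftEnd, Right, 4)"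
  "(4, i, s, w, d, q') \<in> I \<longleftrightarrow> (i, s, w, d, q') = (0, Blank, Blank, Left, cd 0 [p]) \<or>
     (\<exists>b. (i, s, w, d, q') = (0, Bit b, Bit b, Right, 4))"
    by (auto simp: I_def simp del: ins.simps)
qed

lemma act_start:
  "act_tape (LeftEnd, Right) (word_tape x) = (fst (word_tape x), 1)"
  "1 \<le> j \<Longrightarrow> j \<le> length x \<Longrightarrow> act_tape (Bit (x ! (j - 1)), Right) (fst (word_tape x), j) =
     (fst (word_tape x), Suc j)"
  "act_tape (Blank, Left) (fst (word_tape x), Suc (length x)) = stape (stk x)"
  "read_tape (word_tape x) = LeftEnd"
  "1 \<le> j \<Longrightarrow> j \<le> length x \<Longrightarrow> read_tape (fst (word_tape x), j) = Bit (x ! (j - 1))"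
  "read_tape (fst (word_tape x), Suc (length x)) = Blank"
  by (auto simp: act_tape_def word_tape_stape) (auto simp: word_tape_def fun_eq_iff read_tape_def)

lemma tpo_ini: "(tpo (ini [x]) LeftEnd)[0 := stape (stk x)] = tpo (ini [x]) LeftEnd"
proof -
  have "(ini [x])(0 := stk x) = ini [x]" by (auto simp: ini_def fun_eq_iff)
  then show ?thesis using R by (simp add: tpo_upd)
qed

lemma inv_step: "inv A x c \<Longrightarrow> step M A c c' \<Longrightarrow> inv A x c'"
proof (induction rule: inv.induct)
  case inv0
  from step_I_E[OF inv0 numeral_neq_zero] obtain i w d q' where i: "(3, i, map read_tape ((tpo (ini [x]) LeftEnd)[0 := word_tape x]) ! i, w, d, q') \<in> I"
    and c: "c' = (q', ((tpo (ini [x]) LeftEnd)[0 := word_tape x])[i := act_tape (w, d) (((tpo (ini [x]) LeftEnd)[0 := word_tape x]) ! i)])"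
    by blast
  from c i show ?case using inv1[of 1 x A] by (simp add: I_start act_start)
next
  case (inv1 j)
  let ?t = "(tpo (ini [x]) LeftEnd)[0 := (fst (word_tape x), j)]"
  obtain i w d q' where i: "(4, i, map read_tape ?t ! i, w, d, q') \<in> I"
    and c: "c' = (q', ?t[i := act_tape (w, d) (?t ! i)])"
    using step_I_E[OF inv1(3) numeral_neq_zero] by blast
  show ?case
  proof (cases "j \<le> length x")
    case True
    then have "c' = (4, (tpo (ini [x]) LeftEnd)[0 := (fst (word_tape x), Suc j)])"
      using inv1 i c act_start(2)[of j x] act_start(5)[of j x] by (auto simp: I_start)
    then show ?thesis using inv.inv1[of "Suc j" x A] True by simp
  next
    case False
    then have "j = Suc (length x)" using inv1 by simp
    then have "c' = (cd 0 [p], tpo (ini [x]) LeftEnd)"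
      using i c by (auto simp: I_start act_start tpo_ini)
    then show ?thesis by (simp only:) (intro inv.inv2 good_start)
  qed
next
  case (inv2 K s z)
  then show ?case by (rule inv_step_main)
next
  case (inv3 r a K s z)
  let ?t = "(tpo s z)[r := (fst (stape (s r)), Suc (length (s r)))]"
  obtain i w d q' where i: "(cd (Suc 0) (Push r a # K), i, map read_tape ?t ! i, w, d, q') \<in> I"
    and c: "c' = (q', ?t[i := act_tape (w, d) (?t ! i)])"
    using step_I_E[OF inv3(2) cd_ge(1)] by blast
  have "Push r a # K \<in> S" "r < R" using inv3(1) good_uses[OF inv3(1)] by (auto simp: good_def)
  from I_push[OF i this(1)] have "i = r" "w = en a" "d = Stay" "q' = cd 0 K" by auto
  then have "c' = (cd 0 K, tpo (s(r := a # s r)) z)"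
    using c \<open>r < R\<close> by (simp add: act_push tpo_upd)
  then show ?case by (simp only:) (intro inv.inv2 good_step[OF inv3(1)] sstep.intros)
next
  case (inv4 r b K s)
  have "tpo s (Aux (cd 0 (Query r b # K))) ! 1 = stape (s 1)" using R(1) by simp
  with inv4(2) have "c' = (if query_word (stape (s 1)) \<in> A then 1 else 2, tpo s (Aux (cd 0 (Query r b # K))))"
    by - (erule step_E, simp_all)
  then show ?case by (simp only:) (rule inv.inv5[OF inv4(1)])
next
  case (inv5 r b K s)
  let ?b = "query_word (stape (s 1)) \<in> A"
  let ?t = "tpo s (Aux (cd 0 (Query r b # K)))"
  obtain i w d q' where i: "(if ?b then 1 else 2, i, map read_tape ?t ! i, w, d, q') \<in> I"
    and c: "c' = (q', ?t[i := act_tape (w, d) (?t ! i)])"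
    using step_I_E[OF inv5(2)] by (cases ?b) (simp only: if_True if_False one_neq_zero numeral_neq_zero simp_thms; blast)+
  from I_ans[OF i] obtain r' K' where *: "Query r' ?b # K' \<in> S" "i = R"
    "map read_tape ?t ! i = Aux (cd 0 (Query r' ?b # K'))" "w = map read_tape ?t ! i" "d = Stay" "q' = cd 0 K'"
    by blast
  have "Query r b # K \<in> S" using inv5(1) by (simp add: good_def)
  \<comment> \<open>The symbol left on tape \<open>R\<close> tells which query was asked. As the
    instruction that fires was generated for the actual answer, the tested value \<open>b\<close>
    must be that answer.\<close>
  have "cd 0 (Query r b # K) = cd 0 (Query r' ?b # K')" using *(2,3) by (simp add: read_tape_def)
  then have "Query r b # K = Query r' ?b # K'" using cd_inj[OF \<open>Query r b # K \<in> S\<close> *(1)] by simp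
  then have e: "r' = r" "?b = b" "K' = K" by blast+
  have "r = 1" using good_uses[OF inv5(1)] by auto
  have "c' = (cd 0 K, ?t)" unfolding c *(4,5,6) *(2) e(3) by (simp add: read_tape_def act_tape_def tpo_upd)
  moreover have "sstep (Qt A) (Query r b # K, s) (K, s)"
    using e(2) \<open>r = 1\<close> by (auto simp: Qt_def query_word_stape intro!: sstep.intros)
  ultimately show ?case by (simp only:) (intro inv.inv2 good_step[OF inv5(1)])
qed

lemma sound: "accepts M A x \<Longrightarrow> \<exists>t. runs (Qt A) p (ini [x]) t"
proof -
  assume "accepts M A x"
  then obtain tps where "(step M A)\<^sup>*\<^sup>* (init_config M x) (cd 0 [], tps)" by (auto simp: accepts_def)
  then have "inv A x (cd 0 [], tps)"
  proof (induction rule: rtranclp_induct)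
    case base
    show ?case unfolding tpo_init by (rule inv0)
  qed (rule inv_step)
  then have "\<exists>s. good A x [] s"
  proof cases
    case (inv2 K s z)
    then have "K \<in> S" by (simp add: good_def)
    then show ?thesis using inv2 by (auto simp: cd_inj S_def)
  next
    case (inv3 r a K s z)
    then have "Push r a # K \<in> S" by (simp add: good_def)
    then show ?thesis using inv3 cd_inj[of "[]" "Push r a # K" 0 1] by (auto simp: S_def)
  qed (auto split: if_splits)
  then show ?thesis by (auto simp: good_def intro: ssteps_runs)
qed

lemma read_G: "(\<And>r. set (s r) \<subseteq> {..<B}) \<Longrightarrow> z \<in> G \<Longrightarrow> set (map read_tape (tpo s z)) \<subseteq> G"
proof -
  assume a: "\<And>r. set (s r) \<subseteq> {..<B}" "z \<in> G"
  have "read_tape (stape (s r)) \<in> G" for r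
    using a(1)[of r] by (cases "s r") (auto simp: read_stape G_def)
  then show ?thesis using a(2) by (auto simp: tpo_def read_tape_def[of "(_, 0)"])
qed

text \<open>The 3 is the price of a query: storing the continuation, asking, returning. A push takes
  two moves and everything else one.\<close>

lemma complete_step:
  assumes st: "sstep (Qt A) (K, s) (K', s')" and K: "K \<in> S" and B: "\<And>r. set (s r) \<subseteq> {..<B}" and z: "z \<in> G"
  shows "\<exists>n\<le>3. \<exists>z'\<in>G. (step M A ^^ n) (cd 0 K, tpo s z) (cd 0 K', tpo s' z')"
proof -
  have R0: "0 < R" using R by simp
  have IK: "ins K \<subseteq> I" using K by (auto simp: I_def simp del: ins.simps)
  have rG: "set (map read_tape (tpo s z)) \<subseteq> G" by (rule read_G[OF B z])
  have rr: "read_tape (stape (s r)) \<in> G" if "r < R" for r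
    using rG that by (auto simp: tpo_def image_subset_iff)
  have silent: ?thesis if "s' = s" "(cd 0 K, 0, read_tape (stape (s 0)), read_tape (stape (s 0)), Stay, cd 0 K') \<in> ins K"
  proof -
    have "step M A (cd 0 K, tpo s z) (cd 0 K', (tpo s z)[0 := act_tape (read_tape (stape (s 0)), Stay) (tpo s z ! 0)])"
      using that IK rG R0 by (intro step_I) auto
    then have "(step M A ^^ 1) (cd 0 K, tpo s z) (cd 0 K', tpo s' z)"
      using that R0 by (simp add: act_stay tpo_upd eq_OO)
    then show ?thesis using z by (intro exI[of _ 1]) auto
  qed
  note uK = S_prop[OF K]
  from st show ?thesis
  proof cases
    case 1
    then show ?thesis using rr R0 by (intro silent) auto
  next
    case (2 r a)
    then have r: "r < R" "a < B" using uK[of "Push r a"] by auto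
    let ?t = "(tpo s z)[r := (fst (stape (s r)), Suc (length (s r)))]"
    have "step M A (cd 0 K, tpo s z) (cd (Suc 0) K, (tpo s z)[r := act_tape (read_tape (stape (s r)), Right) (tpo s z ! r)])"
      using 2 IK rG rr r by (intro step_I) auto
    then have 1: "step M A (cd 0 K, tpo s z) (cd (Suc 0) K, ?t)" using r by (simp add: act_push)
    have "set (map read_tape ?t) \<subseteq> insert Blank (set (map read_tape (tpo s z)))"
      using set_update_subset_insert[of "map read_tape (tpo s z)" r Blank]
      by (simp add: map_update act_push)
    then have "set (map read_tape ?t) \<subseteq> G" using rG by (auto simp: G_def)
    then have "step M A (cd (Suc 0) K, ?t) (cd 0 K', ?t[r := act_tape (en a, Stay) (?t ! r)])"
      using 2 IK r by (intro step_I) (auto simp: act_push)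
    then have "step M A (cd (Suc 0) K, ?t) (cd 0 K', tpo s' z)" using r 2 by (simp add: act_push tpo_upd)
    with 1 have "(step M A ^^ 2) (cd 0 K, tpo s z) (cd 0 K', tpo s' z)"
      by (auto simp: eval_nat_numeral)
    then show ?thesis using z by (intro exI[of _ 2]) auto
  next
    case (3 r a w)
    then have r: "r < R" using uK[of "Pop r a"] by auto
    have "step M A (cd 0 K, tpo s z) (cd 0 K', (tpo s z)[r := act_tape (Blank, Left) (tpo s z ! r)])"
      using 3 IK rG r by (intro step_I) (auto simp: read_stape)
    then have "(step M A ^^ 1) (cd 0 K, tpo s z) (cd 0 K', tpo s' z)"
      using 3 r by (simp add: act_pop tpo_upd eq_OO)
    then show ?thesis using z by (intro exI[of _ 1]) auto
  next
    case (4 r)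
    then have r: "r < R" using uK[of "IsNil r"] by auto
    have "step M A (cd 0 K, tpo s z) (cd 0 K', (tpo s z)[r := act_tape (LeftEnd, Stay) (tpo s z ! r)])"
      using 4 IK rG r by (intro step_I) (auto simp: read_stape)
    then have "(step M A ^^ 1) (cd 0 K, tpo s z) (cd 0 K', tpo s' z)"
      using 4 r act_stay[of "stape (s r)"] by (simp add: read_stape tpo_upd eq_OO fun_upd_idem)
    then show ?thesis using z by (intro exI[of _ 1]) auto
  next
    case (5 b r)
    then have r: "r = 1" using uK[of "Query r b"] by auto
    let ?z = "Aux (cd 0 K)"
    have z': "?z \<in> G" using K by (auto simp: G_def)
    have "step M A (cd 0 K, tpo s z) (0, (tpo s z)[R := act_tape (?z, Stay) (tpo s z ! R)])"
      using 5 IK rG z by (intro step_I) (auto simp: read_tape_def)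
    then have s1: "step M A (cd 0 K, tpo s z) (0, tpo s ?z)"
      by (simp add: act_tape_def tpo_upd)
    have s2: "step M A (0, tpo s ?z) (if b then 1 else 2, tpo s ?z)"
      using step_query[of M A "tpo s ?z"] R r 5 by (auto simp: Qt_def query_word_stape)
    have "step M A (if b then 1 else 2, tpo s ?z) (cd 0 K', (tpo s ?z)[R := act_tape (?z, Stay) (tpo s ?z ! R)])"
      using 5 IK read_G[OF B z'] by (intro step_I) (auto simp: read_tape_def)
    then have "step M A (if b then 1 else 2, tpo s ?z) (cd 0 K', tpo s' ?z)"
      using 5 by (simp add: act_tape_def tpo_upd)
    with s1 s2 have "(step M A ^^ 3) (cd 0 K, tpo s z) (cd 0 K', tpo s' ?z)"
      by (auto simp: eval_nat_numeral)
    then show ?thesis using z' by (intro exI[of _ 3]) auto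
  next
    case 6
    then show ?thesis using rr R0 by (intro silent) auto
  next
    case 7
    then show ?thesis using rr R0 by (intro silent) auto
  next
    case 8
    then show ?thesis using rr R0 by (intro silent) auto
  next
    case 9
    then show ?thesis using rr R0 by (intro silent) auto
  next
    case 10
    then show ?thesis using rr R0 by (intro silent) auto
  qed
qed

lemma sstep_symbols:
  assumes "sstep Q (K, s) (K', s')" "K \<in> S" "\<And>r. set (s r) \<subseteq> {..<B}"
  shows "set (s' r) \<subseteq> {..<B}"
  using assms(1)
proof cases
  case (2 r' a)
  then have "a < B" using S_prop[OF assms(2), of "Push r' a"] by auto
  then show ?thesis using 2 assms(3) by auto
next
  case (3 r' a w)
  then show ?thesis using assms(3)[of r'] assms(3)[of r] by auto
qed (use assms(3)[of r] in auto)

lemma complete_steps: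
  "(sstep (Qt A) ^^ n) (K, s) (K', s') \<Longrightarrow> K \<in> S \<Longrightarrow> (\<And>r. set (s r) \<subseteq> {..<B}) \<Longrightarrow> z \<in> G \<Longrightarrow>
    \<exists>m\<le>3 * n. \<exists>z'\<in>G. (step M A ^^ m) (cd 0 K, tpo s z) (cd 0 K', tpo s' z')"
proof (induction n arbitrary: K s z)
  case 0
  then show ?case by auto
next
  case (Suc n)
  from Suc.prems(1) obtain K1 s1 where 1: "sstep (Qt A) (K, s) (K1, s1)"
    "(sstep (Qt A) ^^ n) (K1, s1) (K', s')" by (metis relpowp_Suc_D2 surj_pair)
  from complete_step[OF 1(1) Suc.prems(2-4)] obtain m z1 where m: "m \<le> 3" "z1 \<in> G"
    "(step M A ^^ m) (cd 0 K, tpo s z) (cd 0 K1, tpo s1 z1)" by blast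
  have "set (s1 r) \<subseteq> {..<B}" for r using sstep_symbols[OF 1(1) Suc.prems(2,3)] .
  then obtain m' z' where m': "m' \<le> 3 * n" "z' \<in> G"
    "(step M A ^^ m') (cd 0 K1, tpo s1 z1) (cd 0 K', tpo s' z')"
    using Suc.IH[OF 1(2) S_closed[OF Suc.prems(2) 1(1)] _ m(2)] by blast
  have "(step M A ^^ (m + m')) (cd 0 K, tpo s z) (cd 0 K', tpo s' z')"
    using relpowp_trans[OF m(3) m'(3)] .
  then show ?case using m m' by (intro exI[of _ "m + m'"]) auto
qed

text \<open>The scan of the input adds \<open>length x + 2\<close> steps: leaving the end marker,
  one step per bit, and the turn at the first blank.\<close>

lemma complete:
  assumes "exec (Qt A) p (ini [x]) n t" "2 \<le> B"
  shows "\<exists>m \<le> 3 * n + length x + 2. \<exists>tps. (step M A ^^ m) (init_config M x) (accept_st M, tps)"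
proof -
  let ?t = "\<lambda>j. (tpo (ini [x]) LeftEnd)[0 := (fst (word_tape x), j)]"
  have B: "set (ini [x] r) \<subseteq> {..<B}" for r using assms(2) by (auto simp: ini_def stk_def)
  have G': "set (map read_tape (tpo (ini [x]) LeftEnd)) \<subseteq> G" by (rule read_G[OF B]) (auto simp: G_def)
  have G1: "read_tape tp \<in> G \<Longrightarrow> set (map read_tape ((tpo (ini [x]) LeftEnd)[0 := tp])) \<subseteq> G" for tp
    using set_update_subset_insert[of "map read_tape (tpo (ini [x]) LeftEnd)" 0 "read_tape tp"] G'
    by (simp add: map_update) blast
  have "step M A (init_config M x) (4, ((tpo (ini [x]) LeftEnd)[0 := word_tape x])[0 := act_tape (LeftEnd, Right) ((tpo (ini [x]) LeftEnd)[0 := word_tape x] ! 0)])"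
    unfolding tpo_init using G1[of "word_tape x"] by (intro step_I) (auto simp: act_start I_start G_def)
  then have a: "step M A (init_config M x) (4, ?t 1)" by (simp add: act_start)
  have b: "(step M A ^^ k) (4, ?t 1) (4, ?t (Suc k))" if "k \<le> length x" for k
    using that
  proof (induction k)
    case (Suc k)
    have rd: "read_tape (fst (word_tape x), Suc k) = Bit (x ! k)" using Suc.prems act_start(5)[of "Suc k" x] by simp
    then have "set (map read_tape (?t (Suc k))) \<subseteq> G" by (intro G1) (auto simp: G_def)
    then have "step M A (4, ?t (Suc k)) (4, (?t (Suc k))[0 := act_tape (Bit (x ! k), Right) (?t (Suc k) ! 0)])"
      using rd by (intro step_I) (auto simp: I_start)
    then have "step M A (4, ?t (Suc k)) (4, ?t (Suc (Suc k)))"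
      using act_start(2)[of "Suc k" x] Suc.prems by simp
    then show ?case using Suc by auto
  qed simp
  have "set (map read_tape (?t (Suc (length x)))) \<subseteq> G" by (intro G1) (auto simp: act_start G_def)
  then have "step M A (4, ?t (Suc (length x))) (cd 0 [p], (?t (Suc (length x)))[0 := act_tape (Blank, Left) (?t (Suc (length x)) ! 0)])"
    by (intro step_I) (auto simp: I_start act_start)
  then have c: "step M A (4, ?t (Suc (length x))) (cd 0 [p], tpo (ini [x]) LeftEnd)"
    by (simp add: act_start tpo_ini)
  have "(step M A ^^ Suc (length x + 1)) (init_config M x) (cd 0 [p], tpo (ini [x]) LeftEnd)"
    using a b[OF order_refl] c by (intro relpowp_Suc_left[where P = "step M A", OF a]) auto
  moreover obtain m z' where "m \<le> 3 * n" "(step M A ^^ m) (cd 0 [p], tpo (ini [x]) LeftEnd) (cd 0 [], tpo t z')"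
    using complete_steps[OF exec_sstep[OF assms(1)] S_start B, of LeftEnd] by (auto simp: G_def)
  ultimately show ?thesis
    by (intro exI[of _ "Suc (length x + 1) + m"] conjI exI[of _ "tpo t z'"] relpowp_trans) auto
qed

end

text \<open>The machine is chosen before the oracle. It may still have endless runs, since loops of
  the program survive; \<open>clock\<close> removes them. That the answer states differ from the
  query state prevents sequences of queries during which a clock would not advance.\<close>

lemma compile:
  assumes "queries p \<subseteq> {1}"
  shows "\<exists>M. wf_machine M \<and> yes_st M \<noteq> query_st M \<and> no_st M \<noteq> query_st M \<and>
    (\<forall>A x. accepts M A x \<longrightarrow> (\<exists>t. runs (Qt A) p (ini [x]) t)) \<and>
    (\<forall>A x n t. exec (Qt A) p (ini [x]) n t \<longrightarrow>
       (\<exists>m \<le> 3 * n + length x + 2. \<exists>tps. (step M A ^^ m) (init_config M x) (accept_st M, tps)))"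
proof -
  obtain n where n: "\<forall>R B. n \<le> R \<longrightarrow> n \<le> B \<longrightarrow> uses {..<R} B p" using ex_uses by blast
  obtain f :: "prog list \<Rightarrow> nat" where f: "inj_on f (insert [] (cl p []))"
    using finite_imp_inj_to_nat_seg[of "insert [] (cl p [])"] finite_cl by blast
  interpret compiler p "n + 2" "n + 2" f
    by unfold_locales (use n f assms in auto)
  show ?thesis using M_states wf_M sound complete by (intro exI[of _ M]) (simp del: M_simps)
qed

section \<open>Clocked machines\<close>

text \<open>
  The clock is a reflected Gray code counter in base \<open>n + 2\<close>, \<open>n\<close> being the input length. A digit is the position of a head
  on a tape holding \<open>n\<close> marks, together with a flag tape for the direction of its next sweep; so a tick moves one head by one cell
  and toggles the flags of the digits below, in a single machine step.
\<close>

definition mk :: "nat \<Rightarrow> nat \<Rightarrow> tape" where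
  "mk n h = (fst (word_tape (replicate n True)), h)"

definition fl :: "bool \<Rightarrow> tape" where
  "fl b = ((fst (word_tape []))(0 := (if b then LeftEnd else Aux 0)), 0)"

definition cl_tapes :: "nat \<Rightarrow> (nat \<times> bool) list \<Rightarrow> tape list" where
  "cl_tapes n ds = concat (map (\<lambda>(h, b). [mk n h, fl b]) ds)"

text \<open>The distance covered in the present sweep, which goes to the right if the flag is set.
  Heads range over the positions 0 to \<open>n + 1\<close>, hence the base
  \<open>n + 2\<close>.\<close>

fun dig :: "nat \<Rightarrow> nat \<times> bool \<Rightarrow> nat" where
  "dig n (h, b) = (if b then h else Suc n - h)"

primrec val :: "nat \<Rightarrow> (nat \<times> bool) list \<Rightarrow> nat" where
  "val n [] = 0"
| "val n (d # ds) = dig n d + (n + 2) * val n ds"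

definition valid :: "nat \<Rightarrow> (nat \<times> bool) list \<Rightarrow> bool" where
  "valid n ds \<longleftrightarrow> (\<forall>(h, b)\<in>set ds. h \<le> Suc n)"

primrec idle :: "nat \<Rightarrow> (tsym list \<times> (tsym \<times> dir) list) set" where
  "idle 0 = {([], [])}"
| "idle (Suc D) = (\<lambda>(s, f, cs, as). (s # f # cs, (s, Stay) # (f, Stay) # as)) `
     ({LeftEnd, Bit True, Blank} \<times> {LeftEnd, Aux 0} \<times> idle D)"

text \<open>The first two sets advance a digit whose sweep is unfinished and leave the higher digits
  idle. The other two are carries: the flag is toggled while the head stays, because the end of one
  sweep is the start of the next and the digit is thereby 0 again. With no digits left there is no
  transition, so a full clock blocks the machine.\<close>

primrec tick :: "nat \<Rightarrow> (tsym list \<times> (tsym \<times> dir) list) set" where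
  "tick 0 = {}"
| "tick (Suc D) =
     (\<lambda>(s, cs, as). (s # LeftEnd # cs, (s, Right) # (LeftEnd, Stay) # as)) ` ({LeftEnd, Bit True} \<times> idle D) \<union>
     (\<lambda>(s, cs, as). (s # Aux 0 # cs, (s, Left) # (Aux 0, Stay) # as)) ` ({Bit True, Blank} \<times> idle D) \<union>
     (\<lambda>(cs, as). (Blank # LeftEnd # cs, (Blank, Stay) # (Aux 0, Stay) # as)) ` tick D \<union>
     (\<lambda>(cs, as). (LeftEnd # Aux 0 # cs, (LeftEnd, Stay) # (LeftEnd, Stay) # as)) ` tick D"

lemma finite_idle: "finite (idle D)"
  by (induction D) auto

lemma finite_tick: "finite (tick D)"
  by (induction D) (auto simp: finite_idle)

lemma length_idle: "(cs, as) \<in> idle D \<Longrightarrow> length cs = 2 * D \<and> length as = 2 * D"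
  by (induction D arbitrary: cs as) auto

lemma length_tick: "(cs, as) \<in> tick D \<Longrightarrow> length cs = 2 * D \<and> length as = 2 * D"
  by (induction D arbitrary: cs as) (auto simp: length_idle)

lemma cl_simps [simp]: "cl_tapes n [] = []" "cl_tapes n ((h, b) # ds) = mk n h # fl b # cl_tapes n ds"
  by (auto simp: cl_tapes_def)

lemma valid_simps [simp]: "valid n []" "valid n ((h, b) # ds) \<longleftrightarrow> h \<le> Suc n \<and> valid n ds"
  by (auto simp: valid_def)

lemma read_mk: "read_tape (mk n h) = (if h = 0 then LeftEnd else if h \<le> n then Bit True else Blank)"
  by (auto simp: read_tape_def mk_def word_tape_def)

lemma read_fl: "read_tape (fl b) = (if b then LeftEnd else Aux 0)"
  by (auto simp: read_tape_def fl_def)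

lemma act_mk:
  "act_tape (read_tape (mk n h), Stay) (mk n h) = mk n h"
  "act_tape (read_tape (mk n h), Right) (mk n h) = mk n (Suc h)"
  "act_tape (read_tape (mk n h), Left) (mk n h) = mk n (h - 1)"
  by (auto simp: act_tape_def mk_def read_tape_def)

lemma act_fl: "act_tape (LeftEnd, Stay) (fl b) = fl True" "act_tape (Aux 0, Stay) (fl b) = fl False"
  by (auto simp: act_tape_def fl_def)

lemma idle_act: "(map read_tape (cl_tapes n ds), as) \<in> idle (length ds) \<Longrightarrow>
    map2 act_tape as (cl_tapes n ds) = cl_tapes n ds"
proof (induction ds arbitrary: as)
  case (Cons d ds)
  obtain h b where "d = (h, b)" by force
  with Cons show ?case using act_mk(1)[of n h] act_fl[of b] by (auto simp: read_fl split: if_splits)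
qed simp

lemma idle_SucI: "(cs, as) \<in> idle D \<Longrightarrow> s \<in> {LeftEnd, Bit True, Blank} \<Longrightarrow> f \<in> {LeftEnd, Aux 0} \<Longrightarrow>
    (s # f # cs, (s, Stay) # (f, Stay) # as) \<in> idle (Suc D)"
  unfolding idle.simps by (rule image_eqI[of _ _ "(s, f, cs, as)"]) auto

lemma tick_SucI:
  "(cs, as) \<in> idle D \<Longrightarrow> s \<in> {LeftEnd, Bit True} \<Longrightarrow>
    (s # LeftEnd # cs, (s, Right) # (LeftEnd, Stay) # as) \<in> tick (Suc D)"
  "(cs, as) \<in> idle D \<Longrightarrow> s \<in> {Bit True, Blank} \<Longrightarrow>
    (s # Aux 0 # cs, (s, Left) # (Aux 0, Stay) # as) \<in> tick (Suc D)"
  "(cs, as) \<in> tick D \<Longrightarrow> (Blank # LeftEnd # cs, (Blank, Stay) # (Aux 0, Stay) # as) \<in> tick (Suc D)"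
  "(cs, as) \<in> tick D \<Longrightarrow> (LeftEnd # Aux 0 # cs, (LeftEnd, Stay) # (LeftEnd, Stay) # as) \<in> tick (Suc D)"
  unfolding tick.simps Un_iff image_iff by force+

lemma idle_ex: "valid n ds \<Longrightarrow> \<exists>as. (map read_tape (cl_tapes n ds), as) \<in> idle (length ds)"
proof (induction ds)
  case (Cons d ds)
  obtain h b where d: "d = (h, b)" by force
  with Cons obtain as where "(map read_tape (cl_tapes n ds), as) \<in> idle (length ds)" by auto
  then have "(map read_tape (cl_tapes n (d # ds)),
      (read_tape (mk n h), Stay) # (read_tape (fl b), Stay) # as) \<in> idle (Suc (length ds))"
    unfolding d cl_simps list.map by (rule idle_SucI) (auto simp: read_mk read_fl)
  then show ?case unfolding list.size add_0_right add_Suc_right by (rule exI)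
qed simp

lemma val_less: "valid n ds \<Longrightarrow> val n ds < (n + 2) ^ length ds"
proof (induction ds)
  case (Cons d ds)
  obtain h b where d: "d = (h, b)" by force
  have "val n ds + 1 \<le> (n + 2) ^ length ds" using Cons d by simp
  then have "(n + 2) * (val n ds + 1) \<le> (n + 2) * (n + 2) ^ length ds" by (rule mult_le_mono2)
  moreover have "dig n d \<le> Suc n" using Cons d by simp
  ultimately show ?case by (simp add: algebra_simps)
qed simp

lemma tick_sound: "(map read_tape (cl_tapes n ds), as) \<in> tick (length ds) \<Longrightarrow> valid n ds \<Longrightarrow>
    \<exists>ds'. map2 act_tape as (cl_tapes n ds) = cl_tapes n ds' \<and> valid n ds' \<and> length ds' = length ds \<and>
      val n ds' = Suc (val n ds)"
proof (induction ds arbitrary: as)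
  case (Cons d ds)
  obtain h b where d: "d = (h, b)" by force
  have v: "h \<le> Suc n" "valid n ds" using Cons.prems d by auto
  from Cons.prems(1) d
  consider (r) as' where "b" "h \<le> n" "(map read_tape (cl_tapes n ds), as') \<in> idle (length ds)"
      "as = (read_tape (mk n h), Right) # (LeftEnd, Stay) # as'"
    | (l) as' where "\<not> b" "0 < h" "(map read_tape (cl_tapes n ds), as') \<in> idle (length ds)"
      "as = (read_tape (mk n h), Left) # (Aux 0, Stay) # as'"
    | (rl) as' where "b" "h = Suc n" "(map read_tape (cl_tapes n ds), as') \<in> tick (length ds)"
      "as = (read_tape (mk n h), Stay) # (Aux 0, Stay) # as'"
    | (lr) as' where "\<not> b" "h = 0" "(map read_tape (cl_tapes n ds), as') \<in> tick (length ds)"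
      "as = (read_tape (mk n h), Stay) # (LeftEnd, Stay) # as'"
    using v(1) by (auto simp: read_fl read_mk split: if_splits)
  then show ?case
  proof cases
    case r
    then show ?thesis using d v
      by (intro exI[of _ "(Suc h, True) # ds"]) (auto simp: act_mk act_fl idle_act)
  next
    case l
    then show ?thesis using d v
      by (intro exI[of _ "(h - 1, False) # ds"]) (auto simp: act_mk act_fl idle_act)
  next
    case rl
    from Cons.IH[OF rl(3) v(2)] obtain ds' where "map2 act_tape as' (cl_tapes n ds) = cl_tapes n ds'"
      "valid n ds'" "length ds' = length ds" "val n ds' = Suc (val n ds)" by blast
    then show ?thesis using d rl
      by (intro exI[of _ "(Suc n, False) # ds'"]) (auto simp: act_mk act_fl)
  next
    case lr
    from Cons.IH[OF lr(3) v(2)] obtain ds' where "map2 act_tape as' (cl_tapes n ds) = cl_tapes n ds'"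
      "valid n ds'" "length ds' = length ds" "val n ds' = Suc (val n ds)" by blast
    then show ?thesis using d lr
      by (intro exI[of _ "(0, True) # ds'"]) (auto simp: act_mk act_fl)
  qed
qed simp

lemma tick_complete: "valid n ds \<Longrightarrow> Suc (val n ds) < (n + 2) ^ length ds \<Longrightarrow>
    \<exists>as. (map read_tape (cl_tapes n ds), as) \<in> tick (length ds)"
proof (induction ds)
  case (Cons d ds)
  obtain h b where d: "d = (h, b)" by force
  have v: "h \<le> Suc n" "valid n ds" using Cons.prems d by auto
  obtain as where as: "(map read_tape (cl_tapes n ds), as) \<in> idle (length ds)" using idle_ex v by blast
  show ?case
  proof (cases "dig n d = Suc n")
    case False
    show ?thesis
    proof (cases b)
      case True
      then show ?thesis using tick_SucI(1)[OF as, of "read_tape (mk n h)"] False d v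
        by (auto simp: read_fl read_mk simp del: tick.simps split: if_splits)
    next
      case b: False
      then show ?thesis using tick_SucI(2)[OF as, of "read_tape (mk n h)"] False d v
        by (auto simp: read_fl read_mk simp del: tick.simps split: if_splits)
    qed
  next
    case True
    then have "Suc (val n ds) < (n + 2) ^ length ds"
    proof -
      \<comment> \<open>The lowest digit has its maximal value \<open>n + 1\<close>, so the bound
        can be divided by the base and passes to the higher digits.\<close>
      have "(n + 2) * Suc (val n ds) < (n + 2) * (n + 2) ^ length ds"
        using Cons.prems(2) True by (simp add: algebra_simps)
      then show ?thesis by (simp only: mult_less_cancel1)
    qed
    then obtain as' where as': "(map read_tape (cl_tapes n ds), as') \<in> tick (length ds)" using Cons.IH v by blast
    show ?thesis using tick_SucI(3,4)[OF as'] d v True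
      by (cases b) (auto simp: read_fl read_mk simp del: tick.simps)
  qed
qed simp

section \<open>Attaching the clock to a machine\<close>

locale clocked =
  fixes M :: machine and D :: nat
  assumes wf: "wf_machine M"
    and ans: "yes_st M \<noteq> query_st M" "no_st M \<noteq> query_st M"
begin

definition "T1 = num_tapes M - 1"

lemma T1: "num_tapes M = Suc T1" "1 \<le> T1"
  using wf by (auto simp: T1_def wf_machine_def)

text \<open>While the clock is being prepared, all mark tapes are in the same situation, so a single
  symbol \<open>c\<close> describes all of them.\<close>

definition rd0 :: "tsym \<Rightarrow> tsym \<Rightarrow> tsym list" where
  "rd0 s c = s # replicate T1 LeftEnd @ concat (replicate D [c, LeftEnd])"

definition ac0 :: "tsym \<times> dir \<Rightarrow> tsym \<times> dir \<Rightarrow> (tsym \<times> dir) list" where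
  "ac0 a c = a # replicate T1 (LeftEnd, Stay) @ concat (replicate D [c, (LeftEnd, Stay)])"

definition cfg :: "tape \<Rightarrow> tape \<Rightarrow> tape list" where
  "cfg t m = t # replicate T1 (word_tape []) @ concat (replicate D [m, fl True])"

lemma fl_True: "fl True = word_tape []"
  by (auto simp: fl_def word_tape_def fun_eq_iff)

lemma read_cfg: "map read_tape (cfg t m) = rd0 (read_tape t) (read_tape m)"
proof -
  have "read_tape (word_tape []) = LeftEnd" by (simp add: read_tape_def word_tape_def)
  then show ?thesis by (simp add: cfg_def rd0_def map_concat fl_True map_replicate)
qed

lemma act_cfg: "map2 act_tape (ac0 a c) (cfg t m) = cfg (act_tape a t) (act_tape c m)"
proof -
  have e: "act_tape (LeftEnd, Stay) (word_tape []) = word_tape []"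
    by (auto simp: act_tape_def word_tape_def fun_eq_iff)
  have "map2 act_tape (concat (replicate D' [c, (LeftEnd, Stay)])) (concat (replicate D' [m, fl True])) =
      concat (replicate D' [act_tape c m, fl True])" for D'
    by (induction D') (auto simp: fl_True e)
  moreover have "map2 act_tape (replicate k (LeftEnd, Stay)) (replicate k (word_tape [])) = replicate k (word_tape [])" for k
    by (induction k) (auto simp: e)
  ultimately show ?thesis by (simp add: ac0_def cfg_def)
qed

lemma rd0_inj: "rd0 s c = rd0 s' c' \<Longrightarrow> s = s'"
  by (simp add: rd0_def)

text \<open>State 0 walks over the input and writes one mark per bit on every mark tape, state 1
  walks back, and then the original machine starts, its states shifted by 2.\<close>

definition dinit :: "trans set" where
  "dinit = {((0, rd0 LeftEnd LeftEnd), (0, ac0 (LeftEnd, Right) (LeftEnd, Right))),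
     ((0, rd0 Blank Blank), (1, ac0 (Blank, Left) (Blank, Left))),
     ((1, rd0 LeftEnd LeftEnd), (start_st M + 2, ac0 (LeftEnd, Stay) (LeftEnd, Stay)))} \<union>
   (\<lambda>b. ((0, rd0 (Bit b) Blank), (0, ac0 (Bit b, Right) (Bit True, Right)))) ` UNIV \<union>
   (\<lambda>b. ((1, rd0 (Bit b) (Bit True)), (1, ac0 (Bit b, Left) (Bit True, Left)))) ` UNIV"

definition drun :: "trans set" where
  "drun = (\<lambda>(((q, rs), (q', as)), (cs, ca)). ((q + 2, rs @ cs), (q' + 2, as @ ca))) ` (delta M \<times> tick D)"

definition "N = \<lparr>num_tapes = num_tapes M + 2 * D, start_st = 0, accept_st = accept_st M + 2,
  query_st = query_st M + 2, yes_st = yes_st M + 2, no_st = no_st M + 2, delta = dinit \<union> drun\<rparr>"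

lemma N_simps [simp]: "num_tapes N = num_tapes M + 2 * D" "start_st N = 0" "accept_st N = accept_st M + 2"
  "query_st N = query_st M + 2" "yes_st N = yes_st M + 2" "no_st N = no_st M + 2" "delta N = dinit \<union> drun"
  by (auto simp: N_def)

lemma length_cyc: "length (concat (replicate D [a, b])) = 2 * D"
  by (induction D) auto

lemma wf_N: "wf_machine N"
proof -
  have "finite (delta M)" using wf by (auto simp: wf_machine_def)
  then have "finite (delta N)" by (auto simp: dinit_def drun_def finite_tick)
  moreover have "length rs = num_tapes N \<and> length as = num_tapes N"
    if "((q, rs), (q', as)) \<in> delta N" for q rs q' as
    using that wf T1 by (auto simp: dinit_def drun_def rd0_def ac0_def length_cyc wf_machine_def dest: length_tick)
  ultimately show ?thesis using T1 by (auto simp: wf_machine_def)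
qed

lemma init_N: "init_config N x = (0, cfg (word_tape x) (mk 0 0))"
proof -
  have "mk 0 0 = word_tape []" by (simp add: mk_def word_tape_def)
  moreover have "concat (replicate D' [a, a]) = replicate (2 * D') a" for D' and a :: tape
    by (induction D') auto
  moreover have "num_tapes N - 1 = T1 + 2 * D" using T1 by simp
  ultimately show ?thesis by (simp add: init_config_def cfg_def fl_True replicate_add)
qed

lemma init_M: "snd (init_config M x) @ cl_tapes n (replicate D (0, True)) = cfg (word_tape x) (mk n 0)"
  by (auto simp: init_config_def cfg_def T1_def cl_tapes_def)

text \<open>The last argument is a potential that drops in every step and so bounds the running
  time. A unit left on the clock counts 2, because a query does not tick; the additional 1 in the
  query state pays for the answer.\<close>

inductive inv :: "lang \<Rightarrow> bool list \<Rightarrow> config \<Rightarrow> nat \<Rightarrow> bool" for A x where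
  invA: "j \<le> Suc (length x) \<Longrightarrow>
    inv A x (0, cfg (fst (word_tape x), j) (mk (j - 1) j)) (2 * (length x + 2) ^ D + 2 * length x + 6 - j)"
| invB: "j \<le> length x \<Longrightarrow>
    inv A x (1, cfg (fst (word_tape x), j) (mk (length x) j)) (2 * (length x + 2) ^ D + 2 + j)"
| invC: "(step M A)\<^sup>*\<^sup>* (init_config M x) (q, tps) \<Longrightarrow> length tps = num_tapes M \<Longrightarrow>
    valid (length x) ds \<Longrightarrow> length ds = D \<Longrightarrow>
    inv A x (q + 2, tps @ cl_tapes (length x) ds)
      (2 * ((length x + 2) ^ D - val (length x) ds) + (if q = query_st M then 1 else 0))"

lemma val_0: "val n (replicate k (0, True)) = 0" "valid n (replicate k (0, True))"
  by (induction k) auto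

lemma inv_start: "inv A x (start_st M + 2, cfg (word_tape x) (mk (length x) 0))
    (2 * (length x + 2) ^ D + (if start_st M = query_st M then 1 else 0))"
proof -
  have "inv A x (start_st M + 2, snd (init_config M x) @ cl_tapes (length x) (replicate D (0, True)))
    (2 * ((length x + 2) ^ D - val (length x) (replicate D (0, True))) + (if start_st M = query_st M then 1 else 0))"
    by (rule invC) (use T1 in \<open>auto simp: init_config_def val_0\<close>)
  then show ?thesis by (simp add: init_M val_0)
qed

lemma act_word:
  "read_tape (fst (word_tape x), j) = (if j = 0 then LeftEnd else if j \<le> length x then Bit (x ! (j - 1)) else Blank)"
  "act_tape (read_tape (f, j), d) (f, j) = (f, move d j)"
  by (auto simp: read_tape_def word_tape_def act_tape_def)

lemma act_mark: "act_tape (Bit True, Right) (mk (j - 1) j) = mk j (Suc j)" if "0 < j"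
  using that by (auto simp: act_tape_def mk_def word_tape_def fun_eq_iff)

lemma step_N:
  assumes "step N A (q, tps) c" "q < 2"
  obtains q' as where "((q, map read_tape tps), (q', as)) \<in> dinit" "c = (q', map2 act_tape as tps)"
  using assms(1)
proof cases
  case (step_delta q' as)
  then have "((q, map read_tape tps), (q', as)) \<in> dinit"
    using assms(2) by (auto simp: drun_def)
  then show ?thesis using that step_delta by blast
qed (use assms(2) in auto)

lemma inv_step:
  assumes "inv A x c m" "step N A c c'"
  shows "\<exists>m'<m. inv A x c' m'"
  using assms
proof cases
  case (invA j)
  let ?c = "(fst (word_tape x), j)"
  obtain q' as where *: "((0, rd0 (read_tape ?c) (read_tape (mk (j - 1) j))), (q', as)) \<in> dinit"
    "c' = (q', map2 act_tape as (cfg ?c (mk (j - 1) j)))"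
    using assms(2) unfolding invA(1) by (rule step_N) (auto simp: read_cfg)
  consider "j = 0" | "0 < j" "j \<le> length x" | "j = Suc (length x)" using invA(3) by linarith
  then show ?thesis
  proof cases
    case 1
    then have "as = ac0 (LeftEnd, Right) (LeftEnd, Right)" "q' = 0"
      using *(1) by (auto simp: dinit_def act_word dest!: rd0_inj)
    then have "c' = (0, cfg (fst (word_tape x), Suc 0) (mk 0 (Suc 0)))"
      using *(2) 1 act_word(2)[of "fst (word_tape x)" 0 Right] act_mk(2)[of 0 0]
      by (simp add: act_cfg act_word read_mk)
    then have "inv A x c' (2 * (length x + 2) ^ D + 2 * length x + 6 - Suc 0)"
      using inv.invA[of "Suc 0" x A] by simp
    then show ?thesis unfolding invA(2) by (rule_tac exI, rule_tac conjI[rotated], assumption) (use 1 in linarith)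
  next
    case 2
    then have "as = ac0 (Bit (x ! (j - 1)), Right) (Bit True, Right)" "q' = 0"
      using *(1) by (auto simp: dinit_def act_word dest!: rd0_inj)
    then have "c' = (0, cfg (fst (word_tape x), Suc j) (mk j (Suc j)))"
      using *(2) 2 act_word(2)[of "fst (word_tape x)" j Right]
      by (simp add: act_cfg act_word act_mark[simplified])
    then have "inv A x c' (2 * (length x + 2) ^ D + 2 * length x + 6 - Suc j)"
      using inv.invA[of "Suc j" x A] 2 by simp
    then show ?thesis unfolding invA(2) by (rule_tac exI, rule_tac conjI[rotated], assumption) (use 2 in linarith)
  next
    case 3
    then have "as = ac0 (Blank, Left) (Blank, Left)" "q' = 1"
      using *(1) by (auto simp: dinit_def act_word dest!: rd0_inj)
    then have "c' = (1, cfg (fst (word_tape x), length x) (mk (length x) (length x)))"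
      using *(2) 3 act_word(2)[of "fst (word_tape x)" j Left] act_mk(3)[of "length x" "Suc (length x)"]
      by (simp add: act_cfg act_word read_mk)
    then have "inv A x c' (2 * (length x + 2) ^ D + 2 + length x)"
      using inv.invB[of "length x" x A] by simp
    then show ?thesis unfolding invA(2) by (rule_tac exI, rule_tac conjI[rotated], assumption) (use 3 in linarith)
  qed
next
  case (invB j)
  let ?c = "(fst (word_tape x), j)"
  obtain q' as where *: "((1, rd0 (read_tape ?c) (read_tape (mk (length x) j))), (q', as)) \<in> dinit"
    "c' = (q', map2 act_tape as (cfg ?c (mk (length x) j)))"
    using assms(2) unfolding invB(1) by (rule step_N) (auto simp: read_cfg)
  show ?thesis
  proof (cases "j = 0")
    case True
    then have "as = ac0 (LeftEnd, Stay) (LeftEnd, Stay)" "q' = start_st M + 2"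
      using *(1) by (auto simp: dinit_def act_word dest!: rd0_inj)
    then have "c' = (start_st M + 2, cfg (fst (word_tape x), 0) (mk (length x) 0))"
      using *(2) True act_word(2)[of "fst (word_tape x)" 0 Stay] act_mk(1)[of "length x" 0]
      by (simp add: act_cfg act_word read_mk)
    moreover have "(fst (word_tape x), 0) = word_tape x" by (simp add: word_tape_def)
    ultimately have "inv A x c' (2 * (length x + 2) ^ D + (if start_st M = query_st M then 1 else 0))"
      using inv_start by metis
    then show ?thesis unfolding invB(2) by (rule_tac exI, rule_tac conjI[rotated], assumption) simp
  next
    case False
    then have "as = ac0 (Bit (x ! (j - 1)), Left) (Bit True, Left)" "q' = 1"
      using *(1) invB by (auto simp: dinit_def act_word dest!: rd0_inj)
    then have "c' = (1, cfg (fst (word_tape x), j - 1) (mk (length x) (j - 1)))"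
      using *(2) False invB act_word(2)[of "fst (word_tape x)" j Left] act_mk(3)[of "length x" "j"]
      by (simp add: act_cfg act_word read_mk)
    then have "inv A x c' (2 * (length x + 2) ^ D + 2 + (j - 1))"
      using inv.invB[of "j - 1" x A] invB(3) by simp
    then show ?thesis unfolding invB(2) by (rule_tac exI, rule_tac conjI[rotated], assumption) (use False in linarith)
  qed
next
  case (invC q tps ds)
  let ?n = "length x" and ?t = "tps @ cl_tapes (length x) ds"
  have vl: "val ?n ds < (?n + 2) ^ D" using val_less invC by blast
  from assms(2) show ?thesis unfolding invC(1)
  proof cases
    case (step_delta q' as)
    then have "((q + 2, map read_tape ?t), (q', as)) \<in> drun" by (auto simp: dinit_def)
    then obtain rs cs q1 as1 ca where d: "((q, rs), (q1, as1)) \<in> delta M" "(cs, ca) \<in> tick D"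
      "map read_tape ?t = rs @ cs" "q' = q1 + 2" "as = as1 @ ca" by (auto simp: drun_def)
    have l: "length rs = num_tapes M" "length as1 = num_tapes M" using d wf by (auto simp: wf_machine_def)
    then have e: "rs = map read_tape tps" "cs = map read_tape (cl_tapes ?n ds)"
      using d(3) invC by auto
    from tick_sound[of ?n ds ca] d(2) e invC obtain ds' where ds': "map2 act_tape ca (cl_tapes ?n ds) = cl_tapes ?n ds'"
      "valid ?n ds'" "length ds' = D" "val ?n ds' = Suc (val ?n ds)" by auto
    have "q \<noteq> query_st M" using step_delta by auto
    then have "step M A (q, tps) (q1, map2 act_tape as1 tps)" using d e by (auto intro: step.step_delta)
    then have "(step M A)\<^sup>*\<^sup>* (init_config M x) (q1, map2 act_tape as1 tps)"
      using invC(3) by (rule rtranclp.rtrancl_into_rtrancl[rotated])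
    then have "inv A x (q1 + 2, map2 act_tape as1 tps @ cl_tapes ?n ds')
      (2 * ((?n + 2) ^ D - val ?n ds') + (if q1 = query_st M then 1 else 0))"
      by (rule inv.invC) (use l invC ds' in auto)
    moreover have "c' = (q1 + 2, map2 act_tape as1 tps @ cl_tapes ?n ds')"
      using step_delta d ds'(1) l invC(4) by simp
    ultimately show ?thesis using ds'(4) vl val_less[OF ds'(2)] ds'(3) \<open>q \<noteq> query_st M\<close> invC(2)
      by (intro exI[of _ "2 * ((?n + 2) ^ D - val ?n ds') + (if q1 = query_st M then 1 else 0)"]) auto
  next
    case step_query
    let ?q = "if query_word (?t ! 1) \<in> A then yes_st M else no_st M"
    have e: "?t ! 1 = tps ! 1" using invC(4) T1 by (simp add: nth_append)
    have q: "q = query_st M" using step_query by simp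
    then have "step M A (q, tps) (?q, tps)" unfolding e using step.step_query[of M A tps] by simp
    then have "(step M A)\<^sup>*\<^sup>* (init_config M x) (?q, tps)"
      using invC(3) by (rule rtranclp.rtrancl_into_rtrancl[rotated])
    then have "inv A x (?q + 2, ?t) (2 * ((?n + 2) ^ D - val ?n ds) + (if ?q = query_st M then 1 else 0))"
      by (rule inv.invC) (use invC in auto)
    \<comment> \<open>The answer state is not a query state, so the step uses up the extra unit of
      the potential although the clock stands still.\<close>
    moreover have "?q \<noteq> query_st M" using ans by auto
    moreover have "c' = (?q + 2, ?t)" using step_query by simp
    ultimately show ?thesis using q invC(2)
      by (intro exI[of _ "2 * ((?n + 2) ^ D - val ?n ds)"]) auto
  qed
qed

lemma inv_init: "inv A x (init_config N x) (2 * (length x + 2) ^ D + 2 * length x + 6)"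
proof -
  have "(fst (word_tape x), 0) = word_tape x" by (simp add: word_tape_def)
  then show ?thesis using invA[of 0 x A] by (simp add: init_N)
qed

lemma inv_steps: "(step N A ^^ k) (init_config N x) c \<Longrightarrow>
    \<exists>m. inv A x c m \<and> m + k \<le> 2 * (length x + 2) ^ D + 2 * length x + 6"
proof (induction k arbitrary: c)
  case 0
  then show ?case using inv_init by auto
next
  case (Suc k)
  then obtain c1 where "(step N A ^^ k) (init_config N x) c1" "step N A c1 c" by auto
  with Suc.IH inv_step show ?case by fastforce
qed

lemma poly_time_N: "poly_time N A"
proof -
  have "poly (smult 2 ([:2, 1:] ^ D) + [:6, 2:]) n = 2 * (n + 2) ^ D + 2 * n + 6" for n :: nat
    by (simp add: algebra_simps)
  then show ?thesis unfolding poly_time_def using inv_steps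
    by (intro exI[of _ "smult 2 ([:2, 1:] ^ D) + [:6, 2:]"]) fastforce
qed

lemma sound: "accepts N A x \<Longrightarrow> accepts M A x"
proof -
  assume "accepts N A x"
  then obtain tps k where "(step N A ^^ k) (init_config N x) (accept_st M + 2, tps)"
    by (auto simp: accepts_def rtranclp_power)
  from inv_steps[OF this] obtain m where "inv A x (accept_st M + 2, tps) m" by blast
  then show ?thesis by cases (auto simp: accepts_def)
qed

text \<open>Each step uses at most one tick, and a tick is available as long as the value stays
  below the capacity of the clock.\<close>

lemma lift: "(step M A ^^ k) (q, tps) (q', tps') \<Longrightarrow> length tps = num_tapes M \<Longrightarrow> valid n ds \<Longrightarrow>
    length ds = D \<Longrightarrow> val n ds + k < (n + 2) ^ D \<Longrightarrow>
    \<exists>cs. (step N A)\<^sup>*\<^sup>* (q + 2, tps @ cl_tapes n ds) (q' + 2, tps' @ cs)"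
proof (induction k arbitrary: q tps ds)
  case 0
  then show ?case by auto
next
  case (Suc k)
  from Suc.prems(1) obtain q1 tps1 where st: "step M A (q, tps) (q1, tps1)" "(step M A ^^ k) (q1, tps1) (q', tps')"
    by (metis relpowp_Suc_D2 surj_pair)
  from st(1) have "\<exists>ds'. step N A (q + 2, tps @ cl_tapes n ds) (q1 + 2, tps1 @ cl_tapes n ds') \<and>
     length tps1 = num_tapes M \<and> valid n ds' \<and> length ds' = D \<and> val n ds' \<le> Suc (val n ds)"
  proof cases
    case (step_delta as)
    then have l: "length as = num_tapes M" using wf by (auto simp: wf_machine_def)
    obtain ca where ca: "(map read_tape (cl_tapes n ds), ca) \<in> tick D"
      using tick_complete[of n ds] Suc.prems by auto
    from tick_sound[of n ds ca] ca Suc.prems obtain ds' where ds': "map2 act_tape ca (cl_tapes n ds) = cl_tapes n ds'"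
      "valid n ds'" "length ds' = D" "val n ds' = Suc (val n ds)" by auto
    have "((q + 2, map read_tape (tps @ cl_tapes n ds)), (q1 + 2, as @ ca)) \<in> delta N"
      using step_delta ca by (force simp: drun_def)
    then have "step N A (q + 2, tps @ cl_tapes n ds) (q1 + 2, map2 act_tape (as @ ca) (tps @ cl_tapes n ds))"
      using step_delta by (intro step.step_delta) auto
    moreover have "map2 act_tape (as @ ca) (tps @ cl_tapes n ds) = tps1 @ cl_tapes n ds'"
      using l Suc.prems(2) ds'(1) step_delta by simp
    ultimately show ?thesis using ds' l Suc.prems(2) step_delta by auto
  next
    case step_query
    have e: "(tps @ cl_tapes n ds) ! 1 = tps ! 1" using Suc.prems(2) T1 by (simp add: nth_append)
    have "step N A (q + 2, tps @ cl_tapes n ds) (q1 + 2, tps1 @ cl_tapes n ds)"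
      using step.step_query[of N A "tps @ cl_tapes n ds"] e step_query by (simp split: if_splits)
    then show ?thesis using Suc.prems step_query by auto
  qed
  then obtain ds' where ds': "step N A (q + 2, tps @ cl_tapes n ds) (q1 + 2, tps1 @ cl_tapes n ds')"
     "length tps1 = num_tapes M" "valid n ds'" "length ds' = D" "val n ds' \<le> Suc (val n ds)" by blast
  then obtain cs where "(step N A)\<^sup>*\<^sup>* (q1 + 2, tps1 @ cl_tapes n ds') (q' + 2, tps' @ cs)"
    using Suc.IH[OF st(2), of ds'] Suc.prems by auto
  then show ?case using ds'(1) by (meson converse_rtranclp_into_rtranclp)
qed

lemma init_steps: "(step N A)\<^sup>*\<^sup>* (init_config N x) (start_st M + 2, cfg (word_tape x) (mk (length x) 0))"
proof -
  have I: "step N A (q, cfg t m) (q', cfg (act_tape a t) (act_tape c m))"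
    if "((q, rd0 (read_tape t) (read_tape m)), (q', ac0 a c)) \<in> dinit" "q < 2" for q q' t m a c
    using that step_delta[of q N "cfg t m" q' "ac0 a c" A] by (simp add: read_cfg act_cfg)
  have w0: "(fst (word_tape x), 0) = word_tape x" by (simp add: word_tape_def)
  let ?w = "fst (word_tape x)"
  have r0: "read_tape (word_tape x) = LeftEnd" using act_word(1)[of x 0] by (simp add: w0)
  have a: "step N A (init_config N x) (0, cfg (?w, 1) (mk 0 1))"
    using I[of 0 "(?w, 0)" "mk 0 0" 0 "(LeftEnd, Right)" "(LeftEnd, Right)"]
      act_word(2)[of ?w 0 Right] act_mk(2)[of 0 0]
    by (simp add: init_N dinit_def r0 read_mk w0)
  have b: "(step N A)\<^sup>*\<^sup>* (0, cfg (?w, 1) (mk 0 1)) (0, cfg (?w, Suc j) (mk j (Suc j)))" if "j \<le> length x" for j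
    using that
  proof (induction j)
    case (Suc j)
    have "step N A (0, cfg (?w, Suc j) (mk j (Suc j))) (0, cfg (?w, Suc (Suc j)) (mk (Suc j) (Suc (Suc j))))"
      using I[of 0 "(?w, Suc j)" "mk j (Suc j)" 0 "(Bit (x ! j), Right)" "(Bit True, Right)"]
        act_word(2)[of ?w "Suc j" Right] act_mark[of "Suc j"] Suc.prems
      by (simp add: dinit_def act_word read_mk)
    then show ?case using Suc by (meson Suc_leD rtranclp.rtrancl_into_rtrancl)
  qed simp
  have c: "step N A (0, cfg (?w, Suc (length x)) (mk (length x) (Suc (length x)))) (1, cfg (?w, length x) (mk (length x) (length x)))"
    using I[of 0 "(?w, Suc (length x))" "mk (length x) (Suc (length x))" 1 "(Blank, Left)" "(Blank, Left)"]
      act_word(2)[of ?w "Suc (length x)" Left] act_mk(3)[of "length x" "Suc (length x)"]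
    by (simp add: dinit_def act_word read_mk)
  have d: "(step N A)\<^sup>*\<^sup>* (1, cfg (?w, j) (mk (length x) j)) (1, cfg (?w, 0) (mk (length x) 0))" if "j \<le> length x" for j
    using that
  proof (induction j)
    case (Suc j)
    have "step N A (1, cfg (?w, Suc j) (mk (length x) (Suc j))) (1, cfg (?w, j) (mk (length x) j))"
      using I[of 1 "(?w, Suc j)" "mk (length x) (Suc j)" 1 "(Bit (x ! j), Left)" "(Bit True, Left)"]
        act_word(2)[of ?w "Suc j" Left] act_mk(3)[of "length x" "Suc j"] Suc.prems
      by (simp add: dinit_def act_word read_mk)
    then show ?case using Suc by (meson Suc_leD converse_rtranclp_into_rtranclp)
  qed simp
  have e: "step N A (1, cfg (?w, 0) (mk (length x) 0)) (start_st M + 2, cfg (word_tape x) (mk (length x) 0))"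
    using I[of 1 "(?w, 0)" "mk (length x) 0" "start_st M + 2" "(LeftEnd, Stay)" "(LeftEnd, Stay)"]
      act_word(2)[of ?w 0 Stay] act_mk(1)[of "length x" 0]
    by (simp add: dinit_def r0 read_mk w0)
  from a b[OF order_refl] c d[OF order_refl] e show ?thesis
    by (meson converse_rtranclp_into_rtranclp rtranclp.rtrancl_into_rtrancl rtranclp_trans)
qed

lemma complete:
  assumes "(step M A ^^ k) (init_config M x) (accept_st M, tps)" "k < (length x + 2) ^ D"
  shows "accepts N A x"
proof -
  have e: "init_config M x = (start_st M, snd (init_config M x))" by (simp add: init_config_def)
  have "\<exists>cs. (step N A)\<^sup>*\<^sup>* (start_st M + 2, snd (init_config M x) @ cl_tapes (length x) (replicate D (0, True)))
      (accept_st M + 2, tps @ cs)"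
    using assms e T1 by (intro lift[where k = k]) (auto simp: val_0 init_config_def)
  then show ?thesis unfolding init_M accepts_def N_simps using init_steps
    by (meson rtranclp_trans)
qed

end

text \<open>Time is bounded for all oracles and on all paths, at the cost of precision: inputs whose
  accepting runs are all long may be kept or lost. This gap is inherited by \<open>prog_NP\<close>
  and \<open>clock_enc\<close>.\<close>

lemma clock:
  assumes "wf_machine M" "yes_st M \<noteq> query_st M" "no_st M \<noteq> query_st M"
  shows "\<exists>N. wf_machine N \<and> (\<forall>A. poly_time N A \<and> (\<forall>x. accepts N A x \<longrightarrow> accepts M A x) \<and>
    (\<forall>x k tps. (step M A ^^ k) (init_config M x) (accept_st M, tps) \<longrightarrow> k < (length x + 2) ^ D \<longrightarrow>
       accepts N A x))"
proof -
  interpret clocked M D using assms by unfold_locales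
  show ?thesis using wf_N poly_time_N sound complete by blast
qed

section \<open>Polynomial bounds\<close>

text \<open>Since \<open>n + 2\<close> is at least 2, a larger exponent absorbs constants and sums,
  and bounds of this shape are also the capacities of the clocks.\<close>

definition pb :: "(nat \<Rightarrow> nat) \<Rightarrow> bool" where
  "pb f \<longleftrightarrow> (\<exists>d. \<forall>n. f n \<le> (n + 2) ^ d)"

lemma pbI: "(\<And>n. f n \<le> (n + 2) ^ d) \<Longrightarrow> pb f"
  by (auto simp: pb_def)

lemma pb_const: "pb (\<lambda>n. c)"
proof (rule pbI)
  fix n :: nat
  have "c \<le> 2 ^ c" by simp
  also have "\<dots> \<le> (n + 2) ^ c" by (rule power_mono) auto
  finally show "c \<le> (n + 2) ^ c" .
qed

lemma pb_id: "pb (\<lambda>n. n)"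
  by (rule pbI[of _ 1]) simp

lemma pb_add: "pb f \<Longrightarrow> pb g \<Longrightarrow> pb (\<lambda>n. f n + g n)"
proof -
  assume "pb f" "pb g"
  then obtain d e where d: "\<And>n. f n \<le> (n + 2) ^ d" and e: "\<And>n. g n \<le> (n + 2) ^ e"
    by (auto simp: pb_def)
  show ?thesis
  proof (rule pbI)
    fix n :: nat
    have "f n \<le> (n + 2) ^ max d e" by (rule order_trans[OF d], rule power_increasing) auto
    moreover have "g n \<le> (n + 2) ^ max d e" by (rule order_trans[OF e], rule power_increasing) auto
    ultimately have "f n + g n \<le> 2 * (n + 2) ^ max d e" by simp
    also have "\<dots> \<le> (n + 2) ^ Suc (max d e)" by simp
    finally show "f n + g n \<le> (n + 2) ^ Suc (max d e)" .
  qed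
qed

lemma pb_mult: "pb f \<Longrightarrow> pb g \<Longrightarrow> pb (\<lambda>n. f n * g n)"
proof -
  assume "pb f" "pb g"
  then obtain d e where d: "\<And>n. f n \<le> (n + 2) ^ d" and e: "\<And>n. g n \<le> (n + 2) ^ e"
    by (auto simp: pb_def)
  show ?thesis by (rule pbI[of _ "d + e"], unfold power_add, rule mult_mono[OF d e]) auto
qed

lemma pb_Suc: "pb f \<Longrightarrow> pb (\<lambda>n. Suc (f n))"
  using pb_add[OF _ pb_const[of 1]] by simp

lemma pb_power: "pb f \<Longrightarrow> pb (\<lambda>n. f n ^ k)"
  by (induction k) (auto intro: pb_const pb_mult)

lemmas pb_intros = pb_const pb_id pb_add pb_mult pb_Suc pb_power

lemma pb_poly: "pb (poly p)"
  by (induction p) (auto intro!: pb_intros)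

section \<open>Accepting languages by programs\<close>

definition wd :: "nat list \<Rightarrow> bool list" where
  "wd w = rev (map (\<lambda>a. a = 1) w)"

text \<open>The idealised query. \<open>Qt\<close> mirrors the machine and reads a bit prefix; here
  a register with other symbols fails for both answers, so programs speak about whole words
  only.\<close>

definition Qo :: "lang \<Rightarrow> bool \<Rightarrow> nat list \<Rightarrow> bool" where
  "Qo A b w \<longleftrightarrow> set w \<subseteq> {0, 1} \<and> (wd w \<in> A) = b"

lemma wd_stk [simp]: "wd (stk x) = x"
  by (simp add: wd_def stk_def rev_map comp_def)

lemma stk_bits: "set (stk x) \<subseteq> {0, 1}"
  by (auto simp: stk_def)

lemma length_stk [simp]: "length (stk x) = length x"
  by (simp add: stk_def)

lemma length_wd [simp]: "length (wd w) = length w"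
  by (simp add: wd_def)

lemma stk_wd: "set w \<subseteq> {0, 1} \<Longrightarrow> stk (wd w) = w"
  by (auto simp: stk_def wd_def rev_map intro!: map_idI)

lemma Qt_Qo: "set w \<subseteq> {0, 1} \<Longrightarrow> Qt A b w \<longleftrightarrow> Qo A b w"
proof -
  assume a: "set w \<subseteq> {0, 1}"
  have "takeWhile (\<lambda>a. a < 2) (rev w) = rev w" by (subst takeWhile_eq_all_conv) (use a in auto)
  then show ?thesis unfolding Qt_def Qo_def wd_def by (simp only: rev_map a simp_thms)
qed

text \<open>From programs to machines. All queries have to be moved to register 1, which is the
  query tape, and the program must then be compiled and clocked. The language obtained lies between
  the inputs with a short run and those with some run.\<close>

lemma prog_NP:
  "\<exists>L\<in>NP_oracle A. (\<forall>x\<in>L. \<exists>t. runs (Qo A) p (ini [x]) t) \<and>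
     (\<forall>x t. runs_in (Qo A) p (ini [x]) ((length x + 2) ^ d) t \<longrightarrow> x \<in> L)"
proof -
  \<comment> \<open>The queried register is copied to register 1 by way of register 2 and erased
    afterwards. Copying over the alphabet of the bits enforces that the word is proper, which
    reconciles \<open>Qt\<close> with \<open>Qo\<close>.\<close>
  define g where "g r b = (copy [0, 1] r 2 1 ;; Query 1 b) ;; clear 2 1" for r b
  \<comment> \<open>Registers 0, 1, 2 are needed for the input tape, the query tape and scratch, so
    \<open>p\<close> is shifted by 3. The input is moved twice because each move reverses
    it.\<close>
  define p' where "p' = (mv [0, 1] 0 2 ;; mv [0, 1] 2 3) ;; sub g (sh 3 p)"
  obtain B where "uses {..<B} B p" using ex_uses by blast
  then have u: "uses {3..} B (sh 3 p)" by (rule uses_mono[OF uses_sh]) auto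
  have "queries (sub g q) \<subseteq> {1}" for q
    by (induction q) (auto simp: g_def copy_def mv_def mv2_def clear_def each_def alts_def upt_rec)
  then have q: "queries p' \<subseteq> {1}"
    unfolding p'_def by (simp add: mv_def each_def alts_def)
  have g1: "t = s \<and> Qo A b (s r)"
    if "r \<in> {3..}" "\<forall>x. x \<notin> {3..} \<longrightarrow> s x = []" "runs (Qt A) (g r b) s t" for r b s t
  proof -
    have "s 1 = []" "s 2 = []" "r \<noteq> 2" "r \<noteq> 1" using that by auto
    with that(3) have "set (s r) \<subseteq> {0, 1}" "Qt A b (s r)" "t = s" by (auto simp: g_def)
    then show ?thesis by (simp add: Qt_Qo)
  qed
  have g2: "runs_in (Qt A) (g r b) s (20 * W + 20) s"
    if "r \<in> {3..}" "\<forall>x. x \<notin> {3..} \<longrightarrow> s x = []" "Qo A b (s r)" "length (s r) \<le> W" for r b s W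
  proof -
    have s: "s 1 = []" "s 2 = []" "r \<noteq> 2" "r \<noteq> 1" using that by auto
    have bits: "set (s r) \<subseteq> {0, 1}" using that by (simp add: Qo_def)
    have "runs_in (Qt A) (copy [0, 1] r 2 1) s (14 * length (s r) + 7) (s(1 := s r))"
      by (rule runs_in_copy) (use s bits in auto)
    moreover have "runs_in (Qt A) (Query 1 b) (s(1 := s r)) 1 (s(1 := s r))"
      by (rule runs_in_prim) (use that Qt_Qo[OF bits] in auto)
    ultimately have "runs_in (Qt A) (copy [0, 1] r 2 1 ;; Query 1 b) s (14 * length (s r) + 9) (s(1 := s r))"
      by (rule runs_in_Seq) simp
    moreover have "runs_in (Qt A) (clear 2 1) (s(1 := s r)) (6 * length (s r) + 3) s"
      by (rule runs_in_clear) (use s bits in auto)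
    ultimately show ?thesis unfolding g_def by (rule runs_in_Seq) (use that in simp)
  qed
  have st: "(ini [x])(0 := [], 3 := stk x) = glue 3 (\<lambda>_. []) (ini [x])" for x
    by (auto simp: ini_def glue_def fun_eq_iff)
  have mv': "runs Q (mv [0, 1] 0 2 ;; mv [0, 1] 2 3) (ini [x]) t \<longleftrightarrow> t = glue 3 (\<lambda>_. []) (ini [x])" for Q x t
  proof -
    have "(ini [x])(0 := [], 2 := [], 3 := stk x) = (ini [x])(0 := [], 3 := stk x)"
      by (auto simp: ini_def fun_eq_iff)
    moreover have "ini [x] 0 = stk x" "ini [x] 2 = []" "ini [x] 3 = []" by (auto simp: ini_def)
    ultimately show ?thesis using stk_bits[of x] unfolding st[symmetric] by auto
  qed
  have sound: "\<exists>t. runs (Qo A) p (ini [x]) t" if r: "runs (Qt A) p' (ini [x]) t" for x t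
  proof -
    from r have r': "runs (Qt A) (sub g (sh 3 p)) (glue 3 (\<lambda>_. []) (ini [x])) t"
      unfolding p'_def runs_simps(7)[of _ "mv [0, 1] 0 2 ;; mv [0, 1] 2 3"] mv' by simp
    have "runs (Qo A) (sh 3 p) (glue 3 (\<lambda>_. []) (ini [x])) t"
      by (rule runs_sub[where X = "{3..}" and e = "\<lambda>_. []", OF g1 u r']) (auto simp: glue_def)
    then show ?thesis unfolding runs_def by (blast dest: exec_sh2)
  qed
  \<comment> \<open>At most \<open>N\<close> steps of \<open>p\<close>, each possibly a query with a
    word of at most \<open>n + N\<close> symbols, as \<open>N\<close> steps push no more than
    \<open>N\<close> symbols. The rest is the relocation of the input.\<close>
  define cost where "cost n N = N * (20 * (n + N) + 21) + 12 * n + 30" for n N :: nat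
  have complete: "\<exists>t. runs_in (Qt A) p' (ini [x]) (cost (length x) N) t"
    if r: "runs_in (Qo A) p (ini [x]) N t" for x N t
  proof -
    from r obtain n where n: "n \<le> N" "exec (Qo A) p (ini [x]) n t" by (auto simp: runs_in_def)
    let ?s = "glue 3 (\<lambda>_. []) (ini [x])"
    have e: "exec (Qo A) (sh 3 p) ?s n (glue 3 (\<lambda>_. []) t)" using exec_sh1[OF n(2)] .
    have l: "length (?s r) \<le> length x" for r by (auto simp: glue_def ini_def)
    have "runs_in (Qt A) (sub g (sh 3 p)) ?s (n * (20 * (length x + n) + 20 + 1)) (glue 3 (\<lambda>_. []) t)"
      by (rule runs_in_sub[where X = "{3..}" and e = "\<lambda>_. []" and W = "length x + n", OF g2 e u])
        (auto simp: glue_def ini_def)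
    moreover have "runs_in (Qt A) (mv [0, 1] 0 2 ;; mv [0, 1] 2 3) (ini [x]) (12 * length x + 7) ?s"
    proof (rule runs_in_Seq)
      show "runs_in (Qt A) (mv [0, 1] 0 2) (ini [x]) (6 * length x + 3) ((ini [x])(0 := [], 2 := rev (stk x)))"
        by (rule runs_in_mv) (use stk_bits[of x] in \<open>auto simp: ini_def\<close>)
      show "runs_in (Qt A) (mv [0, 1] 2 3) ((ini [x])(0 := [], 2 := rev (stk x))) (6 * length x + 3) ?s"
        by (rule runs_in_mv) (use stk_bits[of x] in \<open>auto simp: ini_def glue_def fun_eq_iff\<close>)
    qed simp
    ultimately have "runs_in (Qt A) p' (ini [x]) (12 * length x + 7 + n * (20 * (length x + n) + 20 + 1) + 1) (glue 3 (\<lambda>_. []) t)"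
      unfolding p'_def by (rule_tac runs_in_Seq) auto
    moreover have "n * (20 * (length x + n) + 20 + 1) \<le> N * (20 * (length x + N) + 21)"
      using n(1) by (intro mult_le_mono) auto
    then have "12 * length x + 7 + n * (20 * (length x + n) + 20 + 1) + 1 \<le> cost (length x) N"
      unfolding cost_def by linarith
    ultimately show ?thesis by (meson runs_in_mono)
  qed
  obtain M where M: "wf_machine M" "yes_st M \<noteq> query_st M" "no_st M \<noteq> query_st M"
    "\<And>A x. accepts M A x \<Longrightarrow> \<exists>t. runs (Qt A) p' (ini [x]) t"
    "\<And>A x n t. exec (Qt A) p' (ini [x]) n t \<Longrightarrow>
       \<exists>m \<le> 3 * n + length x + 2. \<exists>tps. (step M A ^^ m) (init_config M x) (accept_st M, tps)"
    using compile[OF q] by blast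
  have "pb (\<lambda>n. 3 * cost n ((n + 2) ^ d) + n + 3)" unfolding cost_def by (intro pb_intros)
  then obtain D where D: "\<And>n. 3 * cost n ((n + 2) ^ d) + n + 3 \<le> (n + 2) ^ D" by (auto simp: pb_def)
  obtain N where N: "wf_machine N" "\<And>A. poly_time N A" "\<And>A x. accepts N A x \<Longrightarrow> accepts M A x"
    "\<And>A x k tps. (step M A ^^ k) (init_config M x) (accept_st M, tps) \<Longrightarrow> k < (length x + 2) ^ D \<Longrightarrow> accepts N A x"
    using clock[OF M(1-3), of D] by blast
  show ?thesis
  proof (intro bexI conjI ballI allI impI)
    show "{x. accepts N A x} \<in> NP_oracle A" using N by (auto simp: NP_oracle_def)
    show "\<exists>t. runs (Qo A) p (ini [x]) t" if "x \<in> {x. accepts N A x}" for x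
      using that N M(4) sound by blast
    show "x \<in> {x. accepts N A x}" if r: "runs_in (Qo A) p (ini [x]) ((length x + 2) ^ d) t" for x t
    proof -
      obtain n t where n: "n \<le> cost (length x) ((length x + 2) ^ d)" "exec (Qt A) p' (ini [x]) n t"
        using complete[OF r] by (auto simp: runs_in_def)
      from M(5)[OF n(2)] obtain m tps where "m \<le> 3 * n + length x + 2"
        "(step M A ^^ m) (init_config M x) (accept_st M, tps)" by blast
      then show ?thesis using N(4)[of m A x tps] n(1) D[of "length x"] by simp
    qed
  qed
qed

section \<open>Simulating Turing machines by programs\<close>

fun sy :: "tsym \<Rightarrow> nat" where
  "sy (Bit b) = (if b then 1 else 0)"
| "sy Blank = 2"
| "sy LeftEnd = 3"
| "sy (Aux n) = n + 4"

definition sd :: "nat \<Rightarrow> tsym" where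
  "sd n = (if n = 0 then Bit False else if n = 1 then Bit True else if n = 2 then Blank
     else if n = 3 then LeftEnd else Aux (n - 4))"

lemma sd_sy [simp]: "sd (sy a) = a"
  by (cases a) (auto simp: sd_def)

lemma sy_sd [simp]: "sy (sd n) = n"
  by (auto simp: sd_def)

text \<open>All cells beyond the list are blank, so finite lists describe every tape that is
  nonblank in finitely many cells.\<close>

definition lk :: "nat list \<Rightarrow> nat \<Rightarrow> tsym" where
  "lk xs i = (if i < length xs then sd (xs ! i) else Blank)"

text \<open>A tape is a pair of stacks, split at the head, of which the left one has its top just before the head.\<close>

definition trep :: "tape \<Rightarrow> nat list \<Rightarrow> nat list \<Rightarrow> bool" where
  "trep tp l r \<longleftrightarrow> tp = (lk (rev l @ r), length l)"

fun tail_of :: "nat list \<Rightarrow> nat list" where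
  "tail_of [] = []"
| "tail_of (a # w) = w"

definition hd_sym :: "nat list \<Rightarrow> tsym" where
  "hd_sym r = (case r of [] \<Rightarrow> Blank | c # _ \<Rightarrow> sd c)"

lemma read_trep: "trep tp l r \<Longrightarrow> read_tape tp = hd_sym r"
  by (cases r) (auto simp: trep_def read_tape_def lk_def nth_append hd_sym_def)

text \<open>The effect of an action once the symbol under the head has been popped. The third
  equation is the left move on cell 0, which leaves the head in place.\<close>

fun top :: "tsym \<times> dir \<Rightarrow> nat list \<Rightarrow> nat list \<Rightarrow> nat list \<times> nat list" where
  "top (w, Stay) l r = (l, sy w # r)"
| "top (w, Right) l r = (sy w # l, r)"
| "top (w, Left) [] r = ([], sy w # r)"
| "top (w, Left) (c # l) r = (l, c # sy w # r)"

lemma trep_act: "trep tp l r \<Longrightarrow> trep (act_tape a tp) (fst (top a l (tail_of r))) (snd (top a l (tail_of r)))"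
proof -
  assume t: "trep tp l r"
  obtain w d where a: "a = (w, d)" by force
  have app: "lk (xs @ ys) i = (if i < length xs then sd (xs ! i) else lk ys (i - length xs))" for xs ys i
    by (auto simp: lk_def nth_append)
  have cons: "lk (b # ys) i = (if i = 0 then sd b else lk ys (i - 1))" for b ys i
    by (cases i) (auto simp: lk_def)
  have nil: "lk [] i = Blank" for i by (simp add: lk_def)
  have "lk (rev l @ sy w # tail_of r) i = ((lk (rev l @ r))(length l := w)) i" for i
    by (cases r) (simp_all add: app cons nil, simp add: lk_def)
  then have "lk (rev l @ sy w # tail_of r) = (lk (rev l @ r))(length l := w)" by (rule ext)
  then show ?thesis using t a
    by (cases d; cases l) (auto simp: trep_def act_tape_def)
qed

lemma query_word_lk: "query_word (lk cells, h) = map (\<lambda>a. a = 1) (takeWhile (\<lambda>a. a < 2) (tail_of cells))"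
proof -
  let ?v = "takeWhile (\<lambda>a. a < 2) (tail_of cells)"
  have bit: "sd a \<in> range Bit \<longleftrightarrow> a < 2" for a by (auto simp: sd_def)
  have s: "lk cells (Suc i) = lk (tail_of cells) i" for i by (cases cells) (auto simp: lk_def)
  have le: "length ?v \<le> length (tail_of cells)" by (rule length_takeWhile_le)
  have a: "lk cells (Suc i) \<in> range Bit" "(lk cells (Suc i) = Bit True) = (?v ! i = 1)" if "i < length ?v" for i
  proof -
    have "tail_of cells ! i = ?v ! i" using that by (simp add: takeWhile_nth)
    moreover have "?v ! i < 2" using that by (metis nth_mem set_takeWhileD)
    moreover have "lk cells (Suc i) = sd (tail_of cells ! i)" using that le unfolding s by (simp add: lk_def)
    ultimately show "lk cells (Suc i) \<in> range Bit" "(lk cells (Suc i) = Bit True) = (?v ! i = 1)"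
      using bit by (simp_all add: sd_def)
  qed
  have "(LEAST n. lk cells (Suc n) \<notin> range Bit) = length ?v"
  proof (rule Least_equality)
    show "lk cells (Suc (length ?v)) \<notin> range Bit"
    proof (cases "length ?v < length (tail_of cells)")
      case True
      then have "\<not> tail_of cells ! length ?v < 2" by (metis nth_length_takeWhile)
      then show ?thesis unfolding s using True bit by (auto simp: lk_def)
    next
      case False
      then show ?thesis unfolding s by (auto simp: lk_def)
    qed
    show "length ?v \<le> y" if "lk cells (Suc y) \<notin> range Bit" for y
      using that a(1)[of y] by (meson not_le)
  qed
  then show ?thesis by (auto simp: query_word_def a(2)[simplified] intro!: nth_equalityI)
qed

section \<open>Programs for the steps of a machine\<close>

locale simulation =
  fixes M :: machine and B :: nat and ds :: "trans list"
  assumes wf: "wf_machine M"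
    and B4: "4 \<le> B"
    and B_st: "start_st M < B" "accept_st M < B" "query_st M < B" "yes_st M < B" "no_st M < B"
    and B_delta: "\<And>q rs q' as. ((q, rs), (q', as)) \<in> delta M \<Longrightarrow>
       q < B \<and> q' < B \<and> (\<forall>a\<in>set rs. sy a < B) \<and> (\<forall>a\<in>set as. sy (fst a) < B)"
    and ds: "set ds = delta M"
begin

abbreviation "T \<equiv> num_tapes M"
text \<open>Registers 0 to 4 are reserved for the input, the state, the query word and two scratch
  stacks; from 5 on each tape takes two registers.\<close>

abbreviation Lr :: "nat \<Rightarrow> nat" where "Lr i \<equiv> 5 + 2 * i"
abbreviation Rr :: "nat \<Rightarrow> nat" where "Rr i \<equiv> 6 + 2 * i"
definition "al = [0..<B]"

lemma al: "set al = {..<B}" "length al = B"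
  by (auto simp: al_def)

lemma T2: "2 \<le> T"
  using wf by (simp add: wf_machine_def)

text \<open>An empty right stack stands for endless blanks, which is why reading a blank has two
  alternatives.\<close>

definition rdp :: "nat \<Rightarrow> tsym \<Rightarrow> prog" where
  "rdp i a = (if a = Blank then Alt (Pop (Rr i) 2) (IsNil (Rr i)) else Pop (Rr i) (sy a))"

fun wrp :: "nat \<Rightarrow> tsym \<times> dir \<Rightarrow> prog" where
  "wrp i (w, Stay) = Push (Rr i) (sy w)"
| "wrp i (w, Right) = Push (Lr i) (sy w)"
| "wrp i (w, Left) = Push (Rr i) (sy w) ;; Alt (IsNil (Lr i)) (alts (map (\<lambda>c. Pop (Lr i) c ;; Push (Rr i) c) al))"

lemma runs_rdp: "runs Q (rdp i a) s t \<longleftrightarrow> a = hd_sym (s (Rr i)) \<and> t = s(Rr i := tail_of (s (Rr i)))"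
proof (cases "s (Rr i)")
  case Nil
  then show ?thesis by (auto simp: rdp_def hd_sym_def fun_upd_idem)
next
  case (Cons c w)
  have *: "c = sy a \<longleftrightarrow> a = sd c" by (metis sd_sy sy_sd)
  have "runs Q (rdp i a) s t \<longleftrightarrow> c = sy a \<and> t = s(Rr i := w)"
    using Cons by (cases "a = Blank") (simp_all add: rdp_def)
  then show ?thesis unfolding * using Cons by (simp add: hd_sym_def)
qed

lemma runs_wrp:
  assumes "set (s (Lr i)) \<subseteq> {..<B}"
  shows "runs Q (wrp i a) s t \<longleftrightarrow>
     t = s(Lr i := fst (top a (s (Lr i)) (s (Rr i))), Rr i := snd (top a (s (Lr i)) (s (Rr i))))"
proof -
  obtain w d where a: "a = (w, d)" by force
  have n: "Lr i \<noteq> Rr i" "Rr i \<noteq> Lr i" by presburger+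
  show ?thesis
  proof (cases d)
    case Left
    show ?thesis
    proof (cases "s (Lr i)")
      case Nil
      then have "s(Lr i := []) = s" by (simp add: fun_upd_idem)
      then show ?thesis using Nil n a Left by (auto simp: fun_eq_iff)
    next
      case (Cons c l)
      then have "c < B" using assms by auto
      moreover have "s(Rr i := x, Lr i := y, Rr i := z) = s(Lr i := y, Rr i := z)" for x y z
        using n by (auto simp: fun_eq_iff)
      ultimately show ?thesis using Cons n a Left by (auto simp: al)
    qed
  qed (use a n in \<open>auto simp: fun_eq_iff\<close>)
qed

lemma runs_in_rdp: "a = hd_sym (s (Rr i)) \<Longrightarrow> runs_in Q (rdp i a) s 2 (s(Rr i := tail_of (s (Rr i))))"
proof (cases "s (Rr i)")
  case Nil
  assume a: "a = hd_sym (s (Rr i))"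
  show ?thesis using Nil a unfolding rdp_def
    by (auto simp: hd_sym_def fun_upd_idem intro!: runs_in_Alt2[where n = 1] runs_in_prim)
next
  case (Cons c w)
  assume a: "a = hd_sym (s (Rr i))"
  then have "c = sy a" using Cons by (simp add: hd_sym_def)
  then show ?thesis using Cons unfolding rdp_def
    by (auto intro!: runs_in_Alt1[where n = 1] runs_in_prim)
qed

lemma runs_in_wrp:
  assumes "set (s (Lr i)) \<subseteq> {..<B}"
  shows "\<exists>t. runs_in Q (wrp i a) s (B + 6) t"
proof -
  obtain w d where a: "a = (w, d)" by force
  have n: "Lr i \<noteq> Rr i" "Rr i \<noteq> Lr i" by presburger+
  show ?thesis
  proof (cases d)
    case Left
    let ?s = "s(Rr i := sy w # s (Rr i))"
    have 1: "runs_in Q (Push (Rr i) (sy w)) s 1 ?s" by (rule runs_in_prim) auto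
    show ?thesis
    proof (cases "s (Lr i)")
      case Nil
      have "runs_in Q (Alt (IsNil (Lr i)) (alts (map (\<lambda>c. Pop (Lr i) c ;; Push (Rr i) c) al))) ?s 2 ?s"
        by (rule runs_in_Alt1[where n = 1], rule runs_in_prim) (use Nil n in auto)
      with 1 show ?thesis unfolding a Left wrp.simps by (intro exI, rule runs_in_Seq) auto
    next
      case (Cons c l)
      then have "c < B" using assms by auto
      have "runs_in Q (Pop (Lr i) c ;; Push (Rr i) c) ?s 3 (?s(Lr i := l, Rr i := c # ?s (Rr i)))"
        by (rule runs_in_Seq[where n = 1 and m = 1]; (rule runs_in_prim)?) (use Cons n in auto)
      then have "runs_in Q (alts (map (\<lambda>c. Pop (Lr i) c ;; Push (Rr i) c) al)) ?s (3 + B) (?s(Lr i := l, Rr i := c # ?s (Rr i)))"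
        by (rule runs_in_alts[rotated]) (use \<open>c < B\<close> in \<open>auto simp: al\<close>)
      then have "runs_in Q (Alt (IsNil (Lr i)) (alts (map (\<lambda>c. Pop (Lr i) c ;; Push (Rr i) c) al))) ?s (4 + B) (?s(Lr i := l, Rr i := c # ?s (Rr i)))"
        by (rule runs_in_Alt2) simp
      with 1 show ?thesis unfolding a Left wrp.simps by (intro exI, rule runs_in_Seq) auto
    qed
  next
    case Stay
    have "runs_in Q (Push (Rr i) (sy w)) s 1 (s(Rr i := sy w # s (Rr i)))" by (rule runs_in_prim) auto
    then show ?thesis unfolding a Stay wrp.simps by (rule_tac exI, erule_tac runs_in_mono) simp
  next
    case Right
    have "runs_in Q (Push (Lr i) (sy w)) s 1 (s(Lr i := sy w # s (Lr i)))" by (rule runs_in_prim) auto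
    then show ?thesis unfolding a Right wrp.simps by (rule_tac exI, erule_tac runs_in_mono) simp
  qed
qed

primrec tac :: "nat \<Rightarrow> (tsym \<times> tsym \<times> dir) list \<Rightarrow> prog" where
  "tac i [] = Skip"
| "tac i (z # zs) = (rdp i (fst z) ;; wrp i (snd z)) ;; tac (Suc i) zs"

definition reps :: "nat \<Rightarrow> tape list \<Rightarrow> st \<Rightarrow> bool" where
  "reps i tps s \<longleftrightarrow> (\<forall>j<length tps. trep (tps ! j) (s (Lr (i + j))) (s (Rr (i + j))))"

lemma reps_Cons: "reps i (tp # tps) s \<longleftrightarrow> trep tp (s (Lr i)) (s (Rr i)) \<and> reps (Suc i) tps s"
proof
  assume "reps i (tp # tps) s"
  then have r: "\<And>j. j < Suc (length tps) \<Longrightarrow> trep ((tp # tps) ! j) (s (Lr (i + j))) (s (Rr (i + j)))"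
    by (simp add: reps_def)
  show "trep tp (s (Lr i)) (s (Rr i)) \<and> reps (Suc i) tps s"
    unfolding reps_def using r[of 0] r[of "Suc _"] by auto
next
  assume r: "trep tp (s (Lr i)) (s (Rr i)) \<and> reps (Suc i) tps s"
  show "reps i (tp # tps) s" unfolding reps_def
  proof (intro allI impI)
    fix j assume "j < length (tp # tps)"
    with r show "trep ((tp # tps) ! j) (s (Lr (i + j))) (s (Rr (i + j)))"
      by (cases j) (auto simp: reps_def)
  qed
qed

lemma uses_rdp: "uses UNIV B (rdp i a)"
  by (simp add: rdp_def)

lemma uses_wrp: "sy (fst a) < B \<Longrightarrow> uses UNIV B (wrp i a)"
proof -
  have "uses UNIV B (alts (map (\<lambda>c. Pop (Lr i) c ;; Push (Rr i) c) cs))" if "set cs \<subseteq> {..<B}" for cs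
    using that by (induction cs) (auto simp: alts_def)
  then show "sy (fst a) < B \<Longrightarrow> uses UNIV B (wrp i a)"
    by (cases "(i, a)" rule: wrp.cases) (auto simp: al)
qed

lemma runs_symbols: "runs Q p s t \<Longrightarrow> uses UNIV B p \<Longrightarrow> \<forall>r. set (s r) \<subseteq> {..<B} \<Longrightarrow> \<forall>r. set (t r) \<subseteq> {..<B}"
  unfolding runs_def using exec_symbols by blast

lemma uses_tac: "\<forall>z\<in>set zs. sy (fst (snd z)) < B \<Longrightarrow> uses UNIV B (tac i zs)"
  by (induction zs arbitrary: i) (auto simp: uses_rdp uses_wrp)

text \<open>The clause on lower registers is used inside the induction: the stacks of the present
  tape have to survive the treatment of the later tapes.\<close>

lemma tac_sound:
  "runs Q (tac i zs) s t \<Longrightarrow> reps i tps s \<Longrightarrow> length tps = length zs \<Longrightarrow> \<forall>r. set (s r) \<subseteq> {..<B} \<Longrightarrow>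
    \<forall>z\<in>set zs. sy (fst (snd z)) < B \<Longrightarrow>
    map fst zs = map read_tape tps \<and> reps i (map2 act_tape (map snd zs) tps) t \<and>
    (\<forall>r. r < Lr i \<longrightarrow> t r = s r)"
proof (induction zs arbitrary: i s tps)
  case Nil
  then show ?case by (auto simp: reps_def)
next
  case (Cons z zs)
  obtain tp tps' where tps: "tps = tp # tps'" using Cons.prems(3) by (cases tps) auto
  from Cons.prems(1) obtain u where u: "runs Q (rdp i (fst z) ;; wrp i (snd z)) s u" "runs Q (tac (Suc i) zs) u t"
    by auto
  have su: "\<forall>r. set (u r) \<subseteq> {..<B}"
    by (rule runs_symbols[OF u(1)]) (use Cons.prems in \<open>auto simp: uses_rdp uses_wrp\<close>)
  let ?s = "s(Rr i := tail_of (s (Rr i)))"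
  have n: "Lr i \<noteq> Rr i" by presburger
  have z: "fst z = hd_sym (s (Rr i))" "runs Q (wrp i (snd z)) ?s u" using u(1) by (auto simp: runs_rdp)
  have "set (?s (Lr i)) \<subseteq> {..<B}" using Cons.prems(4) n by simp
  from z(2)[unfolded runs_wrp[where s = ?s and i = i, OF this]] have ue:
    "u = s(Lr i := fst (top (snd z) (s (Lr i)) (tail_of (s (Rr i)))), Rr i := snd (top (snd z) (s (Lr i)) (tail_of (s (Rr i)))))"
    using n by (auto simp: fun_eq_iff)
  have r: "trep tp (s (Lr i)) (s (Rr i))" "reps (Suc i) tps' s" using Cons.prems(2) by (auto simp: tps reps_Cons)
  have ne: "Lr (Suc i + j) \<noteq> Lr i" "Lr (Suc i + j) \<noteq> Rr i" "Rr (Suc i + j) \<noteq> Lr i" "Rr (Suc i + j) \<noteq> Rr i" for j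
    by presburger+
  have "reps (Suc i) tps' u" using r(2) unfolding ue reps_def fun_upd_apply by (simp only: ne if_False simp_thms)
  with Cons.IH[OF u(2) this _ su] Cons.prems tps have IH:
    "map fst zs = map read_tape tps'" "reps (Suc i) (map2 act_tape (map snd zs) tps') t"
    "\<And>r. r < Lr (Suc i) \<Longrightarrow> t r = u r" by auto
  have "trep (act_tape (snd z) tp) (u (Lr i)) (u (Rr i))" using trep_act[OF r(1), of "snd z"] n by (simp add: ue)
  then have "trep (act_tape (snd z) tp) (t (Lr i)) (t (Rr i))" using IH(3) by simp
  then show ?case using IH read_trep[OF r(1)] z(1) tps ue by (auto simp: reps_Cons)
qed

lemma tac_complete:
  "map fst zs = map read_tape tps \<Longrightarrow> reps i tps s \<Longrightarrow> \<forall>r. set (s r) \<subseteq> {..<B} \<Longrightarrow>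
    \<forall>z\<in>set zs. sy (fst (snd z)) < B \<Longrightarrow>
    \<exists>t. runs_in Q (tac i zs) s ((B + 10) * length zs + 1) t"
proof (induction zs arbitrary: i s tps)
  case Nil
  have "runs_in Q Skip s 1 s" by (rule runs_in_prim) auto
  then show ?case by auto
next
  case (Cons z zs)
  obtain tp tps' where tps: "tps = tp # tps'" "fst z = read_tape tp" "map fst zs = map read_tape tps'"
    using Cons.prems(1) by (cases tps) auto
  let ?s = "s(Rr i := tail_of (s (Rr i)))"
  have n: "Lr i \<noteq> Rr i" by presburger
  have r: "trep tp (s (Lr i)) (s (Rr i))" "reps (Suc i) tps' s" using Cons.prems(2) by (auto simp: tps reps_Cons)
  then have 1: "runs_in Q (rdp i (fst z)) s 2 ?s" using tps(2) by (intro runs_in_rdp) (simp add: read_trep)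
  have sL: "set (?s (Lr i)) \<subseteq> {..<B}" using Cons.prems(3) n by simp
  from runs_in_wrp[where s = ?s and i = i, OF this] obtain u where u: "runs_in Q (wrp i (snd z)) ?s (B + 6) u" by blast
  from 1 u have 2: "runs_in Q (rdp i (fst z) ;; wrp i (snd z)) s (B + 9) u" by (rule runs_in_Seq) simp
  have su: "\<forall>r. set (u r) \<subseteq> {..<B}"
    by (rule runs_symbols[OF runs_in_runs[OF 2]]) (use Cons.prems in \<open>auto simp: uses_rdp uses_wrp\<close>)
  have ue: "u = s(Lr i := fst (top (snd z) (s (Lr i)) (tail_of (s (Rr i)))), Rr i := snd (top (snd z) (s (Lr i)) (tail_of (s (Rr i)))))"
    using runs_in_runs[OF u] n unfolding runs_wrp[where s = ?s and i = i, OF sL] by (auto simp: fun_eq_iff)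
  have ne: "Lr (Suc i + j) \<noteq> Lr i" "Lr (Suc i + j) \<noteq> Rr i" "Rr (Suc i + j) \<noteq> Lr i" "Rr (Suc i + j) \<noteq> Rr i" for j
    by presburger+
  have "reps (Suc i) tps' u" using r(2) unfolding ue reps_def fun_upd_apply by (simp only: ne if_False simp_thms)
  from Cons.IH[OF tps(3) this su] Cons.prems obtain t where "runs_in Q (tac (Suc i) zs) u ((B + 10) * length zs + 1) t"
    by auto
  with 2 have "runs_in Q (tac i (z # zs)) s ((B + 10) * length (z # zs) + 1) t"
    unfolding tac.simps by (rule runs_in_Seq) simp
  then show ?case by blast
qed

definition srep :: "config \<Rightarrow> st \<Rightarrow> bool" where
  "srep c s \<longleftrightarrow> s 0 = [] \<and> s 1 = [fst c] \<and> s 2 = [] \<and> s 3 = [] \<and> s 4 = [] \<and> length (snd c) = T \<and>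
     reps 0 (snd c) s \<and> (\<forall>r. set (s r) \<subseteq> {..<B})"

fun tpr :: "trans \<Rightarrow> prog" where
  "tpr ((q, rs), (q', as)) = Pop 1 q ;; (tac 0 (zip rs as) ;; Push 1 q')"

lemma delta_props:
  assumes "((q, rs), (q', as)) \<in> delta M"
  shows "length rs = T" "length as = T" "\<forall>z\<in>set (zip rs as). sy (fst (snd z)) < B" "q' < B" "q < B"
  using assms wf B_delta[OF assms] by (auto simp: wf_machine_def) (fastforce dest: set_zip_rightD)

lemma tpr_sound:
  assumes "((q, rs), (q', as)) \<in> delta M" "srep c s" "runs Q (tpr ((q, rs), (q', as))) s t" "q \<noteq> query_st M"
  shows "\<exists>c'. step M A c c' \<and> srep c' t"
proof -
  note p = delta_props[OF assms(1)]
  obtain tps where c: "c = (q, tps)" and s1: "s 1 = [q]" using assms(2,3) by (cases c) (auto simp: srep_def)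
  from assms(3) s1 obtain u where u: "runs Q (tac 0 (zip rs as)) (s(1 := [])) u" "t = u(1 := q' # u 1)"
    by auto
  have "reps 0 tps (s(1 := []))" using assms(2) c by (auto simp: srep_def reps_def)
  from tac_sound[OF u(1) this] have *: "map fst (zip rs as) = map read_tape tps"
    "reps 0 (map2 act_tape (map snd (zip rs as)) tps) u" "\<And>r. r < 5 \<Longrightarrow> u r = (s(1 := [])) r"
    using p assms(2) c by (auto simp: srep_def)
  have su: "\<forall>r. set (u r) \<subseteq> {..<B}"
    by (rule runs_symbols[OF u(1) uses_tac]) (use p assms(2) in \<open>auto simp: srep_def\<close>)
  have rs: "rs = map read_tape tps" and as: "map snd (zip rs as) = as" using *(1) p by simp_all
  have "step M A c (q', map2 act_tape as tps)"
    unfolding c by (rule step_delta) (use assms rs in auto)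
  moreover have "srep (q', map2 act_tape as tps) t"
    using assms(2) c *(2,3) su p u(2) unfolding as by (auto simp: srep_def reps_def)
  ultimately show ?thesis by blast
qed

lemma tpr_complete:
  assumes "((q, map read_tape tps), (q', as)) \<in> delta M" "srep (q, tps) s"
  shows "\<exists>t. runs_in Q (tpr ((q, map read_tape tps), (q', as))) s ((B + 10) * T + 6) t \<and>
    srep (q', map2 act_tape as tps) t"
proof -
  note p = delta_props[OF assms(1)]
  let ?zs = "zip (map read_tape tps) as"
  have "reps 0 tps (s(1 := []))" using assms(2) by (auto simp: srep_def reps_def)
  then have "\<exists>u. runs_in Q (tac 0 ?zs) (s(1 := [])) ((B + 10) * length ?zs + 1) u"
    by (intro tac_complete) (use p assms(2) in \<open>auto simp: srep_def\<close>)
  then obtain u where u: "runs_in Q (tac 0 ?zs) (s(1 := [])) ((B + 10) * T + 1) u" using p by auto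
  have 1: "runs_in Q (Pop 1 q) s 1 (s(1 := []))" using assms(2) by (intro runs_in_prim) (auto simp: srep_def)
  have 3: "runs_in Q (Push 1 q') u 1 (u(1 := q' # u 1))" by (rule runs_in_prim) auto
  have r: "runs_in Q (tpr ((q, map read_tape tps), (q', as))) s ((B + 10) * T + 6) (u(1 := q' # u 1))"
    unfolding tpr.simps by (rule runs_in_Seq[OF 1 runs_in_Seq[OF u 3 order_refl]]) simp
  have *: "reps 0 (map2 act_tape (map snd ?zs) tps) u" "\<And>r. r < 5 \<Longrightarrow> u r = (s(1 := [])) r"
    using tac_sound[OF runs_in_runs[OF u] \<open>reps 0 tps (s(1 := []))\<close>] p assms(2) by (auto simp: srep_def)
  have su: "\<forall>r. set (u r) \<subseteq> {..<B}"
    by (rule runs_symbols[OF runs_in_runs[OF u] uses_tac]) (use p assms(2) in \<open>auto simp: srep_def\<close>)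
  have as: "map snd ?zs = as" using p by simp
  have "srep (q', map2 act_tape as tps) (u(1 := q' # u 1))"
    using assms(2) *(1,2) su p unfolding as by (auto simp: srep_def reps_def)
  with r show ?thesis by blast
qed

section \<open>Queries of the simulated machine\<close>

definition bits_loop :: prog where
  "bits_loop = Star (alts [Pop 3 0 ;; Push 2 0, Pop 3 1 ;; Push 2 1])"

lemma runs_bits: "runs Q bits_loop s t \<longleftrightarrow>
    (\<exists>u v. s 3 = u @ v \<and> set u \<subseteq> {0, 1} \<and> t = s(3 := v, 2 := rev u @ s 2))"
proof
  assume "runs Q bits_loop s t"
  then have "(runs Q (alts [Pop 3 0 ;; Push 2 0, Pop 3 1 ;; Push 2 1]))\<^sup>*\<^sup>* s t" by (simp add: bits_loop_def runs_Star)
  then show "\<exists>u v. s 3 = u @ v \<and> set u \<subseteq> {0, 1} \<and> t = s(3 := v, 2 := rev u @ s 2)"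
  proof (induction rule: converse_rtranclp_induct)
    case base
    show ?case by (rule exI[of _ "[]"], rule exI[of _ "t 3"]) auto
  next
    case (step s s')
    from step.hyps(1) obtain b w where b: "s 3 = b # w" "b \<in> {0, 1}" "s' = s(3 := w, 2 := b # s 2)" by auto
    from step.IH obtain u v where u: "s' 3 = u @ v" "set u \<subseteq> {0, 1}" "t = s'(3 := v, 2 := rev u @ s' 2)" by blast
    show ?case by (rule exI[of _ "b # u"], rule exI[of _ v]) (use b u in auto)
  qed
next
  assume "\<exists>u v. s 3 = u @ v \<and> set u \<subseteq> {0, 1} \<and> t = s(3 := v, 2 := rev u @ s 2)"
  then obtain u v where "s 3 = u @ v" "set u \<subseteq> {0, 1}" "t = s(3 := v, 2 := rev u @ s 2)" by blast
  then have "(runs Q (alts [Pop 3 0 ;; Push 2 0, Pop 3 1 ;; Push 2 1]))\<^sup>*\<^sup>* s t"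
  proof (induction u arbitrary: s)
    case Nil
    then have "t = s" by (auto simp: fun_eq_iff)
    then show ?case by simp
  next
    case (Cons b u)
    let ?s = "s(3 := u @ v, 2 := b # s 2)"
    have "(runs Q (alts [Pop 3 0 ;; Push 2 0, Pop 3 1 ;; Push 2 1]))\<^sup>*\<^sup>* ?s t"
      by (rule Cons.IH) (use Cons.prems in auto)
    moreover have "runs Q (alts [Pop 3 0 ;; Push 2 0, Pop 3 1 ;; Push 2 1]) s ?s"
      using Cons.prems by auto
    ultimately show ?case by (meson converse_rtranclp_into_rtranclp)
  qed
  then show "runs Q bits_loop s t" by (simp add: bits_loop_def runs_Star)
qed

lemma runs_in_bits: "s 3 = u @ v \<Longrightarrow> set u \<subseteq> {0, 1} \<Longrightarrow> runs_in Q bits_loop s (6 * length u + 1) (s(3 := v, 2 := rev u @ s 2))"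
proof (induction u arbitrary: s)
  case Nil
  then show ?case unfolding bits_loop_def by (intro runs_in_prim) (auto simp: fun_eq_iff)
next
  case (Cons b u)
  let ?s = "s(3 := u @ v, 2 := b # s 2)" and ?p = "alts [Pop 3 0 ;; Push 2 0, Pop 3 1 ;; Push 2 1]"
  have "runs_in Q (Pop 3 b ;; Push 2 b) s 3 ?s"
    by (rule runs_in_Seq[where n = 1 and m = 1]; (rule runs_in_prim)?) (use Cons.prems in auto)
  then have 1: "runs_in Q ?p s 5 ?s" using Cons.prems by (intro runs_in_alts[where p = "Pop 3 b ;; Push 2 b"]) auto
  have "runs_in Q bits_loop ?s (6 * length u + 1) (?s(3 := v, 2 := rev u @ ?s 2))"
    by (rule Cons.IH) (use Cons.prems in auto)
  then have 2: "runs_in Q (Star ?p) ?s (6 * length u + 1) (s(3 := v, 2 := rev (b # u) @ s 2))"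
    unfolding bits_loop_def by (simp add: fun_upd_twist)
  show ?case unfolding bits_loop_def by (rule runs_in_Star[OF 1 2]) simp
qed

text \<open>Collects the whole content of tape 1 in register 3 with both stacks of the tape
  preserved. The left stack, popped from the head outwards, is pushed in front of the right one, so
  that cell 0 ends on top.\<close>

definition "qload = copy al (Rr 1) 4 3 ;; (mv2 al (Lr 1) 4 3 ;; mv al 4 (Lr 1))"
text \<open>Cell 0 is skipped, as query words start in cell 1. \<open>bits_loop\<close> may stop too
  early; the test behind it admits only an empty register or a symbol from 2 on and thereby forces
  the longest bit prefix.\<close>

definition "qscan = Alt (IsNil 3) (alts (map (Pop 3) al)) ;; (bits_loop ;;
   (Alt (IsNil 3) (alts (map (Pop 3) [2..<B])) ;; clear B 3))"
definition "qask = Alt (Query 2 True ;; Push 1 (yes_st M)) (Query 2 False ;; Push 1 (no_st M)) ;; clear B 2"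
definition "qpr = Pop 1 (query_st M) ;; (qload ;; (qscan ;; qask))"

lemma runs_qload:
  assumes "s 3 = []" "s 4 = []" "\<forall>r. set (s r) \<subseteq> {..<B}"
  shows "runs Q qload s t \<longleftrightarrow> t = s(3 := rev (s (Lr 1)) @ s (Rr 1))"
proof -
  have "s(3 := rev (s 7) @ s 8, 7 := [], 4 := [], 7 := s 7) = s(3 := rev (s 7) @ s 8)"
    using assms by (auto simp: fun_eq_iff)
  moreover have "set (s 7) \<subseteq> {..<B}" "set (s 8) \<subseteq> {..<B}" using assms by auto
  ultimately show ?thesis using assms by (auto simp: qload_def al fun_upd_twist)
qed

lemma runs_in_qload:
  assumes "s 3 = []" "s 4 = []" "\<forall>r. set (s r) \<subseteq> {..<B}"
  shows "runs_in Q qload s ((2 * B + 10) * (length (s (Rr 1)) + length (s (Lr 1))) + 20) (s(3 := rev (s (Lr 1)) @ s (Rr 1)))"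
proof -
  have b: "set (s 7) \<subseteq> {..<B}" "set (s 8) \<subseteq> {..<B}" using assms by auto
  have "runs_in Q (copy al 8 4 3) s ((2 * B + 10) * length (s 8) + 7) (s(3 := s 8))"
    by (rule runs_in_copy) (use assms b in \<open>auto simp: al\<close>)
  moreover have "runs_in Q (mv2 al 7 4 3) (s(3 := s 8)) ((B + 6) * length (s 7) + 3)
      (s(3 := rev (s 7) @ s 8, 7 := [], 4 := rev (s 7)))"
    by (rule runs_in_mv2) (use assms b in \<open>auto simp: al fun_eq_iff\<close>)
  moreover have "runs_in Q (mv al 4 7) (s(3 := rev (s 7) @ s 8, 7 := [], 4 := rev (s 7)))
      ((B + 4) * length (s 7) + 3) (s(3 := rev (s 7) @ s 8))"
    by (rule runs_in_mv) (use assms b in \<open>auto simp: al fun_eq_iff\<close>)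
  ultimately have "runs_in Q (copy al 8 4 3 ;; (mv2 al 7 4 3 ;; mv al 4 7)) s
      ((2 * B + 10) * (length (s 8) + length (s 7)) + 20) (s(3 := rev (s 7) @ s 8))"
    by (rule runs_in_Seq[OF _ runs_in_Seq[OF _ _ order_refl]]) (simp add: algebra_simps)
  then show ?thesis by (simp add: qload_def)
qed

lemma takeWhile_unique: "u @ v = w \<Longrightarrow> set u \<subseteq> {0, 1} \<Longrightarrow> v = [] \<or> 2 \<le> hd v \<Longrightarrow> u = takeWhile (\<lambda>a. a < (2::nat)) w"
proof -
  assume a: "u @ v = w" "set u \<subseteq> {0, 1}" "v = [] \<or> 2 \<le> hd v"
  have "takeWhile (\<lambda>a. a < (2::nat)) v = []" using a(3) by (cases v) auto
  moreover have "takeWhile (\<lambda>a. a < (2::nat)) (u @ v) = u @ takeWhile (\<lambda>a. a < (2::nat)) v"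
    using a(2) by (intro takeWhile_append2) auto
  ultimately show ?thesis using a(1) by simp
qed

lemma runs_qscan:
  assumes "s 2 = []" "set (s 3) \<subseteq> {..<B}" "runs Q qscan s t"
  shows "t = s(3 := [], 2 := rev (takeWhile (\<lambda>a. a < 2) (tail_of (s 3))))"
proof -
  from assms(3) obtain a b c where r: "runs Q (Alt (IsNil 3) (alts (map (Pop 3) al))) s a" "runs Q bits_loop a b"
    "runs Q (Alt (IsNil 3) (alts (map (Pop 3) [2..<B]))) b c" "runs Q (clear B 3) c t" by (auto simp: qscan_def)
  have a: "a = s(3 := tail_of (s 3))" using r(1) by (auto simp: fun_upd_idem)
  obtain u v where u: "a 3 = u @ v" "set u \<subseteq> {0, 1}" "b = a(3 := v, 2 := rev u @ a 2)" using r(2) runs_bits by blast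
  have v: "v = [] \<or> 2 \<le> hd v" "c = b(3 := tail_of v)" using r(3) u(3) by (auto simp: fun_upd_idem)
  have "u = takeWhile (\<lambda>a. a < 2) (tail_of (s 3))" using takeWhile_unique[of u v "tail_of (s 3)"] u a v by auto
  then show ?thesis using r(4) u a v assms(1) by (auto simp: fun_eq_iff)
qed

lemma set_tail_of: "set (tail_of w) \<subseteq> set w" "length (tail_of w) \<le> length w"
  by (cases w; auto)+

lemma runs_in_qscan:
  assumes "s 2 = []" "set (s 3) \<subseteq> {..<B}"
  shows "runs_in Q qscan s ((B + 10) * length (s 3) + 2 * B + 20) (s(3 := [], 2 := rev (takeWhile (\<lambda>a. a < 2) (tail_of (s 3)))))"
proof -
  let ?w = "tail_of (s 3)"
  let ?u = "takeWhile (\<lambda>a. a < 2) ?w" and ?v = "dropWhile (\<lambda>a. a < 2) ?w"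
  let ?s1 = "s(3 := ?w)" and ?s2 = "s(3 := ?v, 2 := rev ?u)" and ?s3 = "s(3 := tail_of ?v, 2 := rev ?u)"
  have pop: "runs_in Q (Alt (IsNil 3) (alts (map (Pop 3) bs))) x (length bs + 3) (x(3 := tail_of (x 3)))"
    if "x 3 = [] \<or> hd (x 3) \<in> set bs" for x bs
  proof (cases "x 3")
    case Nil
    then show ?thesis by (intro runs_in_Alt1[where n = 1] runs_in_prim) auto
  next
    case (Cons c w)
    then have "runs_in Q (Pop 3 c) x 1 (x(3 := w))" by (intro runs_in_prim) auto
    then have "runs_in Q (alts (map (Pop 3) bs)) x (1 + length bs) (x(3 := w))"
      by (rule runs_in_alts[rotated]) (use Cons that in auto)
    then show ?thesis using Cons by (intro runs_in_Alt2[where n = "1 + length bs"]) auto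
  qed
  have "runs_in Q (Alt (IsNil 3) (alts (map (Pop 3) al))) s (B + 3) ?s1"
    using pop[of s al] assms(2) by (cases "s 3") (auto simp: al)
  moreover have "runs_in Q bits_loop ?s1 (6 * length ?u + 1) (?s1(3 := ?v, 2 := rev ?u @ ?s1 2))"
    by (rule runs_in_bits) (auto dest: set_takeWhileD)
  then have "runs_in Q bits_loop ?s1 (6 * length (s 3) + 1) ?s2"
    using assms(1) length_takeWhile_le[of "\<lambda>a. a < 2" ?w] set_tail_of(2)[of "s 3"]
    by (auto elim!: runs_in_mono)
  moreover have vB: "set ?v \<subseteq> {..<B}" using assms(2) set_tail_of(1)[of "s 3"] set_dropWhileD[of _ _ ?w] by fastforce
  have "runs_in Q (Alt (IsNil 3) (alts (map (Pop 3) [2..<B]))) ?s2 (B + 3) (?s2(3 := tail_of ?v))"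
  proof -
    have "?v = [] \<or> 2 \<le> hd ?v" using hd_dropWhile[of "\<lambda>a. a < 2" ?w] by (metis not_less)
    then have "?v = [] \<or> hd ?v \<in> set [2..<B]" using vB by (cases ?v) auto
    from pop[of ?s2 "[2..<B]"] this show ?thesis by (auto elim!: runs_in_mono)
  qed
  then have "runs_in Q (Alt (IsNil 3) (alts (map (Pop 3) [2..<B]))) ?s2 (B + 3) ?s3"
    by (simp add: fun_upd_twist)
  moreover have "runs_in Q (clear B 3) ?s3 ((B + 4) * length (s 3) + 3) (s(3 := [], 2 := rev ?u))"
  proof (rule runs_in_clear)
    show "set (?s3 3) \<subseteq> {..<B}" using vB set_tail_of(1)[of ?v] by auto
    have "length (tail_of ?v) \<le> length (s 3)"
      using set_tail_of(2)[of ?v] length_dropWhile_le[of "\<lambda>a. a < 2" ?w] set_tail_of(2)[of "s 3"] by linarith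
    then show "(B + 4) * length (?s3 3) + 3 \<le> (B + 4) * length (s 3) + 3" by simp
  qed (auto simp: fun_eq_iff)
  ultimately show ?thesis unfolding qscan_def
    by (rule runs_in_Seq[OF _ runs_in_Seq[OF _ runs_in_Seq[OF _ _ order_refl] order_refl]]) (simp add: algebra_simps)
qed

end

context simulation
begin

lemma qpr_facts:
  assumes "srep (query_st M, tps) s"
  defines "u \<equiv> takeWhile (\<lambda>a. a < 2) (tail_of (rev (s (Lr 1)) @ s (Rr 1)))"
  shows "Qo A v (rev u) \<longleftrightarrow> (query_word (tps ! 1) \<in> A) = v" "length u \<le> length (s (Lr 1)) + length (s (Rr 1))"
    "set u \<subseteq> {..<B}"
proof -
  have "trep (tps ! 1) (s (Lr 1)) (s (Rr 1))"
    using assms(1) T2 by (auto simp: srep_def reps_def dest: spec[of _ 1])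
  then have "query_word (tps ! 1) = map (\<lambda>a. a = 1) u"
    by (simp only: trep_def query_word_lk u_def)
  moreover have u: "set u \<subseteq> {0, 1}" unfolding u_def by (auto dest!: set_takeWhileD)
  ultimately show "Qo A v (rev u) \<longleftrightarrow> (query_word (tps ! 1) \<in> A) = v"
    by (simp add: Qo_def wd_def rev_map)
  show "set u \<subseteq> {..<B}" using u B4 by auto
  have "length u \<le> length (tail_of (rev (s (Lr 1)) @ s (Rr 1)))" unfolding u_def by (rule length_takeWhile_le)
  also have "\<dots> \<le> length (rev (s (Lr 1)) @ s (Rr 1))" by (rule set_tail_of)
  finally show "length u \<le> length (s (Lr 1)) + length (s (Rr 1))" by simp
qed

lemma qpr_state:
  assumes "srep (query_st M, tps) s" "b < B"
  shows "srep (b, tps) (s(1 := [b]))"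
  using assms by (auto simp: srep_def reps_def)

lemma qpr_sound:
  assumes s: "srep c s" and r: "runs (Qo A) qpr s t"
  shows "\<exists>c'. step M A c c' \<and> srep c' t"
proof -
  let ?s = "s(1 := [])" and ?cells = "rev (s (Lr 1)) @ s (Rr 1)"
  let ?u = "takeWhile (\<lambda>a. a < 2) (tail_of ?cells)"
  from s r obtain tps where c: "c = (query_st M, tps)" by (cases c) (auto simp: srep_def qpr_def)
  note f = qpr_facts[OF s[unfolded c]]
  have b: "\<forall>r. set (?s r) \<subseteq> {..<B}" "s 2 = []" "s 3 = []" "s 4 = []" "s 1 = [query_st M]"
    using s by (auto simp: srep_def c)
  from r b obtain a d where 1: "runs (Qo A) qload ?s a" "runs (Qo A) qscan a d" "runs (Qo A) qask d t"
    by (auto simp: qpr_def)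
  have a: "a = ?s(3 := ?cells)" using runs_qload[of ?s] b 1(1) by simp
  have "set (a 3) \<subseteq> {..<B}" using s by (auto simp: a srep_def)
  from runs_qscan[OF _ this 1(2)] have d: "d = s(1 := [], 2 := rev ?u)"
    using b by (simp add: a fun_upd_twist fun_upd_idem)
  let ?b = "if query_word (tps ! 1) \<in> A then yes_st M else no_st M"
  have t: "t = s(1 := [?b])"
    using 1(3) f(1)[of A True] f(1)[of A False] b(2) unfolding qask_def d
    by (auto simp: fun_upd_twist fun_upd_idem)
  have "step M A c (?b, tps)" unfolding c by (rule step_query)
  moreover have "srep (?b, tps) t" unfolding t by (rule qpr_state[OF s[unfolded c]]) (use B_st in auto)
  ultimately show ?thesis by blast
qed

lemma qpr_complete:
  assumes s: "srep (query_st M, tps) s" and W: "length (s (Lr 1)) + length (s (Rr 1)) \<le> W"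
  shows "runs_in (Qo A) qpr s ((4 * B + 24) * W + 2 * B + 60)
    (s(1 := [if query_word (tps ! 1) \<in> A then yes_st M else no_st M]))"
proof -
  let ?s = "s(1 := [])" and ?cells = "rev (s (Lr 1)) @ s (Rr 1)"
  let ?u = "takeWhile (\<lambda>a. a < 2) (tail_of ?cells)"
  let ?b = "if query_word (tps ! 1) \<in> A then yes_st M else no_st M"
  note f = qpr_facts[OF s]
  have b: "\<forall>r. set (?s r) \<subseteq> {..<B}" "s 2 = []" "s 3 = []" "s 4 = []" "s 1 = [query_st M]"
    using s by (auto simp: srep_def)
  have 0: "runs_in (Qo A) (Pop 1 (query_st M)) s 1 ?s" using b by (intro runs_in_prim) auto
  have "runs_in (Qo A) qload ?s ((2 * B + 10) * (length (?s (Rr 1)) + length (?s (Lr 1))) + 20) (?s(3 := rev (?s (Lr 1)) @ ?s (Rr 1)))"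
    by (rule runs_in_qload) (use b in auto)
  then have 1: "runs_in (Qo A) qload ?s ((2 * B + 10) * W + 20) (?s(3 := ?cells))"
    using W by (auto elim!: runs_in_mono simp: add.commute)
  have sc: "set ?cells \<subseteq> {..<B}" using s by (auto simp: srep_def)
  have "runs_in (Qo A) qscan (?s(3 := ?cells)) ((B + 10) * length ((?s(3 := ?cells)) 3) + 2 * B + 20)
     ((?s(3 := ?cells))(3 := [], 2 := rev (takeWhile (\<lambda>a. a < 2) (tail_of ((?s(3 := ?cells)) 3)))))"
    by (rule runs_in_qscan) (use b sc in auto)
  moreover have "(?s(3 := ?cells))(3 := [], 2 := rev (takeWhile (\<lambda>a. a < 2) (tail_of ((?s(3 := ?cells)) 3)))) = s(1 := [], 2 := rev ?u)"
    using b by (auto simp: fun_eq_iff)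
  ultimately have 2: "runs_in (Qo A) qscan (?s(3 := ?cells)) ((B + 10) * W + 2 * B + 20) (s(1 := [], 2 := rev ?u))"
    using W by (auto elim!: runs_in_mono)
  let ?d = "s(1 := [], 2 := rev ?u)"
  have q: "runs_in (Qo A) (Query 2 v ;; Push 1 y) ?d 3 (?d(1 := [y]))" if "(query_word (tps ! 1) \<in> A) = v" for v y
  proof (rule runs_in_Seq[where n = 1 and m = 1])
    show "runs_in (Qo A) (Query 2 v) ?d 1 ?d" by (rule runs_in_prim) (use that f(1) in auto)
    show "runs_in (Qo A) (Push 1 y) ?d 1 (?d(1 := [y]))" by (rule runs_in_prim) auto
  qed simp
  have a: "runs_in (Qo A) (Alt (Query 2 True ;; Push 1 (yes_st M)) (Query 2 False ;; Push 1 (no_st M))) ?d 4 (?d(1 := [?b]))"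
  proof (cases "query_word (tps ! 1) \<in> A")
    case True
    then show ?thesis using q[of True "yes_st M"] by (intro runs_in_Alt1[where n = 3]) auto
  next
    case False
    then show ?thesis using q[of False "no_st M"] by (intro runs_in_Alt2[where n = 3]) auto
  qed
  have "runs_in (Qo A) (clear B 2) (?d(1 := [?b])) ((B + 4) * W + 3) (s(1 := [?b]))"
  proof (rule runs_in_clear)
    have "(B + 4) * length ?u \<le> (B + 4) * W" using f(2) W by (intro mult_le_mono) auto
    then show "(B + 4) * length ((?d(1 := [?b])) 2) + 3 \<le> (B + 4) * W + 3" by simp
  qed (use f(3) b in \<open>auto simp: fun_eq_iff\<close>)
  with a have 3: "runs_in (Qo A) qask ?d ((B + 4) * W + 8) (s(1 := [?b]))"
    unfolding qask_def by (rule runs_in_Seq) simp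
  show ?thesis unfolding qpr_def
    by (rule runs_in_Seq[OF 0 runs_in_Seq[OF 1 runs_in_Seq[OF 2 3 order_refl] order_refl]]) (simp add: algebra_simps)
qed

definition body :: prog where
  "body = alts (qpr # map tpr (filter (\<lambda>t. fst (fst t) \<noteq> query_st M) ds))"

lemma body_sound: "srep c s \<Longrightarrow> runs (Qo A) body s t \<Longrightarrow> \<exists>c'. step M A c c' \<and> srep c' t"
proof -
  assume s: "srep c s" and r: "runs (Qo A) body s t"
  then consider "runs (Qo A) qpr s t" | tr where "tr \<in> delta M" "fst (fst tr) \<noteq> query_st M" "runs (Qo A) (tpr tr) s t"
    by (auto simp: body_def ds simp del: runs_simps tpr.simps)
  then show ?thesis
  proof cases
    case 1
    then show ?thesis using qpr_sound s by blast
  next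
    case 2
    obtain q rs q' as where "tr = ((q, rs), (q', as))" by (metis surj_pair)
    then show ?thesis using 2 tpr_sound[OF _ s] by auto
  qed
qed

text \<open>\<open>K0\<close> bounds the program of one transition and hence the growth of each
  stack. Only a query depends on the tape content, in fact on that of tape 1; \<open>K1\<close>,
  multiplied by its length plus 1, covers both kinds of step.\<close>

definition "K0 = (B + 10) * T + 6"
definition "K1 = K0 + 4 * B + 2 * B + 84 + length ds + 1"

lemma body_complete:
  assumes s: "srep c s" and W: "length (s (Lr 1)) + length (s (Rr 1)) \<le> W" and st: "step M A c c'"
  shows "\<exists>t. runs_in (Qo A) body s (K1 * (W + 1)) t \<and> srep c' t \<and>
    length (t (Lr 1)) + length (t (Rr 1)) \<le> W + 2 * K0"
  using st
proof cases
  case (step_delta q tps q' as)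
  let ?tr = "((q, map read_tape tps), (q', as))"
  from tpr_complete[OF step_delta(4)] s step_delta obtain t where
    t: "runs_in (Qo A) (tpr ?tr) s K0 t" "srep (q', map2 act_tape as tps) t"
    by (auto simp: K0_def)
  have len: "length (filter P ds) \<le> length ds" for P by simp
  have "?tr \<in> set (filter (\<lambda>t. fst (fst t) \<noteq> query_st M) ds)" using step_delta ds by simp
  then have m: "tpr ?tr \<in> set (qpr # map tpr (filter (\<lambda>t. fst (fst t) \<noteq> query_st M) ds))"
    unfolding list.set set_map by blast
  have "runs_in (Qo A) body s (K0 + (length ds + 1)) t"
    unfolding body_def
    by (rule runs_in_alts[OF m t(1)]) (use len[of "\<lambda>t. fst (fst t) \<noteq> query_st M"] in auto)
  then have "runs_in (Qo A) body s (K1 * (W + 1)) t"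
    by (rule runs_in_mono) (simp add: K1_def)
  moreover have "length (t r) \<le> length (s r) + K0" for r
  proof -
    obtain n where n: "n \<le> K0" "exec (Qo A) (tpr ?tr) s n t" using t(1) by (auto simp: runs_in_def)
    show ?thesis using exec_length[OF n(2), of r] n(1) by simp
  qed
  from this[of "Lr 1"] this[of "Rr 1"] have "length (t (Lr 1)) + length (t (Rr 1)) \<le> W + 2 * K0" using W by simp
  ultimately show ?thesis using t(2) step_delta by blast
next
  case (step_query tps)
  let ?t = "s(1 := [if query_word (tps ! 1) \<in> A then yes_st M else no_st M])"
  have s': "srep (query_st M, tps) s" using s step_query by simp
  have len: "length (filter P ds) \<le> length ds" for P by simp
  have "runs_in (Qo A) body s (((4 * B + 24) * W + 2 * B + 60) + (length ds + 1)) ?t"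
    unfolding body_def
    by (rule runs_in_alts[OF _ qpr_complete[OF s' W]]) (use len[of "\<lambda>t. fst (fst t) \<noteq> query_st M"] in auto)
  then have "runs_in (Qo A) body s (K1 * (W + 1)) ?t"
    by (rule runs_in_mono) (simp add: K1_def algebra_simps)
  moreover have "srep c' ?t" using qpr_state[OF s'] B_st step_query by auto
  ultimately show ?thesis using W by (intro exI[of _ ?t]) auto
qed

lemma star_sound: "runs (Qo A) (Star body) s t \<Longrightarrow> srep c s \<Longrightarrow> \<exists>c'. (step M A)\<^sup>*\<^sup>* c c' \<and> srep c' t"
  unfolding runs_Star
proof (induction rule: rtranclp_induct)
  case base
  then show ?case by blast
next
  case (step t u)
  then obtain c' where c': "(step M A)\<^sup>*\<^sup>* c c'" "srep c' t" by blast
  from body_sound[OF c'(2) step(2)] obtain c'' where "step M A c' c''" "srep c'' u" by blast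
  then show ?case using c'(1) by (meson rtranclp.rtrancl_into_rtrancl)
qed

lemma star_complete:
  "(step M A ^^ n) c c' \<Longrightarrow> srep c s \<Longrightarrow> length (s (Lr 1)) + length (s (Rr 1)) + n * (2 * K0) \<le> W \<Longrightarrow>
    \<exists>t. runs_in (Qo A) (Star body) s (n * (K1 * (W + 1) + 1) + 1) t \<and> srep c' t"
proof (induction n arbitrary: c s)
  case 0
  have "runs_in (Qo A) (Star body) s 1 s" by (rule runs_in_prim) auto
  then show ?case using 0 by auto
next
  case (Suc n)
  from Suc.prems(1) obtain c1 where c1: "step M A c c1" "(step M A ^^ n) c1 c'" by (metis relpowp_Suc_D2)
  let ?W = "length (s (Lr 1)) + length (s (Rr 1))"
  from body_complete[OF Suc.prems(2) order_refl c1(1)] obtain t where t: "runs_in (Qo A) body s (K1 * (?W + 1)) t"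
    "srep c1 t" "length (t (Lr 1)) + length (t (Rr 1)) \<le> ?W + 2 * K0" by blast
  have "length (t (Lr 1)) + length (t (Rr 1)) + n * (2 * K0) \<le> W" using t(3) Suc.prems(3) by simp
  from Suc.IH[OF c1(2) t(2) this] obtain t' where t': "runs_in (Qo A) (Star body) t (n * (K1 * (W + 1) + 1) + 1) t'"
    "srep c' t'" by blast
  have "runs_in (Qo A) body s (K1 * (W + 1)) t" by (rule runs_in_mono[OF t(1)]) (use Suc.prems(3) in \<open>intro mult_le_mono, auto\<close>)
  then have "runs_in (Qo A) (Star body) s (Suc n * (K1 * (W + 1) + 1) + 1) t'"
    by (rule runs_in_Star[OF _ t'(1)]) simp
  then show ?case using t'(2) by blast
qed

text \<open>Register 6 is the right stack of tape 0 and 3 is the code of the end marker. Moving the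
  input reverses it, which puts its first bit on top, just below the marker.\<close>

definition load :: prog where
  "load = mv [0, 1] 0 6 ;; (seqs (map (\<lambda>i. Push (Rr i) 3) [0..<T]) ;; Push 1 (start_st M))"

definition s_init :: "bool list \<Rightarrow> st" where
  "s_init x = (\<lambda>r. if \<exists>i<T. r = Rr i then 3 # ((\<lambda>_. [])(6 := rev (stk x))) r else [])(1 := [start_st M])"

lemma runs_pushes: "distinct is \<Longrightarrow> runs Q (seqs (map (\<lambda>i. Push (Rr i) 3) is)) s t \<longleftrightarrow>
    t = (\<lambda>r. if \<exists>i\<in>set is. r = Rr i then 3 # s r else s r)"
proof (induction "is" arbitrary: s)
  case (Cons i "is")
  then have "(\<lambda>r. if \<exists>i\<in>set is. r = Rr i then 3 # (s(Rr i := 3 # s (Rr i))) r else (s(Rr i := 3 # s (Rr i))) r) =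
     (\<lambda>r. if \<exists>i\<in>set (i # is). r = Rr i then 3 # s r else s r)"
    by (auto simp: fun_eq_iff)
  then show ?case using Cons by (simp add: seqs_simps)
qed (simp add: seqs_simps)

lemma runs_in_pushes: "\<exists>t. runs_in Q (seqs (map (\<lambda>i. Push (Rr i) 3) is)) s (2 * length is + 1) t"
proof (induction "is" arbitrary: s)
  case Nil
  have "runs_in Q Skip s 1 s" by (rule runs_in_prim) auto
  then show ?case by (auto simp: seqs_simps)
next
  case (Cons i "is")
  let ?s = "s(Rr i := 3 # s (Rr i))"
  have 1: "runs_in Q (Push (Rr i) 3) s 1 ?s" by (rule runs_in_prim) auto
  from Cons[of ?s] obtain t where "runs_in Q (seqs (map (\<lambda>i. Push (Rr i) 3) is)) ?s (2 * length is + 1) t" by blast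
  with 1 have "runs_in Q (seqs (map (\<lambda>i. Push (Rr i) 3) (i # is))) s (2 * length (i # is) + 1) t"
    unfolding list.map seqs_simps by (rule runs_in_Seq) simp
  then show ?case by blast
qed

lemma runs_load: "runs Q load (ini [x]) t \<longleftrightarrow> t = s_init x"
proof -
  have 1: "(ini [x])(0 := [], 6 := rev (ini [x] 0) @ ini [x] 6) = (\<lambda>_. [])(6 := rev (stk x))"
    by (auto simp: ini_def fun_eq_iff)
  have 2: "ini [x] 0 = stk x" by (simp add: ini_def)
  have 3: "(\<lambda>r. if \<exists>i\<in>set [0..<T]. r = Rr i then 3 # ((\<lambda>_. [])(6 := rev (stk x))) r else ((\<lambda>_. [])(6 := rev (stk x))) r)
     = (\<lambda>r. if \<exists>i<T. r = Rr i then 3 # ((\<lambda>_. [])(6 := rev (stk x))) r else [])" (is "?l = ?r")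
  proof
    fix r
    show "?l r = ?r r"
    proof (cases "r = 6")
      case True
      then have "r = Rr 0" by simp
      moreover have "0 < T" using T2 by simp
      ultimately show ?thesis by (metis (no_types, lifting) atLeastLessThan_iff set_upt zero_le)
    qed auto
  qed
  have mv: "runs Q (mv [0, 1] 0 6) (ini [x]) u \<longleftrightarrow> u = (\<lambda>_. [])(6 := rev (stk x))" for u
    unfolding runs_mv[OF zero_neq_numeral] 1 unfolding 2 using stk_bits[of x] by auto
  let ?F = "\<lambda>r. if \<exists>i<T. r = Rr i then 3 # ((\<lambda>_. [])(6 := rev (stk x))) r else []"
  have "runs Q load (ini [x]) t \<longleftrightarrow> t = ?F(1 := start_st M # ?F 1)"
    by (simp only: load_def runs_simps(7) mv runs_pushes[OF distinct_upt] simp_thms 3 runs_simps(3)) simp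
  moreover have "?F 1 = []" by auto
  ultimately show ?thesis by (simp only: s_init_def)
qed

lemma runs_in_load: "runs_in Q load (ini [x]) (6 * length x + 2 * T + 8) (s_init x)"
proof -
  have 1: "runs_in Q (mv [0, 1] 0 6) (ini [x]) (6 * length x + 3) ((ini [x])(0 := [], 6 := rev (ini [x] 0) @ ini [x] 6))"
    by (rule runs_in_mv) (use stk_bits[of x] in \<open>auto simp: ini_def\<close>)
  obtain t where t: "runs_in Q (seqs (map (\<lambda>i. Push (Rr i) 3) [0..<T])) ((ini [x])(0 := [], 6 := rev (ini [x] 0) @ ini [x] 6)) (2 * T + 1) t"
    using runs_in_pushes[of Q "[0..<T]"] by auto
  have "runs_in Q (Push 1 (start_st M)) t 1 (t(1 := start_st M # t 1))" by (rule runs_in_prim) auto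
  from runs_in_Seq[OF 1 runs_in_Seq[OF t this order_refl] order_refl]
  have r: "runs_in Q load (ini [x]) (6 * length x + 2 * T + 8) (t(1 := start_st M # t 1))"
    unfolding load_def by (auto elim!: runs_in_mono)
  then show ?thesis using runs_in_runs[OF r] unfolding runs_load by simp
qed

lemma srep_init: "srep (init_config M x) (s_init x)"
proof -
  have T0: "0 < T" using T2 by simp
  have w: "word_tape y = (lk (3 # rev (stk y)), 0)" for y
  proof -
    have "lk (3 # rev (stk y)) i = (if i = 0 then LeftEnd else if i \<le> length y then Bit (y ! (i - 1)) else Blank)" for i
      by (cases i) (auto simp: lk_def sd_def stk_def rev_map)
    then show ?thesis by (auto simp: word_tape_def fun_eq_iff)
  qed
  have L: "s_init x (Lr j) = []" for j
  proof -
    have "\<not> (\<exists>i<T. Lr j = Rr i)" by presburger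
    then show ?thesis by (simp add: s_init_def)
  qed
  have R: "s_init x (Rr j) = 3 # (if j = 0 then rev (stk x) else [])" if "j < T" for j
    using that by (simp add: s_init_def)
  have "reps 0 (snd (init_config M x)) (s_init x)"
    unfolding reps_def
  proof (intro allI impI)
    fix j assume j: "j < length (snd (init_config M x))"
    then have jT: "j < T" using T0 by (simp add: init_config_def)
    have "stk [] = []" by (simp add: stk_def)
    then have "snd (init_config M x) ! j = (lk (3 # (if j = 0 then rev (stk x) else [])), 0)"
      using j jT w[of x] w[of "[]"] by (cases j) (auto simp: init_config_def)
    then show "trep (snd (init_config M x) ! j) (s_init x (Lr (0 + j))) (s_init x (Rr (0 + j)))"
      using L[of j] R[OF jT] by (simp add: trep_def)
  qed
  moreover have "set (s_init x r) \<subseteq> {..<B}" for r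
    using B4 B_st stk_bits[of x] by (auto simp: s_init_def)
  moreover have "s_init x 0 = [] \<and> s_init x 2 = [] \<and> s_init x 3 = [] \<and> s_init x 4 = [] \<and> s_init x 1 = [start_st M]"
    by (auto simp: s_init_def)
  ultimately show ?thesis using T0 by (simp add: srep_def init_config_def)
qed

text \<open>The final test is a parameter: \<open>accept_sound\<close> checks for the accepting
  state, \<open>P_compl_prog\<close> for a halt in another one.\<close>

lemma prog_sound:
  assumes "runs (Qo A) (load ;; (Star body ;; fin)) (ini [x]) t"
  shows "\<exists>c s. (step M A)\<^sup>*\<^sup>* (init_config M x) c \<and> srep c s \<and> runs (Qo A) fin s t"
proof -
  from assms obtain s where s: "runs (Qo A) (Star body) (s_init x) s" "runs (Qo A) fin s t"
    by (auto simp: runs_load)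
  from star_sound[OF s(1) srep_init] s(2) show ?thesis by blast
qed

lemma prog_complete:
  assumes "(step M A ^^ n) (init_config M x) c" "n \<le> N"
    and fin: "\<And>s. srep c s \<Longrightarrow> \<exists>t. runs_in (Qo A) fin s F t"
  shows "\<exists>t. runs_in (Qo A) (load ;; (Star body ;; fin)) (ini [x])
    (6 * length x + 2 * T + 20 + N * (K1 * (length x + 2 + N * (2 * K0)) + 1) + F) t"
proof -
  have "length (s_init x (Lr 1)) = 0" "length (s_init x (Rr 1)) \<le> 1"
    by (auto simp: s_init_def)
  then have W: "length (s_init x (Lr 1)) + length (s_init x (Rr 1)) + n * (2 * K0) \<le> length x + 1 + N * (2 * K0)"
    using assms(2) mult_le_mono[OF assms(2) order_refl, of "2 * K0"] by linarith
  from star_complete[OF assms(1) srep_init W] obtain s where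
    s: "runs_in (Qo A) (Star body) (s_init x) (n * (K1 * (length x + 1 + N * (2 * K0) + 1) + 1) + 1) s" "srep c s" by blast
  obtain t where t: "runs_in (Qo A) fin s F t" using fin[OF s(2)] by blast
  have "n * (K1 * (length x + 1 + N * (2 * K0) + 1) + 1) \<le> N * (K1 * (length x + 2 + N * (2 * K0)) + 1)"
    using assms(2) by (intro mult_le_mono) auto
  then show ?thesis
    by (intro exI, rule_tac runs_in_Seq[OF runs_in_load runs_in_Seq[OF s(1) t order_refl]]) auto
qed

lemma accept_sound:
  assumes "runs (Qo A) (load ;; (Star body ;; Pop 1 (accept_st M))) (ini [x]) t"
  shows "accepts M A x"
proof -
  from prog_sound[OF assms] obtain c s w where "(step M A)\<^sup>*\<^sup>* (init_config M x) c" "srep c s" "s 1 = accept_st M # w"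
    by auto
  then show ?thesis unfolding accepts_def by (cases c) (auto simp: srep_def)
qed

lemma accept_complete:
  assumes "poly_time M A"
  shows "\<exists>d. \<forall>x. accepts M A x \<longrightarrow>
    (\<exists>t. runs_in (Qo A) (load ;; (Star body ;; Pop 1 (accept_st M))) (ini [x]) ((length x + 2) ^ d) t)"
proof -
  obtain p where p: "\<And>x n c. (step M A ^^ n) (init_config M x) c \<Longrightarrow> n \<le> poly p (length x)"
    using assms unfolding poly_time_def by blast
  have "pb (\<lambda>n. 6 * n + 2 * T + 20 + poly p n * (K1 * (n + 2 + poly p n * (2 * K0)) + 1) + 1)"
    by (intro pb_intros pb_poly)
  then obtain d where d: "\<And>n. 6 * n + 2 * T + 20 + poly p n * (K1 * (n + 2 + poly p n * (2 * K0)) + 1) + 1 \<le> (n + 2) ^ d"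
    by (auto simp: pb_def)
  show ?thesis
  proof (intro exI[of _ d] allI impI)
    fix x assume "accepts M A x"
    then obtain tps n where n: "(step M A ^^ n) (init_config M x) (accept_st M, tps)"
      by (auto simp: accepts_def rtranclp_power)
    have "\<exists>t. runs_in (Qo A) (Pop 1 (accept_st M)) s 1 t" if "srep (accept_st M, tps) s" for s
      using that by (intro exI, rule_tac runs_in_prim) (auto simp: srep_def)
    from prog_complete[OF n p[OF n] this] show
      "\<exists>t. runs_in (Qo A) (load ;; (Star body ;; Pop 1 (accept_st M))) (ini [x]) ((length x + 2) ^ d) t"
      using d[of "length x"] by (meson runs_in_mono)
  qed
qed

text \<open>Confirms the state and the symbols under all heads by means of an action that writes
  back what it reads and moves nothing.\<close>

definition stuck :: "nat \<times> tsym list \<Rightarrow> prog" where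
  "stuck z = Pop 1 (fst z) ;; tac 0 (map (\<lambda>a. (a, (a, Stay))) (snd z))"

lemma stuck_sound:
  assumes "srep c s" "runs Q (stuck (q, rs)) s t" "length rs = T" "\<forall>a\<in>set rs. sy a < B"
  shows "fst c = q" "map read_tape (snd c) = rs"
proof -
  obtain tps where c: "c = (q, tps)" and s1: "s 1 = [q]" using assms(1,2) by (cases c) (auto simp: srep_def stuck_def)
  then show "fst c = q" by simp
  from assms(2) s1 have u: "runs Q (tac 0 (map (\<lambda>a. (a, (a, Stay))) rs)) (s(1 := [])) t" by (auto simp: stuck_def)
  have "reps 0 tps (s(1 := []))" using assms(1) c by (auto simp: srep_def reps_def)
  from tac_sound[OF u this] show "map read_tape (snd c) = rs"
    using assms c by (auto simp: srep_def comp_def)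
qed

lemma stuck_complete:
  assumes "srep (q, tps) s"
  shows "\<exists>t. runs_in Q (stuck (q, map read_tape tps)) s K0 t" "q < B" "length tps = T"
    "\<forall>a\<in>set (map read_tape tps). sy a < B"
proof -
  show "length tps = T" using assms by (simp add: srep_def)
  show "q < B" using assms unfolding srep_def by (metis fst_conv insert_subset lessThan_iff list.simps(15))
  have "reps 0 tps (s(1 := []))" using assms by (auto simp: srep_def reps_def)
  have hd: "set r \<subseteq> {..<B} \<Longrightarrow> sy (hd_sym r) < B" for r using B4 by (cases r) (auto simp: hd_sym_def)
  show b: "\<forall>a\<in>set (map read_tape tps). sy a < B"
  proof
    fix a assume "a \<in> set (map read_tape tps)"
    then obtain j where j: "j < length tps" "a = read_tape (tps ! j)" by (auto simp: in_set_conv_nth)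
    then have "a = hd_sym (s (Rr j))" using assms by (auto simp: srep_def reps_def read_trep)
    then show "sy a < B" using hd assms by (simp add: srep_def)
  qed
  have "\<exists>u. runs_in Q (tac 0 (map (\<lambda>a. (a, (a, Stay))) (map read_tape tps))) (s(1 := []))
     ((B + 10) * length (map (\<lambda>a. (a, (a, Stay))) (map read_tape tps)) + 1) u"
    by (rule tac_complete[OF _ \<open>reps 0 tps (s(1 := []))\<close>]) (use b assms in \<open>auto simp: srep_def\<close>)
  then obtain u where u: "runs_in Q (tac 0 (map (\<lambda>a. (a, (a, Stay))) (map read_tape tps))) (s(1 := [])) ((B + 10) * T + 1) u"
    using \<open>length tps = T\<close> by auto
  have "runs_in Q (Pop 1 q) s 1 (s(1 := []))" using assms by (intro runs_in_prim) (auto simp: srep_def)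
  then have "runs_in Q (stuck (q, map read_tape tps)) s K0 u"
    unfolding stuck_def fst_conv snd_conv by (rule runs_in_Seq[OF _ u]) (simp add: K0_def)
  then show "\<exists>t. runs_in Q (stuck (q, map read_tape tps)) s K0 t" by blast
qed

end

lemma ex_simulation:
  assumes "wf_machine M"
  shows "\<exists>B ds. simulation M B ds"
proof -
  have fin: "finite (delta M)" using assms by (simp add: wf_machine_def)
  then obtain ds where ds: "set ds = delta M" using finite_list by blast
  define X where "X = {4, start_st M, accept_st M, query_st M, yes_st M, no_st M} \<union>
    (\<Union>((q, rs), (q', as))\<in>delta M. {q, q'} \<union> sy ` set rs \<union> (\<lambda>a. sy (fst a)) ` set as)"
  have "finite X" unfolding X_def using fin by (auto split: prod.splits)
  then obtain B where B: "\<forall>n\<in>X. n < B" using finite_nat_set_iff_bounded by blast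
  have "simulation M B ds"
  proof
    show "4 \<le> B" "start_st M < B" "accept_st M < B" "query_st M < B" "yes_st M < B" "no_st M < B"
      using B by (auto simp: X_def)
    fix q rs q' as assume d: "((q, rs), (q', as)) \<in> delta M"
    have "{q, q'} \<union> sy ` set rs \<union> (\<lambda>a. sy (fst a)) ` set as \<subseteq> X" unfolding X_def using d by force
    then show "q < B \<and> q' < B \<and> (\<forall>a\<in>set rs. sy a < B) \<and> (\<forall>a\<in>set as. sy (fst a) < B)" using B by auto
  qed (use assms ds in auto)
  then show ?thesis by blast
qed

lemma NP_prog:
  assumes "L \<in> NP_oracle A"
  shows "\<exists>p d. (\<forall>x t. runs (Qo A) p (ini [x]) t \<longrightarrow> x \<in> L) \<and>
    (\<forall>x\<in>L. \<exists>t. runs_in (Qo A) p (ini [x]) ((length x + 2) ^ d) t)"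
proof -
  from assms obtain M where M: "wf_machine M" "poly_time M A" "L = {x. accepts M A x}" by (auto simp: NP_oracle_def)
  obtain B ds where "simulation M B ds" using ex_simulation M(1) by blast
  then interpret simulation M B ds .
  obtain d where d: "\<forall>x. accepts M A x \<longrightarrow>
    (\<exists>t. runs_in (Qo A) (load ;; (Star body ;; Pop 1 (accept_st M))) (ini [x]) ((length x + 2) ^ d) t)"
    using accept_complete[OF M(2)] by blast
  show ?thesis
    by (rule exI[of _ "load ;; (Star body ;; Pop 1 (accept_st M))"], rule exI[of _ d])
      (use accept_sound d M(3) in blast)
qed

lemma step_deterministic: "deterministic M \<Longrightarrow> step M A c c1 \<Longrightarrow> step M A c c2 \<Longrightarrow> c1 = c2"
  by (elim step.cases) (auto simp: deterministic_def dest: single_valuedD)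

text \<open>Transitions out of the accepting state are removed first, so that a halting run decides.\<close>

lemma P_compl_prog:
  assumes "L \<in> class_P"
  shows "\<exists>p d. (\<forall>x t. runs (Qo {}) p (ini [x]) t \<longrightarrow> x \<notin> L) \<and>
    (\<forall>x. x \<notin> L \<longrightarrow> (\<exists>t. runs_in (Qo {}) p (ini [x]) ((length x + 2) ^ d) t))"
proof -
  from assms obtain M where M: "wf_machine M" "deterministic M" "oracle_free M" "poly_time M {}"
    "L = {x. accepts M {} x}" by (auto simp: class_P_def)
  define N where "N = M\<lparr>delta := {t \<in> delta M. fst (fst t) \<noteq> accept_st M}\<rparr>"
  have N[simp]: "num_tapes N = num_tapes M" "start_st N = start_st M" "accept_st N = accept_st M"
    "query_st N = query_st M" "yes_st N = yes_st M" "no_st N = no_st M" by (auto simp: N_def)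
  have dN: "delta N = {t \<in> delta M. fst (fst t) \<noteq> accept_st M}" by (simp add: N_def)
  have ic: "init_config N x = init_config M x" for x by (simp add: init_config_def)
  have "wf_machine N" using M(1) by (auto simp: wf_machine_def dN)
  then obtain B ds where "simulation N B ds" using ex_simulation by blast
  then interpret simulation N B ds .
  have NM: "step M {} c c'" if "step N {} c c'" for c c'
    using that
  proof cases
    case (step_delta q tps q' as)
    then show ?thesis by (auto simp: dN intro!: step.step_delta)
  next
    case (step_query tps)
    then show ?thesis using step.step_query[of M "{}" tps] by simp
  qed
  have MN: "step N {} c c'" if "step M {} c c'" "fst c \<noteq> accept_st M" for c c'
    using that(1)
  proof cases
    case (step_delta q tps q' as)
    then show ?thesis using that(2) by (auto simp: dN intro!: step.step_delta)
  next
    case (step_query tps)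
    then show ?thesis using step.step_query[of N "{}" tps] by simp
  qed
  have noq: "fst c \<noteq> query_st M" if "(step M {})\<^sup>*\<^sup>* (init_config M x) c" for x c
    using that
  proof (induction rule: rtranclp_induct)
    case base
    then show ?case using M(3) by (simp add: oracle_free_def init_config_def)
  next
    case (step c c')
    from step(2) step(3) show ?case using M(3) by cases (auto simp: oracle_free_def)
  qed
  \<comment> \<open>The readings on which the machine halts without accepting. They are finitely
    many, so a program can try them one after the other.\<close>
  define Z where "Z = {(q, rs). q < B \<and> q \<noteq> accept_st M \<and> q \<noteq> query_st M \<and> length rs = T \<and>
    (\<forall>a\<in>set rs. sy a < B) \<and> (q, rs) \<notin> Domain (delta N)}"
  have "Z \<subseteq> {..<B} \<times> {rs. set rs \<subseteq> sd ` {..<B} \<and> length rs = T}"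
  proof -
    have "set rs \<subseteq> sd ` {..<B}" if "\<forall>a\<in>set rs. sy a < B" for rs
    proof
      fix a assume "a \<in> set rs"
      then have "sd (sy a) \<in> sd ` {..<B}" using that by blast
      then show "a \<in> sd ` {..<B}" by simp
    qed
    then show ?thesis unfolding Z_def by blast
  qed
  then have "finite Z" by (rule finite_subset) (auto intro: finite_lists_length_eq)
  then obtain zs where zs: "set zs = Z" using finite_list by blast
  define fin where "fin = alts (map stuck zs)"
  have dead: "\<not> step N {} (q, tps) c'" if "(q, map read_tape tps) \<notin> Domain (delta N)" "q \<noteq> query_st M" for q tps c'
    using that by (auto elim!: step.cases)
  have sound: "x \<notin> L" if r: "runs (Qo {}) (load ;; (Star body ;; fin)) (ini [x]) t" for x t
  proof -
    from prog_sound[OF r] obtain c s where c: "(step N {})\<^sup>*\<^sup>* (init_config M x) c" "srep c s" "runs (Qo {}) fin s t"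
      by (auto simp: ic)
    then obtain q rs where z: "(q, rs) \<in> Z" "runs (Qo {}) (stuck (q, rs)) s t" by (auto simp: fin_def zs)
    have zf: "length rs = T" "\<forall>a\<in>set rs. sy a < B" "q \<noteq> query_st M" "q \<noteq> accept_st M" "(q, rs) \<notin> Domain (delta N)"
      using z(1) by (simp_all add: Z_def)
    have e: "fst c = q" "map read_tape (snd c) = rs"
      using stuck_sound[OF c(2) z(2) zf(1,2)] by simp_all
    then have "c = (q, snd c)" by (metis prod.collapse)
    with dead[of q "snd c"] e zf have nd: "\<not> step N {} c c'" "fst c \<noteq> accept_st M" for c' by metis+
    have nq: "fst d' \<noteq> query_st M" if "step N {} d d'" "fst d \<noteq> query_st M" for d d'
      using that(1)
    proof cases
      case (step_delta q tps q' as)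
      then show ?thesis using M(3) by (auto simp: dN oracle_free_def)
    qed (use that(2) in simp)
    \<comment> \<open>By determinism all configurations that \<open>M\<close> reaches lie on the run
      of \<open>N\<close> to \<open>c\<close>. Those before \<open>c\<close> are left by transitions
      of \<open>N\<close>, hence are not accepting, and from \<open>c\<close> no step is
      possible.\<close>
    from c(1) have claim: "fst y \<noteq> accept_st M"
      if "fst (init_config M x) \<noteq> query_st M" "(step M {})\<^sup>*\<^sup>* (init_config M x) y" for y
      using that
    proof (induction arbitrary: y rule: converse_rtranclp_induct)
      case base
      from base(2) show ?case
      proof (cases rule: converse_rtranclpE)
        case base
        then show ?thesis using nd by simp
      next
        case (step y')
        then show ?thesis using MN nd by blast
      qed
    next
      case (step c0 c1)
      from step.prems(2) show ?case
      proof (cases rule: converse_rtranclpE)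
        case base
        from \<open>step N {} c0 c1\<close> show ?thesis
        proof cases
          case (step_delta q tps q' as)
          then show ?thesis using base by (simp add: dN)
        next
          case (step_query tps)
          then show ?thesis using step.prems(1) by simp
        qed
      next
        case (step y')
        have "c1 = y'" using step_deterministic[OF M(2) NM[OF \<open>step N {} c0 c1\<close>] step(1)] .
        then show ?thesis
          using step(2) step.IH nq[OF \<open>step N {} c0 c1\<close> \<open>fst c0 \<noteq> query_st M\<close>] by simp
      qed
    qed
    show ?thesis
    proof
      assume "x \<in> L"
      then obtain tps where "(step M {})\<^sup>*\<^sup>* (init_config M x) (accept_st M, tps)" by (auto simp: M(5) accepts_def)
      from claim[OF noq[OF rtranclp.rtrancl_refl] this] show False by simp
    qed
  qed
  obtain p where p: "\<And>x n c. (step M {} ^^ n) (init_config M x) c \<Longrightarrow> n \<le> poly p (length x)"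
    using M(4) unfolding poly_time_def by blast
  have "pb (\<lambda>n. 6 * n + 2 * T + 20 + poly p n * (K1 * (n + 2 + poly p n * (2 * K0)) + 1) + (K0 + length zs))"
    by (intro pb_intros pb_poly)
  then obtain d where d: "\<And>n. 6 * n + 2 * T + 20 + poly p n * (K1 * (n + 2 + poly p n * (2 * K0)) + 1) + (K0 + length zs) \<le> (n + 2) ^ d"
    unfolding pb_def by blast
  have complete: "\<exists>t. runs_in (Qo {}) (load ;; (Star body ;; fin)) (ini [x]) ((length x + 2) ^ d) t" if x: "x \<notin> L" for x
  proof -
    \<comment> \<open>The length of a longest run, which exists because the running time is bounded;
      its last configuration is a halting one.\<close>
    define k where "k = (GREATEST k. \<exists>c. (step M {} ^^ k) (init_config M x) c)"
    have bd: "\<forall>k. (\<exists>c. (step M {} ^^ k) (init_config M x) c) \<longrightarrow> k \<le> poly p (length x)" using p by blast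
    have "\<exists>c. (step M {} ^^ 0) (init_config M x) c" by simp
    then have "\<exists>c. (step M {} ^^ k) (init_config M x) c"
      unfolding k_def by (rule GreatestI_nat) (use bd in auto)
    then obtain c where c: "(step M {} ^^ k) (init_config M x) c" by blast
    have dd: "\<not> step M {} c c'" for c'
    proof
      assume "step M {} c c'"
      with c have "\<exists>c. (step M {} ^^ Suc k) (init_config M x) c" by (meson relpowp_Suc_I)
      then have "Suc k \<le> k" unfolding k_def by (rule Greatest_le_nat) (use bd in auto)
      then show False by simp
    qed
    have noacc: "fst y \<noteq> accept_st M" if "(step M {})\<^sup>*\<^sup>* (init_config M x) y" for y
      using that x by (cases y) (auto simp: M(5) accepts_def)
    have "(step M {} ^^ j) (init_config M x) y \<Longrightarrow> (step N {} ^^ j) (init_config M x) y" for j y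
    proof (induction j arbitrary: y)
      case (Suc j)
      then obtain y' where y': "(step M {} ^^ j) (init_config M x) y'" "step M {} y' y" by auto
      have "fst y' \<noteq> accept_st M" using noacc y'(1) by (metis rtranclp_power)
      then show ?case using Suc.IH[OF y'(1)] MN[OF y'(2)] by auto
    qed simp
    then have cN: "(step N {} ^^ k) (init_config N x) c" using c by (simp add: ic)
    have cr: "(step M {})\<^sup>*\<^sup>* (init_config M x) c" using c by (metis rtranclp_power)
    have fin: "\<exists>t. runs_in (Qo {}) fin s (K0 + length zs) t" if s: "srep c s" for s
    proof -
      obtain q tps where qt: "c = (q, tps)" by force
      note sc = stuck_complete[OF s[unfolded qt]]
      have "(q, map read_tape tps) \<notin> Domain (delta N)"
      proof
        assume "(q, map read_tape tps) \<in> Domain (delta N)"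
        then obtain q' as where "((q, map read_tape tps), (q', as)) \<in> delta M" by (auto simp: dN)
        then have "step M {} c (q', map2 act_tape as tps)" unfolding qt
          by (rule step_delta[rotated]) (use noq[OF cr] qt in auto)
        then show False using dd by blast
      qed
      then have "(q, map read_tape tps) \<in> Z" using sc noacc[OF cr] noq[OF cr] qt by (auto simp: Z_def)
      then have m: "stuck (q, map read_tape tps) \<in> set (map stuck zs)" using zs by auto
      from sc(1) obtain t where "runs_in (Qo {}) (stuck (q, map read_tape tps)) s K0 t" by blast
      from runs_in_alts[OF m this] show ?thesis unfolding fin_def by auto
    qed
    have "k \<le> poly p (length x)" using p[OF c] .
    from prog_complete[OF cN this fin] show ?thesis using d[of "length x"] by (meson runs_in_mono)
  qed
  show ?thesis using sound complete by blast
qed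

section \<open>Predicates on tuples of strings\<close>

definition sz :: "bool list list \<Rightarrow> nat" where
  "sz xs = sum_list (map length xs)"

text \<open>Any run certifies \<open>\<phi>\<close>, but only one run has to be short: longer runs are cut off by a clock
  when the program is turned into a machine.\<close>

definition acc_by :: "prog \<Rightarrow> (nat \<Rightarrow> nat) \<Rightarrow> lang \<Rightarrow> nat \<Rightarrow> (bool list list \<Rightarrow> bool) \<Rightarrow> bool" where
  "acc_by p f A a \<phi> \<longleftrightarrow> pb f \<and> (\<forall>xs. length xs = a \<longrightarrow>
     (\<forall>t. runs (Qo A) p (ini xs) t \<longrightarrow> \<phi> xs) \<and>
     (\<phi> xs \<longrightarrow> (\<exists>t. runs_in (Qo A) p (ini xs) (f (sz xs)) t)))"

definition Acc :: "lang \<Rightarrow> nat \<Rightarrow> (bool list list \<Rightarrow> bool) \<Rightarrow> bool" where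
  "Acc A a \<phi> \<longleftrightarrow> (\<exists>p f. acc_by p f A a \<phi>)"

definition bits :: "nat list \<Rightarrow> st \<Rightarrow> bool" where
  "bits js s \<longleftrightarrow> (\<forall>j\<in>set js. set (s j) \<subseteq> {0, 1})"

definition args :: "nat list \<Rightarrow> st \<Rightarrow> bool list list" where
  "args js s = map (\<lambda>j. wd (s j)) js"

text \<open>A test uses the empty registers from \<open>b\<close> on as scratch and restores the
  state exactly. It can therefore be repeated, put in sequence with other tests and substituted for
  queries.\<close>

definition tst_by :: "prog \<Rightarrow> (nat \<Rightarrow> nat) \<Rightarrow> lang \<Rightarrow> nat \<Rightarrow> nat list \<Rightarrow> (bool list list \<Rightarrow> bool) \<Rightarrow> bool" where
  "tst_by p f A b js \<phi> \<longleftrightarrow> pb f \<and> (\<forall>s. (\<forall>r\<ge>b. s r = []) \<longrightarrow>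
     (\<forall>t. runs (Qo A) p s t \<longrightarrow> t = s \<and> bits js s \<and> \<phi> (args js s)) \<and>
     (bits js s \<longrightarrow> \<phi> (args js s) \<longrightarrow> runs_in (Qo A) p s (f (sz (args js s))) s))"

definition Tst :: "lang \<Rightarrow> nat \<Rightarrow> nat list \<Rightarrow> (bool list list \<Rightarrow> bool) \<Rightarrow> bool" where
  "Tst A b js \<phi> \<longleftrightarrow> (\<exists>p f. tst_by p f A b js \<phi>)"

lemma AccI:
  assumes "pb f"
    and "\<And>xs t. length xs = a \<Longrightarrow> runs (Qo A) p (ini xs) t \<Longrightarrow> \<phi> xs"
    and "\<And>xs. length xs = a \<Longrightarrow> \<phi> xs \<Longrightarrow> \<exists>t. runs_in (Qo A) p (ini xs) (f (sz xs)) t"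
  shows "Acc A a \<phi>"
  unfolding Acc_def acc_by_def using assms by blast

lemma acc_byD:
  assumes "acc_by p f A a \<phi>"
  shows "pb f" "length xs = a \<Longrightarrow> runs (Qo A) p (ini xs) t \<Longrightarrow> \<phi> xs"
    "length xs = a \<Longrightarrow> \<phi> xs \<Longrightarrow> \<exists>t. runs_in (Qo A) p (ini xs) (f (sz xs)) t"
  using assms unfolding acc_by_def by blast+

lemma TstI:
  assumes "pb f"
    and "\<And>s t. \<forall>r\<ge>b. s r = [] \<Longrightarrow> runs (Qo A) p s t \<Longrightarrow> t = s \<and> bits js s \<and> \<phi> (args js s)"
    and "\<And>s. \<forall>r\<ge>b. s r = [] \<Longrightarrow> bits js s \<Longrightarrow> \<phi> (args js s) \<Longrightarrow>
      runs_in (Qo A) p s (f (sz (args js s))) s"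
  shows "Tst A b js \<phi>"
  unfolding Tst_def tst_by_def
  by (rule exI[of _ p], rule exI[of _ f], intro conjI allI impI assms(1)) (use assms(2,3) in blast)+

lemma tst_byD:
  assumes "tst_by p f A b js \<phi>"
  shows "pb f" "\<forall>r\<ge>b. s r = [] \<Longrightarrow> runs (Qo A) p s t \<Longrightarrow> t = s"
    "\<forall>r\<ge>b. s r = [] \<Longrightarrow> runs (Qo A) p s t \<Longrightarrow> bits js s"
    "\<forall>r\<ge>b. s r = [] \<Longrightarrow> runs (Qo A) p s t \<Longrightarrow> \<phi> (args js s)"
    "\<forall>r\<ge>b. s r = [] \<Longrightarrow> bits js s \<Longrightarrow> \<phi> (args js s) \<Longrightarrow> runs_in (Qo A) p s (f (sz (args js s))) s"
  using assms unfolding tst_by_def by simp_all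

lemma Acc_cong: "Acc A a \<phi> \<Longrightarrow> (\<And>xs. length xs = a \<Longrightarrow> \<phi> xs \<longleftrightarrow> \<psi> xs) \<Longrightarrow> Acc A a \<psi>"
  unfolding Acc_def acc_by_def by simp

lemma length_args [simp]: "length (args js s) = length js"
  by (simp add: args_def)

lemma sz_args: "sz (args js s) = sum_list (map (\<lambda>j. length (s j)) js)"
  by (simp add: sz_def args_def comp_def)

lemma member_le_sz: "j \<in> set js \<Longrightarrow> length (s j) \<le> sz (args js s)"
  by (simp add: member_le_sum_list sz_args)

lemma length_le_sz: "x \<in> set xs \<Longrightarrow> length x \<le> sz xs"
  unfolding sz_def by (rule member_le_sum_list) auto

section \<open>Accepted predicates: renaming, conjunction, disjunction\<close>

definition copies :: "nat list \<Rightarrow> nat \<Rightarrow> nat list \<Rightarrow> prog" where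
  "copies js b is = seqs (map (\<lambda>i. copy [0, 1] (js ! i) b (Suc b + i)) is)"

lemma runs_copies:
  assumes "distinct is" "\<forall>i\<in>set is. js ! i < b" "s b = []"
  shows "runs Q (copies js b is) s t \<longleftrightarrow> (\<forall>i\<in>set is. set (s (js ! i)) \<subseteq> {0, 1}) \<and>
    t = (\<lambda>r. if \<exists>i\<in>set is. r = Suc b + i then s (js ! (r - Suc b)) @ s r else s r)"
  using assms
proof (induction "is" arbitrary: s)
  case Nil
  then show ?case by (auto simp: copies_def seqs_simps)
next
  case (Cons i "is")
  let ?s = "s(Suc b + i := s (js ! i) @ s (Suc b + i))"
  have n: "js ! i < b" "js ! i \<noteq> b" "js ! i \<noteq> Suc b + i" "b \<noteq> Suc b + i" using Cons.prems by auto
  have e: "?s (js ! k) = s (js ! k)" if "k \<in> set is" for k using Cons.prems that by auto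
  have st: "(\<lambda>r. if \<exists>i\<in>set is. r = Suc b + i then ?s (js ! (r - Suc b)) @ ?s r else ?s r) =
    (\<lambda>r. if \<exists>i\<in>set (i # is). r = Suc b + i then s (js ! (r - Suc b)) @ s r else s r)"
    using Cons.prems e by (auto simp: fun_eq_iff)
  have "runs Q (copies js b (i # is)) s t \<longleftrightarrow> set (s (js ! i)) \<subseteq> {0, 1} \<and> runs Q (copies js b is) ?s t"
    unfolding copies_def list.map seqs_simps runs_simps(7) runs_copy[where s = s, OF n(2,3,4) Cons.prems(3)] by auto
  also have "runs Q (copies js b is) ?s t \<longleftrightarrow> (\<forall>i\<in>set is. set (?s (js ! i)) \<subseteq> {0, 1}) \<and>
    t = (\<lambda>r. if \<exists>i\<in>set is. r = Suc b + i then ?s (js ! (r - Suc b)) @ ?s r else ?s r)"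
    by (rule Cons.IH) (use Cons.prems in auto)
  finally show ?case unfolding st using e by auto
qed

lemma runs_in_copies:
  assumes "distinct is" "\<forall>i\<in>set is. js ! i < b" "s b = []" "\<forall>i\<in>set is. set (s (js ! i)) \<subseteq> {0, 1} \<and> length (s (js ! i)) \<le> W"
  shows "\<exists>t. runs_in Q (copies js b is) s ((14 * W + 8) * length is + 1) t"
  using assms
proof (induction "is" arbitrary: s)
  case Nil
  have "runs_in Q Skip s 1 s" by (rule runs_in_prim) auto
  then show ?case by (auto simp: copies_def seqs_simps)
next
  case (Cons i "is")
  let ?s = "s(Suc b + i := s (js ! i) @ s (Suc b + i))"
  have n: "js ! i < b" "js ! i \<noteq> b" "js ! i \<noteq> Suc b + i" "b \<noteq> Suc b + i" using Cons.prems by auto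
  have e: "?s (js ! k) = s (js ! k)" if "k \<in> set is" for k using Cons.prems that by auto
  have 1: "runs_in Q (copy [0, 1] (js ! i) b (Suc b + i)) s (14 * W + 7) ?s"
    by (rule runs_in_copy) (use n Cons.prems in auto)
  have "\<exists>t. runs_in Q (copies js b is) ?s ((14 * W + 8) * length is + 1) t"
    by (rule Cons.IH) (use Cons.prems e in auto)
  then obtain t where t: "runs_in Q (copies js b is) ?s ((14 * W + 8) * length is + 1) t" by blast
  have "runs_in Q (copies js b (i # is)) s ((14 * W + 8) * length (i # is) + 1) t"
    unfolding copies_def list.map seqs_simps by (rule runs_in_Seq[OF 1 t[unfolded copies_def]]) simp
  then show ?case by blast
qed

lemma copies_state:
  assumes "\<forall>j\<in>set js. j < b \<and> set (s j) \<subseteq> {0, 1}" "\<forall>r\<ge>b. s r = []"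
  shows "(\<lambda>r. if \<exists>i\<in>set [0..<length js]. r = Suc b + i then s (js ! (r - Suc b)) @ s r else s r) =
    glue (Suc b) s (ini (map (\<lambda>j. wd (s j)) js))"
proof
  fix r
  show "(if \<exists>i\<in>set [0..<length js]. r = Suc b + i then s (js ! (r - Suc b)) @ s r else s r) =
    glue (Suc b) s (ini (map (\<lambda>j. wd (s j)) js)) r"
  proof (cases "r < Suc b")
    case False
    then obtain i where i: "r = Suc b + i" by (metis le_iff_add not_less)
    have "s r = []" using False assms by simp
    moreover have "set (s (js ! i)) \<subseteq> {0, 1}" if "i < length js" using assms that by simp
    ultimately show ?thesis using i by (auto simp: glue_def ini_def stk_wd)
  qed auto
qed

lemma ini_symbols: "set (ini xs r) \<subseteq> {0, 1}"
  using stk_bits by (auto simp: ini_def)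

lemma length_ini: "length (ini xs r) \<le> sz xs"
  using length_le_sz[of "xs ! r" xs] by (auto simp: ini_def)

lemma runs_sh: "runs Q (sh b p) (glue b e s) u \<longleftrightarrow> (\<exists>t. u = glue b e t \<and> runs Q p s t)"
  unfolding runs_def using exec_sh1 exec_sh2 by metis

lemma runs_in_sh: "runs_in Q p s n t \<Longrightarrow> runs_in Q (sh b p) (glue b e s) n (glue b e t)"
  unfolding runs_in_def using exec_sh1 by metis

text \<open>The arguments are copied above \<open>b\<close>, the program runs on the copies, and
  every register it may have touched is erased. The erasure stays polynomial because a run cannot
  leave more new symbols than it has steps.\<close>

lemma Acc_Tst:
  assumes "Acc A a \<phi>" "length js = a" "\<forall>j\<in>set js. j < b"
  shows "Tst A b js \<phi>"
proof -
  from assms(1) obtain p g where acc: "acc_by p g A a \<phi>" unfolding Acc_def by blast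
  note p = acc_byD(2,3)[OF acc]
  obtain n0 where n0: "\<forall>R B. n0 \<le> R \<longrightarrow> n0 \<le> B \<longrightarrow> uses {..<R} B p" using ex_uses by blast
  define R where "R = n0 + a + 2"
  have u: "uses {..<R} R p" using n0 by (simp add: R_def)
  let ?rs = "[Suc b..<Suc b + R]"
  define q where "q = copies js b [0..<a] ;; (sh (Suc b) p ;; clears R ?rs)"
  define f where "f n = ((14 * n + 8) * a + 1) + (g n + (((R + 4) * (n + g n) + 4) * R + 1) + 1) + 1" for n
  have fin: "t r = []" "set (t r) \<subseteq> {..<R}" if "runs (Qo A) p (ini xs) t" "length xs = a" "r \<ge> R" for xs t r
  proof -
    show "t r = []" using runs_frame[OF that(1) u, of r] that by (simp add: ini_def R_def)
    then show "set (t r) \<subseteq> {..<R}" by simp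
  qed
  have sym: "set (t r) \<subseteq> {..<R}" if t: "runs (Qo A) p (ini xs) t" for xs t r
  proof -
    from t obtain n where "exec (Qo A) p (ini xs) n t" by (auto simp: runs_def)
    then show ?thesis by (rule exec_symbols[OF _ u]) (use ini_symbols in \<open>fastforce simp: R_def\<close>)
  qed
  have cl: "(\<lambda>r. if r \<in> set ?rs then [] else glue (Suc b) s t r) = s"
    if "runs (Qo A) p (ini xs) t" "length xs = a" "\<forall>r\<ge>b. s r = []" for xs t and s :: st
  proof
    fix r
    consider "r < Suc b" | "r \<in> set ?rs" | "r \<ge> Suc b + R" by fastforce
    then show "(if r \<in> set ?rs then [] else glue (Suc b) s t r) = s r"
      by cases (use that fin(1)[OF that(1,2), of "r - Suc b"] in \<open>auto simp: glue_def\<close>)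
  qed
  have cp: "runs (Qo A) (copies js b [0..<a]) s t \<longleftrightarrow> bits js s \<and>
     t = glue (Suc b) s (ini (args js s))" if "\<forall>r\<ge>b. s r = []" for s t
  proof -
    have 1: "\<forall>i\<in>set [0..<a]. js ! i < b" using assms(2,3) by simp
    have "s b = []" using that by simp
    have 2: "(\<forall>i\<in>set [0..<a]. set (s (js ! i)) \<subseteq> {0, 1}) \<longleftrightarrow> bits js s"
      using assms(2) by (auto simp: in_set_conv_nth Ball_def bits_def)
    show ?thesis unfolding runs_copies[where s = s, OF distinct_upt 1 \<open>s b = []\<close>] 2
      using copies_state[of js b s] assms that by (auto simp: bits_def args_def)
  qed
  show ?thesis
  proof (rule TstI[where p = q and f = f])
    show "pb f" unfolding f_def by (intro pb_intros acc_byD(1)[OF acc])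
  next
    fix s t assume s: "\<forall>r\<ge>b. s r = []" and r: "runs (Qo A) q s t"
    let ?xs = "args js s"
    from r obtain u where u: "bits js s" "runs (Qo A) (sh (Suc b) p) (glue (Suc b) s (ini ?xs)) u"
      "runs (Qo A) (clears R ?rs) u t" unfolding q_def runs_simps(7) cp[OF s] by auto
    from u(2) obtain v where v: "u = glue (Suc b) s v" "runs (Qo A) p (ini ?xs) v" unfolding runs_sh by blast
    have "t = s" using u(3) cl[OF v(2) _ s] assms(2) unfolding v(1) runs_clears by simp
    then show "t = s \<and> bits js s \<and> \<phi> ?xs" using u(1) p(1)[OF _ v(2)] assms(2) by (simp add: args_def)
  next
    fix s :: st assume s: "\<forall>r\<ge>b. s r = []" and bits: "bits js s"
      and ph: "\<phi> (args js s)"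
    let ?xs = "args js s" and ?n = "sz (args js s)"
    have n: "?n = sz ?xs" by simp
    have "\<exists>t. runs_in (Qo A) (copies js b [0..<a]) s ((14 * ?n + 8) * length [0..<a] + 1) t"
      by (rule runs_in_copies) (use s bits assms member_le_sz[of _ js s] in \<open>auto simp: bits_def\<close>)
    then obtain t0 where t0: "runs_in (Qo A) (copies js b [0..<a]) s ((14 * ?n + 8) * a + 1) t0" by auto
    have t0e: "t0 = glue (Suc b) s (ini ?xs)" using runs_in_runs[OF t0] unfolding cp[OF s] by simp
    obtain v where v: "runs_in (Qo A) p (ini ?xs) (g ?n) v" using p(2)[OF _ ph] assms(2) n by (auto simp: args_def)
    then have 2: "runs_in (Qo A) (sh (Suc b) p) t0 (g ?n) (glue (Suc b) s v)"
      unfolding t0e by (rule runs_in_sh)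
    have len: "length (v r) \<le> ?n + g ?n" for r
    proof -
      obtain k where k: "k \<le> g ?n" "exec (Qo A) p (ini ?xs) k v" using v by (auto simp: runs_in_def)
      show ?thesis using exec_length[OF k(2), of r] k(1) length_ini[of ?xs r] n by simp
    qed
    have "runs_in (Qo A) (clears R ?rs) (glue (Suc b) s v) (((R + 4) * (?n + g ?n) + 4) * R + 1) s"
    proof (rule runs_in_clears)
      fix r assume "r \<in> set ?rs"
      then have "glue (Suc b) s v r = v (r - Suc b)" by (auto simp: glue_def)
      then show "set (glue (Suc b) s v r) \<subseteq> {..<R} \<and> length (glue (Suc b) s v r) \<le> ?n + g ?n"
        using sym[OF runs_in_runs[OF v]] len by simp
    qed (use cl[OF runs_in_runs[OF v] _ s] assms(2) in \<open>simp_all add: args_def\<close>)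
    from runs_in_Seq[OF t0 runs_in_Seq[OF 2 this order_refl] order_refl]
    show "runs_in (Qo A) q s (f ?n) s" unfolding q_def f_def by simp
  qed
qed

lemma ini_eqs: "length xs \<le> r \<Longrightarrow> ini xs r = []" "j < length xs \<Longrightarrow> ini xs j = stk (xs ! j)"
  by (auto simp: ini_def)

text \<open>Arguments may be repeated in \<open>js\<close>, so the size seen by the test can exceed
  the size of the tuple, by a factor of at most \<open>length js\<close>.\<close>

lemma Tst_Acc:
  assumes "Tst A a js \<phi>" "\<forall>j\<in>set js. j < a"
  shows "Acc A a (\<lambda>xs. \<phi> (map ((!) xs) js))"
proof -
  from assms(1) obtain p g where tst: "tst_by p g A a js \<phi>" unfolding Tst_def by blast
  obtain d where d: "\<And>n. g n \<le> (n + 2) ^ d" using tst_byD(1)[OF tst] by (auto simp: pb_def)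
  have e: "args js (ini xs) = map ((!) xs) js" if "length xs = a" for xs
    using assms(2) that by (auto simp: ini_eqs args_def)
  have l: "sz (args js (ini xs)) \<le> length js * sz xs" for xs
    using sum_list_mono[of js "\<lambda>j. length (ini xs j)" "\<lambda>j. sz xs"] length_ini by (simp add: sum_list_triv sz_args)
  have b: "bits js (ini xs)" for xs using ini_symbols by (auto simp: bits_def)
  show ?thesis
  proof (rule AccI[where p = p and f = "\<lambda>n. (length js * n + 2) ^ d"])
    show "pb (\<lambda>n. (length js * n + 2) ^ d)" by (intro pb_intros)
    show "\<phi> (map ((!) xs) js)" if "length xs = a" "runs (Qo A) p (ini xs) t" for xs t
      using tst_byD(4)[OF tst _ that(2)] that(1) unfolding e[OF that(1)] by (simp add: ini_eqs)
    show "\<exists>t. runs_in (Qo A) p (ini xs) ((length js * sz xs + 2) ^ d) t" if "length xs = a" "\<phi> (map ((!) xs) js)" for xs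
    proof -
      have "runs_in (Qo A) p (ini xs) (g (sz (args js (ini xs)))) (ini xs)"
        by (rule tst_byD(5)[OF tst]) (use that b in \<open>simp_all add: e ini_eqs\<close>)
      moreover have "g (sz (args js (ini xs))) \<le> (length js * sz xs + 2) ^ d"
        by (rule order_trans[OF d], rule power_mono) (use l[of xs] in auto)
      ultimately show ?thesis by (meson runs_in_mono)
    qed
  qed
qed

text \<open>Covers permutation, duplication and dummy arguments at once; all later changes of
  variable order go through it.\<close>

lemma Acc_select: "Acc A a \<phi> \<Longrightarrow> length is = a \<Longrightarrow> \<forall>i\<in>set is. i < b \<Longrightarrow> Acc A b (\<lambda>xs. \<phi> (map ((!) xs) is))"
  by (rule Tst_Acc[OF Acc_Tst])

text \<open>Sequencing is conjunction because the first test hands its state on unchanged.\<close>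

lemma Tst_conj:
  assumes "Tst A b js \<phi>" "Tst A b js \<psi>"
  shows "Tst A b js (\<lambda>xs. \<phi> xs \<and> \<psi> xs)"
proof -
  from assms obtain p f q g where p: "tst_by p f A b js \<phi>" and q: "tst_by q g A b js \<psi>"
    unfolding Tst_def by blast
  show ?thesis
  proof (rule TstI[where p = "p ;; q" and f = "\<lambda>n. f n + g n + 1"])
    show "pb (\<lambda>n. f n + g n + 1)" by (intro pb_intros tst_byD(1)[OF p] tst_byD(1)[OF q])
  next
    fix s t assume s: "\<forall>r\<ge>b. s r = []" and r: "runs (Qo A) (p ;; q) s t"
    from r obtain u where u: "runs (Qo A) p s u" "runs (Qo A) q u t" unfolding runs_simps by (elim exE conjE)
    have us: "u = s" by (rule tst_byD(2)[OF p s u(1)])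
    note u2 = u(2)[unfolded us]
    show "t = s \<and> bits js s \<and> \<phi> (args js s) \<and> \<psi> (args js s)"
      by (intro conjI tst_byD(2)[OF q s u2] tst_byD(3)[OF p s u(1)] tst_byD(4)[OF p s u(1)] tst_byD(4)[OF q s u2])
  next
    fix s :: st assume a: "\<forall>r\<ge>b. s r = []" "bits js s" "\<phi> (args js s) \<and> \<psi> (args js s)"
    show "runs_in (Qo A) (p ;; q) s (f (sz (args js s)) + g (sz (args js s)) + 1) s"
      by (rule runs_in_Seq[OF tst_byD(5)[OF p a(1,2) conjunct1[OF a(3)]] tst_byD(5)[OF q a(1,2) conjunct2[OF a(3)]] order_refl])
  qed
qed

lemma Acc_Tst_id: "Acc A a \<phi> \<Longrightarrow> Tst A a [0..<a] \<phi>"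
  by (rule Acc_Tst) auto

lemma map_nth_id: "length xs = a \<Longrightarrow> map ((!) xs) [0..<a] = xs"
  by (metis map_nth)

lemma Acc_conj: "Acc A a \<phi> \<Longrightarrow> Acc A a \<psi> \<Longrightarrow> Acc A a (\<lambda>xs. \<phi> xs \<and> \<psi> xs)"
  by (rule Acc_cong[OF Tst_Acc[OF Tst_conj[OF Acc_Tst_id Acc_Tst_id]]]) (auto simp: map_nth_id)

lemma Acc_disj:
  assumes "Acc A a \<phi>" "Acc A a \<psi>"
  shows "Acc A a (\<lambda>xs. \<phi> xs \<or> \<psi> xs)"
proof -
  from assms obtain p f q g where p: "acc_by p f A a \<phi>" and q: "acc_by q g A a \<psi>"
    unfolding Acc_def by blast
  show ?thesis
  proof (rule AccI[where p = "Alt p q" and f = "\<lambda>n. f n + g n + 1"])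
    show "pb (\<lambda>n. f n + g n + 1)" by (intro pb_intros acc_byD(1)[OF p] acc_byD(1)[OF q])
    show "\<phi> xs \<or> \<psi> xs" if "length xs = a" "runs (Qo A) (Alt p q) (ini xs) t" for xs t
      using that(2) acc_byD(2)[OF p that(1)] acc_byD(2)[OF q that(1)] by auto
    show "\<exists>t. runs_in (Qo A) (Alt p q) (ini xs) (f (sz xs) + g (sz xs) + 1) t"
      if l: "length xs = a" and or: "\<phi> xs \<or> \<psi> xs" for xs
      using or
    proof
      assume "\<phi> xs"
      from acc_byD(3)[OF p l this] obtain t where "runs_in (Qo A) p (ini xs) (f (sz xs)) t" ..
      then have "runs_in (Qo A) (Alt p q) (ini xs) (f (sz xs) + g (sz xs) + 1) t" by (rule runs_in_Alt1) simp
      then show ?thesis by blast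
    next
      assume "\<psi> xs"
      from acc_byD(3)[OF q l this] obtain t where "runs_in (Qo A) q (ini xs) (g (sz xs)) t" ..
      then have "runs_in (Qo A) (Alt p q) (ini xs) (f (sz xs) + g (sz xs) + 1) t" by (rule runs_in_Alt2) simp
      then show ?thesis by blast
    qed
  qed
qed

lemma Acc_const: "Acc A a (\<lambda>_. c)"
proof -
  have "runs_in (Qo A) Skip (ini xs) 1 (ini xs)" for xs by (rule runs_in_prim) auto
  then show ?thesis
    by (rule_tac AccI[where p = "if c then Skip else Fail" and f = "\<lambda>_. 1"]) (auto intro: pb_const split: if_splits)
qed

definition guess :: "nat \<Rightarrow> prog" where
  "guess r = Star (Alt (Push r 0) (Push r 1))"

lemma runs_guess: "runs Q (guess r) s t \<longleftrightarrow> (\<exists>w. set w \<subseteq> {0, 1} \<and> t = s(r := w @ s r))"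
proof
  assume "runs Q (guess r) s t"
  then have "(runs Q (Alt (Push r 0) (Push r 1)))\<^sup>*\<^sup>* s t" by (simp add: guess_def runs_Star)
  then show "\<exists>w. set w \<subseteq> {0, 1} \<and> t = s(r := w @ s r)"
  proof (induction rule: rtranclp_induct)
    case base
    then show ?case by (intro exI[of _ "[]"]) auto
  next
    case (step t u)
    from step.IH obtain w where w: "set w \<subseteq> {0, 1}" "t = s(r := w @ s r)" by blast
    from step.hyps(2) obtain b where b: "b \<in> {0, 1}" "u = t(r := b # t r)" unfolding runs_simps by blast
    have "u = s(r := (b # w) @ s r)" unfolding b w by (rule ext) simp
    moreover have "set (b # w) \<subseteq> {0, 1}" using b w by auto
    ultimately show ?case by blast
  qed
next
  assume "\<exists>w. set w \<subseteq> {0, 1} \<and> t = s(r := w @ s r)"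
  then obtain w where w: "set w \<subseteq> {0, 1}" "t = s(r := w @ s r)" by blast
  have "(runs Q (Alt (Push r 0) (Push r 1)))\<^sup>*\<^sup>* s (s(r := w @ s r))" using w(1)
  proof (induction w)
    case (Cons b w)
    have "s(r := (b # w) @ s r) = (s(r := w @ s r))(r := b # (s(r := w @ s r)) r)" by (rule ext) simp
    moreover have "b = 0 \<or> b = 1" "set w \<subseteq> {0, 1}" using Cons.prems by auto
    ultimately have "runs Q (Alt (Push r 0) (Push r 1)) (s(r := w @ s r)) (s(r := (b # w) @ s r))"
      unfolding runs_simps by metis
    with Cons.IH[OF \<open>set w \<subseteq> {0, 1}\<close>] show ?case by (meson rtranclp.rtrancl_into_rtrancl)
  qed simp
  then show "runs Q (guess r) s t" using w(2) by (simp add: guess_def runs_Star)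
qed

lemma runs_in_guess: "set w \<subseteq> {0, 1} \<Longrightarrow> runs_in Q (guess r) s (3 * length w + 1) (s(r := w @ s r))"
proof (induction w arbitrary: s rule: rev_induct)
  case Nil
  show ?case unfolding guess_def by (rule runs_in_prim) auto
next
  case (snoc b w)
  have "runs_in Q (Alt (Push r 0) (Push r 1)) s 2 (s(r := b # s r))"
  proof (cases "b = 0")
    case True
    then show ?thesis by (auto intro!: runs_in_Alt1[where n = 1] runs_in_prim)
  next
    case False
    then show ?thesis using snoc.prems by (auto intro!: runs_in_Alt2[where n = 1] runs_in_prim)
  qed
  moreover have "runs_in Q (guess r) (s(r := b # s r)) (3 * length w + 1) (s(r := (w @ [b]) @ s r))"
  proof -
    have "(s(r := b # s r))(r := w @ (s(r := b # s r)) r) = s(r := (w @ [b]) @ s r)" by (rule ext) simp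
    then show ?thesis using snoc.IH[of "s(r := b # s r)"] snoc.prems by (simp del: fun_upd_apply)
  qed
  ultimately show ?case unfolding guess_def by (rule runs_in_Star) simp
qed

lemma ini_guess: "length xs = a \<Longrightarrow> (ini xs)(a := stk y) = ini (xs @ [y])"
  by (auto simp: ini_def fun_eq_iff nth_append less_Suc_eq)

text \<open>Overlong guesses do no harm to soundness; the bound on witnesses only ensures that a
  short run exists. The guess is made in the first free register, behind the given arguments, and a
  selection moves it to the front.\<close>

lemma Acc_ex:
  assumes "Acc A (Suc a) \<phi>" "pb f" "\<And>xs y. length xs = a \<Longrightarrow> \<phi> (y # xs) \<Longrightarrow> length y \<le> f (sz xs)"
  shows "Acc A a (\<lambda>xs. \<exists>y. \<phi> (y # xs))"
proof -
  have "Acc A (Suc a) (\<lambda>xs. \<phi> (map ((!) xs) (a # [0..<a])))"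
    by (rule Acc_select[OF assms(1)]) auto
  then obtain p g where acc: "acc_by p g A (Suc a) (\<lambda>xs. \<phi> (map ((!) xs) (a # [0..<a])))"
    unfolding Acc_def by blast
  note p' = acc_byD(2,3)[OF acc]
  obtain d where d: "\<And>n. g n \<le> (n + 2) ^ d" using acc_byD(1)[OF acc] by (auto simp: pb_def)
  have e: "map ((!) (xs @ [y])) (a # [0..<a]) = y # xs" if "length xs = a" for xs :: "bool list list" and y
    using that by (auto intro!: nth_equalityI simp: nth_append nth_Cons')
  have p: "\<phi> (y # xs)" if "length xs = a" "runs (Qo A) p (ini (xs @ [y])) t" for xs y t
    using p'(1)[OF _ that(2)] that(1) e[OF that(1)] by simp
  have p2: "\<exists>t. runs_in (Qo A) p (ini (xs @ [y])) ((sz xs + length y + 2) ^ d) t" if "length xs = a" "\<phi> (y # xs)" for xs y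
  proof -
    from p'(2)[of "xs @ [y]"] that e[OF that(1), of y]
    obtain t where "runs_in (Qo A) p (ini (xs @ [y])) (g (sz xs + length y)) t" by (auto simp: sz_def)
    then show ?thesis using d by (meson runs_in_mono)
  qed
  show ?thesis
  proof (rule AccI[where p = "guess a ;; p" and f = "\<lambda>n. (3 * f n + 1) + (n + f n + 2) ^ d + 1"])
    show "pb (\<lambda>n. (3 * f n + 1) + (n + f n + 2) ^ d + 1)" by (intro pb_intros assms(2))
  next
    fix xs t assume l: "length xs = a" and "runs (Qo A) (guess a ;; p) (ini xs) t"
    then obtain w where w: "set w \<subseteq> {0, 1}" "runs (Qo A) p ((ini xs)(a := w)) t"
      by (auto simp: runs_guess ini_eqs)
    have "runs (Qo A) p (ini (xs @ [wd w])) t"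
      using w(2) ini_guess[OF l, of "wd w"] by (simp add: stk_wd[OF w(1)])
    then show "\<exists>y. \<phi> (y # xs)" using p[OF l] by blast
  next
    fix xs assume l: "length xs = a" and "\<exists>y. \<phi> (y # xs)"
    then obtain y where y: "\<phi> (y # xs)" by blast
    have "runs_in (Qo A) (guess a) (ini xs) (3 * length (stk y) + 1) ((ini xs)(a := stk y @ ini xs a))"
      by (rule runs_in_guess) (rule stk_bits)
    then have 1: "runs_in (Qo A) (guess a) (ini xs) (3 * length y + 1) (ini (xs @ [y]))"
      using ini_guess[OF l, of y] l by (simp add: ini_eqs)
    obtain t where t: "runs_in (Qo A) p (ini (xs @ [y])) ((sz xs + length y + 2) ^ d) t" using p2[OF l y] by blast
    have ly: "length y \<le> f (sz xs)" using assms(3)[OF l y] .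
    have "runs_in (Qo A) (guess a ;; p) (ini xs) ((3 * f (sz xs) + 1) + (sz xs + f (sz xs) + 2) ^ d + 1) t"
      by (rule runs_in_Seq[OF 1 t]) (use ly power_mono[of "sz xs + length y + 2" "sz xs + f (sz xs) + 2" d] in simp)
    then show "\<exists>t. runs_in (Qo A) (guess a ;; p) (ini xs) ((3 * f (sz xs) + 1) + (sz xs + f (sz xs) + 2) ^ d + 1) t" by blast
  qed
qed

subsection \<open>Encoding tuples\<close>

text \<open>The encoding of a tuple need not be decodable by a program: programs guess the components and compare.\<close>

definition blk :: "nat list \<Rightarrow> nat list" where
  "blk w = concat (map (\<lambda>c. [1, c]) (rev w)) @ [0]"

definition encs :: "nat list list \<Rightarrow> nat list" where
  "encs ws = concat (map blk (rev ws))"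

definition enc :: "bool list list \<Rightarrow> bool list" where
  "enc xs = wd (encs (map stk xs))"

lemma encs_bits: "\<forall>w\<in>set ws. set w \<subseteq> {0, 1} \<Longrightarrow> set (encs ws) \<subseteq> {0, 1}"
  by (auto simp: encs_def blk_def)

lemma stk_enc: "stk (enc xs) = encs (map stk xs)"
  unfolding enc_def by (rule stk_wd, rule encs_bits) (use stk_bits in auto)

text \<open>Blocks are self-delimiting: a 1 announces each symbol and a 0 closes the block, so a
  block can be split off any continuation in one way only.\<close>

lemma blk_inj: "blk w @ u = blk w' @ u' \<Longrightarrow> w = w' \<and> u = u'"
proof -
  have "concat (map (\<lambda>c. [1, c]) v) @ [0] @ u = concat (map (\<lambda>c. [1, c]) v') @ [0] @ u' \<Longrightarrow> v = v' \<and> u = u'" for v v' :: "nat list"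
  proof (induction v arbitrary: v')
    case Nil
    then show ?case by (cases v') auto
  next
    case (Cons c v)
    then show ?case by (cases v') auto
  qed
  from this[of "rev w" "rev w'"] show "blk w @ u = blk w' @ u' \<Longrightarrow> w = w' \<and> u = u'" by (simp add: blk_def)
qed

lemma encs_inj: "length ws = length ws' \<Longrightarrow> encs ws = encs ws' \<Longrightarrow> ws = ws'"
proof -
  have "length vs = length vs' \<Longrightarrow> concat (map blk vs) = concat (map blk vs') \<Longrightarrow> vs = vs'" for vs vs'
    by (induction vs vs' rule: list_induct2) (auto dest: blk_inj)
  from this[of "rev ws" "rev ws'"] show "length ws = length ws' \<Longrightarrow> encs ws = encs ws' \<Longrightarrow> ws = ws'"
    by (simp add: encs_def)
qed

lemma stk_inj: "stk x = stk y \<Longrightarrow> x = y"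
  by (metis wd_stk)

lemma enc_inj: "length xs = length ys \<Longrightarrow> enc xs = enc ys \<Longrightarrow> xs = ys"
proof -
  assume l: "length xs = length ys" and "enc xs = enc ys"
  then have "encs (map stk xs) = encs (map stk ys)" by (metis stk_enc)
  then have "map stk xs = map stk ys" using l by (intro encs_inj) auto
  then show ?thesis by (metis inj_map_eq_map inj_on_def stk_inj)
qed

lemma length_enc: "length (enc xs) = 2 * sz xs + length xs"
proof -
  have "length (concat (map blk vs)) = 2 * sum_list (map length vs) + length vs" for vs
    by (induction vs) (auto simp: blk_def length_concat comp_def sum_list_triv)
  from this[of "rev (map stk xs)"] show ?thesis
    by (simp add: enc_def encs_def sz_def rev_map[symmetric] comp_def sum_list_rev flip: rev_map)
qed

definition pack1 :: "nat \<Rightarrow> nat \<Rightarrow> prog" where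
  "pack1 out r = Push out 0 ;; each [0, 1] r (\<lambda>c. Push out c ;; Push out 1)"

lemma runs_pack1: "r \<noteq> out \<Longrightarrow> runs Q (pack1 out r) s t \<longleftrightarrow> set (s r) \<subseteq> {0, 1} \<and> t = s(r := [], out := blk (s r) @ s out)"
proof -
  assume n: "r \<noteq> out"
  have *: "runs Q (each [0, 1] r (\<lambda>c. Push out c ;; Push out 1)) s t \<longleftrightarrow>
      set (s r) \<subseteq> {0, 1} \<and> t = s(r := [], out := concat (map (\<lambda>c. [1, c]) (rev (s r))) @ s out)" for s t
  proof (induction "s r" arbitrary: s)
    case Nil
    then show ?case by (auto simp: runs_each_Nil fun_upd_idem)
  next
    case (Cons a w)
    have "s r = a # w" using Cons by simp
    with Cons(1)[of "s(r := w, out := 1 # a # s out)"] show ?case using n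
      by (auto simp: runs_each_Cons fun_upd_twist)
  qed
  show ?thesis unfolding pack1_def runs_simps(7) runs_simps(3) * using n by (auto simp: blk_def fun_upd_twist)
qed

lemma runs_in_pack1: "r \<noteq> out \<Longrightarrow> set (s r) \<subseteq> {0, 1} \<Longrightarrow> runs_in Q (pack1 out r) s (8 * length (s r) + 5) (s(r := [], out := blk (s r) @ s out))"
proof -
  assume n: "r \<noteq> out" and b: "set (s r) \<subseteq> {0, 1}"
  have *: "set (s r) \<subseteq> {0, 1} \<Longrightarrow> runs_in Q (each [0, 1] r (\<lambda>c. Push out c ;; Push out 1)) s (8 * length (s r) + 3)
      (s(r := [], out := concat (map (\<lambda>c. [1, c]) (rev (s r))) @ s out))" for s
  proof (induction "s r" arbitrary: s)
    case Nil
    then show ?case by (auto intro!: runs_in_each_Nil simp: fun_upd_idem)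
  next
    case (Cons a w)
    have [simp]: "s r = a # w" using Cons by simp
    let ?u = "s(r := w, out := 1 # a # s out)"
    show ?case
    proof (rule runs_in_each_Cons)
      show "runs_in Q (Push out a ;; Push out 1) (s(r := w)) 3 ?u"
        using n by (intro runs_in_Seq[where n = 1 and m = 1] runs_in_prim) auto
      have "runs_in Q (each [0, 1] r (\<lambda>c. Push out c ;; Push out 1)) ?u (8 * length (?u r) + 3)
         (?u(r := [], out := concat (map (\<lambda>c. [1, c]) (rev (?u r))) @ ?u out))"
        by (rule Cons.hyps(1)) (use Cons.prems n in auto)
      moreover have "?u(r := [], out := concat (map (\<lambda>c. [1, c]) (rev (?u r))) @ ?u out) =
         s(r := [], out := concat (map (\<lambda>c. [1, c]) (rev (s r))) @ s out)"
        using n by (auto simp: fun_eq_iff)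
      ultimately show "runs_in Q (each [0, 1] r (\<lambda>c. Push out c ;; Push out 1)) ?u (8 * length w + 3)
         (s(r := [], out := concat (map (\<lambda>c. [1, c]) (rev (s r))) @ s out))" using n by simp
    qed (use Cons.prems in auto)
  qed
  let ?s = "s(out := 0 # s out)"
  have 1: "runs_in Q (Push out 0) s 1 ?s" by (rule runs_in_prim) auto
  have "runs_in Q (each [0, 1] r (\<lambda>c. Push out c ;; Push out 1)) ?s (8 * length (?s r) + 3)
      (?s(r := [], out := concat (map (\<lambda>c. [1, c]) (rev (?s r))) @ ?s out))"
    by (rule *) (use b n in auto)
  moreover have "?s(r := [], out := concat (map (\<lambda>c. [1, c]) (rev (?s r))) @ ?s out) = s(r := [], out := blk (s r) @ s out)"
    using n by (auto simp: fun_eq_iff blk_def)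
  ultimately have "runs_in Q (each [0, 1] r (\<lambda>c. Push out c ;; Push out 1)) ?s (8 * length (s r) + 3) (s(r := [], out := blk (s r) @ s out))"
    using n by simp
  with 1 show ?thesis unfolding pack1_def by (rule runs_in_Seq) simp
qed

definition pack :: "nat \<Rightarrow> nat list \<Rightarrow> prog" where
  "pack out rs = seqs (map (pack1 out) rs)"

lemma runs_pack: "distinct rs \<Longrightarrow> out \<notin> set rs \<Longrightarrow> runs Q (pack out rs) s t \<longleftrightarrow> (\<forall>r\<in>set rs. set (s r) \<subseteq> {0, 1}) \<and>
    t = (\<lambda>r. if r \<in> set rs then [] else if r = out then encs (map s rs) @ s out else s r)"
proof (induction rs arbitrary: s)
  case Nil
  then show ?case by (auto simp: pack_def seqs_simps encs_def)
next
  case (Cons r rs)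
  let ?s = "s(r := [], out := blk (s r) @ s out)"
  have n: "r \<noteq> out" using Cons.prems by auto
  have m: "map ?s rs = map s rs" using Cons.prems by auto
  have st: "(\<lambda>x. if x \<in> set rs then [] else if x = out then encs (map ?s rs) @ ?s out else ?s x) =
    (\<lambda>x. if x \<in> set (r # rs) then [] else if x = out then encs (map s (r # rs)) @ s out else s x)"
    unfolding m using n by (auto simp: fun_eq_iff encs_def)
  have "runs Q (pack out (r # rs)) s t \<longleftrightarrow> set (s r) \<subseteq> {0, 1} \<and> runs Q (pack out rs) ?s t"
    unfolding pack_def list.map seqs_simps runs_simps(7) runs_pack1[OF n] by auto
  also have "runs Q (pack out rs) ?s t \<longleftrightarrow> (\<forall>r\<in>set rs. set (?s r) \<subseteq> {0, 1}) \<and>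
    t = (\<lambda>x. if x \<in> set rs then [] else if x = out then encs (map ?s rs) @ ?s out else ?s x)"
    by (rule Cons.IH) (use Cons.prems in auto)
  finally show ?case unfolding st using Cons.prems by auto
qed

lemma runs_in_pack: "distinct rs \<Longrightarrow> out \<notin> set rs \<Longrightarrow> \<forall>r\<in>set rs. set (s r) \<subseteq> {0, 1} \<and> length (s r) \<le> W \<Longrightarrow>
    \<exists>t. runs_in Q (pack out rs) s ((8 * W + 6) * length rs + 1) t"
proof (induction rs arbitrary: s)
  case Nil
  have "runs_in Q Skip s 1 s" by (rule runs_in_prim) auto
  then show ?case by (auto simp: pack_def seqs_simps)
next
  case (Cons r rs)
  let ?s = "s(r := [], out := blk (s r) @ s out)"
  have 1: "runs_in Q (pack1 out r) s (8 * length (s r) + 5) ?s" by (rule runs_in_pack1) (use Cons.prems in auto)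
  have "\<exists>t. runs_in Q (pack out rs) ?s ((8 * W + 6) * length rs + 1) t"
    by (rule Cons.IH) (use Cons.prems in auto)
  then obtain t where t: "runs_in Q (pack out rs) ?s ((8 * W + 6) * length rs + 1) t" by blast
  have "runs_in Q (pack out (r # rs)) s ((8 * W + 6) * length (r # rs) + 1) t"
    unfolding pack_def list.map seqs_simps by (rule runs_in_Seq[OF 1 t[unfolded pack_def]]) (use Cons.prems in simp)
  then show ?case by blast
qed

lemma pack_ini:
  assumes "length xs = a"
  shows "runs Q (pack a [0..<a]) (ini xs) t \<longleftrightarrow> t = glue a (\<lambda>_. []) (ini [enc xs])"
    "runs_in Q (pack a [0..<a]) (ini xs) ((8 * sz xs + 6) * a + 1) (glue a (\<lambda>_. []) (ini [enc xs]))"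
proof -
  have "map (ini xs) [0..<a] = map stk xs" using assms by (auto intro!: nth_equalityI simp: ini_eqs)
  then have e: "(\<lambda>r. if r \<in> set [0..<a] then [] else if r = a then encs (map (ini xs) [0..<a]) @ ini xs a else ini xs r)
    = glue a (\<lambda>_. []) (ini [enc xs])"
    using assms by (auto simp: fun_eq_iff glue_def ini_eqs stk_enc ini_def)
  show *: "runs Q (pack a [0..<a]) (ini xs) t \<longleftrightarrow> t = glue a (\<lambda>_. []) (ini [enc xs])" for t
    using ini_symbols[of xs] by (subst runs_pack) (simp_all add: e[simplified])
  have "\<exists>t. runs_in Q (pack a [0..<a]) (ini xs) ((8 * sz xs + 6) * length [0..<a] + 1) t"
    by (rule runs_in_pack) (use ini_symbols length_ini in auto)
  then show "runs_in Q (pack a [0..<a]) (ini xs) ((8 * sz xs + 6) * a + 1) (glue a (\<lambda>_. []) (ini [enc xs]))"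
    using * runs_in_runs by fastforce
qed

text \<open>The encoding is computed into the first register behind the arguments, and the program
  for \<open>P\<close>, shifted there, runs on it.\<close>

lemma Acc_enc:
  assumes "Acc A 1 (\<lambda>xs. P (xs ! 0))"
  shows "Acc A a (\<lambda>xs. P (enc xs))"
proof -
  from assms obtain p g where acc: "acc_by p g A 1 (\<lambda>xs. P (xs ! 0))" unfolding Acc_def by blast
  obtain d where d: "\<And>n. g n \<le> (n + 2) ^ d" using acc_byD(1)[OF acc] by (auto simp: pb_def)
  have p: "P x" if "runs (Qo A) p (ini [x]) t" for x t
    using acc_byD(2)[OF acc _ that] by simp
  have p2: "\<exists>t. runs_in (Qo A) p (ini [x]) ((length x + 2) ^ d) t" if "P x" for x
    using acc_byD(3)[OF acc, of "[x]"] that d[of "length x"] by (auto simp: sz_def dest: runs_in_mono)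
  show ?thesis
  proof (rule AccI[where p = "pack a [0..<a] ;; sh a p" and f = "\<lambda>n. ((8 * n + 6) * a + 1) + (2 * n + a + 2) ^ d + 1"])
    show "pb (\<lambda>n. ((8 * n + 6) * a + 1) + (2 * n + a + 2) ^ d + 1)" by (intro pb_intros)
  next
    fix xs t assume "length xs = a" "runs (Qo A) (pack a [0..<a] ;; sh a p) (ini xs) t"
    then show "P (enc xs)" using p by (auto simp: pack_ini runs_sh)
  next
    fix xs assume l: "length xs = a" and "P (enc xs)"
    then obtain t where "runs_in (Qo A) p (ini [enc xs]) ((length (enc xs) + 2) ^ d) t" using p2 by blast
    then have "runs_in (Qo A) (sh a p) (glue a (\<lambda>_. []) (ini [enc xs])) ((2 * sz xs + a + 2) ^ d) (glue a (\<lambda>_. []) t)"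
      using runs_in_sh l by (simp add: length_enc)
    from runs_in_Seq[OF pack_ini(2)[OF l] this order_refl]
    show "\<exists>t. runs_in (Qo A) (pack a [0..<a] ;; sh a p) (ini xs) (((8 * sz xs + 6) * a + 1) + (2 * sz xs + a + 2) ^ d + 1) t" by blast
  qed
qed

lemma Acc_oracle: "Acc A 1 (\<lambda>xs. (xs ! 0 \<in> A) = b)"
proof (rule AccI[where p = "Query 0 b" and f = "\<lambda>_. 1"])
  show "\<exists>t. runs_in (Qo A) (Query 0 b) (ini xs) 1 t" if "length xs = 1" "(xs ! 0 \<in> A) = b" for xs
  proof -
    have "runs_in (Qo A) (Query 0 b) (ini xs) 1 (ini xs)"
      using that stk_bits[of "xs ! 0"] by (intro runs_in_prim) (auto simp: ini_def Qo_def)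
    then show ?thesis by blast
  qed
qed (auto simp: ini_def Qo_def pb_const)

text \<open>The bridge between machines and programs: from here on Turing machines are no longer
  needed for oracle classes.\<close>

lemma NP_oracle_iff: "L \<in> NP_oracle A \<longleftrightarrow> Acc A 1 (\<lambda>xs. xs ! 0 \<in> L)"
proof
  assume "L \<in> NP_oracle A"
  then obtain p d where p: "\<And>x t. runs (Qo A) p (ini [x]) t \<Longrightarrow> x \<in> L"
    "\<And>x. x \<in> L \<Longrightarrow> \<exists>t. runs_in (Qo A) p (ini [x]) ((length x + 2) ^ d) t" using NP_prog by blast
  show "Acc A 1 (\<lambda>xs. xs ! 0 \<in> L)"
  proof (rule AccI[where p = p and f = "\<lambda>n. (n + 2) ^ d"])
    show "pb (\<lambda>n. (n + 2) ^ d)" by (intro pb_intros)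
    fix xs :: "bool list list" assume "length xs = 1"
    then obtain x where [simp]: "xs = [x]" by (auto simp: length_Suc_conv)
    show "xs ! 0 \<in> L" if "runs (Qo A) p (ini xs) t" for t using that p(1)[of x t] by simp
    show "\<exists>t. runs_in (Qo A) p (ini xs) ((sz xs + 2) ^ d) t" if "xs ! 0 \<in> L" using that p(2)[of x] by (simp add: sz_def)
  qed
next
  assume "Acc A 1 (\<lambda>xs. xs ! 0 \<in> L)"
  then obtain p f where acc: "acc_by p f A 1 (\<lambda>xs. xs ! 0 \<in> L)" unfolding Acc_def by blast
  obtain d where d: "\<And>n. f n \<le> (n + 2) ^ d" using acc_byD(1)[OF acc] by (auto simp: pb_def)
  obtain L' where L': "L' \<in> NP_oracle A" "\<And>x. x \<in> L' \<Longrightarrow> \<exists>t. runs (Qo A) p (ini [x]) t"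
    "\<And>x t. runs_in (Qo A) p (ini [x]) ((length x + 2) ^ d) t \<Longrightarrow> x \<in> L'" using prog_NP[of A p d] by blast
  have "x \<in> L' \<longleftrightarrow> x \<in> L" for x
  proof
    assume "x \<in> L'"
    then obtain t where "runs (Qo A) p (ini [x]) t" using L'(2) by blast
    then show "x \<in> L" using acc_byD(2)[OF acc, of "[x]"] by simp
  next
    assume "x \<in> L"
    then obtain t where "runs_in (Qo A) p (ini [x]) (f (length x)) t"
      using acc_byD(3)[OF acc, of "[x]"] by (auto simp: sz_def)
    then have "runs_in (Qo A) p (ini [x]) ((length x + 2) ^ d) t" using d by (rule runs_in_mono)
    then show "x \<in> L'" by (rule L'(3))
  qed
  then have "L' = L" by blast
  then show "L \<in> NP_oracle A" using L'(1) by simp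
qed

lemma guesses_sound: "runs Q (seqs (map guess is)) s t \<Longrightarrow>
    (\<forall>r. r \<notin> set is \<longrightarrow> t r = s r) \<and> (\<forall>r. set (s r) \<subseteq> {0, 1} \<longrightarrow> set (t r) \<subseteq> {0, 1})"
proof (induction "is" arbitrary: s)
  case Nil
  then show ?case by (simp add: seqs_simps)
next
  case (Cons i "is")
  then obtain u where u: "runs Q (guess i) s u" "runs Q (seqs (map guess is)) u t" by (auto simp: seqs_simps)
  obtain w where w: "set w \<subseteq> {0, 1}" "u = s(i := w @ s i)" using u(1) unfolding runs_guess by blast
  show ?case using Cons.IH[OF u(2)] w by (auto split: if_splits)
qed

lemma guesses_complete: "distinct is \<Longrightarrow> \<forall>i\<in>set is. s i = [] \<and> set (w i) \<subseteq> {0, 1} \<and> length (w i) \<le> W \<Longrightarrow>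
    runs_in Q (seqs (map guess is)) s ((3 * W + 2) * length is + 1) (\<lambda>r. if r \<in> set is then w r else s r)"
proof (induction "is" arbitrary: s)
  case Nil
  then show ?case by (auto simp: seqs_simps intro!: runs_in_prim)
next
  case (Cons i "is")
  have 1: "runs_in Q (guess i) s (3 * length (w i) + 1) (s(i := w i @ s i))"
    by (rule runs_in_guess) (use Cons.prems in auto)
  have 2: "runs_in Q (seqs (map guess is)) (s(i := w i)) ((3 * W + 2) * length is + 1)
      (\<lambda>r. if r \<in> set is then w r else (s(i := w i)) r)"
    by (rule Cons.IH) (use Cons.prems in auto)
  have e1: "s(i := w i @ s i) = s(i := w i)" using Cons.prems by simp
  have e2: "(\<lambda>r. if r \<in> set is then w r else (s(i := w i)) r) = (\<lambda>r. if r \<in> set (i # is) then w r else s r)"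
    by auto
  show ?case unfolding list.map seqs_simps
    by (rule runs_in_Seq[OF 1[unfolded e1] 2[unfolded e2]]) (use Cons.prems in simp)
qed

definition compare :: "nat \<Rightarrow> nat \<Rightarrow> prog" where
  "compare r u = each [0, 1] r (\<lambda>c. Pop u c)"

lemma runs_compare: "r \<noteq> u \<Longrightarrow> runs Q (compare r u) s t \<longleftrightarrow>
    set (s r) \<subseteq> {0, 1} \<and> (\<exists>v. s u = s r @ v \<and> t = s(r := [], u := v))"
  unfolding compare_def
proof (induction "s r" arbitrary: s)
  case Nil
  then have "s(r := [], u := s u) = s" by (simp add: fun_upd_idem)
  then show ?case using Nil by (auto simp: runs_each_Nil)
next
  case (Cons c w)
  have r: "s r = c # w" using Cons by simp
  have IH: "runs Q (each [0, 1] r (Pop u)) (s(r := w, u := x)) t \<longleftrightarrow>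
     set w \<subseteq> {0, 1} \<and> (\<exists>v. x = w @ v \<and> t = s(r := [], u := v))" for x
    using Cons(1)[of "s(r := w, u := x)"] Cons(3) by (simp add: fun_upd_twist)
  have "runs Q (each [0, 1] r (Pop u)) s t \<longleftrightarrow>
      c \<in> {0, 1} \<and> (\<exists>x. s u = c # x \<and> runs Q (each [0, 1] r (Pop u)) (s(r := w, u := x)) t)"
    unfolding runs_each_Cons[of s r c w, OF r] using Cons(3) by auto
  then show ?case unfolding IH using r by auto
qed

lemma runs_in_compare: "r \<noteq> u \<Longrightarrow> set (s r) \<subseteq> {0, 1} \<Longrightarrow> s u = s r @ v \<Longrightarrow>
    runs_in Q (compare r u) s (6 * length (s r) + 3) (s(r := [], u := v))"
  unfolding compare_def
proof (induction "s r" arbitrary: s)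
  case Nil
  then have "s(r := [], u := v) = s" by (auto simp: fun_eq_iff)
  then show ?case using Nil by (auto intro!: runs_in_each_Nil)
next
  case (Cons c w)
  have r: "s r = c # w" using Cons by simp
  let ?u = "s(r := w, u := w @ v)"
  show ?case
  proof (rule runs_in_each_Cons[of s r c w, OF r])
    show "runs_in Q (Pop u c) (s(r := w)) 1 ?u"
      using Cons.prems r by (intro runs_in_prim) auto
    have "runs_in Q (each [0, 1] r (Pop u)) ?u (6 * length (?u r) + 3) (?u(r := [], u := v))"
      by (rule Cons.hyps(1)) (use Cons.prems r in auto)
    moreover have "?u(r := [], u := v) = s(r := [], u := v)" by (auto simp: fun_eq_iff)
    ultimately show "runs_in Q (each [0, 1] r (Pop u)) ?u (6 * length w + 3) (s(r := [], u := v))"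
      using Cons.prems by simp
  qed (use Cons.prems r in auto)
qed

text \<open>The clock may cut off long runs, so \<open>L\<close> is only determined between the tuples with a short run and those with some run.\<close>

lemma clock_enc:
  "\<exists>L\<in>NP_oracle A. (\<forall>z\<in>L. \<exists>xs t. length xs = a \<and> z = enc xs \<and> runs (Qo A) p (ini xs) t) \<and>
    (\<forall>xs t. length xs = a \<longrightarrow> runs_in (Qo A) p (ini xs) ((sz xs + 2) ^ d) t \<longrightarrow> enc xs \<in> L)"
proof -
  \<comment> \<open>Register 0 holds the encoded word, 1 to \<open>a\<close> the guessed components,
    \<open>Suc a\<close> their encoding, and \<open>?b\<close> is scratch for copying. The copies on
    which \<open>p\<close> works start at \<open>Suc ?b\<close>.\<close>
  let ?js = "[1..<Suc a]" and ?b = "a + 2"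
  define G where "G = seqs (map guess ?js)"
  define C where "C = copies ?js ?b [0..<a]"
  define P where "P = pack (Suc a) ?js"
  define E where "E = compare 0 (Suc a) ;; IsNil (Suc a)"
  \<comment> \<open>Packing consumes the guessed components, hence they are copied before. Once the
    comparison has succeeded, all registers up to \<open>?b\<close> are empty again.\<close>
  define q where "q = G ;; (C ;; (P ;; (E ;; sh (Suc ?b) p)))"
  have l: "length ?js = a" by simp
  have js: "\<forall>j\<in>set ?js. j < ?b" by auto
  have jsi: "\<forall>i\<in>set [0..<a]. ?js ! i < ?b" by (auto simp del: upt_Suc)
  have jsb: "(\<forall>i\<in>set [0..<a]. set (s (?js ! i)) \<subseteq> {0, 1}) \<longleftrightarrow> (\<forall>j\<in>set ?js. set (s j) \<subseteq> {0, 1})" for s :: st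
  proof -
    have "set ?js = (\<lambda>i. ?js ! i) ` set [0..<a]" using map_nth[of ?js] l by (metis set_map)
    then show ?thesis by (simp only: ball_simps)
  qed
  have Cs: "runs (Qo A) C s t \<longleftrightarrow> t = glue (Suc ?b) s (ini (args ?js s))"
    if "\<forall>j\<in>set ?js. set (s j) \<subseteq> {0, 1}" "\<forall>r\<ge>?b. s r = []" for s t
  proof -
    have sb: "s ?b = []" using that by simp
    have c: "\<forall>j\<in>set ?js. j < ?b \<and> set (s j) \<subseteq> {0, 1}" using that js by blast
    show ?thesis unfolding C_def runs_copies[where s = s, OF distinct_upt jsi sb] jsb
      using copies_state[OF c that(2)] that(1) unfolding l args_def by simp
  qed
  have Ps: "runs (Qo A) P (glue (Suc ?b) s e) t \<longleftrightarrow>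
     t = (\<lambda>r. if r \<in> set ?js then [] else if r = Suc a then encs (map s ?js) else glue (Suc ?b) s e r)"
    if "\<forall>j\<in>set ?js. set (s j) \<subseteq> {0, 1}" "\<forall>r>a. s r = []" for s e t
  proof -
    have m: "map (glue (Suc ?b) s e) ?js = map s ?js" by (auto simp: glue_def)
    have b: "\<forall>r\<in>set ?js. set (glue (Suc ?b) s e r) \<subseteq> {0, 1}" using that(1) by (auto simp: glue_def)
    have z: "glue (Suc ?b) s e (Suc a) = []" using that(2) by (auto simp: glue_def)
    have n: "Suc a \<notin> set ?js" by auto
    show ?thesis unfolding P_def runs_pack[OF distinct_upt n] m z append_Nil2 using b by blast
  qed
  have st: "(\<lambda>r. if r \<in> set ?js then [] else if r = Suc a then v else glue (Suc ?b) s e r)(0 := [], Suc a := []) =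
      glue (Suc ?b) (\<lambda>_. []) e" if "\<forall>r>a. s r = []" for s e v
  proof
    fix r
    consider "r = 0" | "r \<in> set ?js" | "r = Suc a" | "r = ?b" | "r \<ge> Suc ?b" by fastforce
    then show "((\<lambda>r. if r \<in> set ?js then [] else if r = Suc a then v else glue (Suc ?b) s e r)(0 := [], Suc a := [])) r =
      glue (Suc ?b) (\<lambda>_. []) e r" by cases (use that in \<open>auto simp: glue_def\<close>)
  qed
  have ms: "map s ?js = map stk (args ?js s)" if "\<forall>j\<in>set ?js. set (s j) \<subseteq> {0, 1}" for s
    using that by (auto simp: args_def stk_wd simp del: upt_Suc)
  have sound: "\<exists>xs t. length xs = a \<and> z = enc xs \<and> runs (Qo A) p (ini xs) t" if r: "runs (Qo A) q (ini [z]) t" for z t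
  proof -
    from r obtain s1 s2 s3 s4 where s: "runs (Qo A) G (ini [z]) s1" "runs (Qo A) C s1 s2" "runs (Qo A) P s2 s3"
      "runs (Qo A) E s3 s4" "runs (Qo A) (sh (Suc ?b) p) s4 t" unfolding q_def runs_simps by blast
    from guesses_sound[OF s(1)[unfolded G_def]] have g: "\<forall>r. r \<notin> set ?js \<longrightarrow> s1 r = ini [z] r"
      "\<forall>r. set (s1 r) \<subseteq> {0, 1}" using ini_symbols by blast+
    have b1: "\<forall>j\<in>set ?js. set (s1 j) \<subseteq> {0, 1}" using g(2) by blast
    have e1: "\<forall>r>a. s1 r = []" using g(1) by (auto simp: ini_def)
    then have e1': "\<forall>r\<ge>?b. s1 r = []" by simp
    let ?xs = "args ?js s1"
    note s2 = s(2)[unfolded Cs[OF b1 e1']]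
    note s3 = s(3)[unfolded s2 Ps[OF b1 e1]]
    have z: "s3 0 = stk z" using g(1) by (auto simp: s3 glue_def ini_def)
    have o: "s3 (Suc a) = stk (enc ?xs)" unfolding stk_enc ms[OF b1, symmetric] by (simp add: s3)
    from s(4) obtain v where v: "s3 (Suc a) = s3 0 @ v" "s4 = s3(0 := [], Suc a := v)" "v = []"
      unfolding E_def runs_simps runs_compare[OF Zero_not_Suc] by auto
    have "stk z = stk (enc ?xs)" using v z o by simp
    then have ze: "z = enc ?xs" by (rule stk_inj)
    have s4: "s4 = glue (Suc ?b) (\<lambda>_. []) (ini ?xs)" unfolding v(2,3) s3 by (rule st[OF e1])
    have "\<exists>t'. runs (Qo A) p (ini ?xs) t'" using s(5) unfolding s4 runs_sh by blast
    moreover have "length ?xs = a" using l by (simp only: length_args)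
    ultimately show ?thesis using ze by blast
  qed
  define cost where "cost n = ((3 * n + 2) * a + 1) + (((14 * n + 8) * a + 1) + (((8 * n + 6) * a + 1) +
     ((6 * (2 * n + a) + 3 + 1 + 1) + (n + 2) ^ d + 1) + 1) + 1) + 1" for n
  have complete: "\<exists>t. runs_in (Qo A) q (ini [enc xs]) (cost (sz xs)) t"
    if xs: "length xs = a" and r: "runs_in (Qo A) p (ini xs) ((sz xs + 2) ^ d) t" for xs t
  proof -
    let ?n = "sz xs" and ?z = "enc xs"
    define s1 where "s1 r = (if r \<in> set ?js then stk (xs ! (r - 1)) else ini [?z] r)" for r
    have len: "length (xs ! (r - 1)) \<le> ?n" if "r \<in> set ?js" for r
      using length_le_sz[of "xs ! (r - 1)" xs] that xs by auto
    have i0: "\<forall>i\<in>set ?js. ini [?z] i = [] \<and> set (stk (xs ! (i - 1))) \<subseteq> {0, 1} \<and> length (stk (xs ! (i - 1))) \<le> ?n"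
      using len stk_bits by (auto simp: ini_def simp del: upt_Suc)
    have 1: "runs_in (Qo A) G (ini [?z]) ((3 * ?n + 2) * a + 1) s1"
      using guesses_complete[OF distinct_upt i0] unfolding G_def s1_def l by simp
    have b1: "\<forall>j\<in>set ?js. set (s1 j) \<subseteq> {0, 1}" using stk_bits by (simp add: s1_def del: upt_Suc)
    have e1: "\<forall>r>a. s1 r = []" by (auto simp: s1_def ini_def)
    then have e1': "\<forall>r\<ge>?b. s1 r = []" by simp
    have "args ?js s1 ! i = xs ! i" if "i < a" for i
    proof -
      have "?js ! i = Suc i" using that by (simp del: upt_Suc)
      then show ?thesis using that by (simp add: args_def s1_def del: upt_Suc)
    qed
    then have ax: "args ?js s1 = xs" using xs by (intro nth_equalityI) (simp_all del: upt_Suc)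
    have "\<exists>t. runs_in (Qo A) C s1 ((14 * ?n + 8) * length [0..<a] + 1) t" unfolding C_def
    proof (rule runs_in_copies[OF distinct_upt jsi])
      show "\<forall>i\<in>set [0..<a]. set (s1 (?js ! i)) \<subseteq> {0, 1} \<and> length (s1 (?js ! i)) \<le> ?n"
      proof
        fix i assume "i \<in> set [0..<a]"
        then have "?js ! i \<in> set ?js" using l by (metis atLeastLessThan_iff nth_mem set_upt)
        then show "set (s1 (?js ! i)) \<subseteq> {0, 1} \<and> length (s1 (?js ! i)) \<le> ?n"
          using b1 len by (simp add: s1_def del: upt_Suc)
      qed
    qed (use e1' in simp)
    then obtain s2 where 2: "runs_in (Qo A) C s1 ((14 * ?n + 8) * a + 1) s2" by auto
    note s2 = runs_in_runs[OF 2, unfolded Cs[OF b1 e1'] ax]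
    have "\<exists>t. runs_in (Qo A) P s2 ((8 * ?n + 6) * length ?js + 1) t" unfolding P_def
    proof (rule runs_in_pack[OF distinct_upt])
      show "\<forall>r\<in>set ?js. set (s2 r) \<subseteq> {0, 1} \<and> length (s2 r) \<le> ?n"
      proof
        fix r assume r: "r \<in> set ?js"
        then have "s2 r = s1 r" by (auto simp: s2 glue_def)
        then show "set (s2 r) \<subseteq> {0, 1} \<and> length (s2 r) \<le> ?n" using b1 len r by (simp add: s1_def del: upt_Suc)
      qed
    qed auto
    then obtain s3 where 3: "runs_in (Qo A) P s2 ((8 * ?n + 6) * a + 1) s3" unfolding l by blast
    note s3 = runs_in_runs[OF 3, unfolded s2 Ps[OF b1 e1]]
    have z: "s3 0 = stk ?z" by (auto simp: s3 glue_def s1_def ini_def)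
    have o: "s3 (Suc a) = stk ?z" unfolding stk_enc using ms[OF b1] ax by (simp add: s3 del: upt_Suc)
    have s4: "s3(0 := [], Suc a := []) = glue (Suc ?b) (\<lambda>_. []) (ini xs)" unfolding s3 by (rule st[OF e1])
    have "runs_in (Qo A) (compare 0 (Suc a)) s3 (6 * length (s3 0) + 3) (s3(0 := [], Suc a := []))"
      by (rule runs_in_compare) (use z o stk_bits in auto)
    then have "runs_in (Qo A) (compare 0 (Suc a)) s3 (6 * (2 * ?n + a) + 3) (s3(0 := [], Suc a := []))"
      using z xs by (simp add: length_enc)
    moreover have "runs_in (Qo A) (IsNil (Suc a)) (s3(0 := [], Suc a := [])) 1 (s3(0 := [], Suc a := []))"
      by (rule runs_in_prim) auto
    ultimately have 4: "runs_in (Qo A) E s3 (6 * (2 * ?n + a) + 3 + 1 + 1) (glue (Suc ?b) (\<lambda>_. []) (ini xs))"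
      unfolding E_def s4 by (rule runs_in_Seq) simp
    note 5 = runs_in_sh[OF r, of "Suc ?b" "\<lambda>_. []"]
    have "runs_in (Qo A) q (ini [enc xs]) (cost ?n) (glue (Suc ?b) (\<lambda>_. []) t)" unfolding q_def cost_def
      by (rule runs_in_Seq[OF 1 runs_in_Seq[OF 2 runs_in_Seq[OF 3 runs_in_Seq[OF 4 5 order_refl] order_refl] order_refl] order_refl])
    then show ?thesis by blast
  qed
  have "pb cost" unfolding cost_def by (intro pb_intros)
  then obtain D where D: "\<And>n. cost n \<le> (n + 2) ^ D" by (auto simp: pb_def)
  obtain L where L: "L \<in> NP_oracle A" "\<And>z. z \<in> L \<Longrightarrow> \<exists>t. runs (Qo A) q (ini [z]) t"
    "\<And>z t. runs_in (Qo A) q (ini [z]) ((length z + 2) ^ D) t \<Longrightarrow> z \<in> L" using prog_NP[of A q D] by blast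
  have mem: "enc xs \<in> L" if xs: "length xs = a" and r: "runs_in (Qo A) p (ini xs) ((sz xs + 2) ^ d) t" for xs t
  proof -
    obtain t' where t': "runs_in (Qo A) q (ini [enc xs]) (cost (sz xs)) t'" using complete[OF xs r] by blast
    have "(sz xs + 2) ^ D \<le> (length (enc xs) + 2) ^ D" by (rule power_mono) (auto simp: length_enc)
    then have "cost (sz xs) \<le> (length (enc xs) + 2) ^ D" using D[of "sz xs"] by linarith
    with t' have "runs_in (Qo A) q (ini [enc xs]) ((length (enc xs) + 2) ^ D) t'" by (rule runs_in_mono)
    then show ?thesis by (rule L(3))
  qed
  show ?thesis
  proof (rule bexI[OF _ L(1)], rule conjI)
    show "\<forall>z\<in>L. \<exists>xs t. length xs = a \<and> z = enc xs \<and> runs (Qo A) p (ini xs) t"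
    proof
      fix z assume "z \<in> L"
      from L(2)[OF this] obtain t where "runs (Qo A) q (ini [z]) t" ..
      then show "\<exists>xs t. length xs = a \<and> z = enc xs \<and> runs (Qo A) p (ini xs) t" by (rule sound)
    qed
    show "\<forall>xs t. length xs = a \<longrightarrow> runs_in (Qo A) p (ini xs) ((sz xs + 2) ^ d) t \<longrightarrow> enc xs \<in> L"
      using mem by (intro allI impI)
  qed
qed

definition elang :: "nat \<Rightarrow> (bool list list \<Rightarrow> bool) \<Rightarrow> lang" where
  "elang a \<phi> = {enc xs |xs. length xs = a \<and> \<phi> xs}"

lemma enc_elang: "length xs = a \<Longrightarrow> enc xs \<in> elang a \<phi> \<longleftrightarrow> \<phi> xs"
  unfolding elang_def using enc_inj by blast

text \<open>A program that accepts \<open>\<phi>\<close> has short runs on the tuples satisfying it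
  and no runs on others, so the two sides between which \<open>clock_enc\<close> leaves room
  coincide.\<close>

lemma Acc_elang: "Acc A a \<phi> \<Longrightarrow> elang a \<phi> \<in> NP_oracle A"
proof -
  assume "Acc A a \<phi>"
  then obtain p f where acc: "acc_by p f A a \<phi>" unfolding Acc_def by blast
  obtain d where d: "\<And>n. f n \<le> (n + 2) ^ d" using acc_byD(1)[OF acc] by (auto simp: pb_def)
  obtain L where L: "L \<in> NP_oracle A" "\<And>z. z \<in> L \<Longrightarrow> \<exists>xs t. length xs = a \<and> z = enc xs \<and> runs (Qo A) p (ini xs) t"
    "\<And>xs t. length xs = a \<Longrightarrow> runs_in (Qo A) p (ini xs) ((sz xs + 2) ^ d) t \<Longrightarrow> enc xs \<in> L"
    using clock_enc[of A a p d] by blast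
  have "L = elang a \<phi>"
  proof (rule set_eqI, rule iffI)
    fix z assume "z \<in> L"
    then obtain xs t where "length xs = a" "z = enc xs" "runs (Qo A) p (ini xs) t" using L(2) by blast
    then show "z \<in> elang a \<phi>" unfolding elang_def using acc_byD(2)[OF acc] by blast
  next
    fix z assume "z \<in> elang a \<phi>"
    then obtain xs where xs: "length xs = a" "z = enc xs" "\<phi> xs" unfolding elang_def by blast
    from acc_byD(3)[OF acc xs(1,3)] obtain t where "runs_in (Qo A) p (ini xs) (f (sz xs)) t" by blast
    then have "runs_in (Qo A) p (ini xs) ((sz xs + 2) ^ d) t" using d by (rule runs_in_mono)
    then show "z \<in> L" using L(3) xs by blast
  qed
  then show ?thesis using L(1) by simp
qed

lemma pb_common:
  assumes "finite X" "\<And>r. r \<in> X \<Longrightarrow> pb (f r)"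
  shows "\<exists>d. \<forall>r\<in>X. \<forall>n. f r n \<le> (n + 2) ^ d"
  using assms
proof (induction X)
  case (insert x X)
  then obtain d where d: "\<forall>r\<in>X. \<forall>n. f r n \<le> (n + 2) ^ d" by auto
  obtain e where e: "\<And>n. f x n \<le> (n + 2) ^ e" using insert.prems[of x] by (auto simp: pb_def)
  have "f r n \<le> (n + 2) ^ max d e" if "r \<in> insert x X" for r n
  proof -
    have "(n + 2) ^ d \<le> (n + 2) ^ max d e" "(n + 2) ^ e \<le> (n + 2) ^ max d e"
      by (rule power_increasing; simp)+
    then show ?thesis using that d e[of n] by (metis insertE le_trans)
  qed
  then show ?case by blast
qed simp

text \<open>The queries of an oracle machine for \<open>L\<close> are answered by guessing the answer and verifying a
  certificate; the guesses need only be certifiable for queries of polynomial length.\<close>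

definition certifies ::
  "(bool list list \<Rightarrow> bool) \<Rightarrow> (bool list list \<Rightarrow> bool) \<Rightarrow> lang \<Rightarrow> nat \<Rightarrow> bool list list \<Rightarrow> bool" where
  "certifies Y N A g zs \<longleftrightarrow> (\<forall>w. (Y (w # zs) \<longrightarrow> w \<in> A) \<and> (N (w # zs) \<longrightarrow> w \<notin> A)) \<and>
     (\<forall>w. length w \<le> (length (zs ! 0) + 2) ^ g \<longrightarrow> Y (w # zs) \<or> N (w # zs))"

text \<open>The exponent \<open>g\<close> comes from a program for \<open>L\<close> alone, before
  \<open>Y\<close>, \<open>N\<close> and the new oracle are known. This order lets a later choice of
  hard sequences satisfy the length requirement in \<open>certifies\<close>. On uncertified tuples
  nothing is claimed about \<open>\<psi>\<close>.\<close>

lemma Acc_subst: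
  assumes "L \<in> NP_oracle A"
  shows "\<exists>g. \<forall>c A' Y N. Acc A' (c + 2) Y \<longrightarrow> Acc A' (c + 2) N \<longrightarrow> (\<exists>\<psi>. Acc A' (c + 1) \<psi> \<and>
    (\<forall>zs. length zs = c + 1 \<longrightarrow> certifies Y N A g zs \<longrightarrow> (\<psi> zs \<longleftrightarrow> zs ! 0 \<in> L)))"
proof -
  from assms obtain p d where p: "\<And>x t. runs (Qo A) p (ini [x]) t \<Longrightarrow> x \<in> L"
    "\<And>x. x \<in> L \<Longrightarrow> \<exists>t. runs_in (Qo A) p (ini [x]) ((length x + 2) ^ d) t" using NP_prog by blast
  obtain R0 where R0: "\<forall>R' B. R0 \<le> R' \<longrightarrow> R0 \<le> B \<longrightarrow> uses {..<R'} B p" using ex_uses by blast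
  define R where "R = Suc R0"
  have uR: "uses {..<R} R p" and "0 < R" using R0 by (simp_all add: R_def)
  show ?thesis
  \<comment> \<open>In \<open>(n + 2) ^ d\<close> steps a word of length \<open>n\<close> grows to
    at most \<open>n + (n + 2) ^ d\<close> symbols, which is within
    \<open>(n + 2) ^ Suc d\<close>.\<close>
  proof (intro exI[of _ "Suc d"] allI impI)
    fix c A' Y N
    assume Y: "Acc A' (c + 2) Y" and N: "Acc A' (c + 2) N"
    let ?X = "{c + 2..<c + 2 + R}" and ?is = "[0..<c + 1]"
    have uX: "uses ?X R (sh (c + 2) p)" by (rule uses_mono[OF uses_sh[OF uR]]) auto
    have "\<exists>q f. tst_by q f A' (c + 2 + R) (r # ?is) (if v then Y else N)" if "r \<in> ?X" for r v
    proof -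
      have "Tst A' (c + 2 + R) (r # ?is) (if v then Y else N)"
        using that Y N by (intro Acc_Tst[where a = "c + 2"]) auto
      then show ?thesis unfolding Tst_def .
    qed
    then obtain G F where GF: "\<And>r v. r \<in> ?X \<Longrightarrow> tst_by (G r v) (F r v) A' (c + 2 + R) (r # ?is) (if v then Y else N)"
      by metis
    have "\<exists>D. \<forall>rv\<in>?X \<times> UNIV. \<forall>n. (\<lambda>(r, v). F r v) rv n \<le> (n + 2) ^ D"
    proof (rule pb_common)
      fix rv assume "rv \<in> ?X \<times> (UNIV :: bool set)"
      then obtain r v where "rv = (r, v)" "r \<in> ?X" by blast
      then show "pb ((\<lambda>(r, v). F r v) rv)" using tst_byD(1)[OF GF[of r v]] by simp
    qed simp
    then obtain D where D: "\<And>r v n. r \<in> ?X \<Longrightarrow> F r v n \<le> (n + 2) ^ D" by fastforce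
    define q where "q = copy [0, 1] 0 (c + 1) (c + 2) ;; sub G (sh (c + 2) p)"
    have s0: "(ini zs)(c + 2 := ini zs 0 @ ini zs (c + 2)) = glue (c + 2) (ini zs) (ini [zs ! 0])"
      if "length zs = c + 1" for zs
      using that by (auto simp: fun_eq_iff glue_def ini_def)
    have cp: "runs (Qo A') (copy [0, 1] 0 (c + 1) (c + 2)) (ini zs) t \<longleftrightarrow> t = glue (c + 2) (ini zs) (ini [zs ! 0])"
      if "length zs = c + 1" for zs t
    proof -
      have "ini zs (c + 1) = []" using that by (simp add: ini_eqs)
      then show ?thesis unfolding s0[OF that, symmetric] using ini_symbols[of zs 0] by simp
    qed
    have env: "\<forall>x. x \<notin> ?X \<longrightarrow> glue (c + 2) (ini zs) (ini [zs ! 0]) x = ini zs x" if "length zs = c + 1" for zs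
      using that \<open>0 < R\<close> by (auto simp: glue_def ini_def)
    have ar: "args (r # ?is) s = wd (s r) # zs" if "\<forall>x. x \<notin> ?X \<longrightarrow> s x = ini zs x" "length zs = c + 1" for s r zs
    proof -
      have "map (\<lambda>j. wd (s j)) ?is = map (\<lambda>j. zs ! j) ?is" using that by (auto simp: ini_def)
      also have "\<dots> = zs" by (rule map_nth_id) (rule that(2))
      finally show ?thesis by (simp add: args_def)
    qed
    have em: "\<forall>r\<ge>c + 2 + R. s r = []" if "\<forall>x. x \<notin> ?X \<longrightarrow> s x = ini zs x" "length zs = c + 1" for s zs
      using that by (auto simp: ini_eqs)
    define W where "W n = n + (n + 2) ^ d" for n :: nat
    define K where "K n = (W n + n + 2) ^ D" for n
    define cost where "cost n = (14 * n + 7) + (n + 2) ^ d * (K n + 1) + 1" for n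
    have "pb cost" unfolding cost_def K_def W_def by (intro pb_intros)
    then obtain E where E: "\<And>n. cost n \<le> (n + 2) ^ E" by (auto simp: pb_def)
    \<comment> \<open>On uncertified tuples \<open>q\<close> may have runs of any length and so need
      not accept a predicate in the sense of \<open>Acc\<close>. Membership in a clocked language is
      defined on all tuples and agrees with the intended predicate on the certified ones.\<close>
    obtain L' where L': "L' \<in> NP_oracle A'"
      "\<And>z. z \<in> L' \<Longrightarrow> \<exists>xs t. length xs = c + 1 \<and> z = enc xs \<and> runs (Qo A') q (ini xs) t"
      "\<And>xs t. length xs = c + 1 \<Longrightarrow> runs_in (Qo A') q (ini xs) ((sz xs + 2) ^ E) t \<Longrightarrow> enc xs \<in> L'"
      using clock_enc[of A' "c + 1" q E] by blast
    show "\<exists>\<psi>. Acc A' (c + 1) \<psi> \<and>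
      (\<forall>zs. length zs = c + 1 \<longrightarrow> certifies Y N A (Suc d) zs \<longrightarrow> (\<psi> zs \<longleftrightarrow> zs ! 0 \<in> L))"
    proof (intro exI[of _ "\<lambda>zs. enc zs \<in> L'"] conjI allI impI)
      show "Acc A' (c + 1) (\<lambda>zs. enc zs \<in> L')"
        by (rule Acc_enc) (use L'(1) in \<open>simp add: NP_oracle_iff\<close>)
    next
      fix zs assume zs: "length zs = c + 1" and cert: "certifies Y N A (Suc d) zs"
      from cert have YN: "\<forall>w. (Y (w # zs) \<longrightarrow> w \<in> A) \<and> (N (w # zs) \<longrightarrow> w \<notin> A)"
        and tot: "\<forall>w. length w \<le> (length (zs ! 0) + 2) ^ Suc d \<longrightarrow> Y (w # zs) \<or> N (w # zs)"
        unfolding certifies_def by (rule conjunct1, rule conjunct2)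
      let ?x = "zs ! 0" and ?s = "glue (c + 2) (ini zs) (ini [zs ! 0])"
      have lx: "length ?x \<le> sz zs" using zs by (intro length_le_sz) auto
      show "enc zs \<in> L' \<longleftrightarrow> zs ! 0 \<in> L"
      proof
        assume "enc zs \<in> L'"
        then obtain xs t where "length xs = c + 1" "enc zs = enc xs" "runs (Qo A') q (ini xs) t" using L'(2) by blast
        moreover from this have "xs = zs" using zs enc_inj by metis
        ultimately have "runs (Qo A') q (ini zs) t" by simp
        then have r: "runs (Qo A') (sub G (sh (c + 2) p)) ?s t" unfolding q_def runs_simps cp[OF zs] by blast
        have g: "t = s \<and> Qo A b (s r)" if r: "r \<in> ?X" and s: "\<forall>x. x \<notin> ?X \<longrightarrow> s x = ini zs x"
          and run: "runs (Qo A') (G r b) s t" for r b s t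
        proof
          note T = tst_byD[OF GF[OF r, of b]] and e = em[OF s zs]
          show "t = s" by (rule T(2)[OF e run])
          have "set (s r) \<subseteq> {0, 1}" using T(3)[OF e run] by (simp add: bits_def)
          moreover have "(if b then Y else N) (wd (s r) # zs)" using T(4)[OF e run] unfolding ar[OF s zs] .
          ultimately show "Qo A b (s r)" using YN by (cases b) (auto simp: Qo_def)
        qed
        have "runs (Qo A) (sh (c + 2) p) ?s t"
          by (rule runs_sub[where X = ?X and e = "ini zs", OF g uX r env[OF zs]])
        then show "?x \<in> L" unfolding runs_sh using p(1) by blast
      next
        assume "?x \<in> L"
        then obtain t n where n: "n \<le> (length ?x + 2) ^ d" "exec (Qo A) p (ini [?x]) n t"
          using p(2) unfolding runs_in_def by blast
        note ex = exec_sh1[OF n(2), of "c + 2" "ini zs"]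
        have W: "W (length ?x) \<le> W (sz zs)" "W (length ?x) \<le> (length ?x + 2) ^ Suc d"
        proof -
          show "W (length ?x) \<le> W (sz zs)" unfolding W_def using lx by (intro add_mono power_mono) auto
          have "1 \<le> (length ?x + 2) ^ d" by simp
          then have "length ?x * 1 \<le> length ?x * (length ?x + 2) ^ d" by (rule mult_le_mono2)
          then show "W (length ?x) \<le> (length ?x + 2) ^ Suc d" unfolding W_def power_Suc add_mult_distrib by linarith
        qed
        have g: "runs_in (Qo A') (G r b) s (K (sz zs)) s" if r: "r \<in> ?X" and s: "\<forall>x. x \<notin> ?X \<longrightarrow> s x = ini zs x"
          and Q: "Qo A b (s r)" and len: "length (s r) \<le> W (length ?x)" for r b s
        proof -
          have "bits (r # ?is) s" using Q s ini_symbols[of zs] by (auto simp: bits_def Qo_def)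
          moreover have "Y (wd (s r) # zs) \<or> N (wd (s r) # zs)" using tot len W(2) by auto
          then have "(if b then Y else N) (args (r # ?is) s)"
            unfolding ar[OF s zs] using Q YN by (cases b) (auto simp: Qo_def)
          ultimately have "runs_in (Qo A') (G r b) s (F r b (sz (args (r # ?is) s))) s"
            by (rule tst_byD(5)[OF GF[OF r, of b] em[OF s zs]])
          moreover have "sz (args (r # ?is) s) + 2 \<le> W (sz zs) + sz zs + 2"
            unfolding ar[OF s zs] using len W(1) by (simp add: sz_def)
          then have "F r b (sz (args (r # ?is) s)) \<le> K (sz zs)"
            unfolding K_def by (rule order_trans[OF D[OF r] power_mono]) simp
          ultimately show ?thesis by (rule runs_in_mono)
        qed
        have "\<forall>r\<in>?X. length (?s r) + n \<le> W (length ?x)"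
        proof
          fix r assume "r \<in> ?X"
          then have "length (?s r) \<le> length ?x" by (auto simp: glue_def ini_def)
          then show "length (?s r) + n \<le> W (length ?x)" unfolding W_def using n(1) by simp
        qed
        then have "runs_in (Qo A') (sub G (sh (c + 2) p)) ?s (n * (K (sz zs) + 1)) (glue (c + 2) (ini zs) t)"
          by (intro runs_in_sub[where X = ?X and e = "ini zs", OF g ex uX env[OF zs]])
        moreover have "(length ?x + 2) ^ d \<le> (sz zs + 2) ^ d" using lx by (intro power_mono) auto
        then have "n * (K (sz zs) + 1) \<le> (sz zs + 2) ^ d * (K (sz zs) + 1)"
          using n(1) by (intro mult_le_mono) auto
        ultimately have 2: "runs_in (Qo A') (sub G (sh (c + 2) p)) ?s ((sz zs + 2) ^ d * (K (sz zs) + 1)) (glue (c + 2) (ini zs) t)"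
          by (rule runs_in_mono)
        have "runs_in (Qo A') (copy [0, 1] 0 (c + 1) (c + 2)) (ini zs) (14 * sz zs + 7) ?s"
          by (rule runs_in_copy) (use zs ini_symbols[of zs 0] s0[OF zs] length_ini[of zs 0] in \<open>auto simp: ini_eqs\<close>)
        from runs_in_Seq[OF this 2 order_refl]
        have "runs_in (Qo A') q (ini zs) (cost (sz zs)) (glue (c + 2) (ini zs) t)" unfolding q_def cost_def .
        then have "runs_in (Qo A') q (ini zs) ((sz zs + 2) ^ E) (glue (c + 2) (ini zs) t)" using E by (rule runs_in_mono)
        then show "enc zs \<in> L'" by (rule L'(3)[OF zs])
      qed
    qed
  qed
qed

subsection \<open>Polynomial length bounds\<close>

text \<open>Lengths are compared by optional pops: the number of chances to pop is computed by
  nested loops, and register 0 can be emptied if and only if there are enough of them.\<close>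

definition opt :: prog where
  "opt = Alt Skip (Alt (Pop 0 0) (Pop 0 1))"

lemma opt_sound: "runs Q opt s t \<Longrightarrow> \<exists>j\<le>1. t = s(0 := drop j (s 0))"
proof -
  assume "runs Q opt s t"
  then consider "t = s" | b w where "s 0 = b # w" "t = s(0 := w)" by (auto simp: opt_def)
  then show ?thesis
  proof cases
    case 1
    then show ?thesis by (intro exI[of _ 0]) simp
  next
    case 2
    then show ?thesis by (intro exI[of _ 1]) simp
  qed
qed

lemma opt_complete: "set (s 0) \<subseteq> {0, 1} \<Longrightarrow> runs_in Q opt s 3 (s(0 := drop 1 (s 0)))"
proof (cases "s 0")
  case Nil
  then have "s(0 := drop 1 (s 0)) = s" by (simp add: fun_upd_idem)
  then show ?thesis unfolding opt_def by (auto intro!: runs_in_Alt1[where n = 1] runs_in_prim)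
next
  case (Cons b w)
  assume "set (s 0) \<subseteq> {0, 1}"
  then consider "b = 0" | "b = 1" using Cons by auto
  then have "runs_in Q (Alt (Pop 0 0) (Pop 0 1)) s 2 (s(0 := w))"
    by cases (use Cons in \<open>auto intro: runs_in_Alt1[where n = 1] runs_in_Alt2[where n = 1] runs_in_prim\<close>)
  then show ?thesis unfolding opt_def using Cons by (auto intro: runs_in_Alt2[where n = 2])
qed

definition opt_loop :: prog where
  "opt_loop = each [0, 1] 2 (\<lambda>c. Push 3 c ;; opt)"

lemma opt_loop_sound: "runs Q opt_loop s t \<Longrightarrow>
    \<exists>j\<le>length (s 2). t = s(2 := [], 3 := rev (s 2) @ s 3, 0 := drop j (s 0))"
  unfolding opt_loop_def
proof (induction "s 2" arbitrary: s)
  case Nil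
  then have "t = s" by (simp add: runs_each_Nil)
  then show ?case using Nil by (intro exI[of _ 0]) (auto simp: fun_eq_iff)
next
  case (Cons c w)
  then have "s 2 = c # w" by simp
  note r = Cons.prems[unfolded runs_each_Cons[of s 2 c w, OF this]]
  then obtain u where u: "runs Q opt (s(2 := w, 3 := c # s 3)) u" "runs Q (each [0, 1] 2 (\<lambda>c. Push 3 c ;; opt)) u t"
    by auto
  obtain j where j: "j \<le> 1" "u = s(2 := w, 3 := c # s 3, 0 := drop j (s 0))" using opt_sound[OF u(1)] by auto
  from Cons.hyps(1)[of u] u(2) j obtain k where k: "k \<le> length w"
    "t = u(2 := [], 3 := rev w @ u 3, 0 := drop k (u 0))" by auto
  show ?case
    by (rule exI[of _ "k + j"]) (use j k Cons.hyps(2)[symmetric] in \<open>auto simp: fun_eq_iff\<close>)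
qed

lemma opt_loop_complete: "set (s 0) \<subseteq> {0, 1} \<Longrightarrow> set (s 2) \<subseteq> {0, 1} \<Longrightarrow>
    runs_in Q opt_loop s (10 * length (s 2) + 3) (s(2 := [], 3 := rev (s 2) @ s 3, 0 := drop (length (s 2)) (s 0)))"
  unfolding opt_loop_def
proof (induction "s 2" arbitrary: s)
  case Nil
  then have "s(2 := [], 3 := rev (s 2) @ s 3, 0 := drop (length (s 2)) (s 0)) = s" by (auto simp: fun_eq_iff)
  then show ?case using Nil by (auto intro!: runs_in_each_Nil)
next
  case (Cons c w)
  have s2: "s 2 = c # w" using Cons by simp
  let ?u = "s(2 := w, 3 := c # s 3, 0 := drop 1 (s 0))"
  have sd: "set (drop j (s 0)) \<subseteq> {0, 1}" for j using Cons.prems(1) set_drop_subset[of j "s 0"] by blast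
  show ?case
  proof (rule runs_in_each_Cons[of s 2 c w, OF s2])
    have 1: "runs_in Q (Push 3 c) (s(2 := w)) 1 (s(2 := w, 3 := c # s 3))" by (rule runs_in_prim) auto
    have 2: "runs_in Q opt (s(2 := w, 3 := c # s 3)) 3 ?u"
      using opt_complete[of "s(2 := w, 3 := c # s 3)"] Cons.prems by simp
    show "runs_in Q (Push 3 c ;; opt) (s(2 := w)) 5 ?u" by (rule runs_in_Seq[OF 1 2]) simp
    have "runs_in Q (each [0, 1] 2 (\<lambda>c. Push 3 c ;; opt)) ?u (10 * length (?u 2) + 3)
       (?u(2 := [], 3 := rev (?u 2) @ ?u 3, 0 := drop (length (?u 2)) (?u 0)))"
      by (rule Cons.hyps(1)) (use Cons.prems s2 sd in auto)
    moreover have "?u(2 := [], 3 := rev (?u 2) @ ?u 3, 0 := drop (length (?u 2)) (?u 0)) =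
       s(2 := [], 3 := rev (s 2) @ s 3, 0 := drop (length (s 2)) (s 0))"
      using s2 by (auto simp: fun_eq_iff drop_Suc drop_tl)
    ultimately show "runs_in Q (each [0, 1] 2 (\<lambda>c. Push 3 c ;; opt)) ?u (10 * length w + 3)
       (s(2 := [], 3 := rev (s 2) @ s 3, 0 := drop (length (s 2)) (s 0)))" by simp
  qed (use s2 Cons.prems in auto)
qed

text \<open>One chance to pop per symbol of register 2, which is restored from register 3, and two
  more for the summand 2.\<close>

definition opt_round :: prog where
  "opt_round = opt_loop ;; (mv [0, 1] 3 2 ;; (opt ;; opt))"

lemma opt_round_sound: "s 3 = [] \<Longrightarrow> runs Q opt_round s t \<Longrightarrow> \<exists>j\<le>length (s 2) + 2. t = s(0 := drop j (s 0))"
proof -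
  assume s3: "s 3 = []" and "runs Q opt_round s t"
  then obtain u1 u2 u3 where u: "runs Q opt_loop s u1" "runs Q (mv [0, 1] 3 2) u1 u2" "runs Q opt u2 u3" "runs Q opt u3 t"
    unfolding opt_round_def runs_simps by blast
  obtain j1 where j1: "j1 \<le> length (s 2)" "u1 = s(2 := [], 3 := rev (s 2) @ s 3, 0 := drop j1 (s 0))"
    using opt_loop_sound[OF u(1)] by blast
  have "u2 = u1(3 := [], 2 := rev (u1 3) @ u1 2)" using u(2) by simp
  then have u2: "u2 = s(0 := drop j1 (s 0))" using j1(2) s3 by (auto simp: fun_eq_iff)
  obtain j2 where j2: "j2 \<le> 1" "u3 = u2(0 := drop j2 (u2 0))" using opt_sound[OF u(3)] by blast
  obtain j3 where j3: "j3 \<le> 1" "t = u3(0 := drop j3 (u3 0))" using opt_sound[OF u(4)] by blast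
  show ?thesis by (rule exI[of _ "j3 + (j2 + j1)"]) (use j1 j2 j3 u2 in \<open>simp add: add.assoc\<close>)
qed

lemma opt_round_complete:
  assumes "set (s 0) \<subseteq> {0, 1}" "set (s 2) \<subseteq> {0, 1}" "s 3 = []"
  shows "runs_in Q opt_round s (16 * length (s 2) + 20) (s(0 := drop (length (s 2) + 2) (s 0)))"
proof -
  let ?w = "s 2"
  let ?u1 = "s(2 := [], 3 := rev ?w, 0 := drop (length ?w) (s 0))" and ?u2 = "s(0 := drop (length ?w) (s 0))"
  let ?u3 = "s(0 := drop (length ?w + 1) (s 0))" and ?t = "s(0 := drop (length ?w + 2) (s 0))"
  have sd: "set (drop j (s 0)) \<subseteq> {0, 1}" for j using assms(1) set_drop_subset[of j "s 0"] by blast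
  have 1: "runs_in Q opt_loop s (10 * length ?w + 3) ?u1" using opt_loop_complete[OF assms(1,2)] assms(3) by simp
  have 2: "runs_in Q (mv [0, 1] 3 2) ?u1 (6 * length ?w + 3) ?u2"
    by (rule runs_in_mv) (use assms in \<open>auto simp: fun_eq_iff\<close>)
  have "runs_in Q opt ?u2 3 (?u2(0 := drop 1 (?u2 0)))" by (rule opt_complete) (use sd in simp)
  then have 3: "runs_in Q opt ?u2 3 ?u3" by (simp add: add.commute)
  have "runs_in Q opt ?u3 3 (?u3(0 := drop 1 (?u3 0)))" by (rule opt_complete) (use sd in simp)
  then have 4: "runs_in Q opt ?u3 3 ?t" by (simp add: add.commute numeral_2_eq_2)
  show ?thesis unfolding opt_round_def
    by (rule runs_in_Seq[OF 1 runs_in_Seq[OF 2 runs_in_Seq[OF 3 4 order_refl] order_refl]]) simp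
qed

definition opt_rounds :: prog where
  "opt_rounds = each [0, 1] 1 (\<lambda>_. opt_round)"

lemma opt_rounds_sound: "s 3 = [] \<Longrightarrow> runs Q opt_rounds s t \<Longrightarrow>
    \<exists>j\<le>length (s 1) * (length (s 2) + 2). t = s(1 := [], 0 := drop j (s 0))"
  unfolding opt_rounds_def
proof (induction "s 1" arbitrary: s)
  case Nil
  then have "t = s" by (simp add: runs_each_Nil)
  then show ?case using Nil by (intro exI[of _ 0]) (auto simp: fun_eq_iff)
next
  case (Cons c w)
  then have s1: "s 1 = c # w" by simp
  note r = Cons.prems(2)[unfolded runs_each_Cons[of s 1 c w, OF s1]]
  then obtain u where u: "runs Q opt_round (s(1 := w)) u" "runs Q (each [0, 1] 1 (\<lambda>_. opt_round)) u t" by blast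
  obtain j where j: "j \<le> length (s 2) + 2" "u = s(1 := w, 0 := drop j (s 0))"
    using opt_round_sound[OF _ u(1)] Cons.prems(1) by auto
  have "\<exists>k\<le>length (u 1) * (length (u 2) + 2). t = u(1 := [], 0 := drop k (u 0))"
  proof (rule Cons.hyps(1))
    show "w = u 1" "u 3 = []" using j(2) Cons.prems(1) by simp_all
  qed (rule u(2))
  then obtain k where k: "k \<le> length w * (length (s 2) + 2)" "t = u(1 := [], 0 := drop k (u 0))" using j(2) by auto
  show ?case
    by (rule exI[of _ "k + j"]) (use j k s1 in \<open>auto simp: fun_eq_iff\<close>)
qed

lemma opt_rounds_complete: "set (s 0) \<subseteq> {0, 1} \<Longrightarrow> set (s 1) \<subseteq> {0, 1} \<Longrightarrow> set (s 2) \<subseteq> {0, 1} \<Longrightarrow> s 3 = [] \<Longrightarrow>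
    runs_in Q opt_rounds s ((16 * length (s 2) + 25) * length (s 1) + 3)
      (s(1 := [], 0 := drop (length (s 1) * (length (s 2) + 2)) (s 0)))"
  unfolding opt_rounds_def
proof (induction "s 1" arbitrary: s)
  case Nil
  then have "s(1 := [], 0 := drop (length (s 1) * (length (s 2) + 2)) (s 0)) = s" by (auto simp: fun_eq_iff)
  then show ?case using Nil by (auto intro!: runs_in_each_Nil)
next
  case (Cons c w)
  have s1: "s 1 = c # w" using Cons by simp
  let ?u = "s(1 := w, 0 := drop (length (s 2) + 2) (s 0))"
  have sd: "set (drop j (s 0)) \<subseteq> {0, 1}" for j using Cons.prems(1) set_drop_subset[of j "s 0"] by blast
  show ?case
  proof (rule runs_in_each_Cons[of s 1 c w, OF s1])
    show "runs_in Q opt_round (s(1 := w)) (16 * length (s 2) + 20) ?u"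
      using opt_round_complete[of "s(1 := w)"] Cons.prems by simp
    have "runs_in Q (each [0, 1] 1 (\<lambda>_. opt_round)) ?u ((16 * length (?u 2) + 25) * length (?u 1) + 3)
       (?u(1 := [], 0 := drop (length (?u 1) * (length (?u 2) + 2)) (?u 0)))"
      by (rule Cons.hyps(1)) (use Cons.prems s1 sd in auto)
    moreover have "?u(1 := [], 0 := drop (length (?u 1) * (length (?u 2) + 2)) (?u 0)) =
       s(1 := [], 0 := drop (length (s 1) * (length (s 2) + 2)) (s 0))"
      using s1 by (auto simp: fun_eq_iff algebra_simps)
    ultimately show "runs_in Q (each [0, 1] 1 (\<lambda>_. opt_round)) ?u ((16 * length (s 2) + 25) * length w + 3)
       (s(1 := [], 0 := drop (length (s 1) * (length (s 2) + 2)) (s 0)))" by simp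
  qed (use s1 Cons.prems in auto)
qed

text \<open>No run removes more symbols than the product allows, and the run that uses every chance
  removes that many as far as they exist.\<close>

lemma Acc_len_mult: "Acc A 3 (\<lambda>xs. length (xs ! 0) \<le> length (xs ! 1) * (length (xs ! 2) + 2))"
proof (rule AccI[where p = "opt_rounds ;; IsNil 0" and f = "\<lambda>n. ((16 * n + 25) * n + 3) + 1 + 1"])
  show "pb (\<lambda>n. ((16 * n + 25) * n + 3) + 1 + 1)" by (intro pb_intros)
next
  fix xs :: "bool list list" and t assume xs: "length xs = 3" and r: "runs (Qo A) (opt_rounds ;; IsNil 0) (ini xs) t"
  have i: "ini xs 0 = stk (xs ! 0)" "ini xs 1 = stk (xs ! 1)" "ini xs 2 = stk (xs ! 2)" "ini xs 3 = []"
    using xs by (auto simp: ini_def)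
  from r obtain u where u: "runs (Qo A) opt_rounds (ini xs) u" "u 0 = []" by auto
  from opt_rounds_sound[OF i(4) u(1)] obtain j where j: "j \<le> length (ini xs 1) * (length (ini xs 2) + 2)"
    "u = (ini xs)(1 := [], 0 := drop j (ini xs 0))" by blast
  then have "drop j (stk (xs ! 0)) = []" using u(2) i by simp
  then show "length (xs ! 0) \<le> length (xs ! 1) * (length (xs ! 2) + 2)" using j(1) i by simp
next
  fix xs :: "bool list list" assume xs: "length xs = 3" and le: "length (xs ! 0) \<le> length (xs ! 1) * (length (xs ! 2) + 2)"
  have i: "ini xs 0 = stk (xs ! 0)" "ini xs 1 = stk (xs ! 1)" "ini xs 2 = stk (xs ! 2)" "ini xs 3 = []"
    using xs by (auto simp: ini_def)
  let ?u = "(ini xs)(1 := [], 0 := drop (length (ini xs 1) * (length (ini xs 2) + 2)) (ini xs 0))"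
  have 1: "runs_in (Qo A) opt_rounds (ini xs) ((16 * length (ini xs 2) + 25) * length (ini xs 1) + 3) ?u"
    by (rule opt_rounds_complete) (use i stk_bits in auto)
  have "(16 * length (ini xs 2) + 25) * length (ini xs 1) + 3 \<le> (16 * sz xs + 25) * sz xs + 3"
    using length_ini[of xs 1] length_ini[of xs 2] by (intro add_mono mult_le_mono) auto
  note 1 = runs_in_mono[OF 1 this]
  have 2: "runs_in (Qo A) (IsNil 0) ?u 1 ?u" by (rule runs_in_prim) (use le i in auto)
  show "\<exists>t. runs_in (Qo A) (opt_rounds ;; IsNil 0) (ini xs) (((16 * sz xs + 25) * sz xs + 3) + 1 + 1) t"
    by (rule exI, rule runs_in_Seq[OF 1 2 order_refl])
qed

lemma Acc_len_1: "Acc A 1 (\<lambda>xs. length (xs ! 0) \<le> 1)"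
proof (rule AccI[where p = "opt ;; IsNil 0" and f = "\<lambda>_. 3 + 1 + 1"])
  show "pb (\<lambda>_. 3 + 1 + 1)" by (intro pb_intros)
next
  fix xs :: "bool list list" and t assume xs: "length xs = 1" and r: "runs (Qo A) (opt ;; IsNil 0) (ini xs) t"
  then obtain u where u: "runs (Qo A) opt (ini xs) u" "u 0 = []" by auto
  from opt_sound[OF u(1)] obtain j where "j \<le> 1" "u = (ini xs)(0 := drop j (ini xs 0))" by blast
  then show "length (xs ! 0) \<le> 1" using u(2) xs by (auto simp: ini_def)
next
  fix xs :: "bool list list" assume xs: "length xs = 1" and le: "length (xs ! 0) \<le> 1"
  have 1: "runs_in (Qo A) opt (ini xs) 3 ((ini xs)(0 := drop 1 (ini xs 0)))" by (rule opt_complete) (rule ini_symbols)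
  have 2: "runs_in (Qo A) (IsNil 0) ((ini xs)(0 := drop 1 (ini xs 0))) 1 ((ini xs)(0 := drop 1 (ini xs 0)))"
    by (rule runs_in_prim) (use le xs in \<open>auto simp: ini_def\<close>)
  show "\<exists>t. runs_in (Qo A) (opt ;; IsNil 0) (ini xs) (3 + 1 + 1) t"
    by (rule exI, rule runs_in_Seq[OF 1 2 order_refl])
qed

text \<open>Powers are built up by guessing a word that represents the previous power in unary and
  applying the product test to it.\<close>

lemma Acc_len: "Acc A 2 (\<lambda>xs. length (xs ! 0) \<le> (length (xs ! 1) + 2) ^ d)"
proof (induction d)
  case 0
  have "Acc A 2 (\<lambda>xs. length (map ((!) xs) [0] ! 0) \<le> 1)" by (rule Acc_select[OF Acc_len_1]) auto
  then show ?case by simp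
next
  case (Suc d)
  have 1: "Acc A 3 (\<lambda>xs. length (map ((!) xs) [0, 2] ! 0) \<le> (length (map ((!) xs) [0, 2] ! 1) + 2) ^ d)"
    by (rule Acc_select[OF Suc]) auto
  have 2: "Acc A 3 (\<lambda>xs. length (map ((!) xs) [1, 0, 2] ! 0) \<le> length (map ((!) xs) [1, 0, 2] ! 1) * (length (map ((!) xs) [1, 0, 2] ! 2) + 2))"
    by (rule Acc_select[OF Acc_len_mult]) auto
  have 3: "Acc A (Suc 2) (\<lambda>xs. length (xs ! 0) \<le> (length (xs ! 2) + 2) ^ d \<and> length (xs ! 1) \<le> length (xs ! 0) * (length (xs ! 2) + 2))"
    using Acc_conj[OF 1 2] by (simp add: eval_nat_numeral)
  have "Acc A 2 (\<lambda>xs. \<exists>z. length ((z # xs) ! 0) \<le> (length ((z # xs) ! 2) + 2) ^ d \<and>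
     length ((z # xs) ! 1) \<le> length ((z # xs) ! 0) * (length ((z # xs) ! 2) + 2))"
  proof (rule Acc_ex[OF 3, of "\<lambda>n. (n + 2) ^ d"])
    show "pb (\<lambda>n. (n + 2) ^ d)" by (intro pb_intros)
  next
    fix xs :: "bool list list" and y :: "bool list"
    assume xs: "length xs = 2" and "length ((y # xs) ! 0) \<le> (length ((y # xs) ! 2) + 2) ^ d \<and>
     length ((y # xs) ! 1) \<le> length ((y # xs) ! 0) * (length ((y # xs) ! 2) + 2)"
    then have "length y \<le> (length (xs ! 1) + 2) ^ d" by simp
    also have "\<dots> \<le> (sz xs + 2) ^ d" using xs by (intro power_mono add_mono length_le_sz) auto
    finally show "length y \<le> (sz xs + 2) ^ d" .
  qed
  then show ?case
  proof (rule Acc_cong)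
    fix xs :: "bool list list" assume "length xs = 2"
    show "(\<exists>z. length ((z # xs) ! 0) \<le> (length ((z # xs) ! 2) + 2) ^ d \<and>
     length ((z # xs) ! 1) \<le> length ((z # xs) ! 0) * (length ((z # xs) ! 2) + 2)) \<longleftrightarrow>
     length (xs ! 0) \<le> (length (xs ! 1) + 2) ^ Suc d" (is "?l \<longleftrightarrow> ?r")
    proof
      assume ?l
      then obtain z :: "bool list" where z: "length z \<le> (length (xs ! 1) + 2) ^ d" "length (xs ! 0) \<le> length z * (length (xs ! 1) + 2)" by auto
      have "length z * (length (xs ! 1) + 2) \<le> (length (xs ! 1) + 2) ^ d * (length (xs ! 1) + 2)"
        using z(1) by (rule mult_le_mono1)
      then show ?r using z(2) by (simp add: mult.commute)
    next
      assume ?r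
      \<comment> \<open>The guessed word is taken as long as permitted, so that the product becomes
        the full next power.\<close>
      then show ?l by (intro exI[of _ "replicate ((length (xs ! 1) + 2) ^ d) True"]) (simp add: mult.commute)
    qed
  qed
qed

text \<open>The length of the witness is tested explicitly, so \<open>\<phi>\<close> itself may have
  long witnesses as well.\<close>

lemma Acc_bex:
  assumes "Acc A (Suc a) \<phi>" "i < a"
  shows "Acc A a (\<lambda>xs. \<exists>y. length y \<le> (length (xs ! i) + 2) ^ d \<and> \<phi> (y # xs))"
proof -
  have "Acc A (Suc a) (\<lambda>xs. length (map ((!) xs) [0, Suc i] ! 0) \<le> (length (map ((!) xs) [0, Suc i] ! 1) + 2) ^ d)"
    by (rule Acc_select[OF Acc_len]) (use assms(2) in auto)
  from Acc_conj[OF this assms(1)]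
  have 1: "Acc A (Suc a) (\<lambda>xs. length (xs ! 0) \<le> (length (xs ! Suc i) + 2) ^ d \<and> \<phi> xs)" by simp
  have "Acc A a (\<lambda>xs. \<exists>y. length ((y # xs) ! 0) \<le> (length ((y # xs) ! Suc i) + 2) ^ d \<and> \<phi> (y # xs))"
  proof (rule Acc_ex[OF 1, of "\<lambda>n. (n + 2) ^ d"])
    show "pb (\<lambda>n. (n + 2) ^ d)" by (intro pb_intros)
  next
    fix xs :: "bool list list" and y :: "bool list"
    assume xs: "length xs = a" and "length ((y # xs) ! 0) \<le> (length ((y # xs) ! Suc i) + 2) ^ d \<and> \<phi> (y # xs)"
    then have "length y \<le> (length (xs ! i) + 2) ^ d" by simp
    also have "\<dots> \<le> (sz xs + 2) ^ d" using xs assms(2) by (intro power_mono add_mono length_le_sz) auto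
    finally show "length y \<le> (sz xs + 2) ^ d" .
  qed
  then show ?thesis by simp
qed

section \<open>The levels of the polynomial hierarchy\<close>

text \<open>\<open>Orc (Suc k)\<close> is level \<open>k + 1\<close> of the hierarchy; starting from the empty oracle instead of \<open>P\<close> makes all levels alike.
  Thus \<open>Sig k\<close> consists of the predicates of level \<open>k + 1\<close>.\<close>

fun Orc :: "nat \<Rightarrow> lang set" where
  "Orc 0 = {{}}"
| "Orc (Suc k) = NP_relative (Orc k)"

definition Sig :: "nat \<Rightarrow> nat \<Rightarrow> (bool list list \<Rightarrow> bool) \<Rightarrow> bool" where
  "Sig k a \<phi> \<longleftrightarrow> (\<exists>A\<in>Orc k. Acc A a \<phi>)"

lemma Orc_Suc: "L \<in> Orc (Suc k) \<longleftrightarrow> Sig k 1 (\<lambda>xs. xs ! 0 \<in> L)"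
  by (simp add: Sig_def NP_relative_def NP_oracle_iff)

lemma Acc_eq_const:
  assumes "length c \<le> 1"
  shows "Acc A 1 (\<lambda>xs. xs ! 0 = c)"
proof -
  define p where "p = (if c = [] then IsNil 0 else Pop 0 (if hd c then 1 else 0) ;; IsNil 0)"
  show ?thesis
  proof (rule AccI[where p = p and f = "\<lambda>_. 3"])
    show "pb (\<lambda>_. 3)" by (rule pb_const)
  next
    fix xs :: "bool list list" and t assume xs: "length xs = 1" and r: "runs (Qo A) p (ini xs) t"
    have i: "ini xs 0 = stk (xs ! 0)" using xs by (simp add: ini_def)
    have "stk (xs ! 0) = stk c"
    proof (cases c)
      case Nil
      then show ?thesis using r i by (simp add: p_def stk_def)
    next
      case (Cons b w)
      then have "w = []" using assms by simp
      then show ?thesis using r i Cons by (auto simp: p_def stk_def)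
    qed
    then show "xs ! 0 = c" by (rule stk_inj)
  next
    fix xs :: "bool list list" assume xs: "length xs = 1" "xs ! 0 = c"
    then have i: "ini xs 0 = stk c" by (simp add: ini_def)
    show "\<exists>t. runs_in (Qo A) p (ini xs) 3 t"
    proof (cases c)
      case Nil
      then have "runs_in (Qo A) p (ini xs) 3 (ini xs)" using i unfolding p_def
        by (simp add: stk_def) (rule runs_in_prim, auto)
      then show ?thesis by blast
    next
      case (Cons b w)
      then have w: "w = []" using assms by simp
      have "runs_in (Qo A) (Pop 0 (if b then 1 else 0)) (ini xs) 1 ((ini xs)(0 := []))"
        by (rule runs_in_prim) (use i Cons w in \<open>auto simp: stk_def\<close>)
      moreover have "runs_in (Qo A) (IsNil 0) ((ini xs)(0 := [])) 1 ((ini xs)(0 := []))" by (rule runs_in_prim) auto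
      ultimately have "runs_in (Qo A) (Pop 0 (if b then 1 else 0) ;; IsNil 0) (ini xs) 3 ((ini xs)(0 := []))"
        by (rule runs_in_Seq) simp
      then show ?thesis using Cons by (auto simp: p_def)
    qed
  qed
qed

lemma Acc_const_arg:
  assumes "Acc A (Suc a) \<phi>" "length c \<le> 1"
  shows "Acc A a (\<lambda>xs. \<phi> (c # xs))"
proof -
  have "Acc A (Suc a) (\<lambda>xs. map ((!) xs) [0] ! 0 = c)" by (rule Acc_select[OF Acc_eq_const[OF assms(2)]]) auto
  from Acc_conj[OF this assms(1)] have 1: "Acc A (Suc a) (\<lambda>xs. xs ! 0 = c \<and> \<phi> xs)" by simp
  have "Acc A a (\<lambda>xs. \<exists>y. (y # xs) ! 0 = c \<and> \<phi> (y # xs))"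
    by (rule Acc_ex[OF 1, of "\<lambda>_. 1"]) (use assms(2) in \<open>auto intro: pb_const\<close>)
  then show ?thesis by simp
qed

text \<open>If both answers of \<open>A\<close> can be verified with the oracle \<open>C\<close>,
  then guessing and verifying replaces the queries. The predicate passes through its encoded
  language, since \<open>Acc_subst\<close> is about languages.\<close>

lemma Acc_reduce:
  assumes "Acc A a \<phi>" "\<And>b. Acc C 1 (\<lambda>xs. (xs ! 0 \<in> A) = b)"
  shows "Acc C a \<phi>"
proof -
  obtain g where g: "\<forall>c A' Y N. Acc A' (c + 2) Y \<longrightarrow> Acc A' (c + 2) N \<longrightarrow> (\<exists>\<psi>. Acc A' (c + 1) \<psi> \<and>
    (\<forall>zs. length zs = c + 1 \<longrightarrow> certifies Y N A g zs \<longrightarrow> (\<psi> zs \<longleftrightarrow> zs ! 0 \<in> elang a \<phi>)))"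
    using Acc_subst[OF Acc_elang[OF assms(1)]] by (elim exE)
  have "Acc C (0 + 2) (\<lambda>xs. (map ((!) xs) [0] ! 0 \<in> A) = b)" for b
    by (rule Acc_select[OF assms(2)]) auto
  then have "Acc C (0 + 2) (\<lambda>xs. (xs ! 0 \<in> A) = b)" for b by simp
  from g[THEN spec, THEN spec, THEN spec, THEN spec, THEN mp, THEN mp, OF this[of True] this[of False]]
  obtain \<psi> where \<psi>: "Acc C (0 + 1) \<psi>"
    "\<forall>zs. length zs = 0 + 1 \<longrightarrow> certifies (\<lambda>xs. (xs ! 0 \<in> A) = True) (\<lambda>xs. (xs ! 0 \<in> A) = False) A g zs \<longrightarrow>
       (\<psi> zs \<longleftrightarrow> zs ! 0 \<in> elang a \<phi>)" by (elim exE conjE)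
  have "certifies (\<lambda>xs. (xs ! 0 \<in> A) = True) (\<lambda>xs. (xs ! 0 \<in> A) = False) A g zs" for zs
    by (auto simp: certifies_def)
  then have "Acc C (0 + 1) (\<lambda>zs. zs ! 0 \<in> elang a \<phi>)" using \<psi>(2) by (intro Acc_cong[OF \<psi>(1)]) blast
  then have "Acc C 1 (\<lambda>zs. zs ! 0 \<in> elang a \<phi>)" by simp
  from Acc_enc[OF this, of a] show ?thesis by (rule Acc_cong) (simp add: enc_elang)
qed

text \<open>The join is a disjoint union with the tags \<open>[]\<close> and \<open>[True]\<close>.
  That it lies in the same level requires a common oracle for its two halves one level below, hence
  the induction.\<close>

lemma Orc_join: "A \<in> Orc k \<Longrightarrow> B \<in> Orc k \<Longrightarrow>
    \<exists>C\<in>Orc k. \<forall>a \<phi>. (Acc A a \<phi> \<longrightarrow> Acc C a \<phi>) \<and> (Acc B a \<phi> \<longrightarrow> Acc C a \<phi>)"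
proof (induction k arbitrary: A B)
  case 0
  then show ?case by auto
next
  case (Suc k)
  from Suc.prems obtain A' B' where AB: "A' \<in> Orc k" "Acc A' 1 (\<lambda>xs. xs ! 0 \<in> A)" "B' \<in> Orc k" "Acc B' 1 (\<lambda>xs. xs ! 0 \<in> B)"
    unfolding Orc_Suc Sig_def by blast
  from Suc.IH[OF AB(1,3)] AB(2,4) obtain C where C: "C \<in> Orc k" "Acc C 1 (\<lambda>xs. xs ! 0 \<in> A)" "Acc C 1 (\<lambda>xs. xs ! 0 \<in> B)" by blast
  define \<phi> where "\<phi> xs \<longleftrightarrow> (xs ! 0 = [] \<and> xs ! 1 \<in> A) \<or> (xs ! 0 = [True] \<and> xs ! 1 \<in> B)" for xs :: "bool list list"
  have e: "Acc C 2 (\<lambda>xs. map ((!) xs) [0] ! 0 = c)" if "length c \<le> 1" for c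
    by (rule Acc_select[OF Acc_eq_const[OF that]]) auto
  have m: "Acc C 2 (\<lambda>xs. map ((!) xs) [1] ! 0 \<in> D)" if "Acc C 1 (\<lambda>xs. xs ! 0 \<in> D)" for D
    by (rule Acc_select[OF that]) auto
  have "Acc C 2 \<phi>"
    using Acc_disj[OF Acc_conj[OF e[of "[]"] m[OF C(2)]] Acc_conj[OF e[of "[True]"] m[OF C(3)]]]
    by (simp add: \<phi>_def[abs_def])
  define J where "J = elang 2 \<phi>"
  have J: "J \<in> Orc (Suc k)" unfolding J_def Orc_Suc Sig_def
    using C(1) Acc_elang[OF \<open>Acc C 2 \<phi>\<close>] NP_oracle_iff by blast
  have q: "Acc J 1 (\<lambda>xs. (enc (c # xs) \<in> J) = b)" if "length c \<le> 1" for c b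
    by (rule Acc_const_arg[OF _ that]) (use Acc_enc[OF Acc_oracle[of J b], of 2] in \<open>simp add: numeral_2_eq_2\<close>)
  have qA: "Acc J 1 (\<lambda>xs. (xs ! 0 \<in> A) = b)" for b
    by (rule Acc_cong[OF q[of "[]" b]]) (auto simp: J_def enc_elang \<phi>_def)
  have qB: "Acc J 1 (\<lambda>xs. (xs ! 0 \<in> B) = b)" for b
    by (rule Acc_cong[OF q[of "[True]" b]]) (auto simp: J_def enc_elang \<phi>_def)
  show ?case using J Acc_reduce[OF _ qA] Acc_reduce[OF _ qB] by blast
qed

lemma Sig_cong: "Sig k a \<phi> \<Longrightarrow> (\<And>xs. length xs = a \<Longrightarrow> \<phi> xs \<longleftrightarrow> \<psi> xs) \<Longrightarrow> Sig k a \<psi>"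
  unfolding Sig_def using Acc_cong by blast

lemma Sig_select: "Sig k a \<phi> \<Longrightarrow> length is = a \<Longrightarrow> \<forall>i\<in>set is. i < b \<Longrightarrow> Sig k b (\<lambda>xs. \<phi> (map ((!) xs) is))"
  unfolding Sig_def using Acc_select by blast

lemma Sig_join: "Sig k a \<phi> \<Longrightarrow> Sig k b \<psi> \<Longrightarrow> \<exists>C\<in>Orc k. Acc C a \<phi> \<and> Acc C b \<psi>"
  unfolding Sig_def using Orc_join by blast

lemma Sig_conj: "Sig k a \<phi> \<Longrightarrow> Sig k a \<psi> \<Longrightarrow> Sig k a (\<lambda>xs. \<phi> xs \<and> \<psi> xs)"
  using Sig_join[of k a \<phi> a \<psi>] Acc_conj unfolding Sig_def by blast

lemma Sig_disj: "Sig k a \<phi> \<Longrightarrow> Sig k a \<psi> \<Longrightarrow> Sig k a (\<lambda>xs. \<phi> xs \<or> \<psi> xs)"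
  using Sig_join[of k a \<phi> a \<psi>] Acc_disj unfolding Sig_def by blast

lemma Orc_nonempty: "\<exists>A. A \<in> Orc k"
proof (induction k)
  case (Suc k)
  then obtain A where A: "A \<in> Orc k" by blast
  have "Acc A 1 (\<lambda>xs. xs ! 0 \<in> {})" using Acc_const[of A 1 False] by simp
  then show ?case unfolding Orc_Suc Sig_def using A by blast
qed simp

lemma Sig_const: "Sig k a (\<lambda>_. c)"
  using Orc_nonempty[of k] Acc_const unfolding Sig_def by blast

lemma Sig_ex_less:
  fixes n :: nat
  shows "(\<And>i. i < n \<Longrightarrow> Sig k a (\<phi> i)) \<Longrightarrow> Sig k a (\<lambda>xs. \<exists>i<n. \<phi> i xs)"
proof (induction n)
  case 0
  then show ?case using Sig_const[of k a False] by simp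
next
  case (Suc n)
  then have "Sig k a (\<lambda>xs. (\<exists>i<n. \<phi> i xs) \<or> \<phi> n xs)" by (intro Sig_disj) auto
  then show ?case by (rule Sig_cong) (auto simp: less_Suc_eq)
qed

lemma Sig_all_less:
  fixes n :: nat
  shows "(\<And>i. i < n \<Longrightarrow> Sig k a (\<phi> i)) \<Longrightarrow> Sig k a (\<lambda>xs. \<forall>i<n. \<phi> i xs)"
proof (induction n)
  case 0
  then show ?case using Sig_const[of k a True] by simp
next
  case (Suc n)
  then have "Sig k a (\<lambda>xs. (\<forall>i<n. \<phi> i xs) \<and> \<phi> n xs)" by (intro Sig_conj) auto
  then show ?case by (rule Sig_cong) (auto simp: less_Suc_eq)
qed

lemma Sig_bex: "Sig k (Suc a) \<phi> \<Longrightarrow> i < a \<Longrightarrow>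
    Sig k a (\<lambda>xs. \<exists>y. length y \<le> (length (xs ! i) + 2) ^ d \<and> \<phi> (y # xs))"
  unfolding Sig_def using Acc_bex by blast

lemma Sig_bexs: "Sig k (q + a) \<phi> \<Longrightarrow> i < a \<Longrightarrow>
    Sig k a (\<lambda>xs. \<exists>ys. length ys = q \<and> (\<forall>y\<in>set ys. length y \<le> (length (xs ! i) + 2) ^ d) \<and> \<phi> (ys @ xs))"
proof (induction q arbitrary: \<phi>)
  case 0
  then show ?case by simp
next
  case (Suc q)
  have "Sig k (q + a) (\<lambda>zs. \<exists>y. length y \<le> (length (zs ! (q + i)) + 2) ^ d \<and> \<phi> (y # zs))"
    by (rule Sig_bex) (use Suc.prems in auto)
  from Suc.IH[OF this Suc.prems(2)]
  show ?case
  proof (rule Sig_cong)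
    fix xs :: "bool list list"
    let ?b = "(length (xs ! i) + 2) ^ d"
    show "(\<exists>ys. length ys = q \<and> (\<forall>y\<in>set ys. length y \<le> ?b) \<and>
        (\<exists>y. length y \<le> (length ((ys @ xs) ! (q + i)) + 2) ^ d \<and> \<phi> (y # ys @ xs))) \<longleftrightarrow>
      (\<exists>ys. length ys = Suc q \<and> (\<forall>y\<in>set ys. length y \<le> ?b) \<and> \<phi> (ys @ xs))" (is "?l \<longleftrightarrow> ?r")
    proof
      assume ?l
      then obtain ys y where "length ys = q" "\<forall>y\<in>set ys. length y \<le> ?b" "length y \<le> ?b" "\<phi> (y # ys @ xs)"
        by (auto simp: nth_append)
      then show ?r by (intro exI[of _ "y # ys"]) auto
    next
      assume ?r
      then obtain y ys where "length ys = q" "\<forall>y\<in>set ys. length y \<le> ?b" "length y \<le> ?b" "\<phi> (y # ys @ xs)"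
        by (auto simp: length_Suc_conv)
      then show ?l by (intro exI[of _ ys]) (auto simp: nth_append)
    qed
  qed
qed

lemma Sig_len: "i < a \<Longrightarrow> j < a \<Longrightarrow> Sig k a (\<lambda>xs. length (xs ! i) \<le> (length (xs ! j) + 2) ^ d)"
proof -
  assume a: "i < a" "j < a"
  have "Sig k 2 (\<lambda>xs. length (xs ! 0) \<le> (length (xs ! 1) + 2) ^ d)"
    using Orc_nonempty[of k] Acc_len unfolding Sig_def by blast
  from Sig_select[OF this, of "[i, j]" a] a show ?thesis by simp
qed

lemma Sig_elang: "Sig k a \<phi> \<Longrightarrow> elang a \<phi> \<in> Orc (Suc k)"
  using Acc_elang unfolding Sig_def Orc_Suc NP_oracle_iff by blast

lemma Sig_enc: "L \<in> Orc (Suc k) \<Longrightarrow> Sig k a (\<lambda>xs. enc xs \<in> L)"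
  unfolding Orc_Suc Sig_def using Acc_enc[where P = "\<lambda>z. z \<in> L" and a = a] by blast

text \<open>One level up, the encoded language of \<open>\<phi>\<close> is itself available as
  oracle, and an oracle can be asked for both answers.\<close>

lemma Sig_Suc_eq: "Sig k a \<phi> \<Longrightarrow> Sig (Suc k) a (\<lambda>xs. \<phi> xs = b)"
proof -
  assume "Sig k a \<phi>"
  then have "elang a \<phi> \<in> Orc (Suc k)" by (rule Sig_elang)
  moreover have "Acc (elang a \<phi>) a (\<lambda>xs. \<phi> xs = b)"
    by (rule Acc_cong[OF Acc_enc[OF Acc_oracle[of "elang a \<phi>" b]]]) (simp add: enc_elang)
  ultimately show ?thesis unfolding Sig_def by blast
qed

lemma Sig_up: "Sig k a \<phi> \<Longrightarrow> Sig (Suc k) a \<phi>"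
  using Sig_Suc_eq[of k a \<phi> True] by simp

lemma Sig_not: "Sig k a \<phi> \<Longrightarrow> Sig (Suc k) a (\<lambda>xs. \<not> \<phi> xs)"
  using Sig_Suc_eq[of k a \<phi> False] by simp

lemma Sig_ups: "k \<le> l \<Longrightarrow> Sig k a \<phi> \<Longrightarrow> Sig l a \<phi>"
  by (induction l rule: dec_induct) (auto intro: Sig_up)

lemma Sig_mem: "L \<in> Orc (Suc k) \<Longrightarrow> i < a \<Longrightarrow> Sig k a (\<lambda>xs. xs ! i \<in> L)"
proof -
  assume "L \<in> Orc (Suc k)" "i < a"
  then have "Sig k a (\<lambda>xs. map ((!) xs) [i] ! 0 \<in> L)" unfolding Orc_Suc by (intro Sig_select) auto
  then show ?thesis by simp
qed

text \<open>The verifiers of the two answers may come with different oracles of the level; a join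
  provides one for both. The exponent is even uniform in the level.\<close>

lemma Sig_subst:
  assumes "L \<in> NP_oracle A"
  shows "\<exists>g. \<forall>k c Y N. Sig k (c + 2) Y \<longrightarrow> Sig k (c + 2) N \<longrightarrow> (\<exists>\<psi>. Sig k (c + 1) \<psi> \<and>
    (\<forall>zs. length zs = c + 1 \<longrightarrow> certifies Y N A g zs \<longrightarrow> (\<psi> zs \<longleftrightarrow> zs ! 0 \<in> L)))"
proof -
  obtain g where g: "\<forall>c A' Y N. Acc A' (c + 2) Y \<longrightarrow> Acc A' (c + 2) N \<longrightarrow> (\<exists>\<psi>. Acc A' (c + 1) \<psi> \<and>
    (\<forall>zs. length zs = c + 1 \<longrightarrow> certifies Y N A g zs \<longrightarrow> (\<psi> zs \<longleftrightarrow> zs ! 0 \<in> L)))"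
    using Acc_subst[OF assms] by (elim exE)
  show ?thesis
  proof (rule exI[of _ g], intro allI impI)
    fix k c Y N assume "Sig k (c + 2) Y" "Sig k (c + 2) N"
    from Sig_join[OF this] obtain C where C: "C \<in> Orc k" "Acc C (c + 2) Y" "Acc C (c + 2) N" by blast
    from g[THEN spec, THEN spec, THEN spec, THEN spec, THEN mp, THEN mp, OF C(2,3)]
    obtain \<psi> where "Acc C (c + 1) \<psi>" "\<forall>zs. length zs = c + 1 \<longrightarrow> certifies Y N A g zs \<longrightarrow> (\<psi> zs \<longleftrightarrow> zs ! 0 \<in> L)"
      by (elim exE conjE)
    then show "\<exists>\<psi>. Sig k (c + 1) \<psi> \<and>
      (\<forall>zs. length zs = c + 1 \<longrightarrow> certifies Y N A g zs \<longrightarrow> (\<psi> zs \<longleftrightarrow> zs ! 0 \<in> L))"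
      using C(1) unfolding Sig_def by (intro exI[of _ \<psi>] conjI bexI[of _ C])
  qed
qed

lemma Orc_mono: "L \<in> Orc (Suc k) \<Longrightarrow> k \<le> l \<Longrightarrow> L \<in> Orc (Suc l)"
  unfolding Orc_Suc by (rule Sig_ups[of k])

lemma Orc_compl: "L \<in> Orc (Suc k) \<Longrightarrow> - L \<in> Orc (Suc (Suc k))"
  using Sig_not[of k 1 "\<lambda>xs. xs ! 0 \<in> L"] unfolding Orc_Suc by simp

lemma Sig_lang: "Sig k 1 \<phi> \<Longrightarrow> {x. \<phi> [x]} \<in> Orc (Suc k)"
  unfolding Orc_Suc by (erule Sig_cong) (auto simp: length_Suc_conv)

text \<open>The work is in the base case, that NP relative to P is NP: an oracle in P and its
  complement are both accepted without queries, so \<open>Acc_reduce\<close> removes the oracle. The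
  converse inclusion uses that the empty language is in P.\<close>

lemma SigmaP_Orc: "SigmaP (Suc k) = Orc (Suc k)"
proof (induction k)
  case 0
  have P: "Acc {} 1 (\<lambda>xs. (xs ! 0 \<in> B) = b)" if B: "B \<in> class_P" for B b
  proof (cases b)
    case True
    have "B \<in> NP_oracle {}" using B by (auto simp: class_P_def NP_oracle_def)
    then show ?thesis using True by (simp add: NP_oracle_iff)
  next
    case False
    obtain p d where p: "\<And>x t. runs (Qo {}) p (ini [x]) t \<Longrightarrow> x \<notin> B"
      "\<And>x. x \<notin> B \<Longrightarrow> \<exists>t. runs_in (Qo {}) p (ini [x]) ((length x + 2) ^ d) t" using P_compl_prog[OF B] by blast
    have "Acc {} 1 (\<lambda>xs. xs ! 0 \<notin> B)"
    proof (rule AccI[where p = p and f = "\<lambda>n. (n + 2) ^ d"])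
      show "pb (\<lambda>n. (n + 2) ^ d)" by (intro pb_intros)
      fix xs :: "bool list list" assume "length xs = 1"
      then obtain x where [simp]: "xs = [x]" by (auto simp: length_Suc_conv)
      show "xs ! 0 \<notin> B" if "runs (Qo {}) p (ini xs) t" for t using that p(1)[of x t] by simp
      show "\<exists>t. runs_in (Qo {}) p (ini xs) ((sz xs + 2) ^ d) t" if "xs ! 0 \<notin> B" using that p(2)[of x] by (simp add: sz_def)
    qed
    then show ?thesis using False by simp
  qed
  have "{} \<in> class_P"
  proof -
    \<comment> \<open>A machine without transitions, whose start state is neither the accepting nor
      the query state.\<close>
    define M where "M = \<lparr>num_tapes = 2, start_st = 0, accept_st = 1, query_st = 2, yes_st = 0, no_st = 0, delta = {}\<rparr>"
    have ns: "\<not> step M {} (init_config M x) c" for x c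
      by (auto simp: M_def init_config_def elim: step.cases)
    have "n \<le> poly 0 (length x)" if "(step M {} ^^ n) (init_config M x) c" for n x c
      using that ns by (cases n) (auto simp del: relpowp.simps dest: relpowp_Suc_D2)
    then have "poly_time M {}" unfolding poly_time_def by blast
    moreover have "\<not> accepts M {} x" for x
    proof
      assume "accepts M {} x"
      then obtain tps where "(step M {})\<^sup>*\<^sup>* (init_config M x) (accept_st M, tps)" by (auto simp: accepts_def)
      then show False using ns by (cases rule: converse_rtranclpE) (auto simp: M_def init_config_def)
    qed
    ultimately show ?thesis unfolding class_P_def
      by (intro CollectI exI[of _ M]) (auto simp: M_def wf_machine_def deterministic_def oracle_free_def)
  qed
  moreover have "L \<in> NP_oracle {}" if "L \<in> NP_oracle B" "B \<in> class_P" for L B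
    using that(1) Acc_reduce[OF _ P[OF that(2)]] unfolding NP_oracle_iff by blast
  ultimately show ?case by (auto simp: NP_relative_def)
qed simp

lemma PH_Orc: "PH = (\<Union>k. Orc (Suc k))"
proof -
  have "SigmaP 0 \<subseteq> Orc (Suc 0)" by (auto simp: NP_relative_def class_P_def NP_oracle_def)
  then have "SigmaP k \<subseteq> (\<Union>k. Orc (Suc k))" for k by (cases k) (auto simp del: SigmaP.simps(2) Orc.simps(2) simp: SigmaP_Orc)
  moreover have "Orc (Suc k) \<subseteq> PH" for k unfolding PH_def SigmaP_Orc[symmetric] by blast
  ultimately show ?thesis unfolding PH_def by blast
qed

text \<open>Guesses arrive in front of the input, while predicates on hard sequences expect the
  input first; a selection swaps them.\<close>

lemma Sig_bexs_tail:
  assumes "Sig k (r + 1) \<phi>"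
  shows "Sig k 1 (\<lambda>xs. \<exists>s. length s = r \<and> (\<forall>y\<in>set s. length y \<le> (length (xs ! 0) + 2) ^ d) \<and> \<phi> (xs ! 0 # s))"
proof -
  let ?is = "r # [0..<r]"
  have "Sig k (r + 1) (\<lambda>ys. \<phi> (map ((!) ys) ?is))" by (rule Sig_select[OF assms]) auto
  from Sig_bexs[OF this, of 0 d] show ?thesis
  proof (rule Sig_cong)
    fix xs :: "bool list list" assume "length xs = 1"
    then obtain x where x: "xs = [x]" by (auto simp: length_Suc_conv)
    have "map ((!) (s @ [x])) ?is = x # s" if "length s = r" for s
    proof -
      have "map ((!) (s @ [x])) [0..<r] = s" by (rule nth_equalityI) (auto simp: nth_append that)
      then show ?thesis using that by (simp add: nth_append)
    qed
    then show "(\<exists>ys. length ys = r \<and> (\<forall>y\<in>set ys. length y \<le> (length (xs ! 0) + 2) ^ d) \<and> \<phi> (map ((!) (ys @ xs)) ?is)) \<longleftrightarrow>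
      (\<exists>s. length s = r \<and> (\<forall>y\<in>set s. length y \<le> (length (xs ! 0) + 2) ^ d) \<and> \<phi> (xs ! 0 # s))"
      unfolding x by (intro ex_cong1 conj_cong refl) simp
  qed simp
qed

section \<open>The difference hierarchy\<close>

primrec nest :: "lang list \<Rightarrow> lang" where
  "nest [] = {}"
| "nest (L # Ls) = L - nest Ls"

lemma DIFF_nest: "L \<in> DIFF m C \<longleftrightarrow> (\<exists>Ls. length Ls = m \<and> set Ls \<subseteq> C \<and> L = nest Ls)"
proof (induction m C arbitrary: L rule: DIFF.induct)
  case (1 C)
  then show ?case by auto
next
  case (2 C)
  show ?case
  proof
    assume "L \<in> DIFF (Suc 0) C"
    then show "\<exists>Ls. length Ls = Suc 0 \<and> set Ls \<subseteq> C \<and> L = nest Ls" by (intro exI[of _ "[L]"]) auto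
  qed (auto simp: length_Suc_conv)
next
  case (3 m C)
  have "L \<in> DIFF (Suc (Suc m)) C \<longleftrightarrow> (\<exists>L1\<in>C. \<exists>L2\<in>DIFF (Suc m) C. L = L1 - L2)"
    by (auto simp: diff_class_def)
  also have "\<dots> \<longleftrightarrow> (\<exists>Ls. length Ls = Suc (Suc m) \<and> set Ls \<subseteq> C \<and> L = nest Ls)" (is "?l \<longleftrightarrow> ?r")
  proof
    assume ?l
    then obtain L1 L2 where L: "L1 \<in> C" "L2 \<in> DIFF (Suc m) C" "L = L1 - L2" by blast
    from L(2) obtain Ls where "length Ls = Suc m" "set Ls \<subseteq> C" "L2 = nest Ls" unfolding 3 by blast
    then show ?r using L by (intro exI[of _ "L1 # Ls"]) auto
  next
    assume ?r
    then obtain L1 Ls where "length Ls = Suc m" "L1 \<in> C" "set Ls \<subseteq> C" "L = L1 - nest Ls"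
      by (auto simp: length_Suc_conv[of _ "Suc m"])
    then have "nest Ls \<in> DIFF (Suc m) C" unfolding 3 by blast
    then show ?l using \<open>L1 \<in> C\<close> \<open>L = L1 - nest Ls\<close> by blast
  qed
  finally show ?case .
qed

text \<open>Each further language that contains \<open>x\<close> flips the outcome, and the first
  one that does not contain it cuts off the rest.\<close>

lemma nest_iff: "x \<in> nest Ls \<longleftrightarrow> odd (length (takeWhile (\<lambda>L. x \<in> L) Ls))"
  by (induction Ls) auto

lemma nest_map_iff: "x \<in> nest (map F xs) \<longleftrightarrow> odd (length (takeWhile (\<lambda>i. x \<in> F i) xs))"
  unfolding nest_iff by (simp add: takeWhile_map comp_def)

lemma length_takeWhile_ge: "j \<le> length (takeWhile P xs) \<longleftrightarrow> j \<le> length xs \<and> (\<forall>i<j. P (xs ! i))"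
proof (induction xs arbitrary: j)
  case (Cons x xs)
  then show ?case by (cases j) (auto simp: All_less_Suc2)
qed auto

lemma length_takeWhile_eq: "length (takeWhile P [0..<m]) = J \<longleftrightarrow> J \<le> m \<and> (\<forall>i<J. P i) \<and> (J < m \<longrightarrow> \<not> P J)"
proof -
  have ge: "j \<le> length (takeWhile P [0..<m]) \<longleftrightarrow> j \<le> m \<and> (\<forall>i<j. P i)" for j
    unfolding length_takeWhile_ge by auto
  have "length (takeWhile P [0..<m]) = J \<longleftrightarrow> J \<le> length (takeWhile P [0..<m]) \<and> \<not> Suc J \<le> length (takeWhile P [0..<m])"
    by auto
  then show ?thesis unfolding ge by (auto simp: less_Suc_eq)
qed

text \<open>The length of the initial segment takes only \<open>m + 1\<close> values, so a finite
  disjunction over them suffices. The price of a level is due to the first failing condition, which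
  occurs negated.\<close>

lemma Sig_parity:
  assumes "\<And>i. i < m \<Longrightarrow> Sig k a (\<phi> i)"
  shows "Sig (Suc k) a (\<lambda>xs. odd (length (takeWhile (\<lambda>i. \<phi> i xs) [0..<m])) = b)"
proof -
  have "Sig (Suc k) a (\<lambda>xs. \<exists>J<Suc m. (odd J = b \<and> (\<forall>i<J. \<phi> i xs)) \<and> (\<not> J < m \<or> \<not> \<phi> J xs))"
  proof (rule Sig_ex_less)
    fix J assume J: "J < Suc m"
    have "Sig (Suc k) a (\<lambda>xs. \<forall>i<J. \<phi> i xs)" using assms J by (intro Sig_up Sig_all_less) auto
    moreover have "Sig (Suc k) a (\<lambda>xs. \<not> J < m \<or> \<not> \<phi> J xs)"
      using assms[of J] Sig_not[of k a "\<phi> J"] Sig_const[of "Suc k" a True] by (cases "J < m") auto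
    ultimately show "Sig (Suc k) a (\<lambda>xs. (odd J = b \<and> (\<forall>i<J. \<phi> i xs)) \<and> (\<not> J < m \<or> \<not> \<phi> J xs))"
      by (intro Sig_conj Sig_const)
  qed
  then show ?thesis
  proof (rule Sig_cong)
    fix xs
    show "(\<exists>J<Suc m. (odd J = b \<and> (\<forall>i<J. \<phi> i xs)) \<and> (\<not> J < m \<or> \<not> \<phi> J xs)) \<longleftrightarrow>
      (odd (length (takeWhile (\<lambda>i. \<phi> i xs) [0..<m])) = b)" (is "?l \<longleftrightarrow> ?r")
    proof
      assume ?l
      then obtain J where "J < Suc m" "odd J = b" "\<forall>i<J. \<phi> i xs" "\<not> J < m \<or> \<not> \<phi> J xs" by blast
      then have "length (takeWhile (\<lambda>i. \<phi> i xs) [0..<m]) = J" unfolding length_takeWhile_eq by auto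
      then show ?r using \<open>odd J = b\<close> by simp
    next
      assume ?r
      define J where "J = length (takeWhile (\<lambda>i. \<phi> i xs) [0..<m])"
      then have "J \<le> m \<and> (\<forall>i<J. \<phi> i xs) \<and> (J < m \<longrightarrow> \<not> \<phi> J xs)" using length_takeWhile_eq by metis
      moreover have "odd J = b" using \<open>?r\<close> by (simp add: J_def)
      ultimately show ?l by (intro exI[of _ J]) auto
    qed
  qed
qed

section \<open>Mind-change chains\<close>

text \<open>\<open>W r b\<close> reads: some candidate of rank \<open>r\<close> predicts the value \<open>b\<close>.\<close>

primrec chain :: "(nat \<Rightarrow> bool \<Rightarrow> bool) \<Rightarrow> nat \<Rightarrow> nat \<Rightarrow> nat \<Rightarrow> bool \<Rightarrow> bool" where
  "chain W m 0 r c = True"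
| "chain W m (Suc j) r c = (\<exists>r'<m. (r \<le> r' \<and> W r' (\<not> c)) \<and> chain W m j (Suc r') (\<not> c))"

lemma chain_bound: "chain W m (Suc j) r c \<Longrightarrow> r + Suc j \<le> m"
proof (induction j arbitrary: r c)
  case (Suc j)
  from Suc.prems obtain r' where "r' < m" "r \<le> r'" "W r' (\<not> c)" "chain W m (Suc j) (Suc r') (\<not> c)"
    unfolding chain.simps(2)[of W m "Suc j"] by blast
  then show ?case using Suc.IH[of "Suc r'" "\<not> c"] by simp
qed auto

text \<open>Every link flips the current value. A chain that cannot be prolonged must end in
  \<open>l\<close>, because otherwise rank \<open>rs\<close>, which predicts \<open>l\<close>, would
  provide one more link.\<close>

lemma chain_parity:
  assumes "rs < m" "\<And>r b. rs < r \<Longrightarrow> r < m \<Longrightarrow> \<not> W r b" "\<And>b. W rs b \<longleftrightarrow> b = l"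
  shows "chain W m J r c \<Longrightarrow> \<not> chain W m (Suc J) r c \<Longrightarrow> r \<le> rs \<or> c = l \<Longrightarrow> c \<noteq> l \<longleftrightarrow> odd J"
proof (induction J arbitrary: r c)
  case 0
  have "c = l"
  proof (rule ccontr)
    assume "c \<noteq> l"
    then have "W rs (\<not> c)" "r \<le> rs" using assms(3) 0 by auto
    then show False using 0(2) assms(1) by auto
  qed
  then show ?case by simp
next
  case (Suc J)
  from Suc.prems(1) obtain r' where r': "r' < m" "r \<le> r'" "W r' (\<not> c)" "chain W m J (Suc r') (\<not> c)" by auto
  have "\<not> chain W m (Suc J) (Suc r') (\<not> c)" using Suc.prems(2) r' unfolding chain.simps(2)[of W m "Suc J"] by blast
  \<comment> \<open>No candidates exist beyond \<open>rs\<close>; and if the link is at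
    \<open>rs\<close> itself, the value it leads to is \<open>l\<close>.\<close>
  moreover have "r' \<le> rs" using assms(2)[of r'] r' by (metis not_le)
  then have "Suc r' \<le> rs \<or> (\<not> c) = l" using assms(3)[of "\<not> c"] r'(3) by (cases "r' = rs") auto
  ultimately have "(\<not> c) \<noteq> l \<longleftrightarrow> odd J" by (rule Suc.IH[OF r'(4)])
  then show ?case by auto
qed

text \<open>Ranks increase strictly along a chain, so from rank \<open>r\<close> on there are at
  most \<open>m - r\<close> links and the list of tests is long enough to find where the
  prolongation fails.\<close>

lemma chain_value:
  assumes "rs < m" "\<And>r b. rs < r \<Longrightarrow> r < m \<Longrightarrow> \<not> W r b" "\<And>b. W rs b \<longleftrightarrow> b = l" "r \<le> rs \<or> c = l"
  shows "odd (length (takeWhile (\<lambda>j. chain W m (Suc j) r c) [0..<m - r])) \<longleftrightarrow> c \<noteq> l"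
proof -
  define J where "J = length (takeWhile (\<lambda>j. chain W m (Suc j) r c) [0..<m - r])"
  have J: "J \<le> m - r" "\<forall>i<J. chain W m (Suc i) r c" "J < m - r \<longrightarrow> \<not> chain W m (Suc J) r c"
    using length_takeWhile_eq[of "\<lambda>j. chain W m (Suc j) r c" "m - r" J] unfolding J_def by blast+
  have c1: "chain W m J r c" using J(2) by (cases J) (auto simp del: chain.simps(2))
  have c2: "\<not> chain W m (Suc J) r c"
  proof
    assume c: "chain W m (Suc J) r c"
    from chain_bound[OF this] have "J < m - r" by simp
    then show False using J(3) c by blast
  qed
  have "c \<noteq> l \<longleftrightarrow> odd J"
    by (rule chain_parity[where rs = rs and m = m and W = W]) (fact assms c1 c2)+
  then show ?thesis by (simp add: J_def)
qed

lemma Sig_chain: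
  assumes "\<And>r b. r < m \<Longrightarrow> Sig k a (\<lambda>zs. W zs r b)"
  shows "Sig k a (\<lambda>zs. chain (W zs) m j r c)"
proof (induction j arbitrary: r c)
  case 0
  then show ?case using Sig_const[of k a True] by simp
next
  case (Suc j)
  show ?case unfolding chain.simps by (intro Sig_ex_less Sig_conj Sig_const assms Suc.IH)
qed

section \<open>Hard sequences\<close>

text \<open>\<open>Cs\<close> represents the complement of the parity language of \<open>A\<close> on \<open>m\<close>-tuples; \<open>Suc k\<close> is the level of the informal statement.\<close>

locale hard_sequences =
  fixes k m :: nat and A :: lang and Cs :: "lang list"
  assumes m: "1 \<le> m" and A: "A \<in> Orc (Suc k)" and Cs: "length Cs = m" "set Cs \<subseteq> Orc (Suc k)"
    and compl: "nest Cs = - nest (map (\<lambda>i. elang m (\<lambda>xs. \<exists>j<m. i \<le> j \<and> xs ! j \<in> A)) [0..<m])"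
begin

text \<open>The conditions weaken to the left, so their number is the position, counted from one, of
  the last word in \<open>A\<close>, or 0 if there is none.\<close>

definition MA :: "bool list list \<Rightarrow> nat" where
  "MA xs = length (takeWhile (\<lambda>i. \<exists>j<m. i \<le> j \<and> xs ! j \<in> A) [0..<m])"

definition MB :: "bool list list \<Rightarrow> nat" where
  "MB xs = length (takeWhile (\<lambda>L. enc xs \<in> L) Cs)"

text \<open>The two counts belong to complementary languages, so exactly one of them is odd; in
  particular they are never equal.\<close>

lemma parity: "length xs = m \<Longrightarrow> odd (MB xs) \<longleftrightarrow> even (MA xs)"
proof -
  assume xs: "length xs = m"
  have "enc xs \<in> nest Cs \<longleftrightarrow> enc xs \<notin> nest (map (\<lambda>i. elang m (\<lambda>xs. \<exists>j<m. i \<le> j \<and> xs ! j \<in> A)) [0..<m])"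
    unfolding compl by simp
  then show ?thesis unfolding nest_map_iff unfolding nest_iff MA_def MB_def enc_elang[OF xs] by simp
qed

definition Bge :: "nat \<Rightarrow> bool list list \<Rightarrow> bool" where
  "Bge j xs \<longleftrightarrow> (\<forall>i<j. enc xs \<in> Cs ! i)"

lemma MB_ge: "j \<le> m \<Longrightarrow> j \<le> MB xs \<longleftrightarrow> Bge j xs"
  by (simp add: MB_def Bge_def length_takeWhile_ge Cs)

lemma MB_le: "MB xs \<le> m"
  using length_takeWhile_le[of _ Cs] by (simp add: MB_def Cs)

lemma MA_ge: "i < m \<Longrightarrow> Suc i \<le> MA xs \<longleftrightarrow> (\<exists>j<m. i \<le> j \<and> xs ! j \<in> A)"
  unfolding MA_def length_takeWhile_ge by (auto simp: less_Suc_eq_le)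

lemma MA_le: "MA xs \<le> m"
  using length_takeWhile_le[of _ "[0..<m]"] by (simp add: MA_def)

definition bdd :: "nat \<Rightarrow> bool list list \<Rightarrow> bool" where
  "bdd n ys \<longleftrightarrow> (\<forall>y\<in>set ys. length y \<le> n)"

text \<open>Hard words are collected at the right end of the tuple: \<open>ys @ w # s\<close> has \<open>w\<close> to the left of the hard sequence \<open>s\<close>.\<close>

definition easy :: "nat \<Rightarrow> bool list \<Rightarrow> bool list list \<Rightarrow> bool" where
  "easy n w s \<longleftrightarrow> (\<exists>ys. length ys = m - Suc (length s) \<and> bdd n ys \<and> Bge (m - length s) (ys @ w # s))"

primrec hard :: "nat \<Rightarrow> bool list list \<Rightarrow> bool" where
  "hard n [] = True"
| "hard n (h # s) = (hard n s \<and> h \<notin> A \<and> \<not> easy n h s)"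

lemma hard_notin: "hard n s \<Longrightarrow> h \<in> set s \<Longrightarrow> h \<notin> A"
  by (induction s) auto

text \<open>A larger count would make \<open>zs\<close> a certificate that the leftmost word of
  \<open>s\<close> is easy.\<close>

lemma hard_MB:
  assumes "hard n s" "length zs + length s = m" "bdd n zs"
  shows "MB (zs @ s) \<le> length zs"
proof (cases s)
  case Nil
  then show ?thesis using MB_le[of "zs @ s"] assms(2) by simp
next
  case (Cons h s')
  then have "\<not> easy n h s'" using assms(1) by simp
  then have "\<not> Bge (m - length s') (zs @ h # s')" using assms(2,3) Cons by (auto simp: easy_def)
  moreover have "m - length s' = Suc (length zs)" "Suc (length zs) \<le> m" using assms(2) Cons by auto
  ultimately show ?thesis using MB_ge[of "Suc (length zs)" "zs @ s"] Cons by auto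
qed

lemma hard_MA: "hard n s \<Longrightarrow> length zs + length s = m \<Longrightarrow> MA (zs @ s) \<le> length zs"
proof -
  assume h: "hard n s" and l: "length zs + length s = m"
  have "\<not> Suc (length zs) \<le> MA (zs @ s)" if "length zs < m"
  proof -
    have "(zs @ s) ! j \<notin> A" if "j < m" "length zs \<le> j" for j
      using that l hard_notin[OF h] by (auto simp: nth_append)
    then show ?thesis using MA_ge[OF that] by blast
  qed
  then show ?thesis using MA_le[of "zs @ s"] l by (cases "length zs < m") auto
qed

text \<open>Suppose \<open>w\<close> is in \<open>A\<close>. The words of \<open>s\<close> cap both
  counts at the position of \<open>w\<close>; the certificate raises \<open>MB\<close> to it and the
  membership of \<open>w\<close> raises \<open>MA\<close>. Equal counts contradict
  \<open>parity\<close>.\<close>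

lemma easy_notin:
  assumes "hard n s" "length s < m" "easy n w s" "length w \<le> n"
  shows "w \<notin> A"
proof
  assume w: "w \<in> A"
  obtain ys where ys: "length ys = m - Suc (length s)" "bdd n ys" "Bge (m - length s) (ys @ w # s)"
    using assms(3) by (auto simp: easy_def)
  let ?zs = "ys @ [w]"
  have l: "length ?zs + length s = m" "length ?zs = m - length s" "bdd n ?zs"
    using ys assms(2,4) by (auto simp: bdd_def)
  have "MB (?zs @ s) \<le> length ?zs" by (rule hard_MB[OF assms(1) l(1,3)])
  moreover have "length ?zs \<le> MB (?zs @ s)" using MB_ge[of "m - length s" "?zs @ s"] ys(3) l(2) by simp
  ultimately have 1: "MB (?zs @ s) = length ?zs" by simp
  have "MA (?zs @ s) \<le> length ?zs" by (rule hard_MA[OF assms(1) l(1)])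
  moreover have "Suc (length ys) \<le> MA (?zs @ s)"
    using MA_ge[of "length ys" "?zs @ s"] l(1) w by (auto intro!: exI[of _ "length ys"] simp: nth_append)
  ultimately have 2: "MA (?zs @ s) = length ?zs" by simp
  show False using parity[of "?zs @ s"] 1 2 l(1) by simp
qed

text \<open>A tuple of \<open>m\<close> hard words would have both counts 0.\<close>

lemma hard_length: "hard n s \<Longrightarrow> length s \<le> m \<Longrightarrow> length s < m"
proof (rule ccontr)
  assume h: "hard n s" and "length s \<le> m" "\<not> length s < m"
  then have l: "length s = m" by simp
  have "MB s = 0" "MA s = 0" using hard_MB[OF h, of "[]"] hard_MA[OF h, of "[]"] l by (auto simp: bdd_def)
  then show False using parity[OF l] by simp
qed

definition maxh :: "nat \<Rightarrow> bool list list \<Rightarrow> bool" where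
  "maxh n s \<longleftrightarrow> hard n s \<and> bdd n s \<and> length s < m \<and> (\<forall>h. length h \<le> n \<longrightarrow> \<not> hard n (h # s))"

text \<open>The gain from hardness: a word outside \<open>A\<close> that was not easy would extend
  the maximal sequence, so nonmembership becomes an existential condition.\<close>

lemma maxh_iff: "maxh n s \<Longrightarrow> length w \<le> n \<Longrightarrow> w \<notin> A \<longleftrightarrow> easy n w s"
  using easy_notin unfolding maxh_def by auto

text \<open>\<open>rs\<close> is the largest length of a hard sequence. Sequences that are maximal
  under extension may be shorter, but at length \<open>rs\<close> all of them are maximal, which is
  what the mind-change argument needs.\<close>

lemma ex_rank: "\<exists>rs<m. (\<exists>s. length s = rs \<and> hard n s \<and> bdd n s) \<and>
    (\<forall>r s. rs < r \<longrightarrow> r < m \<longrightarrow> length s = r \<longrightarrow> \<not> (hard n s \<and> bdd n s)) \<and>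
    (\<forall>s. length s = rs \<longrightarrow> hard n s \<longrightarrow> bdd n s \<longrightarrow> maxh n s)"
proof -
  define X where "X = {r. r < m \<and> (\<exists>s. length s = r \<and> hard n s \<and> bdd n s)}"
  have "0 \<in> X" using m by (auto simp: X_def bdd_def)
  have fin: "finite X" by (simp add: X_def)
  define rs where "rs = Max X"
  have rs: "rs \<in> X" unfolding rs_def using \<open>0 \<in> X\<close> fin by (intro Max_in) auto
  have mx: "r \<le> rs" if "r \<in> X" for r unfolding rs_def using fin that by (rule Max_ge)
  have "maxh n s" if s: "length s = rs" "hard n s" "bdd n s" for s
    unfolding maxh_def
  proof (intro conjI allI impI s)
    show "length s < m" using rs s by (simp add: X_def)
    fix h :: "bool list" assume h: "length h \<le> n"
    show "\<not> hard n (h # s)"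
    proof
      assume H: "hard n (h # s)"
      have "length (h # s) < m" by (rule hard_length[OF H]) (use \<open>length s < m\<close> in simp)
      moreover have "bdd n (h # s)" using s h by (simp add: bdd_def)
      ultimately have "Suc rs \<in> X" using H s(1) unfolding X_def by (intro CollectI conjI exI[of _ "h # s"]) simp_all
      then show False using mx by fastforce
    qed
  qed
  moreover have "\<not> (hard n s \<and> bdd n s)" if "rs < r" "r < m" "length s = r" for r s
    using that mx[of r] by (auto simp: X_def)
  ultimately show ?thesis using rs unfolding X_def by blast
qed

subsection \<open>Complexity of hard sequences\<close>

abbreviation pw :: "nat \<Rightarrow> bool list \<Rightarrow> nat" where "pw d x \<equiv> (length x + 2) ^ d"

lemma Sig_Bge: "j \<le> m \<Longrightarrow> Sig k m (Bge j)"
  unfolding Bge_def[abs_def] using Cs by (intro Sig_all_less Sig_enc) auto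

lemma Sig_easy: "r < m \<Longrightarrow> Sig k (r + 2) (\<lambda>zs. easy (pw d (zs ! 0)) (zs ! 1) (drop 2 zs))"
proof -
  assume r: "r < m"
  let ?q = "m - Suc r"
  \<comment> \<open>The arguments arrive as \<open>ys @ x # w # s\<close>; the index list skips
    \<open>x\<close>, which only supplies the length bound.\<close>
  let ?is = "[0..<?q] @ [Suc ?q..<?q + (r + 2)]"
  have l: "length ?is = m" using r by simp
  have 1: "Sig k (?q + (r + 2)) (\<lambda>zs. Bge (m - r) (map ((!) zs) ?is))"
    by (rule Sig_select[OF Sig_Bge l]) auto
  have "Sig k (r + 2) (\<lambda>xs. \<exists>ys. length ys = ?q \<and> (\<forall>y\<in>set ys. length y \<le> pw d (xs ! 0)) \<and>
     Bge (m - r) (map ((!) (ys @ xs)) ?is))" by (rule Sig_bexs[OF 1]) simp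
  then show ?thesis
  proof (rule Sig_cong)
    fix xs :: "bool list list" assume xs: "length xs = r + 2"
    then obtain x w s where e: "xs = x # w # s" "length s = r" by (auto simp: length_Suc_conv)
    have "map ((!) (ys @ xs)) ?is = ys @ w # s" if "length ys = ?q" for ys
    proof (rule nth_equalityI)
      show "length (map ((!) (ys @ xs)) ?is) = length (ys @ w # s)" using that e r by simp
      fix i assume "i < length (map ((!) (ys @ xs)) ?is)"
      then have i: "i < m" using l by simp
      show "map ((!) (ys @ xs)) ?is ! i = (ys @ w # s) ! i"
      proof (cases "i < ?q")
        case True
        then show ?thesis using that by (simp add: nth_append)
      next
        case False
        then obtain t where t: "i = ?q + t" by (metis le_iff_add not_less)
        have "?is ! i = [Suc ?q..<?q + (r + 2)] ! t"
          unfolding t using nth_append_length_plus[of "[0..<?q]" _ t] by (metis diff_zero length_upt)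
        also have "\<dots> = Suc ?q + t" by (rule nth_upt) (use i t r in simp)
        finally have "?is ! i = Suc ?q + t" .
        moreover have "map ((!) (ys @ xs)) ?is ! i = (ys @ xs) ! (?is ! i)" by (rule nth_map) (simp only: l i)
        ultimately have "map ((!) (ys @ xs)) ?is ! i = (ys @ xs) ! (?q + Suc t)" by simp
        also have "\<dots> = (w # s) ! t" using that unfolding e by (metis nth_Cons_Suc nth_append_length_plus)
        also have "\<dots> = (ys @ w # s) ! i" using that t by (metis nth_append_length_plus)
        finally show ?thesis .
      qed
    qed
    moreover have "xs ! 1 = w" "drop 2 xs = s" using e by auto
    ultimately show "(\<exists>ys. length ys = ?q \<and> (\<forall>y\<in>set ys. length y \<le> pw d (xs ! 0)) \<and>
     Bge (m - r) (map ((!) (ys @ xs)) ?is)) \<longleftrightarrow> easy (pw d (xs ! 0)) (xs ! 1) (drop 2 xs)"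
      unfolding easy_def bdd_def by (intro ex_cong1 conj_cong) (simp_all only: e(2))
  qed
qed

lemma map_nth_tail: "length zs = c + r \<Longrightarrow> map ((!) zs) [c..<c + r] = drop c zs"
  by (rule nth_equalityI) auto

text \<open>A sequence fails to be hard through a word in \<open>A\<close> or an easy word. Both are
  existential at the level of \<open>A\<close>, so non-hardness is on that level and hardness one
  above.\<close>

lemma Sig_not_hard: "r \<le> m \<Longrightarrow> Sig k (r + 1) (\<lambda>zs. \<not> hard (pw d (zs ! 0)) (tl zs))"
proof (induction r)
  case 0
  show ?case by (rule Sig_cong[OF Sig_const[of k _ False]]) (auto simp: length_Suc_conv)
next
  case (Suc r)
  have "Sig k (Suc r + 1) (\<lambda>zs. \<not> hard (pw d (map ((!) zs) (0 # [2..<2 + r]) ! 0)) (tl (map ((!) zs) (0 # [2..<2 + r]))))"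
    by (rule Sig_select[OF Suc.IH]) (use Suc.prems in auto)
  moreover have "Sig k (Suc r + 1) (\<lambda>zs. zs ! 1 \<in> A)" by (rule Sig_mem[OF A]) simp
  moreover have "Sig k (Suc r + 1) (\<lambda>zs. easy (pw d (zs ! 0)) (zs ! 1) (drop 2 zs))"
    using Sig_easy[of r d] Suc.prems by simp
  ultimately have "Sig k (Suc r + 1) (\<lambda>zs. (\<not> hard (pw d (map ((!) zs) (0 # [2..<2 + r]) ! 0)) (tl (map ((!) zs) (0 # [2..<2 + r]))) \<or>
     zs ! 1 \<in> A) \<or> easy (pw d (zs ! 0)) (zs ! 1) (drop 2 zs))" by (intro Sig_disj)
  then show ?case
  proof (rule Sig_cong)
    fix zs :: "bool list list" assume "length zs = Suc r + 1"
    then obtain x h s where e: "zs = x # h # s" "length s = r" by (auto simp: length_Suc_conv)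
    have "map ((!) zs) [2..<2 + r] = s" using map_nth_tail[of zs 2 r] e by simp
    then show "((\<not> hard (pw d (map ((!) zs) (0 # [2..<2 + r]) ! 0)) (tl (map ((!) zs) (0 # [2..<2 + r]))) \<or>
     zs ! 1 \<in> A) \<or> easy (pw d (zs ! 0)) (zs ! 1) (drop 2 zs)) \<longleftrightarrow> \<not> hard (pw d (zs ! 0)) (tl zs)"
      using e by auto
  qed
qed

lemma Sig_hard: "r \<le> m \<Longrightarrow> Sig (Suc k) (r + 1) (\<lambda>zs. hard (pw d (zs ! 0)) (tl zs))"
  using Sig_not[OF Sig_not_hard] by simp

subsection \<open>Lowering complexity with a maximal hard sequence\<close>

text \<open>\<open>Adv j L\<close>: with a maximal hard sequence \<open>s\<close> for a polynomial bound as advice, \<open>L\<close> drops to \<open>Sig j\<close>. The length of \<open>x\<close>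
  sets the bound; the word \<open>u\<close> that is tested may be longer than \<open>x\<close>, which iteration needs.\<close>

definition Adv :: "nat \<Rightarrow> lang \<Rightarrow> bool" where
  "Adv j L \<longleftrightarrow> (\<exists>e. \<forall>d r. r < m \<longrightarrow> (\<exists>\<chi>. Sig j (r + 2) \<chi> \<and> (\<forall>u x s. length s = r \<longrightarrow> maxh (pw d x) s \<longrightarrow>
     pw e u \<le> pw d x \<longrightarrow> (\<chi> (u # x # s) \<longleftrightarrow> u \<in> L))))"

lemma pw_mono: "d \<le> e \<Longrightarrow> pw d x \<le> pw e x"
  by (rule power_increasing) auto

text \<open>Given a maximal hard sequence, positive answers of \<open>A\<close> are verified
  directly and negative ones by \<open>easy\<close>, both at the level of \<open>A\<close>.
  Substituting these for the queries keeps \<open>L\<close> on that level.\<close>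

lemma Adv_base: "L \<in> NP_oracle A \<Longrightarrow> Adv k L"
proof -
  assume "L \<in> NP_oracle A"
  from Sig_subst[OF this] obtain g where g: "\<forall>k c Y N. Sig k (c + 2) Y \<longrightarrow> Sig k (c + 2) N \<longrightarrow> (\<exists>\<psi>. Sig k (c + 1) \<psi> \<and>
    (\<forall>zs. length zs = c + 1 \<longrightarrow> certifies Y N A g zs \<longrightarrow> (\<psi> zs \<longleftrightarrow> zs ! 0 \<in> L)))" by (elim exE)
  show ?thesis unfolding Adv_def
  proof (rule exI[of _ g], intro allI impI)
    fix d r assume r: "r < m"
    \<comment> \<open>The verifier receives the query \<open>w\<close>, then \<open>u\<close>,
      \<open>x\<close> and \<open>s\<close>; \<open>easy\<close> expects \<open>x\<close>,
      \<open>w\<close> and \<open>s\<close>.\<close>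
    let ?is = "[2, 0] @ [3..<3 + r]"
    define Y where "Y zs \<longleftrightarrow> zs ! 0 \<in> A" for zs :: "bool list list"
    define N where "N zs \<longleftrightarrow> length (zs ! 0) \<le> pw d (zs ! 2) \<and>
      easy (pw d (map ((!) zs) ?is ! 0)) (map ((!) zs) ?is ! 1) (drop 2 (map ((!) zs) ?is))" for zs
    have Y: "Sig k (r + 1 + 2) Y" unfolding Y_def[abs_def] by (rule Sig_mem[OF A]) simp
    have N: "Sig k (r + 1 + 2) N" unfolding N_def[abs_def]
      by (intro Sig_conj Sig_len Sig_select[OF Sig_easy[OF r]]) auto
    from g[THEN spec, THEN spec, THEN spec, THEN spec, THEN mp, THEN mp, OF Y N] obtain \<psi> where
      \<psi>: "Sig k (r + 1 + 1) \<psi>" "\<forall>zs. length zs = r + 1 + 1 \<longrightarrow> certifies Y N A g zs \<longrightarrow> (\<psi> zs \<longleftrightarrow> zs ! 0 \<in> L)"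
      by (elim exE conjE)
    show "\<exists>\<chi>. Sig k (r + 2) \<chi> \<and> (\<forall>u x s. length s = r \<longrightarrow> maxh (pw d x) s \<longrightarrow>
     pw g u \<le> pw d x \<longrightarrow> (\<chi> (u # x # s) \<longleftrightarrow> u \<in> L))"
    proof (rule exI[of _ \<psi>], intro conjI allI impI)
      show "Sig k (r + 2) \<psi>" using \<psi>(1) by simp
      fix u x s assume s: "length s = r" and mx: "maxh (pw d x) s" and le: "pw g u \<le> pw d x"
      have N': "N (w # u # x # s) \<longleftrightarrow> length w \<le> pw d x \<and> easy (pw d x) w s" for w
      proof -
        have "map ((!) (w # u # x # s)) [3..<3 + r] = s" using map_nth_tail[of "w # u # x # s" 3 r] s by simp
        then show ?thesis by (simp add: N_def)
      qed
      have Y': "Y (w # u # x # s) \<longleftrightarrow> w \<in> A" for w by (simp add: Y_def)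
      have "certifies Y N A g (u # x # s)" unfolding certifies_def N' Y' nth_Cons_0
        using maxh_iff[OF mx] le_trans[OF _ le] by blast
      then show "\<psi> (u # x # s) \<longleftrightarrow> u \<in> L" using \<psi>(2) s by simp
    qed
  qed
qed

text \<open>The prediction for the oracle \<open>A'\<close> and its negation are both available one
  level up and verify the two answers; the hard sequence is passed on unchanged.\<close>

lemma Adv_step: "Adv j A' \<Longrightarrow> L \<in> NP_oracle A' \<Longrightarrow> Adv (Suc j) L"
proof -
  assume adv: "Adv j A'" and "L \<in> NP_oracle A'"
  from Sig_subst[OF this(2)] obtain g where g: "\<forall>k c Y N. Sig k (c + 2) Y \<longrightarrow> Sig k (c + 2) N \<longrightarrow> (\<exists>\<psi>. Sig k (c + 1) \<psi> \<and>
    (\<forall>zs. length zs = c + 1 \<longrightarrow> certifies Y N A' g zs \<longrightarrow> (\<psi> zs \<longleftrightarrow> zs ! 0 \<in> L)))" by (elim exE)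
  from adv obtain e where e: "\<forall>d r. r < m \<longrightarrow> (\<exists>\<chi>. Sig j (r + 2) \<chi> \<and> (\<forall>u x s. length s = r \<longrightarrow> maxh (pw d x) s \<longrightarrow>
     pw e u \<le> pw d x \<longrightarrow> (\<chi> (u # x # s) \<longleftrightarrow> u \<in> A')))" unfolding Adv_def by (elim exE)
  show ?thesis unfolding Adv_def
  \<comment> \<open>Queries of \<open>L\<close> on \<open>u\<close> have length at most
    \<open>pw g u\<close>. Adding 2 stays below \<open>pw (g + 2) u\<close>, and the bound for
    \<open>A'\<close> raises this to the power \<open>e\<close>.\<close>
  proof (rule exI[of _ "(g + 2) * e"], intro allI impI)
    fix d r assume r: "r < m"
    from e[THEN spec, THEN spec, THEN mp, OF r, of d] obtain \<chi> where \<chi>: "Sig j (r + 2) \<chi>"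
      "\<forall>u x s. length s = r \<longrightarrow> maxh (pw d x) s \<longrightarrow> pw e u \<le> pw d x \<longrightarrow> (\<chi> (u # x # s) \<longleftrightarrow> u \<in> A')"
      by (elim exE conjE)
    let ?is = "0 # [2..<2 + (r + 1)]"
    define Z where "Z b zs \<longleftrightarrow> length (zs ! 0) \<le> pw g (zs ! 1) \<and> \<chi> (map ((!) zs) ?is) = b" for b zs
    have Z: "Sig (Suc j) (r + 1 + 2) (Z b)" for b
    proof -
      have "Sig j (r + 1 + 2) (\<lambda>zs. \<chi> (map ((!) zs) ?is))" by (rule Sig_select[OF \<chi>(1)]) auto
      from Sig_Suc_eq[OF this] show ?thesis unfolding Z_def[abs_def] by (intro Sig_conj Sig_len) auto
    qed
    from g[THEN spec, THEN spec, THEN spec, THEN spec, THEN mp, THEN mp, OF Z[of True] Z[of False]] obtain \<psi> where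
      \<psi>: "Sig (Suc j) (r + 1 + 1) \<psi>" "\<forall>zs. length zs = r + 1 + 1 \<longrightarrow> certifies (Z True) (Z False) A' g zs \<longrightarrow> (\<psi> zs \<longleftrightarrow> zs ! 0 \<in> L)"
      by (elim exE conjE)
    show "\<exists>\<chi>. Sig (Suc j) (r + 2) \<chi> \<and> (\<forall>u x s. length s = r \<longrightarrow> maxh (pw d x) s \<longrightarrow>
     pw ((g + 2) * e) u \<le> pw d x \<longrightarrow> (\<chi> (u # x # s) \<longleftrightarrow> u \<in> L))"
    proof (rule exI[of _ \<psi>], intro conjI allI impI)
      show "Sig (Suc j) (r + 2) \<psi>" using \<psi>(1) by simp
      fix u x s assume s: "length s = r" and mx: "maxh (pw d x) s" and le: "pw ((g + 2) * e) u \<le> pw d x"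
      have key: "\<chi> (w # x # s) \<longleftrightarrow> w \<in> A'" if w: "length w \<le> pw g u" for w
      proof -
        have p1: "1 \<le> pw g u" by simp
        have "4 * pw g u \<le> (length u + 2) * (length u + 2) * pw g u"
          by (intro mult_le_mono1) simp
        then have "4 * pw g u \<le> pw (g + 2) u" by (simp add: power_add power2_eq_square mult_ac)
        then have "length w + 2 \<le> pw (g + 2) u" using w p1 by linarith
        then have "pw e w \<le> (pw (g + 2) u) ^ e" by (rule power_mono) simp
        also have "\<dots> = pw ((g + 2) * e) u" by (simp only: power_mult)
        finally have "pw e w \<le> pw d x" using le by linarith
        then show ?thesis using \<chi>(2) s mx by blast
      qed
      have Z': "Z b (w # u # x # s) \<longleftrightarrow> length w \<le> pw g u \<and> \<chi> (w # x # s) = b" for b w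
      proof -
        have "map ((!) (w # u # x # s)) [2..<2 + (r + 1)] = x # s" using map_nth_tail[of "w # u # x # s" 2 "r + 1"] s by simp
        then show ?thesis by (simp add: Z_def del: upt_Suc)
      qed
      have "certifies (Z True) (Z False) A' g (u # x # s)" unfolding certifies_def Z' using key by auto
      then show "\<psi> (u # x # s) \<longleftrightarrow> u \<in> L" using \<psi>(2) s by simp
    qed
  qed
qed

text \<open>The tested word is now the input itself, so every exponent from \<open>e\<close> on is
  admissible. This allows several predictions to share one exponent and hence the same hard
  sequences.\<close>

lemma AdvD:
  assumes "Adv j L"
  shows "\<exists>e \<chi>. \<forall>d. e \<le> d \<longrightarrow> (\<forall>r<m. Sig j (r + 1) (\<chi> d r)) \<and>
    (\<forall>x s. maxh (pw d x) s \<longrightarrow> (\<chi> d (length s) (x # s) \<longleftrightarrow> x \<in> L))"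
proof -
  from assms obtain e where e: "\<forall>d r. r < m \<longrightarrow> (\<exists>\<chi>. Sig j (r + 2) \<chi> \<and> (\<forall>u x s. length s = r \<longrightarrow> maxh (pw d x) s \<longrightarrow>
     pw e u \<le> pw d x \<longrightarrow> (\<chi> (u # x # s) \<longleftrightarrow> u \<in> L)))" unfolding Adv_def by (elim exE)
  then obtain \<chi> where \<chi>: "\<And>d r. r < m \<Longrightarrow> Sig j (r + 2) (\<chi> d r)"
    "\<And>d r u x s. r < m \<Longrightarrow> length s = r \<Longrightarrow> maxh (pw d x) s \<Longrightarrow> pw e u \<le> pw d x \<Longrightarrow> \<chi> d r (u # x # s) \<longleftrightarrow> u \<in> L"
    by metis
  show ?thesis
  proof (intro exI[of _ e] exI[of _ "\<lambda>d r zs. \<chi> d r (map ((!) zs) (0 # [0..<r + 1]))"] allI impI conjI)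
    fix d r assume "r < m"
    show "Sig j (r + 1) (\<lambda>zs. \<chi> d r (map ((!) zs) (0 # [0..<r + 1])))"
      by (rule Sig_select[OF \<chi>(1)[OF \<open>r < m\<close>]]) auto
  next
    fix d x s assume d: "e \<le> d" and mx: "maxh (pw d x) s"
    have "map ((!) (x # s)) (0 # [0..<length s + 1]) = x # x # s"
      using map_nth[of "x # s"] by (simp del: upt_Suc)
    then show "\<chi> d (length s) (map ((!) (x # s)) (0 # [0..<length s + 1])) \<longleftrightarrow> x \<in> L"
      using \<chi>(2)[where r = "length s" and s = s and d = d and x = x and u = x] mx pw_mono[OF d] by (simp add: maxh_def del: upt_Suc)
  qed
qed

text \<open>One level above \<open>Adv\<close>, the maximal hard sequence itself can be guessed and verified.\<close>

lemma Adv_collapse: "Adv (k + 2) L \<Longrightarrow> L \<in> Orc (k + 3)"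
proof -
  assume "Adv (k + 2) L"
  from AdvD[OF this] obtain e \<chi> where "\<forall>d. e \<le> d \<longrightarrow> (\<forall>r<m. Sig (k + 2) (r + 1) (\<chi> d r)) \<and>
    (\<forall>x s. maxh (pw d x) s \<longrightarrow> (\<chi> d (length s) (x # s) \<longleftrightarrow> x \<in> L))" by (elim exE)
  then have \<chi>: "\<And>r. r < m \<Longrightarrow> Sig (k + 2) (r + 1) (\<chi> e r)"
    "\<And>x s. maxh (pw e x) s \<Longrightarrow> \<chi> e (length s) (x # s) \<longleftrightarrow> x \<in> L" by auto
  \<comment> \<open>Maximality means that no one-word extension is hard, a negated bounded
    quantifier over a \<open>Sig (Suc k)\<close> predicate and thus within
    \<open>Sig (k + 2)\<close>. The permutation puts \<open>h\<close> between the input and the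
    sequence.\<close>
  define P where "P r zs \<longleftrightarrow> (hard (pw e (zs ! 0)) (tl zs) \<and>
      \<not> (\<exists>h. length h \<le> pw e (zs ! 0) \<and> hard (pw e (map ((!) (h # zs)) (1 # 0 # [2..<2 + r]) ! 0)) (tl (map ((!) (h # zs)) (1 # 0 # [2..<2 + r]))))) \<and>
      \<chi> e r zs" for r zs
  have "Sig (k + 2) (r + 1) (P r)" if r: "r < m" for r
    unfolding P_def[abs_def]
  proof (intro Sig_conj \<chi>(1)[OF r])
    show "Sig (k + 2) (r + 1) (\<lambda>zs. hard (pw e (zs ! 0)) (tl zs))"
      by (rule Sig_ups[OF _ Sig_hard]) (use r in auto)
    have "Sig (Suc k) (Suc (r + 1)) (\<lambda>zs. hard (pw e (map ((!) zs) (1 # 0 # [2..<2 + r]) ! 0)) (tl (map ((!) zs) (1 # 0 # [2..<2 + r]))))"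
      by (rule Sig_select[OF Sig_hard[of "Suc r"]]) (use r in auto)
    from Sig_not[OF Sig_bex[OF this, of 0 e]]
    show "Sig (k + 2) (r + 1) (\<lambda>zs. \<not> (\<exists>h. length h \<le> pw e (zs ! 0) \<and> hard (pw e (map ((!) (h # zs)) (1 # 0 # [2..<2 + r]) ! 0)) (tl (map ((!) (h # zs)) (1 # 0 # [2..<2 + r])))))"
      by simp
  qed
  then have "Sig (k + 2) 1 (\<lambda>xs. \<exists>r<m. \<exists>s. length s = r \<and> (\<forall>y\<in>set s. length y \<le> pw e (xs ! 0)) \<and> P r (xs ! 0 # s))"
    by (intro Sig_ex_less Sig_bexs_tail)
  moreover have "(\<exists>r<m. \<exists>s. length s = r \<and> (\<forall>y\<in>set s. length y \<le> pw e x) \<and> P r (x # s)) \<longleftrightarrow> x \<in> L" for x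
  proof -
    have P: "P r (x # s) \<longleftrightarrow> maxh (pw e x) s \<and> \<chi> e r (x # s)"
      if s: "length s = r" "\<forall>y\<in>set s. length y \<le> pw e x" and r: "r < m" for r s
    proof -
      have "map ((!) (h # x # s)) (1 # 0 # [2..<2 + r]) = x # h # s" for h
        using map_nth_tail[of "h # x # s" 2 r] s by simp
      then show ?thesis unfolding P_def maxh_def bdd_def using s r by auto
    qed
    obtain rs s where "rs < m" "length s = rs" "bdd (pw e x) s" "maxh (pw e x) s" using ex_rank by metis
    then show ?thesis using P \<chi>(2) unfolding bdd_def by metis
  qed
  ultimately have "Sig (k + 2) 1 (\<lambda>xs. xs ! 0 \<in> L)" by simp
  then show ?thesis using Orc_Suc[of L "k + 2"] by (simp add: numeral_3_eq_3)
qed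

end

declare Orc.simps(2) [simp del] SigmaP.simps(2) [simp del]

lemma Orc_relative: "L \<in> Orc (Suc k) \<longleftrightarrow> (\<exists>A\<in>Orc k. L \<in> NP_oracle A)"
  by (auto simp: NP_relative_def Orc.simps(2))

lemma Orc_Int: "L \<in> Orc (Suc k) \<Longrightarrow> L' \<in> Orc (Suc k) \<Longrightarrow> L \<inter> L' \<in> Orc (Suc k)"
  unfolding Orc_Suc Int_iff by (rule Sig_conj)

lemma Orc_Un: "L \<in> Orc (Suc k) \<Longrightarrow> L' \<in> Orc (Suc k) \<Longrightarrow> L \<union> L' \<in> Orc (Suc k)"
  unfolding Orc_Suc Un_iff by (rule Sig_disj)

text \<open>Differences are formed by intersection with complements, and one level up all components
  and their complements are available.\<close>

lemma Orc_nest: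
  "set Ls \<subseteq> Orc (Suc k) \<Longrightarrow> nest Ls \<in> Orc (Suc (Suc k)) \<and> - nest Ls \<in> Orc (Suc (Suc k))"
proof (induction Ls)
  case Nil
  have "Sig (Suc k) 1 (\<lambda>xs. xs ! 0 \<in> {})" "Sig (Suc k) 1 (\<lambda>xs. xs ! 0 \<in> UNIV)"
    using Sig_const[of "Suc k" 1 False] Sig_const[of "Suc k" 1 True] by simp_all
  then show ?case unfolding Orc_Suc[symmetric] by simp
next
  case (Cons L Ls)
  then have "L \<in> Orc (Suc (Suc k))" "- L \<in> Orc (Suc (Suc k))"
    using Orc_mono[of L k "Suc k"] Orc_compl by auto
  moreover have "L - nest Ls = L \<inter> - nest Ls" "- (L - nest Ls) = - L \<union> nest Ls" by auto
  ultimately show ?case using Cons by (simp add: Orc_Int Orc_Un)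
qed

text \<open>One oracle for all components, so that a single notion of hardness predicts all of them
  at once.\<close>

lemma Orc_common:
  "set Ls \<subseteq> Orc (Suc k) \<Longrightarrow> \<exists>A\<in>Orc k. \<forall>L\<in>set Ls. L \<in> NP_oracle A"
proof (induction Ls)
  case Nil
  then show ?case using Orc_nonempty by auto
next
  case (Cons L Ls)
  then obtain A B where "A \<in> Orc k" "L \<in> NP_oracle A" and B: "B \<in> Orc k" "\<forall>L\<in>set Ls. L \<in> NP_oracle B"
    unfolding Orc_relative[symmetric] by (auto simp: Orc_relative)
  from Orc_join[OF this(1) B(1)] obtain C where "C \<in> Orc k"
    "\<forall>a \<phi>. (Acc A a \<phi> \<longrightarrow> Acc C a \<phi>) \<and> (Acc B a \<phi> \<longrightarrow> Acc C a \<phi>)" by blast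
  then show ?case using B \<open>L \<in> NP_oracle A\<close> unfolding NP_oracle_iff by (intro bexI[of _ C]) auto
qed

context hard_sequences
begin

text \<open>If every maximal hard sequence predicts membership in \<open>L\<close> correctly, then membership can be
  read off from the number of alternations of the predictions along hard sequences of increasing length:
  the longest ones are maximal, so the last prediction in a longest alternation is correct.\<close>

lemma mind_changes:
  assumes S: "\<And>r b. r < m \<Longrightarrow> Sig (Suc k) (r + 1) (\<chi> r b)"
    and C: "\<And>x s b. maxh (pw d x) s \<Longrightarrow> \<chi> (length s) b (x # s) \<longleftrightarrow> b = (x \<in> L)"
  obtains U where "\<And>j r c. U j r c \<in> Orc (Suc (Suc k))"
    "\<And>x r c. r = 0 \<or> r = 1 \<and> (maxh (pw d x) [] \<longrightarrow> c = (x \<in> L)) \<Longrightarrow>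
      odd (length (takeWhile (\<lambda>j. x \<in> U j r c) [0..<m - r])) \<longleftrightarrow> c \<noteq> (x \<in> L)"
proof -
  \<comment> \<open>Hardness is in \<open>Sig (Suc k)\<close>, but maximality is not claimed there;
    so candidates are merely hard sequences, and their predictions may be wrong until the largest
    length is reached.\<close>
  define W where "W x r b \<longleftrightarrow> (\<exists>s. length s = r \<and> (\<forall>y\<in>set s. length y \<le> pw d x) \<and>
    (hard (pw d ((x # s) ! 0)) (tl (x # s)) \<and> \<chi> r b (x # s)))" for x r b
  have W: "Sig (Suc k) 1 (\<lambda>xs. W (xs ! 0) r b)" if r: "r < m" for r b
    unfolding W_def
    by (rule Sig_bexs_tail[where \<phi> = "\<lambda>zs. hard (pw d (zs ! 0)) (tl zs) \<and> \<chi> r b zs"])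
      (use r in \<open>intro Sig_conj S Sig_hard; simp\<close>)
  show ?thesis
  proof (rule that[of "\<lambda>j r c. {x. chain (W x) m (Suc j) r c}"])
    fix j r :: nat and c :: bool
    have "Sig (Suc k) 1 (\<lambda>xs. chain (W (xs ! 0)) m (Suc j) r c)" by (rule Sig_chain[OF W])
    from Sig_lang[OF this] show "{x. chain (W x) m (Suc j) r c} \<in> Orc (Suc (Suc k))" by simp
  next
    fix x c and r :: nat assume r: "r = 0 \<or> r = 1 \<and> (maxh (pw d x) [] \<longrightarrow> c = (x \<in> L))"
    obtain rs where rs: "rs < m" "\<exists>s. length s = rs \<and> hard (pw d x) s \<and> bdd (pw d x) s"
      "\<forall>r s. rs < r \<longrightarrow> r < m \<longrightarrow> length s = r \<longrightarrow> \<not> (hard (pw d x) s \<and> bdd (pw d x) s)"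
      "\<forall>s. length s = rs \<longrightarrow> hard (pw d x) s \<longrightarrow> bdd (pw d x) s \<longrightarrow> maxh (pw d x) s"
      using ex_rank[of "pw d x"] by - (erule exE, (erule conjE)+, rule that; assumption)
    have W': "W x r b \<longleftrightarrow> (\<exists>s. length s = r \<and> bdd (pw d x) s \<and> hard (pw d x) s \<and> \<chi> r b (x # s))" for r b
      unfolding W_def bdd_def by simp
    have "odd (length (takeWhile (\<lambda>j. chain (W x) m (Suc j) r c) [0..<m - r])) \<longleftrightarrow> c \<noteq> (x \<in> L)"
    proof (rule chain_value[OF rs(1)])
      show "\<not> W x r b" if "rs < r" "r < m" for r b using rs(3) that unfolding W' by blast
      show "W x rs b \<longleftrightarrow> b = (x \<in> L)" for b
        using rs(2,4) C[of x _ b] unfolding W' by metis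
      show "r \<le> rs \<or> c = (x \<in> L)"
      \<comment> \<open>If only the empty sequence is hard, it is maximal. A count from rank 1 then
        meets no candidate, so its starting value has to be right already; this is the side
        condition for \<open>r = 1\<close>.\<close>
      proof (cases "rs = 0")
        case True
        then have "maxh (pw d x) []" using rs(4) by (simp add: bdd_def)
        then show ?thesis using r by auto
      qed (use r in auto)
    qed
    then show "odd (length (takeWhile (\<lambda>j. x \<in> {x. chain (W x) m (Suc j) r c}) [0..<m - r])) \<longleftrightarrow> c \<noteq> (x \<in> L)"
      by simp
  qed
qed

end

section \<open>Collapse under closure of the difference class under complement\<close>

locale DIFF_closed =
  fixes k m :: nat
  assumes m: "1 \<le> m" and closed: "DIFF m (Orc (Suc k)) = co_class (DIFF m (Orc (Suc k)))"
begin

text \<open>The only use of the hypothesis: the parity language of \<open>A\<close> is a nested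
  difference by construction, so its complement is one too, and the components of the latter define
  hardness.\<close>

lemma ex_hard_sequences:
  assumes A: "A \<in> Orc (Suc k)"
  shows "\<exists>Cs. hard_sequences k m A Cs"
proof -
  let ?Ts = "map (\<lambda>i. elang m (\<lambda>xs. \<exists>j<m. i \<le> j \<and> xs ! j \<in> A)) [0..<m]"
  have "elang m (\<lambda>xs. \<exists>j<m. i \<le> j \<and> xs ! j \<in> A) \<in> Orc (Suc k)" for i
    by (intro Sig_elang Sig_ex_less Sig_conj Sig_const Sig_mem A)
  then have "nest ?Ts \<in> DIFF m (Orc (Suc k))" unfolding DIFF_nest by (intro exI[of _ ?Ts]) auto
  then have "- nest ?Ts \<in> co_class (DIFF m (Orc (Suc k)))" unfolding co_class_def by blast
  then have "- nest ?Ts \<in> DIFF m (Orc (Suc k))" unfolding closed[symmetric] .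
  then obtain Cs where "length Cs = m" "set Cs \<subseteq> Orc (Suc k)" "- nest ?Ts = nest Cs"
    unfolding DIFF_nest by blast
  then show ?thesis using A m by (intro exI[of _ Cs] hard_sequences.intro) simp_all
qed

text \<open>Unfolding three oracles reaches some \<open>A\<close> in level \<open>k + 1\<close>.
  Hard sequences for it lower the whole tower by one level, and guessing a maximal one fits into the
  level thus gained.\<close>

lemma collapse_step:
  assumes "L \<in> Orc (Suc (k + 3))"
  shows "L \<in> Orc (k + 3)"
proof -
  have "L \<in> Orc (Suc (Suc (Suc (Suc k))))" using assms by (simp add: numeral_3_eq_3)
  then obtain A3 where A3: "A3 \<in> Orc (Suc (Suc (Suc k)))" "L \<in> NP_oracle A3" unfolding Orc_relative[of L] by blast
  from A3(1) obtain A2 where A2: "A2 \<in> Orc (Suc (Suc k))" "A3 \<in> NP_oracle A2" unfolding Orc_relative[of A3] by blast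
  from A2(1) obtain A where orc: "A \<in> Orc (Suc k)" and rel: "A2 \<in> NP_oracle A" unfolding Orc_relative[of A2] by blast
  from ex_hard_sequences[OF orc] obtain Cs where "hard_sequences k m A Cs" ..
  then interpret hard_sequences k m A Cs .
  have "Adv (Suc (Suc k)) L" by (rule Adv_step[OF Adv_step[OF Adv_base]]) (fact rel A2 A3)+
  then show ?thesis by (intro Adv_collapse) simp
qed

text \<open>Once two consecutive levels agree, the oracle on each higher level can be replaced by
  one from the lower level. \<open>k + 3\<close> is two above the level \<open>Suc k\<close> of the
  hypothesis.\<close>

lemma PH_collapse: "PH = Orc (k + 3)"
proof -
  have "L \<in> Orc (k + 3 + i) \<Longrightarrow> L \<in> Orc (k + 3)" for L i
  proof (induction i arbitrary: L)
    case (Suc i)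
    from Suc.prems obtain B where "B \<in> Orc (k + 3 + i)" "L \<in> NP_oracle B"
      unfolding add_Suc_right Orc_relative by blast
    then have "L \<in> Orc (Suc (k + 3))" using Suc.IH unfolding Orc_relative by blast
    then show ?case by (rule collapse_step)
  qed simp
  moreover have "L \<in> Orc (k + 3 + j)" if "L \<in> Orc (Suc j)" for L j
    using Orc_mono[OF that, of "k + 2 + j"] by (simp add: numeral_3_eq_3)
  moreover have "Orc (k + 3) \<subseteq> PH" unfolding PH_Orc by (auto simp: numeral_3_eq_3)
  ultimately show ?thesis unfolding PH_Orc by blast
qed

lemma PH_compl: "L \<in> PH \<Longrightarrow> - L \<in> PH"
  unfolding PH_Orc using Orc_compl by blast

text \<open>By the collapse, \<open>L\<close> and its complement are on the same level. With a
  common \<open>A\<close> at the bottom one hard sequence serves both: the prediction for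
  \<open>L\<close> stands for the value \<open>True\<close>, that for the complement for
  \<open>False\<close>, and neither has to be negated.\<close>

lemma PH_DIFF:
  assumes "L \<in> PH"
  shows "L \<in> DIFF m (Orc (Suc (Suc k)))"
proof -
  have "L \<in> Orc (Suc (Suc (Suc k)))" "- L \<in> Orc (Suc (Suc (Suc k)))"
    using assms PH_compl[OF assms] by (simp_all add: PH_collapse numeral_3_eq_3)
  then obtain A1 A0 where A1: "A1 \<in> Orc (Suc (Suc k))" "L \<in> NP_oracle A1"
    and A0: "A0 \<in> Orc (Suc (Suc k))" "- L \<in> NP_oracle A0"
    unfolding Orc_relative[of L] Orc_relative[of "- L"] by blast
  obtain A where orc: "A \<in> Orc (Suc k)" and rel: "A1 \<in> NP_oracle A" "A0 \<in> NP_oracle A"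
    using Orc_common[of "[A1, A0]" "Suc k"] A1 A0 by auto
  from ex_hard_sequences[OF orc] obtain Cs where "hard_sequences k m A Cs" ..
  then interpret hard_sequences k m A Cs .
  have "Adv (Suc k) L" "Adv (Suc k) (- L)"
    using Adv_step[OF Adv_base[OF rel(1)] A1(2)] Adv_step[OF Adv_base[OF rel(2)] A0(2)] by blast+
  then obtain e1 \<chi>1 e0 \<chi>0 where
    1: "\<forall>d. e1 \<le> d \<longrightarrow> (\<forall>r<m. Sig (Suc k) (r + 1) (\<chi>1 d r)) \<and>
      (\<forall>x s. maxh (pw d x) s \<longrightarrow> (\<chi>1 d (length s) (x # s) \<longleftrightarrow> x \<in> L))" and
    0: "\<forall>d. e0 \<le> d \<longrightarrow> (\<forall>r<m. Sig (Suc k) (r + 1) (\<chi>0 d r)) \<and>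
      (\<forall>x s. maxh (pw d x) s \<longrightarrow> (\<chi>0 d (length s) (x # s) \<longleftrightarrow> x \<in> - L))"
    by (elim AdvD[elim_format] exE)
  define d where "d = max e1 e0"
  have d: "e1 \<le> d" "e0 \<le> d" by (simp_all add: d_def)
  obtain U where U: "\<And>j r c. U j r c \<in> Orc (Suc (Suc k))"
    "\<And>x r c. r = 0 \<or> r = 1 \<and> (maxh (pw d x) [] \<longrightarrow> c = (x \<in> L)) \<Longrightarrow>
      odd (length (takeWhile (\<lambda>j. x \<in> U j r c) [0..<m - r])) \<longleftrightarrow> c \<noteq> (x \<in> L)"
  proof (rule mind_changes[where \<chi> = "\<lambda>r b. if b then \<chi>1 d r else \<chi>0 d r" and d = d and L = L])
    show "Sig (Suc k) (r + 1) (if b then \<chi>1 d r else \<chi>0 d r)" if "r < m" for r b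
      using 1 0 d that by simp
    show "(if b then \<chi>1 d (length s) else \<chi>0 d (length s)) (x # s) \<longleftrightarrow> b = (x \<in> L)"
      if "maxh (pw d x) s" for x s b
      using 1 0 d that by simp
  next
    fix U assume "\<And>j r c. U j r c \<in> Orc (Suc (Suc k))"
      "\<And>x r c. r = 0 \<or> r = 1 \<and> (maxh (pw d x) [] \<longrightarrow> c = (x \<in> L)) \<Longrightarrow>
        odd (length (takeWhile (\<lambda>j. x \<in> U j r c) [0..<m - r])) \<longleftrightarrow> c \<noteq> (x \<in> L)"
    then show thesis by (rule that)
  qed
  have "x \<in> nest (map (\<lambda>j. U j 0 False) [0..<m]) \<longleftrightarrow> x \<in> L" for x
    using U(2)[of 0 x False] unfolding nest_map_iff by simp
  then have "L = nest (map (\<lambda>j. U j 0 False) [0..<m])" by blast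
  then show ?thesis unfolding DIFF_nest
    by (intro exI[of _ "map (\<lambda>j. U j 0 False) [0..<m]"]) (use U(1) in auto)
qed

text \<open>The components of a difference over level \<open>k + 2\<close> have oracles of level
  \<open>k + 1\<close>, so only one lowering is needed and their predictions are already on the
  level of the hypothesis. The parity of these predictions and its negation lie one level higher, as
  the mind-change argument demands.\<close>

lemma PH_symdiff:
  assumes "L \<in> PH"
  shows "\<exists>E\<in>DIFF m (Orc (Suc k)). \<exists>D\<in>DIFF (m - 1) (Orc (Suc (Suc k))). L = sym_diff E D"
proof -
  obtain Ls where Ls: "length Ls = m" "set Ls \<subseteq> Orc (Suc (Suc k))" "L = nest Ls"
    using PH_DIFF[OF assms] unfolding DIFF_nest by blast
  from Orc_common[OF Ls(2)] obtain A where orc: "A \<in> Orc (Suc k)" and rel: "\<forall>L\<in>set Ls. L \<in> NP_oracle A" by blast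
  from ex_hard_sequences[OF orc] obtain Cs where "hard_sequences k m A Cs" ..
  then interpret hard_sequences k m A Cs .
  have "\<exists>e \<chi>. \<forall>d. e \<le> d \<longrightarrow> (\<forall>r<m. Sig k (r + 1) (\<chi> d r)) \<and>
      (\<forall>x s. maxh (pw d x) s \<longrightarrow> (\<chi> d (length s) (x # s) \<longleftrightarrow> x \<in> Ls ! i))" if "i < m" for i
    by (rule AdvD[OF Adv_base]) (use rel Ls(1) that in simp)
  then obtain e \<chi> where e: "\<And>i d. i < m \<Longrightarrow> e i \<le> d \<Longrightarrow> (\<forall>r<m. Sig k (r + 1) (\<chi> i d r)) \<and>
      (\<forall>x s. maxh (pw d x) s \<longrightarrow> (\<chi> i d (length s) (x # s) \<longleftrightarrow> x \<in> Ls ! i))" by metis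
  \<comment> \<open>The sum dominates each of the finitely many exponents.\<close>
  define d where "d = (\<Sum>i<m. e i)"
  have d: "e i \<le> d" if "i < m" for i unfolding d_def using that by (intro member_le_sum) auto
  define \<pi> where "\<pi> r zs \<longleftrightarrow> odd (length (takeWhile (\<lambda>i. \<chi> i d r zs) [0..<m]))" for r zs
  have \<pi>: "\<pi> (length s) (x # s) \<longleftrightarrow> x \<in> L" if "maxh (pw d x) s" for x s
  proof -
    have "takeWhile (\<lambda>i. \<chi> i d (length s) (x # s)) [0..<m] = takeWhile (\<lambda>i. x \<in> Ls ! i) [0..<m]"
      by (rule takeWhile_cong) (use e d that in auto)
    moreover have "L = nest (map ((!) Ls) [0..<m])" using map_nth[of Ls] Ls by simp
    ultimately show ?thesis unfolding \<pi>_def by (simp only: nest_map_iff)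
  qed
  obtain U where U: "\<And>j r c. U j r c \<in> Orc (Suc (Suc k))"
    "\<And>x r c. r = 0 \<or> r = 1 \<and> (maxh (pw d x) [] \<longrightarrow> c = (x \<in> L)) \<Longrightarrow>
      odd (length (takeWhile (\<lambda>j. x \<in> U j r c) [0..<m - r])) \<longleftrightarrow> c \<noteq> (x \<in> L)"
  proof (rule mind_changes[where \<chi> = "\<lambda>r b zs. \<pi> r zs = b" and d = d and L = L])
    show "Sig (Suc k) (r + 1) (\<lambda>zs. \<pi> r zs = b)" if "r < m" for r b
      unfolding \<pi>_def by (rule Sig_parity) (use e d that in blast)
    show "(\<pi> (length s) (x # s) = b) \<longleftrightarrow> b = (x \<in> L)" if "maxh (pw d x) s" for x s b
      using \<pi>[OF that] by auto
  next
    fix U assume "\<And>j r c. U j r c \<in> Orc (Suc (Suc k))"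
      "\<And>x r c. r = 0 \<or> r = 1 \<and> (maxh (pw d x) [] \<longrightarrow> c = (x \<in> L)) \<Longrightarrow>
        odd (length (takeWhile (\<lambda>j. x \<in> U j r c) [0..<m - r])) \<longleftrightarrow> c \<noteq> (x \<in> L)"
    then show thesis by (rule that)
  qed
  \<comment> \<open>The predictions made with the empty hard sequence, which take no further
    argument and so define languages.\<close>
  define Es where "Es = map (\<lambda>i. {x. \<chi> i d 0 [x]}) [0..<m]"
  have Es: "set Es \<subseteq> Orc (Suc k)"
  proof -
    have "{x. \<chi> i d 0 [x]} \<in> Orc (Suc k)" if i: "i < m" for i
    proof (rule Sig_lang)
      have "Sig k (0 + 1) (\<chi> i d 0)" using conjunct1[OF e[OF i d[OF i]]] m by simp
      then show "Sig k 1 (\<chi> i d 0)" by simp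
    qed
    then show ?thesis by (auto simp: Es_def)
  qed
  define E where "E = nest Es"
  have E: "x \<in> E \<longleftrightarrow> \<pi> 0 [x]" for x unfolding E_def Es_def \<pi>_def nest_map_iff by simp
  have E2: "E \<in> Orc (Suc (Suc k))" "- E \<in> Orc (Suc (Suc k))" using Orc_nest[OF Es] by (simp_all add: E_def)
  \<comment> \<open>The count starts with the value predicted by the empty sequence, that is with
    membership in \<open>E\<close>, and runs through ranks 1 to \<open>m - 1\<close>; hence
    \<open>m - 1\<close> components.\<close>
  define Ds where "Ds = map (\<lambda>j. E \<inter> U j 1 True \<union> - E \<inter> U j 1 False) [0..<m - 1]"
  have "x \<in> nest Ds \<longleftrightarrow> odd (length (takeWhile (\<lambda>j. x \<in> U j 1 (x \<in> E)) [0..<m - 1]))" for x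
    unfolding Ds_def nest_map_iff by (cases "x \<in> E") simp_all
  moreover have "maxh (pw d x) [] \<Longrightarrow> (x \<in> E) = (x \<in> L)" for x using \<pi>[of x "[]"] E by simp
  ultimately have "x \<in> nest Ds \<longleftrightarrow> (x \<in> E) \<noteq> (x \<in> L)" for x using U(2)[of 1 x "x \<in> E"] by simp
  then have "L = sym_diff E (nest Ds)" by blast
  moreover have "E \<in> DIFF m (Orc (Suc k))" unfolding DIFF_nest E_def using Es by (intro exI[of _ Es]) (simp add: Es_def)
  moreover have "nest Ds \<in> DIFF (m - 1) (Orc (Suc (Suc k)))"
  proof -
    have "set Ds \<subseteq> Orc (Suc (Suc k))" using U(1) E2 by (auto simp: Ds_def intro!: Orc_Un Orc_Int)
    then show ?thesis unfolding DIFF_nest by (intro exI[of _ Ds]) (simp add: Ds_def)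
  qed
  ultimately show ?thesis by blast
qed

text \<open>The converse inclusion: both operands and their complements are on level
  \<open>k + 3\<close>, which is closed under union and intersection.\<close>

lemma symdiff_PH:
  assumes "E \<in> DIFF m (Orc (Suc k))" "D \<in> DIFF (m - 1) (Orc (Suc (Suc k)))"
  shows "sym_diff E D \<in> PH"
proof -
  obtain Es Ds where "set Es \<subseteq> Orc (Suc k)" "E = nest Es" "set Ds \<subseteq> Orc (Suc (Suc k))" "D = nest Ds"
    using assms unfolding DIFF_nest by blast
  then have "E \<in> Orc (Suc (Suc k))" "- E \<in> Orc (Suc (Suc k))"
    and D: "D \<in> Orc (Suc (Suc (Suc k)))" "- D \<in> Orc (Suc (Suc (Suc k)))" using Orc_nest by auto
  then have "E \<in> Orc (Suc (Suc (Suc k)))" "- E \<in> Orc (Suc (Suc (Suc k)))"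
    using Orc_mono[of _ "Suc k" "Suc (Suc k)"] by auto
  then have "E \<inter> - D \<union> D \<inter> - E \<in> Orc (Suc (Suc (Suc k)))" using D by (intro Orc_Un Orc_Int)
  then show ?thesis unfolding PH_Orc Diff_eq by blast
qed

end

theorem theorem4p1:
  fixes m k :: nat
  assumes "m \<ge> 1" and "k \<ge> 1"
    and "DIFF m (SigmaP k) = co_class (DIFF m (SigmaP k))"
  shows "PH = DIFF m (SigmaP k) \<^bold>\<Delta> DIFF (m - 1) (SigmaP (k + 1))"
proof -
  \<comment> \<open>\<open>Orc\<close> and \<open>SigmaP\<close> agree from level 1 on, so the level
    is written as a successor.\<close>
  obtain k' where k: "k = Suc k'" using assms(2) by (cases k) auto
  interpret DIFF_closed k' m using assms(1,3) unfolding k SigmaP_Orc by unfold_locales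
  show ?thesis unfolding k Suc_eq_plus1[symmetric] SigmaP_Orc symdiff_class_def
    using PH_symdiff symdiff_PH by blast
qed

end
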